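(* Let $G=\mathrm{SL}_n(\mathbb K)$ and $X=G/Q$ with $Q=P_{k_1}\cap\dots\cap P_{k_m}$, $1\le k_1<\dots<k_m\le n-1$. The varieties $X_{(\theta,i)}=X_{\max_{Q_i}(\theta)}\subseteq G/Q_i$ for $(\theta,i)\in\underline W=\coprod_{i=1}^mW/W_i\times\{i\}$, together with the index sets $I_{(\theta,i)}=\{i,\dots,m\}$ and the extremal functions $f_{(\theta,i)}=p_{(\theta,i)}$ (Plücker coordinates), form a multiprojective Seshadri stratification on $X=G/Q\hookrightarrow\prod_{j=1}^m\mathbb P(V(\omega_{k_j}))$.
   Context: Groups. $\mathbb K$ is an algebraically closed field of characteristic zero, $G=\mathrm{SL}_n(\mathbb K)$, $B$ the upper triangular matrices in $G$, $W\cong S_n$ the Weyl group, $\omega_1,\dots,\omega_{n-1}$ the fundamental weights, $V(\omega_i)=\bigwedge^i\mathbb K^n$, and $P_i\supseteq B$ the maximal parabolic subgroup whose Weyl group $W_{P_i}\cong S_i\times S_{n-i}$ is the stabilizer of $\omega_i$. For a parabolic $P\supseteq B$, $W_P$ is its Weyl group and $W/W_P$ carries the Bruhat order. $W_i=W_{P_{k_i}}$, $Q_i=P_{k_i}\cap\dots\cap P_{k_m}$. For $\theta\in W/W_i$, $\max_{Q_i}(\theta)$ is the unique maximal preimage of $\theta$ under $W/W_{Q_i}\to W/W_i$. For $\sigma\in W/W_{Q_i}$, $X_\sigma\subseteq G/Q_i$ is the Schubert variety. $G/Q$ and $G/Q_i$ are embedded by Plücker embeddings in $\prod_{j=1}^m\mathbb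 P(V(\omega_{k_j}))$ and $\prod_{j=i}^m\mathbb P(V(\omega_{k_j}))$; $G/Q_i$ is the image of $G/Q$ under the projection to the factors $i,\dots,m$. An element $\theta=\sigma W_i\in W/W_i$ corresponds to the subset $\{\sigma(1),\dots,\sigma(k_i)\}=\{j_1<\dots<j_{k_i}\}$ of $\{1,\dots,n\}$; $p_{(\theta,i)}\in V(\omega_{k_i})^*$ is the dual basis vector of $e_{j_1}\wedge\dots\wedge e_{j_{k_i}}$, viewed as a function in the multihomogeneous coordinate ring of $G/Q$ by pullback along the projection to $V(\omega_{k_i})$. Multicones. Let $V_1,\dots,V_m$ be finite-dimensional $\mathbb K$-vector spaces, $V=\prod_iV_i$, $[m]=\{1,\dots,m\}$. For $\varnothing\ne I\subseteq[m]$ and a closed subvariety $Y\subseteq\prod_{i\in I}\mathbb P(V_i)$, the multicone $\hat Y\subseteq\prod_{i\in I}V_i$ is the set of tuples $(v_i)$ for which there are non-zero $w_i\in V_i$ with $v_i\in\mathbb Kw_i$ and $([w_i])_i\in Y$; viewing $\prod_{i\in I}V_i\subseteq V$ with the remaining coordinates zero, all multicones are closed subvarieties of $V$. For a closed $X\subseteq\prod_{i=1}^m\mathbb P(V_i)$ let $R=\mathbb K[X]=\mathbb K[\hat X]$ be the $\mathbb N_0^m$-graded multihomogeneous coordinate ring, $X_I$ the image of $X$ in $\prod_{i\in I}\mathbb P(V_i)$, and $\mathbb K[X_I]\subseteq R$ the subalgebra $\bigoplus_{\underline d:\,d_j=0\,\forall j\notin I}R_{\underline d}$. Seshadri stratification.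 A (multiprojective) Seshadri stratification on $X$ consists of a finite set $A$ and, for each $p\in A$, a non-empty index set $I_p\subseteq[m]$, an irreducible closed subvariety $X_p\subseteq X_{I_p}$ that is smooth in codimension one, and a non-constant multihomogeneous $f_p\in\mathbb K[X_{I_p}]\subseteq R$, where $A$ is partially ordered by $q\le p\Leftrightarrow\hat X_q\subseteq\hat X_p$, such that there is $p_{\max}\in A$ with $I_{p_{\max}}=[m]$, $X_{p_{\max}}=X$, and: (S1) if $q<p$ is a covering relation then $\hat X_q\subseteq\hat X_p$ has codimension one; (S2) $f_q$ vanishes on $\hat X_p$ if $q\nleq p$; (S3) for each $p\in A$, $\{x\in\hat X\mid f_p(x)=0\}\cap\hat X_p=\{0\}\cup\bigcup_{p\text{ covers }q}\hat X_q$ set-theoretically. *)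

theory Defs
  imports
    "HOL-Analysis.Function_Topology"
    "HOL-Library.Poly_Mapping"
    "HOL-Library.Function_Algebras"
    "HOL-Library.Extended_Nat"
    "HOL-Combinatorics.Permutations"
    "HOL-Algebra.Left_Coset"
    "Jordan_Normal_Form.Determinant"
    "Jordan_Normal_Form.DL_Submatrix"
begin

section \<open>Irreducibility, dimension and codimension in a topological space\<close>

definition irreducible_closedin :: "'x topology \<Rightarrow> 'x set \<Rightarrow> bool" where
  "irreducible_closedin T Z \<longleftrightarrow> closedin T Z \<and> Z \<noteq> {} \<and>
     (\<forall>C D. closedin T C \<longrightarrow> closedin T D \<longrightarrow> Z \<subseteq> C \<union> D \<longrightarrow> Z \<subseteq> C \<or> Z \<subseteq> D)"

definition irreducible_chain :: "'x topology \<Rightarrow> nat \<Rightarrow> (nat \<Rightarrow> 'x set) \<Rightarrow> bool" where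
  "irreducible_chain T l Z \<longleftrightarrow>
     (\<forall>i\<le>l. irreducible_closedin T (Z i)) \<and> (\<forall>i<l. Z i \<subset> Z (Suc i))"

definition krull_dim :: "'x topology \<Rightarrow> enat" where
  "krull_dim T = Sup {enat l |l Z. irreducible_chain T l Z}"

definition codim :: "'x topology \<Rightarrow> 'x set \<Rightarrow> enat" where
  "codim T Y = (INF Z\<in>{Z. irreducible_closedin T Z \<and> Z \<subseteq> Y}.
     Sup {enat l |l C. irreducible_chain T l C \<and> C 0 = Z})"


section \<open>Polynomials and affine space\<close>

text \<open>A polynomial in variables of type \<open>'v\<close> maps each monomial (a finitely supported exponent
  function) to its coefficient.\<close>

type_synonym ('v, 'a) polynomial = "('v \<Rightarrow>\<^sub>0 nat) \<Rightarrow>\<^sub>0 'a"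

definition polys :: "'v set \<Rightarrow> ('v, 'a::zero) polynomial set" where
  "polys vs = {P. \<forall>\<mu>\<in>Poly_Mapping.keys P. Poly_Mapping.keys \<mu> \<subseteq> vs}"

definition poly_eval :: "('v, 'a::comm_semiring_1) polynomial \<Rightarrow> ('v \<Rightarrow> 'a) \<Rightarrow> 'a" where
  "poly_eval P x = (\<Sum>\<mu>\<in>Poly_Mapping.keys P. Poly_Mapping.lookup P \<mu> *
     (\<Prod>v\<in>Poly_Mapping.keys \<mu>. x v ^ Poly_Mapping.lookup \<mu> v))"

text \<open>The differential of \<open>P\<close> at \<open>x\<close>, applied to the direction \<open>u\<close>.\<close>

definition poly_diff ::
    "('v, 'a::comm_semiring_1) polynomial \<Rightarrow> ('v \<Rightarrow> 'a) \<Rightarrow> ('v \<Rightarrow> 'a) \<Rightarrow> 'a" where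
  "poly_diff P x u = (\<Sum>\<mu>\<in>Poly_Mapping.keys P. Poly_Mapping.lookup P \<mu> *
     (\<Sum>v\<in>Poly_Mapping.keys \<mu>. of_nat (Poly_Mapping.lookup \<mu> v) * u v * x v ^ (Poly_Mapping.lookup \<mu> v - 1) *
        (\<Prod>w\<in>Poly_Mapping.keys \<mu> - {v}. x w ^ Poly_Mapping.lookup \<mu> w)))"

text \<open>The vector space with basis \<open>vs\<close>: coordinate functions extended by \<open>0\<close>.\<close>

definition affine_space :: "'v set \<Rightarrow> ('v \<Rightarrow> 'a::zero) set" where
  "affine_space vs = {x. \<forall>v. v \<notin> vs \<longrightarrow> x v = 0}"

text \<open>The principal open sets \<open>P \<noteq> 0\<close> are a basis of the Zariski topology (they are closed under
  finite intersections, and \<open>P = 1\<close> yields the whole space).\<close>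

definition zariski_affine :: "'v set \<Rightarrow> ('v \<Rightarrow> 'a::comm_semiring_1) topology" where
  "zariski_affine vs =
     topology_generated_by ((\<lambda>P. {x \<in> affine_space vs. poly_eval P x \<noteq> 0}) ` polys vs)"

definition tangent_space :: "'v set \<Rightarrow> ('v \<Rightarrow> 'a::comm_semiring_1) set \<Rightarrow> ('v \<Rightarrow> 'a) \<Rightarrow> ('v \<Rightarrow> 'a) set"
  where
  "tangent_space vs Z x = {u \<in> affine_space vs.
     \<forall>P\<in>polys vs. (\<forall>z\<in>Z. poly_eval P z = 0) \<longrightarrow> poly_diff P x u = 0}"

abbreviation vdim :: "('v \<Rightarrow> 'a::field) set \<Rightarrow> nat" where
  "vdim \<equiv> vector_space.dim (\<lambda>c x v. c * x v)"


section \<open>Products of projective spaces and multicones\<close>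

text \<open>Throughout, \<open>S i\<close> is a basis of the finite-dimensional vector space \<open>V\<^sub>i\<close>. An element of
  \<open>\<Prod>i\<in>I. V\<^sub>i\<close> is an element \<open>v\<close> of \<open>affine_space (Sigma I S)\<close>; its component in \<open>V\<^sub>i\<close> is
  \<open>curry v i\<close>. As coordinates outside \<open>Sigma I S\<close> are \<open>0\<close>, this space is literally a subset of
  \<open>affine_space (Sigma J S)\<close> whenever \<open>I \<subseteq> J\<close>.
  A point of \<open>\<P>(V\<^sub>i)\<close> is a one-dimensional subspace of \<open>V\<^sub>i\<close>, and a point of \<open>\<Prod>i\<in>I. \<P>(V\<^sub>i)\<close> is a
  function on \<open>I\<close> that is \<open>undefined\<close> outside \<open>I\<close>.\<close>

definition line :: "('b \<Rightarrow> 'a::comm_semiring_1) \<Rightarrow> ('b \<Rightarrow> 'a) set" where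
  "line x = range (\<lambda>c b. c * x b)"

definition mp_point ::
    "nat set \<Rightarrow> (nat \<times> 'b \<Rightarrow> 'a::comm_semiring_1) \<Rightarrow> nat \<Rightarrow> ('b \<Rightarrow> 'a) set" where
  "mp_point I w = (\<lambda>i\<in>I. line (curry w i))"

definition mp_coords ::
    "(nat \<Rightarrow> 'b set) \<Rightarrow> nat set \<Rightarrow> (nat \<times> 'b \<Rightarrow> 'a::comm_semiring_1) set" where
  "mp_coords S I = {w \<in> affine_space (Sigma I S). \<forall>i\<in>I. curry w i \<noteq> 0}"

definition multihomogeneous ::
    "(nat \<times> 'b, 'a::zero) polynomial \<Rightarrow> (nat \<Rightarrow> nat) \<Rightarrow> bool" where
  "multihomogeneous P d \<longleftrightarrow> (\<forall>\<mu>\<in>Poly_Mapping.keys P. \<forall>i.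
     (\<Sum>v\<in>{v\<in>Poly_Mapping.keys \<mu>. fst v = i}. Poly_Mapping.lookup \<mu> v) = d i)"

definition zariski_mp ::
    "(nat \<Rightarrow> 'b set) \<Rightarrow> nat set \<Rightarrow> (nat \<Rightarrow> ('b \<Rightarrow> 'a::comm_semiring_1) set) topology" where
  "zariski_mp S I = topology_generated_by
     ((\<lambda>P. mp_point I ` {w \<in> mp_coords S I. poly_eval P w \<noteq> 0}) `
        {P \<in> polys (Sigma I S). \<exists>d. multihomogeneous P d})"

definition multicone ::
    "(nat \<Rightarrow> 'b set) \<Rightarrow> nat set \<Rightarrow> (nat \<Rightarrow> ('b \<Rightarrow> 'a::comm_semiring_1) set) set
      \<Rightarrow> (nat \<times> 'b \<Rightarrow> 'a) set" where
  "multicone S I Y = {v \<in> affine_space (Sigma I S).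
     \<exists>w\<in>mp_coords S I. (\<forall>i\<in>I. curry v i \<in> line (curry w i)) \<and> mp_point I w \<in> Y}"

text \<open>The affine chart of \<open>Y\<close> where the coordinates \<open>c i\<close> are non-zero, normalized to \<open>1\<close>.\<close>

definition chart ::
    "(nat \<Rightarrow> 'b set) \<Rightarrow> nat set \<Rightarrow> (nat \<Rightarrow> 'b) \<Rightarrow> (nat \<Rightarrow> ('b \<Rightarrow> 'a::comm_semiring_1) set) set
      \<Rightarrow> (nat \<times> 'b \<Rightarrow> 'a) set" where
  "chart S I c Y = {v \<in> multicone S I Y. \<forall>i\<in>I. v (i, c i) = 1}"

text \<open>Smoothness of an irreducible \<open>Y\<close> at \<open>x\<close>. The non-empty charts of \<open>Y\<close> are irreducible, so that
  their local dimension at every point is their Krull dimension. The choice of a chart around \<open>x\<close>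
  does not matter.\<close>

definition smooth_at ::
    "(nat \<Rightarrow> 'b set) \<Rightarrow> nat set \<Rightarrow> (nat \<Rightarrow> ('b \<Rightarrow> 'a::field) set) set
      \<Rightarrow> (nat \<Rightarrow> ('b \<Rightarrow> 'a) set) \<Rightarrow> bool" where
  "smooth_at S I Y x \<longleftrightarrow> (\<exists>c. \<exists>v\<in>chart S I c Y. mp_point I v = x \<and>
     enat (vdim (tangent_space (Sigma I S) (chart S I c Y) v)) =
     krull_dim (subtopology (zariski_affine (Sigma I S)) (chart S I c Y)))"

definition smooth_in_codim_one ::
    "(nat \<Rightarrow> 'b set) \<Rightarrow> nat set \<Rightarrow> (nat \<Rightarrow> ('b \<Rightarrow> 'a::field) set) set \<Rightarrow> bool" where
  "smooth_in_codim_one S I Y \<longleftrightarrow>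
     codim (subtopology (zariski_mp S I) Y) {x \<in> Y. \<not> smooth_at S I Y x} \<ge> 2"

text \<open>The component \<open>R\<^sub>d\<close> of the multihomogeneous coordinate ring of \<open>X\<close>, whose elements are
  functions on the multicone of \<open>X\<close>.\<close>

definition coord_ring_component ::
    "nat \<Rightarrow> (nat \<Rightarrow> 'b set) \<Rightarrow> (nat \<Rightarrow> ('b \<Rightarrow> 'a::comm_semiring_1) set) set \<Rightarrow> (nat \<Rightarrow> nat)
      \<Rightarrow> ((nat \<times> 'b \<Rightarrow> 'a) \<Rightarrow> 'a) set" where
  "coord_ring_component m S X d =
     {restrict (poly_eval P) (multicone S {1..m} X) |P.
        P \<in> polys (Sigma {1..m} S) \<and> multihomogeneous P d}"


section \<open>Multiprojective Seshadri stratifications\<close>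

definition covers_on :: "'p set \<Rightarrow> ('p \<Rightarrow> 'c set) \<Rightarrow> 'p \<Rightarrow> 'p \<Rightarrow> bool" where
  "covers_on A C p q \<longleftrightarrow> p \<in> A \<and> q \<in> A \<and> C q \<subset> C p \<and> \<not> (\<exists>r\<in>A. C q \<subset> C r \<and> C r \<subset> C p)"

text \<open>Injectivity of \<open>p \<mapsto> cone p\<close> expresses that \<open>q \<le> p \<longleftrightarrow> cone q \<subseteq> cone p\<close> is antisymmetric,
  hence a partial order on \<open>A\<close>.\<close>

definition seshadri_stratification ::
    "nat \<Rightarrow> (nat \<Rightarrow> 'b set) \<Rightarrow> (nat \<Rightarrow> ('b \<Rightarrow> 'a::field) set) set \<Rightarrow>
     'p set \<Rightarrow> ('p \<Rightarrow> nat set) \<Rightarrow> ('p \<Rightarrow> (nat \<Rightarrow> ('b \<Rightarrow> 'a) set) set) \<Rightarrow>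
     ('p \<Rightarrow> (nat \<times> 'b \<Rightarrow> 'a) \<Rightarrow> 'a) \<Rightarrow> bool" where
  "seshadri_stratification m S X A I Xs f \<longleftrightarrow>
    (let cone = (\<lambda>p. multicone S (I p) (Xs p)) in
     (\<forall>i\<in>{1..m}. finite (S i)) \<and>
     closedin (zariski_mp S {1..m}) X \<and>
     finite A \<and>
     (\<forall>p\<in>A. I p \<noteq> {} \<and> I p \<subseteq> {1..m}) \<and>
     (\<forall>p\<in>A. irreducible_closedin (zariski_mp S (I p)) (Xs p) \<and>
        Xs p \<subseteq> (\<lambda>x. restrict x (I p)) ` X \<and> smooth_in_codim_one S (I p) (Xs p)) \<and>
     (\<forall>p\<in>A. (\<exists>d. (\<forall>j. j \<notin> I p \<longrightarrow> d j = 0) \<and> f p \<in> coord_ring_component m S X d) \<and>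
        \<not> (\<exists>c. \<forall>x\<in>multicone S {1..m} X. f p x = c)) \<and>
     inj_on cone A \<and>
     (\<exists>pmax\<in>A. I pmax = {1..m} \<and> Xs pmax = X) \<and>
     \<comment> \<open>(S1)\<close>
     (\<forall>p q. covers_on A cone p q \<longrightarrow>
        codim (subtopology (zariski_affine (Sigma {1..m} S)) (cone p)) (cone q) = 1) \<and>
     \<comment> \<open>(S2)\<close>
     (\<forall>p\<in>A. \<forall>q\<in>A. \<not> cone q \<subseteq> cone p \<longrightarrow> (\<forall>x\<in>cone p. f q x = 0)) \<and>
     \<comment> \<open>(S3)\<close>
     (\<forall>p\<in>A. {x \<in> multicone S {1..m} X. f p x = 0} \<inter> cone p =
        {0} \<union> (\<Union>q\<in>{q. covers_on A cone p q}. cone q)))"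


section \<open>The special linear group and its Weyl group\<close>

text \<open>Rows and columns of matrices are numbered from \<open>0\<close>, so \<open>{..<n}\<close> takes the role of
  \<open>{1,\<dots>,n}\<close>.\<close>

definition SL :: "nat \<Rightarrow> 'a::comm_ring_1 mat monoid" where
  "SL n = \<lparr>carrier = {g \<in> carrier_mat n n. det g = 1}, monoid.mult = (*), one = 1\<^sub>m n\<rparr>"

definition borel :: "nat \<Rightarrow> 'a::comm_ring_1 mat set" where
  "borel n = {g \<in> carrier (SL n). upper_triangular g}"

text \<open>The maximal parabolic subgroup \<open>P\<^sub>l\<close>: block upper triangular matrices with diagonal blocks of
  sizes \<open>l\<close> and \<open>n - l\<close>.\<close>

definition parabolic :: "nat \<Rightarrow> nat \<Rightarrow> 'a::comm_ring_1 mat set" where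
  "parabolic n l = {g \<in> carrier (SL n). \<forall>a b. l \<le> a \<longrightarrow> a < n \<longrightarrow> b < l \<longrightarrow> g $$ (a, b) = 0}"

definition weyl :: "nat \<Rightarrow> (nat \<Rightarrow> nat) monoid" where
  "weyl n = \<lparr>carrier = {\<sigma>. \<sigma> permutes {..<n}}, monoid.mult = (\<circ>), one = id\<rparr>"

text \<open>The representatives of \<open>\<sigma>\<close> in the normalizer of the diagonal torus: they map the line through
  the basis vector \<open>b\<close> to the line through the basis vector \<open>\<sigma> b\<close>.\<close>

definition weyl_reps :: "nat \<Rightarrow> (nat \<Rightarrow> nat) \<Rightarrow> 'a::comm_ring_1 mat set" where
  "weyl_reps n \<sigma> = {w \<in> carrier (SL n). \<forall>a<n. \<forall>b<n. w $$ (a, b) \<noteq> 0 \<longleftrightarrow> a = \<sigma> b}"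

text \<open>The Weyl group \<open>W\<^sub>P\<close> of a subgroup \<open>P\<close> containing the Borel subgroup.\<close>

definition weyl_of :: "nat \<Rightarrow> 'a::comm_ring_1 mat set \<Rightarrow> (nat \<Rightarrow> nat) set" where
  "weyl_of n P = {\<sigma> \<in> carrier (weyl n). weyl_reps n \<sigma> \<inter> P \<noteq> {}}"

definition perm_length :: "nat \<Rightarrow> (nat \<Rightarrow> nat) \<Rightarrow> nat" where
  "perm_length n \<sigma> = card {(a, b). a < b \<and> b < n \<and> \<sigma> b < \<sigma> a}"

definition bruhat :: "nat \<Rightarrow> (nat \<Rightarrow> nat) \<Rightarrow> (nat \<Rightarrow> nat) \<Rightarrow> bool" where
  "bruhat n = (\<lambda>u v. \<exists>a<n. \<exists>b<n. v = u \<circ> Transposition.transpose a b \<and>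
     perm_length n u < perm_length n v)\<^sup>*\<^sup>*"

text \<open>The Bruhat order on \<open>W/W\<^sub>P\<close>, as the image of the Bruhat order on \<open>W\<close>. Comparing the
  representatives of minimal length gives the same order.\<close>

definition bruhat_coset :: "nat \<Rightarrow> (nat \<Rightarrow> nat) set \<Rightarrow> (nat \<Rightarrow> nat) set \<Rightarrow> bool" where
  "bruhat_coset n C D \<longleftrightarrow> (\<exists>u\<in>C. \<exists>v\<in>D. bruhat n u v)"

text \<open>For \<open>Q \<subseteq> P\<close>, the preimages of \<open>\<theta>\<close> under \<open>W/W\<^sub>Q \<rightarrow> W/W\<^sub>P\<close> are the cosets contained in \<open>\<theta>\<close>.\<close>

definition max_preimage :: "nat \<Rightarrow> 'a::comm_ring_1 mat set \<Rightarrow> (nat \<Rightarrow> nat) set \<Rightarrow> (nat \<Rightarrow> nat) set" where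
  "max_preimage n Q \<theta> = (THE \<sigma>. \<sigma> \<in> lcosets\<^bsub>weyl n\<^esub> (weyl_of n Q) \<and> \<sigma> \<subseteq> \<theta> \<and>
     (\<forall>\<tau>\<in>lcosets\<^bsub>weyl n\<^esub> (weyl_of n Q). \<tau> \<subseteq> \<theta> \<longrightarrow> bruhat_coset n \<sigma> \<tau> \<longrightarrow> \<tau> = \<sigma>))"


section \<open>Exterior powers, partial flag varieties and Schubert varieties\<close>

text \<open>\<open>\<Lambda>\<^sup>l \<K>\<^sup>n\<close> is the vector space with basis \<open>e\<^sub>J\<close>, where \<open>J\<close> ranges over the \<open>l\<close>-subsets of
  \<open>{..<n}\<close>. A matrix \<open>g\<close> acts by \<open>g e\<^sub>J = \<Sum>\<^sub>L det(g\<^sub>L\<^sub>J) e\<^sub>L\<close>.\<close>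

definition ext_basis :: "nat \<Rightarrow> nat \<Rightarrow> nat set set" where
  "ext_basis n l = {J. J \<subseteq> {..<n} \<and> card J = l}"

definition ext_basis_vector :: "nat set \<Rightarrow> nat set \<Rightarrow> 'a::comm_ring_1" where
  "ext_basis_vector J = (\<lambda>L. if L = J then 1 else 0)"

definition ext_act ::
    "nat \<Rightarrow> nat \<Rightarrow> 'a::comm_ring_1 mat \<Rightarrow> (nat set \<Rightarrow> 'a) \<Rightarrow> nat set \<Rightarrow> 'a" where
  "ext_act n l g x = (\<lambda>L. if L \<in> ext_basis n l
     then \<Sum>J\<in>ext_basis n l. det (submatrix g L J) * x J else 0)"

definition flag_basis :: "nat \<Rightarrow> (nat \<Rightarrow> nat) \<Rightarrow> nat \<Rightarrow> nat set set" where
  "flag_basis n k = (\<lambda>j. ext_basis n (k j))"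

definition flag_parabolic :: "nat \<Rightarrow> (nat \<Rightarrow> nat) \<Rightarrow> nat \<Rightarrow> nat \<Rightarrow> 'a::comm_ring_1 mat set" where
  "flag_parabolic n k m i = (\<Inter>j\<in>{i..m}. parabolic n (k j))"

text \<open>The Pluecker embedding of \<open>G/Q\<^sub>i\<close>. The lines through \<open>g \<cdot> (e\<^sub>0 \<and> \<dots> \<and> e\<^bsub>k j - 1\<^esub>)\<close> agree for all
  \<open>g\<close> in a coset \<open>C\<close> of \<open>Q\<^sub>i\<close>, so the union is just this common line.\<close>

definition pluecker ::
    "nat \<Rightarrow> (nat \<Rightarrow> nat) \<Rightarrow> nat \<Rightarrow> nat \<Rightarrow> 'a::comm_ring_1 mat set \<Rightarrow> nat \<Rightarrow> (nat set \<Rightarrow> 'a) set" where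
  "pluecker n k m i C =
     (\<lambda>j\<in>{i..m}. \<Union>g\<in>C. line (ext_act n (k j) g (ext_basis_vector {..<k j})))"

definition flag_variety ::
    "nat \<Rightarrow> (nat \<Rightarrow> nat) \<Rightarrow> nat \<Rightarrow> nat \<Rightarrow> (nat \<Rightarrow> (nat set \<Rightarrow> 'a::comm_ring_1) set) set" where
  "flag_variety n k m i = pluecker n k m i ` (lcosets\<^bsub>SL n\<^esub> (flag_parabolic n k m i))"

text \<open>The Schubert variety of \<open>\<sigma> \<in> W/W\<^bsub>Q\<^sub>i\<^esub>\<close> is the closure of \<open>B\<sigma>Q\<^sub>i/Q\<^sub>i\<close> in \<open>G/Q\<^sub>i\<close>.\<close>

definition schubert_variety ::
    "nat \<Rightarrow> (nat \<Rightarrow> nat) \<Rightarrow> nat \<Rightarrow> nat \<Rightarrow> (nat \<Rightarrow> nat) set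
      \<Rightarrow> (nat \<Rightarrow> (nat set \<Rightarrow> 'a::comm_ring_1) set) set" where
  "schubert_variety n k m i \<sigma> =
     subtopology (zariski_mp (flag_basis n k) {i..m}) (flag_variety n k m i) closure_of
       {pluecker n k m i ((b \<otimes>\<^bsub>SL n\<^esub> w) <#\<^bsub>SL n\<^esub> flag_parabolic n k m i) |b w.
          b \<in> borel n \<and> (\<exists>u\<in>\<sigma>. w \<in> weyl_reps n u)}"


section \<open>The stratification data\<close>

text \<open>The index set \<open>\<Coprod>\<^sub>i W/W\<^sub>i \<times> {i}\<close>. The type argument selects the ground field.\<close>

definition strata :: "'a::comm_ring_1 itself \<Rightarrow> nat \<Rightarrow> (nat \<Rightarrow> nat) \<Rightarrow> nat \<Rightarrow> ((nat \<Rightarrow> nat) set \<times> nat) set"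
  where
  "strata K n k m = {(\<theta>, i). i \<in> {1..m} \<and>
     \<theta> \<in> lcosets\<^bsub>weyl n\<^esub> (weyl_of n (parabolic n (k i) :: 'a mat set))}"

definition stratum ::
    "nat \<Rightarrow> (nat \<Rightarrow> nat) \<Rightarrow> nat \<Rightarrow> (nat \<Rightarrow> nat) set \<times> nat
      \<Rightarrow> (nat \<Rightarrow> (nat set \<Rightarrow> 'a::comm_ring_1) set) set" where
  "stratum n k m = (\<lambda>(\<theta>, i). schubert_variety n k m i
     (max_preimage n (flag_parabolic n k m i :: 'a mat set) \<theta>))"

text \<open>The subset \<open>\<sigma>{..<l}\<close> of \<open>{..<n}\<close>, which is the same for all \<open>\<sigma>\<close> in a coset \<open>\<theta>\<close> of \<open>W\<^bsub>P\<^sub>l\<^esub>\<close>.\<close>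

definition coset_subset :: "nat \<Rightarrow> (nat \<Rightarrow> nat) set \<Rightarrow> nat set" where
  "coset_subset l \<theta> = (\<Union>\<sigma>\<in>\<theta>. \<sigma> ` {..<l})"

text \<open>The Pluecker coordinates \<open>p\<^bsub>(\<theta>,i)\<^esub>\<close> as elements of the coordinate ring of \<open>G/Q\<close>, that is, as
  functions on the multicone over \<open>G/Q\<close>.\<close>

definition pluecker_coordinate ::
    "nat \<Rightarrow> (nat \<Rightarrow> nat) \<Rightarrow> nat \<Rightarrow> (nat \<Rightarrow> nat) set \<times> nat
      \<Rightarrow> (nat \<times> nat set \<Rightarrow> 'a::comm_ring_1) \<Rightarrow> 'a" where
  "pluecker_coordinate n k m = (\<lambda>(\<theta>, i).
     \<lambda>v\<in>multicone (flag_basis n k) {1..m} (flag_variety n k m 1).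
       curry v i (coset_subset (k i) \<theta>))"

end

theory Submission
  imports Defs
begin

text \<open>A point of \<open>G/Q\<^sub>i\<close> is given by the minors of a matrix \<open>g\<close> on its first \<open>k j\<close> columns, \<open>j \<ge> i\<close>.
  The stratum of \<open>(\<theta>, i)\<close>, with \<open>J\<close> the subset of \<open>\<theta>\<close>, consists of the points for which the \<open>a\<close>-th of
  the first \<open>k i\<close> columns of \<open>g\<close> may be chosen to vanish below row \<open>j\<^sub>a\<close>; equivalently, a Pluecker coordinate
  \<open>L\<close> can only be non-zero if \<open>L \<sqsubseteq> J\<close>. Column reduction (the Bruhat decomposition) shows that a non-zero
  point of the cone lies in the cone of \<open>(P, j)\<close> for some non-vanishing coordinate \<open>P\<close>, which yields
  (S2), (S3) and the description of the order: it is \<open>\<sqsubseteq>\<close>, and its covers lower one element of \<open>J\<close> or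
  pass from level \<open>i\<close> to level \<open>i + 1\<close>. Near the permutation flags of \<open>J\<close> and of its lower
  neighbours the stratum is a coordinate subspace of an affine chart, hence smooth; the remaining
  points lie in strata at least two steps below. Dimensions are numbers of algebraically
  independent functions, which are read off from these charts and give (S1).\<close>

section \<open>Polynomial functions\<close>

text \<open>The flag variety and its strata are given as sets of points, so their closedness has to
  be won from equations; this is the hardest part. At a point satisfying all multihomogeneous
  equations of a stratum, an exchange identity between minors of two consecutive levels forces
  non-zero coordinates to occur along nested subsets, which places the point in a chart. There the
  remaining identities are fractions of multidegree zero, and the product of the chart coordinates
  clears their denominators. The maximal preimages enter through one permutation: the elements of
  \<open>J\<close> in increasing order, then all other rows in decreasing order. The decreasing tail
  makes it the largest at every level, so that only the Schubert condition of level \<open>i\<close>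
  remains, which is what the column bounds express. Irreducibility, density of Schubert cells and
  independence of functions all rest on the infinity of the field: two polynomial functions that do
  not vanish identically on an affine space are non-zero at a common point, found on a line.\<close>

definition polyfun :: "'v set \<Rightarrow> (('v \<Rightarrow> 'a::comm_ring_1) \<Rightarrow> 'a) set" where
  "polyfun W = poly_eval ` polys W"

text \<open>Like \<open>polyfun\<close>, a set of functions and not of formal polynomials:
  substitution becomes composition, and only values enter the topologies. The functions live on all
  coordinate assignments; \<open>W\<close> limits the variables that occur. The zero function has
  every multidegree.\<close>

definition mhfun ::
    "(nat \<times> 'b) set \<Rightarrow> (nat \<Rightarrow> nat) \<Rightarrow> ((nat \<times> 'b \<Rightarrow> 'a::comm_ring_1) \<Rightarrow> 'a) set" where
  "mhfun W d = poly_eval ` {P \<in> polys W. multihomogeneous P d}"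

definition monom_eval :: "('v \<Rightarrow>\<^sub>0 nat) \<Rightarrow> ('v \<Rightarrow> 'a::comm_semiring_1) \<Rightarrow> 'a" where
  "monom_eval \<mu> x = (\<Prod>v\<in>Poly_Mapping.keys \<mu>. x v ^ Poly_Mapping.lookup \<mu> v)"

lemma monom_eval_superset:
  assumes "finite A" "Poly_Mapping.keys \<mu> \<subseteq> A"
  shows "monom_eval \<mu> x = (\<Prod>v\<in>A. x v ^ Poly_Mapping.lookup \<mu> v)"
  unfolding monom_eval_def using assms
  by (intro prod.mono_neutral_left) (auto simp: in_keys_iff)

lemma monom_eval_add: "monom_eval (\<mu> + \<nu>) x = monom_eval \<mu> x * monom_eval \<nu> x"
proof -
  let ?A = "Poly_Mapping.keys \<mu> \<union> Poly_Mapping.keys \<nu>"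
  have "monom_eval (\<mu> + \<nu>) x = (\<Prod>v\<in>?A. x v ^ Poly_Mapping.lookup (\<mu> + \<nu>) v)"
    using keys_add[of \<mu> \<nu>] by (intro monom_eval_superset) auto
  also have "\<dots> = (\<Prod>v\<in>?A. x v ^ Poly_Mapping.lookup \<mu> v) * (\<Prod>v\<in>?A. x v ^ Poly_Mapping.lookup \<nu> v)"
    by (simp add: lookup_add power_add prod.distrib)
  also have "\<dots> = monom_eval \<mu> x * monom_eval \<nu> x"
    by (subst (1 2) monom_eval_superset[of ?A]) auto
  finally show ?thesis .
qed

lemma poly_eval_superset:
  assumes "finite A" "Poly_Mapping.keys P \<subseteq> A"
  shows "poly_eval P x = (\<Sum>\<mu>\<in>A. Poly_Mapping.lookup P \<mu> * monom_eval \<mu> x)"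
  unfolding poly_eval_def monom_eval_def[symmetric] using assms
  by (intro sum.mono_neutral_left) (auto simp: in_keys_iff)

lemma poly_eval_add: "poly_eval (P + Q) x = poly_eval P x + poly_eval Q x"
proof -
  let ?A = "Poly_Mapping.keys P \<union> Poly_Mapping.keys Q"
  have "poly_eval (P + Q) x = (\<Sum>\<mu>\<in>?A. Poly_Mapping.lookup (P + Q) \<mu> * monom_eval \<mu> x)"
    using keys_add[of P Q] by (intro poly_eval_superset) auto
  also have "\<dots> = (\<Sum>\<mu>\<in>?A. Poly_Mapping.lookup P \<mu> * monom_eval \<mu> x) +
      (\<Sum>\<mu>\<in>?A. Poly_Mapping.lookup Q \<mu> * monom_eval \<mu> x)"
    by (simp add: lookup_add distrib_right sum.distrib)
  also have "\<dots> = poly_eval P x + poly_eval Q x"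
    by (subst (1 2) poly_eval_superset[of ?A]) auto
  finally show ?thesis .
qed

lemma poly_eval_zero [simp]: "poly_eval 0 x = 0"
  by (simp add: poly_eval_def)

lemma poly_eval_sum: "poly_eval (\<Sum>i\<in>A. f i) x = (\<Sum>i\<in>A. poly_eval (f i) x)"
  by (induction A rule: infinite_finite_induct) (auto simp: poly_eval_add)

lemma poly_eval_single: "poly_eval (Poly_Mapping.single \<mu> c) x = c * monom_eval \<mu> x"
  by (subst poly_eval_superset[of "{\<mu>}"]) (auto split: if_splits)

lemma poly_mapping_eq_sum_single:
  "P = (\<Sum>\<mu>\<in>Poly_Mapping.keys P. Poly_Mapping.single \<mu> (Poly_Mapping.lookup P \<mu>))"
proof (rule poly_mapping_eqI)
  fix \<nu>
  have "Poly_Mapping.lookup (\<Sum>\<mu>\<in>Poly_Mapping.keys P. Poly_Mapping.single \<mu> (Poly_Mapping.lookup P \<mu>)) \<nu>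
    = (\<Sum>\<mu>\<in>Poly_Mapping.keys P. if \<mu> = \<nu> then Poly_Mapping.lookup P \<mu> else 0)"
    by (simp add: lookup_sum lookup_single when_def)
  then show "Poly_Mapping.lookup P \<nu> =
      Poly_Mapping.lookup (\<Sum>\<mu>\<in>Poly_Mapping.keys P. Poly_Mapping.single \<mu> (Poly_Mapping.lookup P \<mu>)) \<nu>"
    by (simp add: in_keys_iff)
qed

lemma poly_eval_mult:
  fixes P Q :: "('v, 'a::comm_semiring_1) polynomial"
  shows "poly_eval (P * Q) x = poly_eval P x * poly_eval Q x"
proof -
  let ?s = "\<lambda>P :: ('v, 'a) polynomial. \<lambda>\<mu>. Poly_Mapping.single \<mu> (Poly_Mapping.lookup P \<mu>)"
  have "P * Q = (\<Sum>\<mu>\<in>Poly_Mapping.keys P. ?s P \<mu>) * (\<Sum>\<mu>\<in>Poly_Mapping.keys Q. ?s Q \<mu>)"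
    using poly_mapping_eq_sum_single[of P] poly_mapping_eq_sum_single[of Q] by simp
  also have "poly_eval \<dots> x =
      (\<Sum>\<mu>\<in>Poly_Mapping.keys P. poly_eval (?s P \<mu>) x) * (\<Sum>\<mu>\<in>Poly_Mapping.keys Q. poly_eval (?s Q \<mu>) x)"
    by (simp add: sum_product poly_eval_sum mult_single poly_eval_single monom_eval_add mult_ac)
  also have "\<dots> = poly_eval P x * poly_eval Q x"
    using poly_mapping_eq_sum_single[of P] poly_mapping_eq_sum_single[of Q]
    by (simp add: poly_eval_sum[symmetric])
  finally show ?thesis .
qed

lemma polys_add:
  assumes "P \<in> polys W" "Q \<in> polys W"
  shows "P + Q \<in> polys W"
  unfolding polys_def
proof safe
  fix \<mu> v assume \<mu>: "\<mu> \<in> Poly_Mapping.keys (P + Q)" "v \<in> Poly_Mapping.keys \<mu>"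
  then have "\<mu> \<in> Poly_Mapping.keys P \<or> \<mu> \<in> Poly_Mapping.keys Q" using keys_add[of P Q] by auto
  then show "v \<in> W" using assms \<mu>(2) unfolding polys_def by blast
qed

lemma polys_mult:
  assumes "P \<in> polys W" "Q \<in> polys W"
  shows "P * Q \<in> polys W"
  unfolding polys_def
proof safe
  fix \<kappa> v assume \<kappa>: "\<kappa> \<in> Poly_Mapping.keys (P * Q)" "v \<in> Poly_Mapping.keys \<kappa>"
  then obtain \<mu> \<nu> where \<mu>\<nu>: "\<kappa> = \<mu> + \<nu>" "\<mu> \<in> Poly_Mapping.keys P" "\<nu> \<in> Poly_Mapping.keys Q"
    using keys_mult[of P Q] by auto
  then have "v \<in> Poly_Mapping.keys \<mu> \<or> v \<in> Poly_Mapping.keys \<nu>" using keys_add[of \<mu> \<nu>] \<kappa>(2) by auto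
  then show "v \<in> W" using assms \<mu>\<nu> unfolding polys_def by blast
qed

lemma mhfun_subset_polyfun: "mhfun W d \<subseteq> polyfun W"
  by (auto simp: mhfun_def polyfun_def)

lemma mhfun_zero: "(\<lambda>x. 0) \<in> mhfun W d"
  unfolding mhfun_def by (rule image_eqI[where x = 0]) (auto simp: polys_def multihomogeneous_def)

lemma mhfun_const: "(\<lambda>x. c) \<in> mhfun W (\<lambda>_. 0)"
  unfolding mhfun_def
  by (rule image_eqI[where x = "Poly_Mapping.single 0 c"])
    (auto simp: polys_def multihomogeneous_def poly_eval_single monom_eval_def fun_eq_iff)

lemma mhfun_var:
  assumes "v \<in> W"
  shows "(\<lambda>x. x v) \<in> mhfun W (\<lambda>j. if j = fst v then 1 else 0)"
  unfolding mhfun_def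
proof (rule image_eqI[where x = "Poly_Mapping.single (Poly_Mapping.single v 1) 1"])
  have "{w. w = v \<and> fst w = i} = (if i = fst v then {v} else {})" for i by auto
  then have "card {w. w = v \<and> fst w = i} = (if i = fst v then 1 else 0)" for i by simp
  then show "Poly_Mapping.single (Poly_Mapping.single v 1) 1 \<in>
    {P \<in> polys W. multihomogeneous P (\<lambda>j. if j = fst v then 1 else 0)}"
    using assms unfolding polys_def multihomogeneous_def by simp
qed (auto simp: poly_eval_single monom_eval_def fun_eq_iff)

lemma mhfun_add:
  assumes "f \<in> mhfun W d" "g \<in> mhfun W d"
  shows "(\<lambda>x. f x + g x) \<in> mhfun W d"
proof -
  from assms obtain P Q where "f = poly_eval P" "g = poly_eval Q" "P \<in> polys W" "Q \<in> polys W"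
    "multihomogeneous P d" "multihomogeneous Q d" by (auto simp: mhfun_def)
  moreover from this have "multihomogeneous (P + Q) d"
    using keys_add[of P Q] unfolding multihomogeneous_def by blast
  ultimately show ?thesis unfolding mhfun_def
    by (intro image_eqI[where x = "P + Q"]) (auto simp: poly_eval_add polys_add fun_eq_iff)
qed

lemma mhfun_mult:
  assumes "f \<in> mhfun W d" "g \<in> mhfun W e"
  shows "(\<lambda>x. f x * g x) \<in> mhfun W (\<lambda>j. d j + e j)"
proof -
  from assms obtain P Q where PQ: "f = poly_eval P" "g = poly_eval Q" "P \<in> polys W" "Q \<in> polys W"
    "multihomogeneous P d" "multihomogeneous Q e" by (auto simp: mhfun_def)
  have deg: "(\<Sum>v\<in>{v \<in> Poly_Mapping.keys (\<mu> + \<nu>). fst v = i}. Poly_Mapping.lookup (\<mu> + \<nu>) v) = d i + e i"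
    if "\<mu> \<in> Poly_Mapping.keys P" "\<nu> \<in> Poly_Mapping.keys Q" for \<mu> \<nu> i
  proof -
    let ?A = "Poly_Mapping.keys \<mu> \<union> Poly_Mapping.keys \<nu>"
    have sup: "(\<Sum>v\<in>{v \<in> Poly_Mapping.keys \<kappa>. fst v = i}. Poly_Mapping.lookup \<kappa> v) =
        (\<Sum>v\<in>{v \<in> ?A. fst v = i}. Poly_Mapping.lookup \<kappa> v)"
      if "Poly_Mapping.keys \<kappa> \<subseteq> ?A" for \<kappa>
      using that by (intro sum.mono_neutral_left) (auto simp: in_keys_iff)
    have "(\<Sum>v\<in>{v \<in> ?A. fst v = i}. Poly_Mapping.lookup \<mu> v) = d i"
      "(\<Sum>v\<in>{v \<in> ?A. fst v = i}. Poly_Mapping.lookup \<nu> v) = e i"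
      using PQ(5,6) that unfolding multihomogeneous_def by (subst sup[symmetric]; blast)+
    then show ?thesis
      by (subst sup) (use keys_add[of \<mu> \<nu>] in \<open>auto simp: lookup_add sum.distrib\<close>)
  qed
  have "P * Q \<in> polys W" using PQ(3,4) by (rule polys_mult)
  moreover have "multihomogeneous (P * Q) (\<lambda>j. d j + e j)"
    unfolding multihomogeneous_def using keys_mult[of P Q] deg by blast
  ultimately show ?thesis unfolding mhfun_def
    by (intro image_eqI[where x = "P * Q"]) (auto simp: poly_eval_mult fun_eq_iff PQ)
qed

lemma mhfun_mult':
  assumes "f \<in> mhfun W d" "g \<in> mhfun W e" "\<And>j. c j = d j + e j"
  shows "(\<lambda>x. f x * g x) \<in> mhfun W c"
proof -
  have "c = (\<lambda>j. d j + e j)" using assms(3) by auto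
  then show ?thesis using mhfun_mult[OF assms(1,2)] by simp
qed

lemma mhfun_cmult: "f \<in> mhfun W d \<Longrightarrow> (\<lambda>x. c * f x) \<in> mhfun W d"
  by (rule mhfun_mult'[OF mhfun_const]) auto

lemma mhfun_diff:
  assumes "f \<in> mhfun W d" "g \<in> mhfun W d"
  shows "(\<lambda>x. f x - g x) \<in> mhfun W d"
  using mhfun_add[OF assms(1) mhfun_cmult[OF assms(2), of "-1"]] by simp

lemma mhfun_sum: "(\<And>i. i \<in> A \<Longrightarrow> f i \<in> mhfun W d) \<Longrightarrow> (\<lambda>x. \<Sum>i\<in>A. f i x) \<in> mhfun W d"
  by (induction A rule: infinite_finite_induct) (auto intro: mhfun_zero mhfun_add)

lemma mhfun_prod:
  "(\<And>i. i \<in> A \<Longrightarrow> f i \<in> mhfun W (d i)) \<Longrightarrow> (\<lambda>x. \<Prod>i\<in>A. f i x) \<in> mhfun W (\<lambda>j. \<Sum>i\<in>A. d i j)"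
  by (induction A rule: infinite_finite_induct) (auto intro: mhfun_const mhfun_mult)

lemma mhfun_power: "f \<in> mhfun W d \<Longrightarrow> (\<lambda>x. f x ^ N) \<in> mhfun W (\<lambda>j. N * d j)"
  by (induction N) (auto intro: mhfun_const mhfun_mult')

lemma polyfun_const: "(\<lambda>x. c) \<in> polyfun W"
  unfolding polyfun_def
  by (rule image_eqI[where x = "Poly_Mapping.single 0 c"])
    (auto simp: polys_def poly_eval_single monom_eval_def fun_eq_iff)

lemma polyfun_var: "v \<in> W \<Longrightarrow> (\<lambda>x. x v) \<in> polyfun W"
  unfolding polyfun_def
  by (rule image_eqI[where x = "Poly_Mapping.single (Poly_Mapping.single v 1) 1"])
    (auto simp: polys_def poly_eval_single monom_eval_def fun_eq_iff)

lemma polyfun_add: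
  assumes "f \<in> polyfun W" "g \<in> polyfun W"
  shows "(\<lambda>x. f x + g x) \<in> polyfun W"
proof -
  from assms obtain P Q where "f = poly_eval P" "g = poly_eval Q" "P \<in> polys W" "Q \<in> polys W"
    by (auto simp: polyfun_def)
  then show ?thesis unfolding polyfun_def
    by (intro image_eqI[where x = "P + Q"]) (auto simp: poly_eval_add polys_add fun_eq_iff)
qed

lemma polyfun_mult:
  assumes "f \<in> polyfun W" "g \<in> polyfun W"
  shows "(\<lambda>x. f x * g x) \<in> polyfun W"
proof -
  from assms obtain P Q where PQ: "f = poly_eval P" "g = poly_eval Q" "P \<in> polys W" "Q \<in> polys W"
    by (auto simp: polyfun_def)
  have "P * Q \<in> polys W" using PQ(3,4) by (rule polys_mult)
  then show ?thesis unfolding polyfun_def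
    by (intro image_eqI[where x = "P * Q"]) (auto simp: poly_eval_mult fun_eq_iff PQ)
qed

lemma polyfun_cmult: "f \<in> polyfun W \<Longrightarrow> (\<lambda>x. c * f x) \<in> polyfun W"
  by (intro polyfun_mult polyfun_const)

lemma polyfun_diff:
  assumes "f \<in> polyfun W" "g \<in> polyfun W"
  shows "(\<lambda>x. f x - g x) \<in> polyfun W"
  using polyfun_add[OF assms(1) polyfun_cmult[OF assms(2), of "-1"]] by simp

lemma polyfun_sum: "(\<And>i. i \<in> A \<Longrightarrow> f i \<in> polyfun W) \<Longrightarrow> (\<lambda>x. \<Sum>i\<in>A. f i x) \<in> polyfun W"
  by (induction A rule: infinite_finite_induct) (auto intro: polyfun_const polyfun_add)

lemma polyfun_prod: "(\<And>i. i \<in> A \<Longrightarrow> f i \<in> polyfun W) \<Longrightarrow> (\<lambda>x. \<Prod>i\<in>A. f i x) \<in> polyfun W"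
  by (induction A rule: infinite_finite_induct) (auto intro: polyfun_const polyfun_mult)

lemma polyfun_power: "f \<in> polyfun W \<Longrightarrow> (\<lambda>x. f x ^ N) \<in> polyfun W"
  by (induction N) (auto intro: polyfun_const polyfun_mult)

section \<open>Substitution into polynomial functions, and restriction to lines\<close>

lemma polyfun_compose:
  assumes "f \<in> polyfun V" "\<And>v. v \<in> V \<Longrightarrow> (\<lambda>x. \<phi> x v) \<in> polyfun W"
  shows "(\<lambda>x. f (\<phi> x)) \<in> polyfun W"
proof -
  from assms(1) obtain P where P: "f = poly_eval P" "P \<in> polys V"
    unfolding polyfun_def by auto
  show ?thesis unfolding P(1) poly_eval_def
    using P(2) assms(2)
    by (intro polyfun_sum polyfun_cmult polyfun_prod polyfun_power) (auto simp: polys_def)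
qed

lemma polyfun_det:
  assumes "\<And>a b. a < k \<Longrightarrow> b < k \<Longrightarrow> (\<lambda>x. h x (a, b)) \<in> polyfun W"
  shows "(\<lambda>x. det (mat k k (h x))) \<in> polyfun W"
proof -
  have "(\<lambda>x. det (mat k k (h x))) =
     (\<lambda>x. \<Sum>p | p permutes {0..<k}. signof p * (\<Prod>i = 0..<k. h x (i, p i)))"
    by (auto simp: fun_eq_iff det_def'[of _ k] intro!: sum.cong prod.cong)
  also have "\<dots> \<in> polyfun W"
    using assms by (intro polyfun_sum polyfun_cmult polyfun_prod) (auto simp: permutes_in_image)
  finally show ?thesis .
qed

lemma polyfun_line:
  fixes a b :: "'v \<Rightarrow> 'a::comm_ring_1"
  assumes "f \<in> polyfun W"
  shows "\<exists>p :: 'a poly. \<forall>t. f (\<lambda>v. a v + t * b v) = poly p t"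
proof -
  from assms obtain P where P: "f = poly_eval P" "P \<in> polys W"
    unfolding polyfun_def by auto
  show ?thesis unfolding P(1) poly_eval_def
    by (rule exI[where x = "\<Sum>\<mu>\<in>Poly_Mapping.keys P. smult (Poly_Mapping.lookup P \<mu>)
         (\<Prod>v\<in>Poly_Mapping.keys \<mu>. [:a v, b v:] ^ Poly_Mapping.lookup \<mu> v)"])
      (simp add: poly_sum poly_prod mult.commute)
qed

lemma poly_nonzero_common:
  fixes p q :: "'a::field_char_0 poly"
  assumes "p \<noteq> 0" "q \<noteq> 0"
  shows "\<exists>t. poly p t \<noteq> 0 \<and> poly q t \<noteq> 0"
proof -
  have "finite {t. poly (p * q) t = 0}" using assms by (intro poly_roots_finite) auto
  then have "{t. poly (p * q) t = 0} \<noteq> UNIV" by (metis infinite_UNIV_char_0)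
  then show ?thesis by auto
qed

text \<open>On the line joining \<open>a\<close> and \<open>b\<close>, the functions become
  polynomials in one variable, non-zero at \<open>t = 0\<close> and at \<open>t = 1\<close>
  respectively. Their product has finitely many roots, and the field is infinite.\<close>

lemma polyfun_nonzero_common:
  fixes f g :: "('v \<Rightarrow> 'a::field_char_0) \<Rightarrow> 'a"
  assumes "f \<in> polyfun V" "g \<in> polyfun V" "a \<in> affine_space W" "b \<in> affine_space W"
    "f a \<noteq> 0" "g b \<noteq> 0"
  shows "\<exists>c\<in>affine_space W. f c \<noteq> 0 \<and> g c \<noteq> 0"
proof -
  obtain p where p: "\<And>t. f (\<lambda>v. a v + t * (b v - a v)) = poly p t"
    using polyfun_line[OF assms(1), of a "\<lambda>v. b v - a v"] by blast
  obtain q where q: "\<And>t. g (\<lambda>v. a v + t * (b v - a v)) = poly q t"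
    using polyfun_line[OF assms(2), of a "\<lambda>v. b v - a v"] by blast
  have "p \<noteq> 0" using p[of 0] assms(5) by auto
  moreover have "q \<noteq> 0" using q[of 1] assms(6) by auto
  ultimately obtain t where "poly p t \<noteq> 0" "poly q t \<noteq> 0" using poly_nonzero_common by blast
  then show ?thesis using assms(3,4) p q
    by (intro bexI[where x = "\<lambda>v. a v + t * (b v - a v)"]) (auto simp: affine_space_def)
qed

section \<open>Zariski topologies\<close>

lemma topspace_zariski_affine [simp]:
  "topspace (zariski_affine vs :: ('b \<Rightarrow> 'a::comm_ring_1) topology) = affine_space vs"
proof -
  have "affine_space vs \<subseteq> (\<Union>P\<in>polys vs. {x \<in> affine_space vs. poly_eval P x \<noteq> (0::'a)})"
  proof -
    have "Poly_Mapping.single 0 (1::'a) \<in> polys vs" by (auto simp: polys_def)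
    moreover have "poly_eval (Poly_Mapping.single 0 (1::'a)) x \<noteq> 0" for x :: "'b \<Rightarrow> 'a"
      by (simp add: poly_eval_single monom_eval_def del: single_one)
    ultimately show ?thesis by blast
  qed
  then show ?thesis unfolding zariski_affine_def topology_generated_by_topspace by auto
qed

text \<open>Intersections of principal open sets are handled by products, so every neighbourhood can
  be replaced by the non-vanishing of a single function.\<close>

lemma openin_zariski_affine_basis:
  fixes U :: "('v \<Rightarrow> 'a::field) set"
  assumes "openin (zariski_affine vs) U" "x \<in> U"
  shows "\<exists>f\<in>polyfun vs. f x \<noteq> 0 \<and> (\<forall>y\<in>affine_space vs. f y \<noteq> 0 \<longrightarrow> y \<in> U)"
proof -
  have "generate_topology_on ((\<lambda>P. {x \<in> affine_space vs. poly_eval P x \<noteq> 0}) ` polys vs) U"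
    using assms(1) unfolding zariski_affine_def openin_topology_generated_by_iff .
  then show ?thesis using assms(2)
  proof (induction U arbitrary: x rule: generate_topology_on.induct)
    case (Int A B)
    have x: "x \<in> A" "x \<in> B" using Int.prems by auto
    obtain f where f: "f \<in> polyfun vs" "f x \<noteq> 0" "\<forall>y\<in>affine_space vs. f y \<noteq> 0 \<longrightarrow> y \<in> A"
      using Int.IH(1)[OF x(1)] by blast
    obtain g where g: "g \<in> polyfun vs" "g x \<noteq> 0" "\<forall>y\<in>affine_space vs. g y \<noteq> 0 \<longrightarrow> y \<in> B"
      using Int.IH(2)[OF x(2)] by blast
    note fg = f(1) g(1) f(2) g(2) f(3) g(3)
    show ?case
    proof (intro bexI conjI ballI impI)
      show "(\<lambda>x. f x * g x) \<in> polyfun vs" by (rule polyfun_mult[OF fg(1,2)])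
      show "f x * g x \<noteq> 0" using fg(3,4) by simp
      fix y assume "y \<in> affine_space vs" "f y * g y \<noteq> 0"
      then show "y \<in> A \<inter> B" using fg(5,6) by auto
    qed
  next
    case (UN K)
    then obtain A where A: "A \<in> K" "x \<in> A" by auto
    then show ?case using UN.IH[OF A] by (meson UnionI)
  qed (auto simp: polyfun_def)
qed

lemma openin_zariski_affine_principal:
  assumes "f \<in> polyfun vs"
  shows "openin (zariski_affine vs) {x \<in> affine_space vs. f x \<noteq> 0}"
  unfolding zariski_affine_def using assms
  by (intro topology_generated_by_Basis) (auto simp: polyfun_def)

lemma closedin_zariski_affine_zeros:
  assumes "f \<in> polyfun vs"
  shows "closedin (zariski_affine vs) {x \<in> affine_space vs. f x = 0}"
proof -
  have "affine_space vs - {x \<in> affine_space vs. f x = 0} = {x \<in> affine_space vs. f x \<noteq> 0}" by auto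
  then show ?thesis using openin_zariski_affine_principal[OF assms] by (auto simp: closedin_def)
qed

lemma closedin_zariski_subtopologyD:
  fixes Z :: "('v \<Rightarrow> 'a::field) set"
  assumes "closedin (subtopology (zariski_affine vs) Y) Z" "x \<in> Y" "x \<in> affine_space vs" "x \<notin> Z"
  shows "\<exists>f\<in>polyfun vs. f x \<noteq> 0 \<and> (\<forall>z\<in>Z. f z = 0)"
proof -
  obtain C where C: "closedin (zariski_affine vs) C" "Z = C \<inter> Y"
    using assms(1) by (auto simp: closedin_subtopology)
  have "openin (zariski_affine vs) (affine_space vs - C)" "x \<in> affine_space vs - C"
    using C assms by (auto simp: closedin_def)
  from openin_zariski_affine_basis[OF this] obtain f where f: "f \<in> polyfun vs" "f x \<noteq> 0"
    "\<forall>y\<in>affine_space vs. f y \<noteq> 0 \<longrightarrow> y \<in> affine_space vs - C" by blast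
  have "C \<subseteq> affine_space vs" using closedin_subset[OF C(1)] by simp
  then have "\<forall>z\<in>Z. f z = 0" using f(3) C(2) by auto
  then show ?thesis using f(1,2) by (intro bexI[of _ f] conjI)
qed

lemma closedin_zariski_subtopologyI:
  fixes Z :: "('v \<Rightarrow> 'a::field) set"
  assumes "F \<subseteq> polyfun vs" "Y \<subseteq> affine_space vs" "Z = {x \<in> Y. \<forall>f\<in>F. f x = 0}"
  shows "closedin (subtopology (zariski_affine vs) Y) Z"
proof -
  \<comment> \<open>The factor \<open>affine_space vs\<close> matters for empty \<open>F\<close>:
    the intersection of the empty family is the universe.\<close>
  let ?C = "affine_space vs \<inter> \<Inter>((\<lambda>f. {x \<in> affine_space vs. f x = 0}) ` F)"
  have "closedin (zariski_affine vs) ?C"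
  proof (cases "F = {}")
    case True
    then show ?thesis using closedin_topspace[of "zariski_affine vs :: ('v \<Rightarrow> 'a) topology"] by simp
  next
    case False
    then show ?thesis using assms(1) closedin_topspace[of "zariski_affine vs :: ('v \<Rightarrow> 'a) topology"]
      by (intro closedin_Int closedin_Inter) (auto intro!: closedin_zariski_affine_zeros)
  qed
  moreover have "Z = ?C \<inter> Y" using assms(2,3) by auto
  ultimately show ?thesis by (auto simp: closedin_subtopology)
qed

lemma topspace_zariski_mp [simp]:
  "topspace (zariski_mp S I :: (nat \<Rightarrow> ('b \<Rightarrow> 'a::comm_ring_1) set) topology) =
     mp_point I ` mp_coords S I"
proof -
  let ?P = "Poly_Mapping.single 0 (1::'a) :: (nat \<times> 'b, 'a) polynomial"
  have "?P \<in> {P \<in> polys (Sigma I S). \<exists>d. multihomogeneous P d}"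
    by (auto simp: polys_def multihomogeneous_def)
  moreover have "poly_eval ?P x \<noteq> 0" for x
    by (simp add: poly_eval_single monom_eval_def del: single_one)
  ultimately have "mp_point I ` mp_coords S I \<subseteq> (\<Union>P\<in>{P \<in> polys (Sigma I S). \<exists>d. multihomogeneous P d}.
      mp_point I ` {w \<in> mp_coords S I. poly_eval P w \<noteq> (0::'a)})"
    by blast
  then show ?thesis unfolding zariski_mp_def topology_generated_by_topspace by blast
qed

lemma line_scale:
  fixes x y :: "'b \<Rightarrow> 'a::field"
  assumes "line x = line y" "x \<noteq> 0"
  shows "\<exists>c. c \<noteq> 0 \<and> (\<forall>b. x b = c * y b)"
proof -
  have "x = (\<lambda>b. 1 * x b)" by simp
  then have "x \<in> line x" unfolding line_def by (rule range_eqI)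
  then have "x \<in> line y" using assms(1) by simp
  then obtain c where c: "x = (\<lambda>b. c * y b)" by (auto simp: line_def)
  then have "c \<noteq> 0" using assms(2) by (auto simp: fun_eq_iff)
  then show ?thesis using c by auto
qed

lemma line_cmult:
  fixes x :: "'b \<Rightarrow> 'a::field"
  assumes "c \<noteq> 0"
  shows "line (\<lambda>b. c * x b) = line x"
proof
  show "line (\<lambda>b. c * x b) \<subseteq> line x"
    by (auto simp: line_def mult.assoc[symmetric])
  show "line x \<subseteq> line (\<lambda>b. c * x b)"
  proof
    fix y assume "y \<in> line x"
    then obtain d where "y = (\<lambda>b. d * x b)" by (auto simp: line_def)
    then have "y = (\<lambda>b. (d / c) * (c * x b))" using assms by simp
    then show "y \<in> line (\<lambda>b. c * x b)" unfolding line_def by (rule range_eqI)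
  qed
qed

lemma mp_point_eq_iff:
  fixes v w :: "nat \<times> 'b \<Rightarrow> 'a::field"
  assumes "v \<in> mp_coords S I"
  shows "mp_point I v = mp_point I w \<longleftrightarrow> (\<exists>c. \<forall>i\<in>I. c i \<noteq> 0 \<and> (\<forall>b. v (i, b) = c i * w (i, b)))"
proof
  assume eq: "mp_point I v = mp_point I w"
  have "\<exists>c. c \<noteq> 0 \<and> (\<forall>b. v (i, b) = c * w (i, b))" if i: "i \<in> I" for i
  proof -
    have "line (curry v i) = line (curry w i)"
      using fun_cong[OF eq, of i] i by (simp add: mp_point_def)
    moreover have "curry v i \<noteq> 0" using assms i by (auto simp: mp_coords_def)
    ultimately show ?thesis using line_scale[of "curry v i" "curry w i"] by (auto simp: curry_def)
  qed
  then show "\<exists>c. \<forall>i\<in>I. c i \<noteq> 0 \<and> (\<forall>b. v (i, b) = c i * w (i, b))" by metis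
next
  assume "\<exists>c. \<forall>i\<in>I. c i \<noteq> 0 \<and> (\<forall>b. v (i, b) = c i * w (i, b))"
  then obtain c where c: "\<forall>i\<in>I. c i \<noteq> 0 \<and> (\<forall>b. v (i, b) = c i * w (i, b))" by blast
  show "mp_point I v = mp_point I w"
  proof
    fix i
    show "mp_point I v i = mp_point I w i"
    proof (cases "i \<in> I")
      case True
      then have "curry v i = (\<lambda>b. c i * curry w i b)" using c by (auto simp: curry_def)
      then show ?thesis using True c line_cmult[of "c i" "curry w i"] by (simp add: mp_point_def)
    qed (simp add: mp_point_def)
  qed
qed

text \<open>Each variable of factor \<open>i\<close> contributes \<open>c i\<close>. Grouping the
  variables of a monomial by factor, the exponents in group \<open>i\<close> add up to
  \<open>d i\<close>, the same for all monomials.\<close>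

lemma mhfun_scale:
  fixes v w :: "nat \<times> 'b \<Rightarrow> 'a::field"
  assumes "f \<in> mhfun (Sigma I S) d" "finite I"
    "\<And>i b. i \<in> I \<Longrightarrow> v (i, b) = c i * w (i, b)"
  shows "f v = (\<Prod>i\<in>I. c i ^ d i) * f w"
proof -
  from assms(1) obtain P where P: "f = poly_eval P" "P \<in> polys (Sigma I S)" "multihomogeneous P d"
    by (auto simp: mhfun_def)
  have "monom_eval \<mu> v = (\<Prod>i\<in>I. c i ^ d i) * monom_eval \<mu> w" if \<mu>: "\<mu> \<in> Poly_Mapping.keys P" for \<mu>
  proof -
    have sub: "Poly_Mapping.keys \<mu> \<subseteq> Sigma I S" using P(2) \<mu> by (auto simp: polys_def)
    have "monom_eval \<mu> v = (\<Prod>x\<in>Poly_Mapping.keys \<mu>. c (fst x) ^ Poly_Mapping.lookup \<mu> x) * monom_eval \<mu> w"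
      unfolding monom_eval_def prod.distrib[symmetric]
      using sub assms(3) by (intro prod.cong refl) (auto simp: power_mult_distrib)
    also have "(\<Prod>x\<in>Poly_Mapping.keys \<mu>. c (fst x) ^ Poly_Mapping.lookup \<mu> x) =
       (\<Prod>i\<in>I. \<Prod>x\<in>{x \<in> Poly_Mapping.keys \<mu>. fst x = i}. c (fst x) ^ Poly_Mapping.lookup \<mu> x)"
      using sub assms(2) by (intro prod.group[symmetric]) auto
    also have "\<dots> = (\<Prod>i\<in>I. c i ^ d i)"
    proof (intro prod.cong refl)
      fix i
      have "(\<Prod>x\<in>{x \<in> Poly_Mapping.keys \<mu>. fst x = i}. c (fst x) ^ Poly_Mapping.lookup \<mu> x) =
         c i ^ (\<Sum>x\<in>{x \<in> Poly_Mapping.keys \<mu>. fst x = i}. Poly_Mapping.lookup \<mu> x)"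
        by (simp add: power_sum)
      also have "\<dots> = c i ^ d i" using P(3) \<mu> by (simp add: multihomogeneous_def)
      finally show "(\<Prod>x\<in>{x \<in> Poly_Mapping.keys \<mu>. fst x = i}. c (fst x) ^ Poly_Mapping.lookup \<mu> x) =
         c i ^ d i" .
    qed
    finally show ?thesis .
  qed
  then show ?thesis unfolding P(1) poly_eval_def monom_eval_def[symmetric]
    by (simp add: sum_distrib_left mult_ac cong: sum.cong)
qed

lemma mhfun_mp_point:
  fixes v w :: "nat \<times> 'b \<Rightarrow> 'a::field"
  assumes "f \<in> mhfun (Sigma I S) d" "finite I" "v \<in> mp_coords S I"
    "mp_point I v = mp_point I w"
  shows "f v = 0 \<longleftrightarrow> f w = 0"
proof -
  obtain c where c: "\<forall>i\<in>I. c i \<noteq> 0 \<and> (\<forall>b. v (i, b) = c i * w (i, b))"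
    using assms(4) mp_point_eq_iff[OF assms(3)] by blast
  then have "f v = (\<Prod>i\<in>I. c i ^ d i) * f w" using mhfun_scale[OF assms(1,2)] by blast
  moreover have "(\<Prod>i\<in>I. c i ^ d i) \<noteq> 0" using c assms(2) by (simp add: prod_zero_iff)
  ultimately show ?thesis by simp
qed

lemma openin_zariski_mp_basis:
  fixes U :: "(nat \<Rightarrow> ('b \<Rightarrow> 'a::field) set) set"
  assumes "openin (zariski_mp S I) U" "finite I" "w \<in> mp_coords S I" "mp_point I w \<in> U"
  shows "\<exists>f d. f \<in> mhfun (Sigma I S) d \<and> f w \<noteq> 0 \<and> (\<forall>v\<in>mp_coords S I. f v \<noteq> 0 \<longrightarrow> mp_point I v \<in> U)"
proof -
  have "generate_topology_on ((\<lambda>P. mp_point I ` {w \<in> mp_coords S I. poly_eval P w \<noteq> 0}) `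
        {P \<in> polys (Sigma I S). \<exists>d. multihomogeneous P d}) U"
    using assms(1) unfolding zariski_mp_def openin_topology_generated_by_iff .
  then show ?thesis using assms(4)
  proof (induction U rule: generate_topology_on.induct)
    case (Int A B)
    have w: "mp_point I w \<in> A" "mp_point I w \<in> B" using Int.prems by auto
    obtain f d where f: "f \<in> mhfun (Sigma I S) d" "f w \<noteq> 0"
      "\<forall>v\<in>mp_coords S I. f v \<noteq> 0 \<longrightarrow> mp_point I v \<in> A" using Int.IH(1)[OF w(1)] by blast
    obtain g e where g: "g \<in> mhfun (Sigma I S) e" "g w \<noteq> 0"
      "\<forall>v\<in>mp_coords S I. g v \<noteq> 0 \<longrightarrow> mp_point I v \<in> B" using Int.IH(2)[OF w(2)] by blast
    note fg = f(1) g(1) f(2) g(2) f(3) g(3)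
    show ?case
    proof (intro exI conjI ballI impI)
      show "(\<lambda>x. f x * g x) \<in> mhfun (Sigma I S) (\<lambda>j. d j + e j)" by (rule mhfun_mult[OF fg(1,2)])
      show "f w * g w \<noteq> 0" using fg(3,4) by simp
      fix v assume "v \<in> mp_coords S I" "f v * g v \<noteq> 0"
      then show "mp_point I v \<in> A \<inter> B" using fg(5,6) by auto
    qed
  next
    case (UN K)
    then obtain A where A: "A \<in> K" "mp_point I w \<in> A" by auto
    then show ?case using UN.IH[OF A] by (meson UnionI)
  next
    case (Basis s)
    then obtain P d where P: "P \<in> polys (Sigma I S)" "multihomogeneous P d"
      "s = mp_point I ` {w \<in> mp_coords S I. poly_eval P w \<noteq> 0}" by auto
    then obtain w' where w': "w' \<in> mp_coords S I" "poly_eval P w' \<noteq> 0" "mp_point I w = mp_point I w'"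
      using Basis.prems by auto
    have f: "poly_eval P \<in> mhfun (Sigma I S) d" using P(1,2) by (auto simp: mhfun_def)
    \<comment> \<open>\<open>P\<close> is known to be non-zero at some representative
      \<open>w'\<close> of the point; multihomogeneity carries this over to the given representative
      \<open>w\<close>.\<close>
    have "poly_eval P w \<noteq> 0" using mhfun_mp_point[OF f assms(2,3) w'(3)] w'(2) by simp
    then show ?case using f P(3) by (intro exI[of _ "poly_eval P"] exI[of _ d] conjI ballI impI imageI) auto
  qed auto
qed

lemma openin_zariski_mp_principal:
  assumes "f \<in> mhfun (Sigma I S) d"
  shows "openin (zariski_mp S I) (mp_point I ` {w \<in> mp_coords S I. f w \<noteq> 0})"
  unfolding zariski_mp_def using assms
  by (intro topology_generated_by_Basis) (auto simp: mhfun_def)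

text \<open>One separating multihomogeneous function per outside point yields an open neighbourhood
  avoiding \<open>Z\<close>. Thus strata can be shown closed without writing down a system of
  equations for them.\<close>

lemma closedin_zariski_mpI:
  fixes Z :: "(nat \<Rightarrow> ('b \<Rightarrow> 'a::field) set) set"
  assumes "finite I" "Z \<subseteq> mp_point I ` mp_coords S I"
    "\<And>w. w \<in> mp_coords S I \<Longrightarrow> mp_point I w \<notin> Z \<Longrightarrow>
       \<exists>f d. f \<in> mhfun (Sigma I S) d \<and> f w \<noteq> 0 \<and> (\<forall>v\<in>mp_coords S I. mp_point I v \<in> Z \<longrightarrow> f v = 0)"
  shows "closedin (zariski_mp S I) Z"
proof -
  have "openin (zariski_mp S I) (mp_point I ` mp_coords S I - Z)"
  proof (subst openin_subopen, intro ballI)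
    fix x assume x: "x \<in> mp_point I ` mp_coords S I - Z"
    then obtain w where w: "w \<in> mp_coords S I" "x = mp_point I w" "mp_point I w \<notin> Z" by auto
    obtain f d where f: "f \<in> mhfun (Sigma I S) d" "f w \<noteq> 0"
      "\<forall>v\<in>mp_coords S I. mp_point I v \<in> Z \<longrightarrow> f v = 0"
      using assms(3)[OF w(1,3)] by blast
    have "openin (zariski_mp S I) (mp_point I ` {w \<in> mp_coords S I. f w \<noteq> 0})"
      by (rule openin_zariski_mp_principal[OF f(1)])
    moreover have "x \<in> mp_point I ` {w \<in> mp_coords S I. f w \<noteq> 0}" using w f(2) by auto
    moreover have "mp_point I ` {w \<in> mp_coords S I. f w \<noteq> 0} \<subseteq> mp_point I ` mp_coords S I - Z"
      using f(3) by auto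
    ultimately show "\<exists>T. openin (zariski_mp S I) T \<and> x \<in> T \<and> T \<subseteq> mp_point I ` mp_coords S I - Z"
      by blast
  qed
  then show ?thesis using assms(2) by (simp add: closedin_def)
qed

section \<open>Irreducible sets\<close>

text \<open>If neither \<open>C\<close> nor \<open>D\<close> contained the image, each would be
  avoided near some parameter. The two non-vanishing conditions, both multiplied by \<open>h\<close>
  to stay in \<open>U\<close>, have a common solution, whose image is outside
  \<open>C \<union> D\<close>. Continuity is spelled out as \<open>cont\<close> because the target
  is affine in one use and multiprojective in the other.\<close>

lemma irreducible_closedin_image:
  fixes h :: "('w \<Rightarrow> 'a::field_char_0) \<Rightarrow> 'a"
  assumes h: "h \<in> polyfun V" and U: "U = {a \<in> affine_space W. h a \<noteq> 0}" "U \<noteq> {}"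
    and closed: "closedin T (\<Phi> ` U)"
    and cont: "\<And>N a. openin T N \<Longrightarrow> a \<in> U \<Longrightarrow> \<Phi> a \<in> N \<Longrightarrow>
      \<exists>f\<in>polyfun V. f a \<noteq> 0 \<and> (\<forall>b\<in>U. f b \<noteq> 0 \<longrightarrow> \<Phi> b \<in> N)"
  shows "irreducible_closedin T (\<Phi> ` U)"
  unfolding irreducible_closedin_def
proof (intro conjI allI impI)
  fix C D assume CD: "closedin T C" "closedin T D" "\<Phi> ` U \<subseteq> C \<union> D"
  show "\<Phi> ` U \<subseteq> C \<or> \<Phi> ` U \<subseteq> D"
  proof (rule ccontr)
    assume "\<not> (\<Phi> ` U \<subseteq> C \<or> \<Phi> ` U \<subseteq> D)"
    then obtain a b where ab: "a \<in> U" "b \<in> U" "\<Phi> a \<notin> C" "\<Phi> b \<notin> D" by auto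
    have top: "\<Phi> ` U \<subseteq> topspace T" using closedin_subset[OF closed] .
    have o: "openin T (topspace T - C)" "openin T (topspace T - D)" using CD by (auto simp: closedin_def)
    have m: "\<Phi> a \<in> topspace T - C" "\<Phi> b \<in> topspace T - D" using ab top by auto
    obtain f where f: "f \<in> polyfun V" "f a \<noteq> 0" "\<forall>b\<in>U. f b \<noteq> 0 \<longrightarrow> \<Phi> b \<in> topspace T - C"
      using cont[OF o(1) ab(1) m(1)] by blast
    obtain g where g: "g \<in> polyfun V" "g b \<noteq> 0" "\<forall>b\<in>U. g b \<noteq> 0 \<longrightarrow> \<Phi> b \<in> topspace T - D"
      using cont[OF o(2) ab(2) m(2)] by blast
    note fg = f(1) g(1) f(2) g(2) f(3) g(3)
    have "\<exists>c\<in>affine_space W. f c * h c \<noteq> 0 \<and> g c * h c \<noteq> 0"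
      using ab fg h U(1)
      by (intro polyfun_nonzero_common[where a = a and b = b and V = V] polyfun_mult) auto
    then obtain c where "c \<in> affine_space W" "f c \<noteq> 0" "g c \<noteq> 0" "h c \<noteq> 0" by auto
    then show False using fg(5,6) CD(3) U(1) by blast
  qed
qed (use closed U in auto)

lemma irreducible_closedin_subtopology:
  assumes "irreducible_closedin T Z" "Z \<subseteq> Y"
  shows "irreducible_closedin (subtopology T Y) Z"
  unfolding irreducible_closedin_def
proof (intro conjI allI impI)
  show "closedin (subtopology T Y) Z"
    using assms by (auto simp: irreducible_closedin_def closedin_subtopology)
  show "Z \<noteq> {}" using assms by (auto simp: irreducible_closedin_def)
  fix C D assume "closedin (subtopology T Y) C" "closedin (subtopology T Y) D" and CD: "Z \<subseteq> C \<union> D"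
  then obtain C' D' where "closedin T C'" "C = C' \<inter> Y" "closedin T D'" "D = D' \<inter> Y"
    by (auto simp: closedin_subtopology)
  moreover from this have "Z \<subseteq> C' \<union> D'" using CD by auto
  ultimately have "Z \<subseteq> C' \<or> Z \<subseteq> D'" using assms(1) by (auto simp: irreducible_closedin_def)
  then show "Z \<subseteq> C \<or> Z \<subseteq> D" using assms(2) \<open>C = C' \<inter> Y\<close> \<open>D = D' \<inter> Y\<close> by auto
qed

lemma irreducible_closedin_finite_Union:
  assumes "irreducible_closedin T Z" "finite K" "\<And>C. C \<in> K \<Longrightarrow> closedin T C" "Z \<subseteq> \<Union>K"
  shows "\<exists>C\<in>K. Z \<subseteq> C"
  using assms(2-4)
proof (induction K)
  case empty
  then show ?case using assms(1) by (auto simp: irreducible_closedin_def)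
next
  case (insert C K)
  have "closedin T (\<Union>K)" using insert by (intro closedin_Union) auto
  then have "Z \<subseteq> C \<or> Z \<subseteq> \<Union>K" using insert assms(1) by (auto simp: irreducible_closedin_def)
  then show ?case using insert by auto
qed

text \<open>The vanishing ideal is prime, or the unit ideal when \<open>Z\<close> is empty. In this
  form irreducibility enters the dimension argument, where factors are cancelled from algebraic
  relations.\<close>

definition prime_zeros :: "'v set \<Rightarrow> ('v \<Rightarrow> 'a::comm_ring_1) set \<Rightarrow> bool" where
  "prime_zeros vs Z \<longleftrightarrow> (\<forall>f\<in>polyfun vs. \<forall>g\<in>polyfun vs. (\<forall>z\<in>Z. f z * g z = 0) \<longrightarrow>
     (\<forall>z\<in>Z. f z = 0) \<or> (\<forall>z\<in>Z. g z = 0))"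

lemma irreducible_closedin_prime_zeros:
  fixes Z :: "('v \<Rightarrow> 'a::field) set"
  assumes "irreducible_closedin (subtopology (zariski_affine vs) Y) Z"
  shows "prime_zeros vs Z"
  unfolding prime_zeros_def
proof (intro ballI impI)
  fix f g :: "('v \<Rightarrow> 'a) \<Rightarrow> 'a"
  assume fg: "f \<in> polyfun vs" "g \<in> polyfun vs" "\<forall>z\<in>Z. f z * g z = 0"
  let ?V = "\<lambda>f. {x \<in> affine_space vs. f x = 0} \<inter> Y"
  have c: "closedin (subtopology (zariski_affine vs) Y) (?V f)"
    if "f \<in> polyfun vs" for f :: "('v \<Rightarrow> 'a) \<Rightarrow> 'a"
    using closedin_zariski_affine_zeros[OF that] by (auto simp: closedin_subtopology)
  have "closedin (subtopology (zariski_affine vs) Y) Z" using assms by (auto simp: irreducible_closedin_def)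
  then have "Z \<subseteq> affine_space vs \<inter> Y" using closedin_subset by fastforce
  then have "Z \<subseteq> ?V f \<union> ?V g" using fg(3) by auto
  then have "Z \<subseteq> ?V f \<or> Z \<subseteq> ?V g" using c[OF fg(1)] c[OF fg(2)] assms
    by (auto simp: irreducible_closedin_def)
  then show "(\<forall>z\<in>Z. f z = 0) \<or> (\<forall>z\<in>Z. g z = 0)" by auto
qed

lemma prime_zeros_affine_space:
  "prime_zeros vs (affine_space W :: ('v \<Rightarrow> 'a::field_char_0) set)"
  unfolding prime_zeros_def
proof (intro ballI impI, rule ccontr)
  fix f g :: "('v \<Rightarrow> 'a) \<Rightarrow> 'a"
  assume fg: "f \<in> polyfun vs" "g \<in> polyfun vs" "\<forall>z\<in>affine_space W. f z * g z = 0"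
    and "\<not> ((\<forall>z\<in>affine_space W. f z = 0) \<or> (\<forall>z\<in>affine_space W. g z = 0))"
  then obtain a b where ab: "a \<in> affine_space W" "b \<in> affine_space W" "f a \<noteq> 0" "g b \<noteq> 0" by blast
  obtain c where c: "c \<in> affine_space W" "f c \<noteq> 0" "g c \<noteq> 0"
    using polyfun_nonzero_common[of f vs g a W b] fg(1,2) ab by blast
  show False using bspec[OF fg(3) c(1)] c(2,3) by simp
qed

lemma prime_zeros_power:
  fixes Z :: "('v \<Rightarrow> 'a::field) set"
  assumes "prime_zeros vs Z" "f \<in> polyfun vs" "g \<in> polyfun vs" "\<forall>z\<in>Z. f z ^ N * g z = 0"
    "\<not> (\<forall>z\<in>Z. f z = 0)"
  shows "\<forall>z\<in>Z. g z = 0"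
proof -
  have "(\<forall>z\<in>Z. f z ^ N = 0) \<or> (\<forall>z\<in>Z. g z = 0)"
    using bspec[OF bspec[OF assms(1)[unfolded prime_zeros_def] polyfun_power[OF assms(2)]] assms(3)]
      assms(4) by (rule mp)
  then show ?thesis using assms(5) by auto
qed

section \<open>Dimension\<close>

text \<open>The dimension of an irreducible set is computed as the maximal number of algebraically
  independent polynomial functions on it, which avoids the dimension theory of rings. The exponent
  vectors \<open>\<alpha>\<close> vanish outside \<open>{..<l}\<close>.\<close>

definition alg_indep :: "'x set \<Rightarrow> (nat \<Rightarrow> 'x \<Rightarrow> 'a::field) \<Rightarrow> nat \<Rightarrow> bool" where
  "alg_indep Z F l \<longleftrightarrow> (\<forall>S c. finite S \<longrightarrow> S \<subseteq> {\<alpha>. \<forall>i\<ge>l. \<alpha> i = 0} \<longrightarrow>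
     (\<forall>z\<in>Z. (\<Sum>\<alpha>\<in>S. c \<alpha> * (\<Prod>i<l. F i z ^ \<alpha> i)) = 0) \<longrightarrow> (\<forall>\<alpha>\<in>S. c \<alpha> = 0))"

lemma alg_indepD:
  assumes "alg_indep Z F l" "finite S" "S \<subseteq> {\<alpha>. \<forall>i\<ge>l. \<alpha> i = 0}"
    "\<And>z. z \<in> Z \<Longrightarrow> (\<Sum>\<alpha>\<in>S. c \<alpha> * (\<Prod>i<l. F i z ^ \<alpha> i)) = 0" "\<alpha> \<in> S"
  shows "c \<alpha> = 0"
  using assms unfolding alg_indep_def by blast

lemma alg_indep_mono:
  assumes "alg_indep Z F l" "Z \<subseteq> Z'"
  shows "alg_indep Z' F l"
  unfolding alg_indep_def
proof (intro allI impI)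
  fix S c assume "finite S" "S \<subseteq> {\<alpha>. \<forall>i\<ge>l. \<alpha> i = 0}"
    and "\<forall>z\<in>Z'. (\<Sum>\<alpha>\<in>S. c \<alpha> * (\<Prod>i<l. F i z ^ \<alpha> i)) = 0"
  then show "\<forall>\<alpha>\<in>S. c \<alpha> = 0" using alg_indepD[OF assms(1), of S c] assms(2) by blast
qed

text \<open>The only admissible exponent vector is zero, so a relation is a single constant, which
  is read off at any point of \<open>Z\<close>.\<close>

lemma alg_indep_0: "Z \<noteq> {} \<Longrightarrow> alg_indep Z F 0"
  unfolding alg_indep_def
proof (intro allI impI ballI)
  fix S :: "(nat \<Rightarrow> nat) set" and c :: "(nat \<Rightarrow> nat) \<Rightarrow> 'b" and \<alpha>
  assume Z: "Z \<noteq> {}" and S: "S \<subseteq> {\<alpha>. \<forall>i\<ge>0. \<alpha> i = 0}"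
    and z: "\<forall>z\<in>Z. (\<Sum>\<alpha>\<in>S. c \<alpha> * (\<Prod>i<0. F i z ^ \<alpha> i)) = 0" and \<alpha>: "\<alpha> \<in> S"
  have "\<beta> = \<alpha>" if "\<beta> \<in> S" for \<beta>
  proof
    fix i
    have "\<beta> \<in> {\<alpha>. \<forall>i\<ge>0. \<alpha> i = 0}" "\<alpha> \<in> {\<alpha>. \<forall>i\<ge>0. \<alpha> i = 0}" using S \<alpha> that by (auto simp only: subset_iff)
    then show "\<beta> i = \<alpha> i" by simp
  qed
  then have eq: "S = {\<alpha>}" using \<alpha> by blast
  obtain x where "x \<in> Z" using Z by blast
  from bspec[OF z this] show "c \<alpha> = 0" unfolding eq by simp
qed

text \<open>A relation between the enlarged family is first divided by the largest possible power of the
  new function \<open>F l\<close>; what is left restricts to a relation on \<open>Z\<close>.\<close>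

lemma alg_indep_Suc:
  assumes indep: "alg_indep Z F l" and sub: "Z \<subseteq> Z'" and prime: "prime_zeros vs Z'"
    and F: "\<And>i. i \<le> l \<Longrightarrow> F i \<in> polyfun vs"
    and zero: "\<And>z. z \<in> Z \<Longrightarrow> F l z = 0" and nz: "z0 \<in> Z'" "F l z0 \<noteq> 0"
  shows "alg_indep Z' F (Suc l)"
  unfolding alg_indep_def
proof (intro allI impI ballI, rule ccontr)
  fix S :: "(nat \<Rightarrow> nat) set" and c :: "(nat \<Rightarrow> nat) \<Rightarrow> 'b" and \<alpha>0
  assume fin: "finite S" and S: "S \<subseteq> {\<alpha>. \<forall>i\<ge>Suc l. \<alpha> i = 0}"
    and rel: "\<forall>z\<in>Z'. (\<Sum>\<alpha>\<in>S. c \<alpha> * (\<Prod>i<Suc l. F i z ^ \<alpha> i)) = 0"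
    and \<alpha>0: "\<alpha>0 \<in> S" "c \<alpha>0 \<noteq> 0"
  define S' where "S' = {\<alpha> \<in> S. c \<alpha> \<noteq> 0}"
  have S': "finite S'" "S' \<noteq> {}" using fin \<alpha>0 by (auto simp: S'_def)
  define e where "e = Min ((\<lambda>\<alpha>. \<alpha> l) ` S')"
  have e: "\<And>\<alpha>. \<alpha> \<in> S' \<Longrightarrow> e \<le> \<alpha> l" using S' by (auto simp: e_def)
  have "e \<in> (\<lambda>\<alpha>. \<alpha> l) ` S'" unfolding e_def using S' by (intro Min_in) auto
  then obtain \<alpha>1 where \<alpha>1: "\<alpha>1 \<in> S'" "\<alpha>1 l = e" by auto
  define G where "G = (\<lambda>z. \<Sum>\<alpha>\<in>S'. c \<alpha> * ((\<Prod>i<l. F i z ^ \<alpha> i) * F l z ^ (\<alpha> l - e)))"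
  have G: "G \<in> polyfun vs"
    unfolding G_def using F by (intro polyfun_sum polyfun_cmult polyfun_mult polyfun_prod polyfun_power) auto
  have "F l z ^ e * G z = 0" if z: "z \<in> Z'" for z
  proof -
    have "F l z ^ e * G z = (\<Sum>\<alpha>\<in>S'. c \<alpha> * (\<Prod>i<Suc l. F i z ^ \<alpha> i))"
      unfolding G_def sum_distrib_left
    proof (intro sum.cong refl)
      fix \<alpha> assume "\<alpha> \<in> S'"
      then have "F l z ^ \<alpha> l = F l z ^ e * F l z ^ (\<alpha> l - e)"
        using e by (simp add: power_add[symmetric])
      then show "F l z ^ e * (c \<alpha> * ((\<Prod>i<l. F i z ^ \<alpha> i) * F l z ^ (\<alpha> l - e))) =
         c \<alpha> * (\<Prod>i<Suc l. F i z ^ \<alpha> i)"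
        by (simp add: mult_ac)
    qed
    also have "\<dots> = (\<Sum>\<alpha>\<in>S. c \<alpha> * (\<Prod>i<Suc l. F i z ^ \<alpha> i))"
      using fin by (intro sum.mono_neutral_left) (auto simp: S'_def)
    finally show ?thesis using rel z by simp
  qed
  \<comment> \<open>Primality cancels \<open>F l ^ e\<close>, since \<open>F l\<close> is non-zero
    at \<open>z0\<close>.\<close>
  then have G0: "\<forall>z\<in>Z'. G z = 0"
    using nz by (intro prime_zeros_power[OF prime F[OF order_refl] G, of e]) auto
  \<comment> \<open>The terms with exponent exactly \<open>e\<close>, with the entry for
    \<open>F l\<close> reset to 0; all other terms of \<open>G\<close> keep a factor
    \<open>F l\<close> and vanish on \<open>Z\<close>.\<close>
  define T where "T = (\<lambda>\<alpha>. \<alpha>(l := 0)) ` {\<alpha> \<in> S'. \<alpha> l = e}"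
  have inj: "inj_on (\<lambda>\<alpha>. \<alpha>(l := 0)) {\<alpha> \<in> S'. \<alpha> l = e}"
  proof (rule inj_onI)
    fix \<alpha> \<beta> assume ab: "\<alpha> \<in> {\<alpha> \<in> S'. \<alpha> l = e}" "\<beta> \<in> {\<alpha> \<in> S'. \<alpha> l = e}" "\<alpha>(l := 0) = \<beta>(l := 0)"
    show "\<alpha> = \<beta>"
    proof
      fix i
      have "(\<alpha>(l := 0)) i = (\<beta>(l := 0)) i" by (simp only: ab(3))
      then show "\<alpha> i = \<beta> i" using ab(1,2) by (cases "i = l") simp_all
    qed
  qed
  have "c ((\<alpha>1(l := 0))(l := e)) = 0"
  proof (rule alg_indepD[OF indep, of T "\<lambda>\<beta>. c (\<beta>(l := e))" "\<alpha>1(l := 0)"])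
    show "finite T" using S' by (auto simp: T_def)
    show "\<alpha>1(l := 0) \<in> T" using \<alpha>1 by (auto simp: T_def)
    show "T \<subseteq> {\<alpha>. \<forall>i\<ge>l. \<alpha> i = 0}"
    proof
      fix \<beta> assume "\<beta> \<in> T"
      then obtain \<alpha> where \<alpha>: "\<alpha> \<in> S" "\<beta> = \<alpha>(l := 0)" by (auto simp: T_def S'_def)
      have "\<forall>i\<ge>Suc l. \<alpha> i = 0" using \<alpha>(1) S by auto
      then show "\<beta> \<in> {\<alpha>. \<forall>i\<ge>l. \<alpha> i = 0}" using \<alpha>(2) by auto
    qed
    fix z assume z: "z \<in> Z"
    have "(\<Sum>\<beta>\<in>T. c (\<beta>(l := e)) * (\<Prod>i<l. F i z ^ \<beta> i)) =
       (\<Sum>\<alpha>\<in>{\<alpha> \<in> S'. \<alpha> l = e}. c \<alpha> * (\<Prod>i<l. F i z ^ \<alpha> i))"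
      unfolding T_def by (subst sum.reindex[OF inj]) (auto intro!: sum.cong)
    also have "\<dots> = G z"
      unfolding G_def
    proof (rule sum.mono_neutral_cong_left)
      show "\<forall>\<alpha>\<in>S' - {\<alpha> \<in> S'. \<alpha> l = e}. c \<alpha> * ((\<Prod>i<l. F i z ^ \<alpha> i) * F l z ^ (\<alpha> l - e)) = 0"
      proof
        fix \<alpha> assume "\<alpha> \<in> S' - {\<alpha> \<in> S'. \<alpha> l = e}"
        then have "0 < \<alpha> l - e" using e[of \<alpha>] by auto
        then show "c \<alpha> * ((\<Prod>i<l. F i z ^ \<alpha> i) * F l z ^ (\<alpha> l - e)) = 0"
          using zero[OF z] by simp
      qed
    qed (use S' in auto)
    finally show "(\<Sum>\<beta>\<in>T. c (\<beta>(l := e)) * (\<Prod>i<l. F i z ^ \<beta> i)) = 0"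
      using G0 sub z by auto
  qed
  moreover have "(\<alpha>1(l := 0))(l := e) = \<alpha>1" using \<alpha>1 by auto
  ultimately show False using \<alpha>1 by (auto simp: S'_def)
qed

lemma alg_indep_cong:
  assumes "alg_indep Z F l" "\<And>i. i < l \<Longrightarrow> F i = G i"
  shows "alg_indep Z G l"
proof -
  have "(\<Prod>i<l. F i z ^ \<alpha> i) = (\<Prod>i<l. G i z ^ \<alpha> i)" for z \<alpha> using assms(2) by (intro prod.cong) auto
  then show ?thesis using assms(1) unfolding alg_indep_def by simp
qed

text \<open>Each strict inclusion contributes a function vanishing on the smaller set but not on the
  larger one, and \<open>alg_indep_Suc\<close> adds it to the family. Starting from \<open>r\<close>
  functions on the bottom set makes the count usable for chains above a given set, as codimension
  requires.\<close>

lemma alg_indep_chain: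
  fixes Z :: "nat \<Rightarrow> ('v \<Rightarrow> 'a::field) set"
  assumes "irreducible_chain (subtopology (zariski_affine vs) Y) l Z"
    "alg_indep (Z 0) F r" "\<And>i. i < r \<Longrightarrow> F i \<in> polyfun vs"
  shows "\<exists>G. (\<forall>i<r + l. G i \<in> polyfun vs) \<and> alg_indep (Z l) G (r + l)"
  using assms(1)
proof (induction l)
  case 0
  then show ?case using assms(2,3) by auto
next
  case (Suc l)
  let ?T = "subtopology (zariski_affine vs) Y"
  have "irreducible_chain ?T l Z" using Suc.prems by (auto simp: irreducible_chain_def)
  then obtain G where G: "\<forall>i<r + l. G i \<in> polyfun vs" "alg_indep (Z l) G (r + l)" using Suc.IH by blast
  have irr: "irreducible_closedin ?T (Z l)" "irreducible_closedin ?T (Z (Suc l))" "Z l \<subset> Z (Suc l)"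
    using Suc.prems by (auto simp: irreducible_chain_def)
  then have cl: "closedin ?T (Z l)" "closedin ?T (Z (Suc l))" by (auto simp: irreducible_closedin_def)
  obtain x where x: "x \<in> Z (Suc l)" "x \<notin> Z l" using irr(3) by auto
  then have "x \<in> Y" "x \<in> affine_space vs" using closedin_subset[OF cl(2)] by auto
  then obtain f where f: "f \<in> polyfun vs" "f x \<noteq> 0" "\<forall>z\<in>Z l. f z = 0"
    using closedin_zariski_subtopologyD[OF cl(1)] x(2) by blast
  define H where "H = G(r + l := f)"
  have H: "\<And>i. i \<le> r + l \<Longrightarrow> H i \<in> polyfun vs" using G(1) f(1) by (auto simp: H_def)
  have "alg_indep (Z l) H (r + l)" using G(2) by (rule alg_indep_cong) (auto simp: H_def)
  then have "alg_indep (Z (Suc l)) H (Suc (r + l))"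
    by (rule alg_indep_Suc[OF _ _ irreducible_closedin_prime_zeros[OF irr(2)] H, where ?z0.0 = x])
      (use irr(3) f x(1) in \<open>auto simp: H_def\<close>)
  then show ?case using H by (intro exI[of _ H]) auto
qed

text \<open>The coordinate subspaces form a chain: the coordinate \<open>l\<close> vanishes on the
  subspace of the first \<open>l\<close> coordinates, but not at its unit vector.\<close>

lemma alg_indep_coordinates:
  "alg_indep (affine_space {..<l}) (\<lambda>i x. x i :: 'a::field_char_0) l"
proof (induction l)
  case 0
  have "(\<lambda>_. 0) \<in> affine_space ({..<0} :: nat set)" by (auto simp: affine_space_def)
  then show ?case by (intro alg_indep_0) blast
next
  case (Suc l)
  let ?u = "\<lambda>i. if i = l then 1 else 0 :: 'a"
  show ?case
    by (rule alg_indep_Suc[OF Suc _ prime_zeros_affine_space[of UNIV], where ?z0.0 = ?u])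
      (auto intro: polyfun_var simp: affine_space_def)
qed

text \<open>A relation becomes a polynomial \<open>R\<close> that vanishes wherever the product
  \<open>p\<close> of the coordinates does not; so \<open>p * R\<close> vanishes everywhere, and
  primality removes \<open>p\<close>. Prescribing only non-zero values later allows division by
  them.\<close>

lemma alg_indepI:
  fixes F :: "nat \<Rightarrow> 'x \<Rightarrow> 'a::field_char_0"
  assumes ex: "\<And>y. (\<And>i. i < l \<Longrightarrow> y i \<noteq> 0) \<Longrightarrow> \<exists>z\<in>Z. \<forall>i<l. F i z = y i"
  shows "alg_indep Z F l"
  unfolding alg_indep_def
proof (intro allI impI ballI)
  fix S :: "(nat \<Rightarrow> nat) set" and c :: "(nat \<Rightarrow> nat) \<Rightarrow> 'a" and \<alpha>
  assume S: "finite S" "S \<subseteq> {\<alpha>. \<forall>i\<ge>l. \<alpha> i = 0}" and \<alpha>: "\<alpha> \<in> S"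
    and rel: "\<forall>z\<in>Z. (\<Sum>\<alpha>\<in>S. c \<alpha> * (\<Prod>i<l. F i z ^ \<alpha> i)) = 0"
  define R where "R = (\<lambda>y :: nat \<Rightarrow> 'a. \<Sum>\<alpha>\<in>S. c \<alpha> * (\<Prod>i<l. y i ^ \<alpha> i))"
  define p where "p = (\<lambda>y :: nat \<Rightarrow> 'a. \<Prod>i<l. y i)"
  have R: "R \<in> polyfun UNIV" and p: "p \<in> polyfun UNIV"
    unfolding R_def p_def by (auto intro!: polyfun_sum polyfun_cmult polyfun_prod polyfun_power polyfun_var)
  have "\<forall>y\<in>affine_space {..<l}. p y * R y = 0"
  proof
    fix y
    show "p y * R y = 0"
  proof (cases "p y = 0")
    case False
    then have "\<And>i. i < l \<Longrightarrow> y i \<noteq> 0" by (auto simp: p_def)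
    then obtain z where z: "z \<in> Z" "\<forall>i<l. F i z = y i" using ex by blast
    have "R y = (\<Sum>\<alpha>\<in>S. c \<alpha> * (\<Prod>i<l. F i z ^ \<alpha> i))"
      unfolding R_def using z(2) by (intro sum.cong refl arg_cong2[where f = "(*)"] prod.cong) auto
    then show ?thesis using rel z(1) by simp
    qed simp
  qed
  then have "(\<forall>y\<in>affine_space {..<l}. p y = 0) \<or> (\<forall>y\<in>affine_space {..<l}. R y = 0)"
    by (rule mp[OF bspec[OF bspec[OF prime_zeros_affine_space[of UNIV "{..<l}", unfolded prime_zeros_def] p] R]])
  moreover have "p (\<lambda>i. if i < l then 1 else 0) \<noteq> 0" by (simp add: p_def)
  moreover have "(\<lambda>i. if i < l then 1 else 0 :: 'a) \<in> affine_space {..<l}" by (auto simp: affine_space_def)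
  ultimately have "\<forall>y\<in>affine_space {..<l}. R y = 0" by auto
  then show "c \<alpha> = 0"
    by (intro alg_indepD[OF alg_indep_coordinates S _ \<alpha>]) (auto simp: R_def)
qed

section \<open>Counting bound for independent polynomials on affine space\<close>

global_interpretation fun_vs: vector_space "\<lambda>(c::'a::field) (f::'x \<Rightarrow> 'a) x. c * f x"
  by standard (auto simp: fun_eq_iff algebra_simps)

lemma sum_fun_apply: "(\<Sum>i\<in>A. f i) x = (\<Sum>i\<in>A. f i x)"
  by (induction A rule: infinite_finite_induct) auto

text \<open>Exponents are bounded in each variable separately, not in total, so that the admissible
  monomials fill a box and their number is bounded by a plain power.\<close>

definition bounded_polys :: "'v set \<Rightarrow> nat \<Rightarrow> ('v, 'a::zero) polynomial set" where
  "bounded_polys W e = {P \<in> polys W. \<forall>\<mu>\<in>Poly_Mapping.keys P. \<forall>v. Poly_Mapping.lookup \<mu> v \<le> e}"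

lemma bounded_polys_mono: "d \<le> e \<Longrightarrow> bounded_polys W d \<subseteq> bounded_polys W e"
  unfolding bounded_polys_def by (auto intro: order_trans)

lemma polys_bounded:
  assumes "P \<in> polys W"
  shows "\<exists>e. P \<in> bounded_polys W e"
proof -
  let ?A = "\<Union>\<mu>\<in>Poly_Mapping.keys P. Poly_Mapping.lookup \<mu> ` Poly_Mapping.keys \<mu>"
  have "Poly_Mapping.lookup \<mu> v \<le> Max (insert 0 ?A)" if "\<mu> \<in> Poly_Mapping.keys P" for \<mu> v
  proof (cases "v \<in> Poly_Mapping.keys \<mu>")
    case True
    then show ?thesis using that by (intro Max_ge) auto
  qed (simp add: in_keys_iff)
  then show ?thesis using assms unfolding bounded_polys_def by blast
qed

lemma bounded_polys_mult:
  assumes "P \<in> bounded_polys W d" "Q \<in> bounded_polys W e"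
  shows "P * Q \<in> bounded_polys W (d + e)"
proof -
  have "Poly_Mapping.lookup \<kappa> v \<le> d + e" if \<kappa>: "\<kappa> \<in> Poly_Mapping.keys (P * Q)" for \<kappa> v
  proof -
    obtain \<mu> \<nu> where "\<kappa> = \<mu> + \<nu>" "\<mu> \<in> Poly_Mapping.keys P" "\<nu> \<in> Poly_Mapping.keys Q"
      using subsetD[OF keys_mult[of P Q] \<kappa>] by blast
    then show ?thesis using assms by (auto simp: bounded_polys_def lookup_add intro!: add_mono)
  qed
  then show ?thesis using assms by (auto simp: bounded_polys_def intro: polys_mult)
qed

lemma bounded_polys_one: "1 \<in> bounded_polys W 0"
  by (auto simp: bounded_polys_def polys_def)

lemma bounded_polys_power: "P \<in> bounded_polys W d \<Longrightarrow> P ^ N \<in> bounded_polys W (N * d)"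
  by (induction N) (auto intro: bounded_polys_one bounded_polys_mult)

lemma bounded_polys_prod:
  "finite A \<Longrightarrow> (\<And>i. i \<in> A \<Longrightarrow> f i \<in> bounded_polys W d) \<Longrightarrow> (\<Prod>i\<in>A. f i) \<in> bounded_polys W (card A * d)"
  by (induction A rule: finite_induct) (auto intro: bounded_polys_one bounded_polys_mult)

lemma poly_eval_one [simp]: "poly_eval 1 x = 1"
  by (simp add: poly_eval_single monom_eval_def flip: single_one)

lemma poly_eval_power: "poly_eval (P ^ N) x = poly_eval P x ^ N"
  by (induction N) (auto simp: poly_eval_mult)

lemma poly_eval_prod: "poly_eval (\<Prod>i\<in>A. f i) x = (\<Prod>i\<in>A. poly_eval (f i) x)"
  by (induction A rule: infinite_finite_induct) (auto simp: poly_eval_mult)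

definition bounded_monoms :: "'v set \<Rightarrow> nat \<Rightarrow> ('v \<Rightarrow>\<^sub>0 nat) set" where
  "bounded_monoms W e = {\<mu>. Poly_Mapping.keys \<mu> \<subseteq> W \<and> (\<forall>v. Poly_Mapping.lookup \<mu> v \<le> e)}"

lemma card_bounded_monoms:
  assumes "finite W"
  shows "finite (bounded_monoms W e)" "card (bounded_monoms W e) \<le> (e + 1) ^ card W"
proof -
  let ?f = "\<lambda>\<mu>. restrict (Poly_Mapping.lookup \<mu>) W" and ?B = "W \<rightarrow>\<^sub>E {..e}"
  have inj: "inj_on ?f (bounded_monoms W e)"
  proof (rule inj_onI)
    fix \<mu> \<nu> assume m: "\<mu> \<in> bounded_monoms W e" "\<nu> \<in> bounded_monoms W e" "?f \<mu> = ?f \<nu>"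
    show "\<mu> = \<nu>"
    proof (rule poly_mapping_eqI)
      fix v
      show "Poly_Mapping.lookup \<mu> v = Poly_Mapping.lookup \<nu> v"
      proof (cases "v \<in> W")
        case True
        then show ?thesis using fun_cong[OF m(3), of v] by simp
      next
        case False
        then have "v \<notin> Poly_Mapping.keys \<mu>" "v \<notin> Poly_Mapping.keys \<nu>"
          using m by (auto simp: bounded_monoms_def)
        then show ?thesis by (simp add: in_keys_iff)
      qed
    qed
  qed
  have img: "?f ` bounded_monoms W e \<subseteq> ?B" by (auto simp: bounded_monoms_def)
  have fin: "finite ?B" using assms by (intro finite_PiE) auto
  show "finite (bounded_monoms W e)" by (rule inj_on_finite[OF inj img fin])
  have "card ?B = (e + 1) ^ card W" using assms by (simp add: card_PiE)
  then show "card (bounded_monoms W e) \<le> (e + 1) ^ card W" using card_inj_on_le[OF inj img fin] by simp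
qed

lemma bounded_polys_span:
  fixes P :: "('v, 'a::field) polynomial"
  assumes "P \<in> bounded_polys W e"
  shows "poly_eval P \<in> fun_vs.span (monom_eval ` bounded_monoms W e)"
proof -
  have "poly_eval P = (\<Sum>\<mu>\<in>Poly_Mapping.keys P. (\<lambda>x. Poly_Mapping.lookup P \<mu> * monom_eval \<mu> x))"
    by (auto simp: fun_eq_iff poly_eval_def monom_eval_def sum_fun_apply)
  also have "\<dots> \<in> fun_vs.span (monom_eval ` bounded_monoms W e)"
    using assms by (intro fun_vs.span_sum fun_vs.span_scale fun_vs.span_base imageI)
      (auto simp: bounded_polys_def bounded_monoms_def polys_def)
  finally show ?thesis .
qed

text \<open>For \<open>l\<close> independent polynomials of degree at most \<open>e\<close> in each variable, the \<open>(D + 1)\<^sup>l\<close>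
  monomials in them with exponents at most \<open>D\<close> are linearly independent, but lie in a space of
  dimension at most \<open>(l D e + 1)\<^bsup>card W\<^esup>\<close>.\<close>

lemma alg_indep_affine_space_bound:
  fixes G :: "nat \<Rightarrow> ('w \<Rightarrow> 'a::field) \<Rightarrow> 'a"
  assumes indep: "alg_indep (affine_space W) G l" and W: "finite W"
    and G: "\<And>i. i < l \<Longrightarrow> G i \<in> polyfun W"
  shows "l \<le> card W"
proof (rule ccontr)
  assume "\<not> l \<le> card W"
  then have lW: "Suc (card W) \<le> l" by simp
  have "\<exists>P e. G i = poly_eval P \<and> P \<in> bounded_polys W e" if "i < l" for i
    using G[OF that] polys_bounded by (fastforce simp: polyfun_def)
  then obtain P e where P: "\<And>i. i < l \<Longrightarrow> G i = poly_eval (P i)"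
    "\<And>i. i < l \<Longrightarrow> P i \<in> bounded_polys W (e i)" by metis
  define E where "E = Max (insert 0 (e ` {..<l}))"
  have PE: "P i \<in> bounded_polys W E" if "i < l" for i
    using P(2)[OF that] that bounded_polys_mono[of "e i" E W] by (auto simp: E_def)
  \<comment> \<open>With this value, \<open>((l * E + 1) * (D + 1)) ^ card W\<close> equals
    \<open>D * (D + 1) ^ card W\<close>, which is less than \<open>(D + 1) ^ Suc (card W)\<close>.
    So for \<open>l > card W\<close> there are more monomials in the \<open>G i\<close> than
    dimensions.\<close>
  define D where "D = (l * E + 1) ^ card W"
  \<comment> \<open>Extensional functions are \<open>undefined\<close> outside
    \<open>{..<l}\<close>, whereas \<open>alg_indep\<close> wants exponent vectors that are 0
    there.\<close>
  define ext where "ext = (\<lambda>(f :: nat \<Rightarrow> nat) i. if i < l then f i else 0)"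
  define A where "A = ext ` ({..<l} \<rightarrow>\<^sub>E {..D})"
  have injext: "inj_on ext ({..<l} \<rightarrow>\<^sub>E {..D})"
  proof (rule inj_onI)
    fix f g assume fg: "f \<in> {..<l} \<rightarrow>\<^sub>E {..D}" "g \<in> {..<l} \<rightarrow>\<^sub>E {..D}" "ext f = ext g"
    have "f i = g i" if "i < l" for i using fun_cong[OF fg(3), of i] that by (simp add: ext_def)
    then show "f = g" using fg by (intro PiE_ext[OF fg(1,2)]) auto
  qed
  have finA: "finite A" unfolding A_def by (intro finite_imageI finite_PiE) auto
  have cardA: "card A = (D + 1) ^ l" unfolding A_def card_image[OF injext] by (simp add: card_PiE)
  have A: "A \<subseteq> {\<alpha>. \<forall>i\<ge>l. \<alpha> i = 0}"
  proof
    fix \<alpha> assume "\<alpha> \<in> A"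
    then show "\<alpha> \<in> {\<alpha>. \<forall>i\<ge>l. \<alpha> i = 0}" unfolding A_def by (rule imageE) (simp add: ext_def)
  qed
  have AD: "\<alpha> i \<le> D" if "\<alpha> \<in> A" for \<alpha> i
  proof -
    from that obtain f where f: "\<alpha> = ext f" "f \<in> {..<l} \<rightarrow>\<^sub>E {..D}" unfolding A_def by (rule imageE)
    then show ?thesis using PiE_mem[OF f(2), of i] by (simp add: ext_def)
  qed
  define M where "M = (\<lambda>\<alpha> x. \<Prod>i<l. G i x ^ \<alpha> i)"
  have injM: "inj_on M A"
  proof (rule inj_onI, rule ccontr)
    fix \<alpha> \<beta> assume ab: "\<alpha> \<in> A" "\<beta> \<in> A" "M \<alpha> = M \<beta>" "\<alpha> \<noteq> \<beta>"
    have "(\<lambda>\<gamma>. if \<gamma> = \<alpha> then 1 else - 1 :: 'a) \<alpha> = 0"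
    proof (rule alg_indepD[OF indep, of "{\<alpha>, \<beta>}" "\<lambda>\<gamma>. if \<gamma> = \<alpha> then 1 else - 1 :: 'a" \<alpha>])
      show "{\<alpha>, \<beta>} \<subseteq> {\<alpha>. \<forall>i\<ge>l. \<alpha> i = 0}" using A ab by auto
      fix x
      show "(\<Sum>\<gamma>\<in>{\<alpha>, \<beta>}. (if \<gamma> = \<alpha> then 1 else - 1) * (\<Prod>i<l. G i x ^ \<gamma> i)) = 0"
        using ab(1,2,4) fun_cong[OF ab(3)[unfolded M_def], of x] by simp
    qed auto
    then show False by simp
  qed
  have "fun_vs.independent (M ` A)"
  proof
    assume "fun_vs.dependent (M ` A)"
    then obtain u where u: "\<exists>f\<in>M ` A. u f \<noteq> 0" "(\<Sum>f\<in>M ` A. (\<lambda>x. u f * f x)) = 0"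
      using fun_vs.dependent_finite[of "M ` A"] finA by auto
    have "(\<Sum>\<alpha>\<in>A. u (M \<alpha>) * (\<Prod>i<l. G i x ^ \<alpha> i)) = 0" for x
    proof -
      have "0 = (\<Sum>f\<in>M ` A. u f * f x)" using fun_cong[OF u(2), of x] by (simp add: sum_fun_apply)
      also have "\<dots> = (\<Sum>\<alpha>\<in>A. u (M \<alpha>) * M \<alpha> x)" by (subst sum.reindex[OF injM]) simp
      finally show ?thesis by (simp add: M_def)
    qed
    then have "u (M \<alpha>) = 0" if "\<alpha> \<in> A" for \<alpha>
      using alg_indepD[OF indep finA A, of "\<lambda>\<alpha>. u (M \<alpha>)"] that by blast
    then show False using u(1) by auto
  qed
  moreover have "M ` A \<subseteq> fun_vs.span (monom_eval ` bounded_monoms W (l * (D * E)))"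
  proof safe
    fix \<alpha> assume \<alpha>: "\<alpha> \<in> A"
    have "P i ^ \<alpha> i \<in> bounded_polys W (D * E)" if "i < l" for i
      using bounded_polys_power[OF PE[OF that], of "\<alpha> i"] AD[OF \<alpha>, of i]
        bounded_polys_mono[of "\<alpha> i * E" "D * E" W] by (auto intro: mult_right_mono)
    then have "(\<Prod>i<l. P i ^ \<alpha> i) \<in> bounded_polys W (card {..<l} * (D * E))"
      by (intro bounded_polys_prod) auto
    moreover have "M \<alpha> = poly_eval (\<Prod>i<l. P i ^ \<alpha> i)"
      by (auto simp: M_def fun_eq_iff poly_eval_prod poly_eval_power P(1) intro!: prod.cong)
    ultimately show "M \<alpha> \<in> fun_vs.span (monom_eval ` bounded_monoms W (l * (D * E)))"
      using bounded_polys_span by fastforce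
  qed
  ultimately have "card (M ` A) \<le> card (monom_eval ` bounded_monoms W (l * (D * E)) :: (('w \<Rightarrow> 'a) \<Rightarrow> 'a) set)"
    using fun_vs.independent_span_bound card_bounded_monoms(1)[OF W] by blast
  also have "\<dots> \<le> card (bounded_monoms W (l * (D * E)))"
    by (rule card_image_le[OF card_bounded_monoms(1)[OF W]])
  also have "\<dots> \<le> (l * (D * E) + 1) ^ card W" by (rule card_bounded_monoms(2)[OF W])
  also have "\<dots> \<le> ((l * E + 1) * (D + 1)) ^ card W"
    by (intro power_mono) (auto simp: algebra_simps)
  also have "\<dots> = D * (D + 1) ^ card W" unfolding power_mult_distrib by (simp only: D_def)
  also have "\<dots> < (D + 1) ^ Suc (card W)" by simp
  also have "\<dots> \<le> (D + 1) ^ l" using lW by (intro power_increasing) auto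
  finally show False by (simp add: card_image[OF injM] cardA)
qed

text \<open>No polynomial function that is non-zero somewhere on \<open>Z\<close> is killed by
  pulling it back along \<open>\<phi>\<close>. This transports independent families from
  \<open>Z\<close> to \<open>affine_space W\<close>, where they can be counted.\<close>

definition dominated :: "'v set \<Rightarrow> 'w set \<Rightarrow> (('w \<Rightarrow> 'a) \<Rightarrow> 'v \<Rightarrow> 'a) \<Rightarrow> ('v \<Rightarrow> 'a::comm_ring_1) set \<Rightarrow> bool" where
  "dominated vs W \<phi> Z \<longleftrightarrow> (\<forall>v\<in>vs. (\<lambda>x. \<phi> x v) \<in> polyfun W) \<and>
     (\<forall>f\<in>polyfun vs. (\<forall>x\<in>affine_space W. f (\<phi> x) = 0) \<longrightarrow> (\<forall>z\<in>Z. f z = 0))"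

lemma alg_indep_bound:
  fixes F :: "nat \<Rightarrow> ('v \<Rightarrow> 'a::field) \<Rightarrow> 'a"
  assumes indep: "alg_indep Z F l" and F: "\<And>i. i < l \<Longrightarrow> F i \<in> polyfun vs"
    and dom: "dominated vs W \<phi> Z" and W: "finite W"
  shows "l \<le> card W"
proof (rule alg_indep_affine_space_bound[OF _ W])
  show "(\<lambda>x. F i (\<phi> x)) \<in> polyfun W" if "i < l" for i
    using bspec[OF conjunct1[OF dom[unfolded dominated_def]]] by (rule polyfun_compose[OF F[OF that]])
  show "alg_indep (affine_space W) (\<lambda>i x. F i (\<phi> x)) l"
    unfolding alg_indep_def
  proof (intro allI impI ballI)
    fix S :: "(nat \<Rightarrow> nat) set" and c :: "(nat \<Rightarrow> nat) \<Rightarrow> 'a" and \<alpha>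
    assume S: "finite S" "S \<subseteq> {\<alpha>. \<forall>i\<ge>l. \<alpha> i = 0}" and \<alpha>: "\<alpha> \<in> S"
      and rel: "\<forall>z\<in>affine_space W. (\<Sum>\<alpha>\<in>S. c \<alpha> * (\<Prod>i<l. F i (\<phi> z) ^ \<alpha> i)) = 0"
    define R where "R = (\<lambda>z. \<Sum>\<alpha>\<in>S. c \<alpha> * (\<Prod>i<l. F i z ^ \<alpha> i))"
    have R: "R \<in> polyfun vs"
      unfolding R_def using F by (intro polyfun_sum polyfun_cmult polyfun_prod polyfun_power) auto
    have "\<forall>x\<in>affine_space W. R (\<phi> x) = 0" using rel by (simp add: R_def)
    moreover have "(\<forall>x\<in>affine_space W. R (\<phi> x) = 0) \<longrightarrow> (\<forall>z\<in>Z. R z = 0)"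
      using conjunct2[OF dom[unfolded dominated_def]] R by (rule bspec)
    ultimately have "\<forall>z\<in>Z. R z = 0" by blast
    then show "c \<alpha> = 0" using alg_indepD[OF indep S, of c] \<alpha> by (simp add: R_def)
  qed
qed

text \<open>A chain of length \<open>l\<close> above \<open>Z\<close> extends the \<open>N\<close>
  independent functions on \<open>Z\<close> to \<open>N + l\<close> on \<open>Y\<close>, so
  \<open>N + l \<le> card W\<close>. Conversely every irreducible set inside \<open>Z\<close> is
  strictly contained in \<open>Y\<close>, which bounds the infimum in \<open>codim\<close> from
  below.\<close>

lemma codim_eq_1:
  fixes Z Y :: "('v \<Rightarrow> 'a::field) set"
  assumes "irreducible_closedin (subtopology (zariski_affine vs) Y) Z"
    "irreducible_closedin (subtopology (zariski_affine vs) Y) Y" "Z \<subset> Y"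
    "alg_indep Z F N" "\<And>i. i < N \<Longrightarrow> F i \<in> polyfun vs"
    "dominated vs W \<phi> Y" "finite W" "card W = Suc N"
  shows "codim (subtopology (zariski_affine vs) Y) Z = 1"
proof (rule antisym)
  let ?T = "subtopology (zariski_affine vs) Y"
  show "codim ?T Z \<le> 1"
    unfolding codim_def
  proof (rule INF_lower2[of Z])
    show "Sup {enat l |l C. irreducible_chain ?T l C \<and> C 0 = Z} \<le> 1"
    proof (rule Sup_least)
      fix x assume "x \<in> {enat l |l C. irreducible_chain ?T l C \<and> C 0 = Z}"
      then obtain l C where C: "x = enat l" "irreducible_chain ?T l C" "C 0 = Z" by auto
      obtain G where G: "\<forall>i<N + l. G i \<in> polyfun vs" "alg_indep (C l) G (N + l)"
        using alg_indep_chain[OF C(2), of F N] assms(4,5) C(3) by blast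
      have "closedin ?T (C l)" using C(2) by (auto simp: irreducible_chain_def irreducible_closedin_def)
      then have "C l \<subseteq> Y" using closedin_subset by fastforce
      then have "alg_indep Y G (N + l)" using G(2) by (rule alg_indep_mono[rotated])
      then have "N + l \<le> card W" using G(1) by (intro alg_indep_bound[OF _ _ assms(6,7)]) auto
      then show "x \<le> 1" using assms(8) C(1) by (simp add: one_enat_def)
    qed
  qed (use assms(1) in auto)
  show "1 \<le> codim ?T Z"
    unfolding codim_def
  proof (rule INF_greatest)
    fix Z' assume Z': "Z' \<in> {Z'. irreducible_closedin ?T Z' \<and> Z' \<subseteq> Z}"
    then have "irreducible_chain ?T 1 (\<lambda>i. if i = 0 then Z' else Y)"
      using assms(2,3) by (auto simp: irreducible_chain_def)
    then have "enat 1 \<in> {enat l |l C. irreducible_chain ?T l C \<and> C 0 = Z'}"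
      by (intro CollectI exI[of _ 1] exI[of _ "\<lambda>i. if i = 0 then Z' else Y"]) simp
    then show "1 \<le> Sup {enat l |l C. irreducible_chain ?T l C \<and> C 0 = Z'}"
      unfolding one_enat_def by (rule Sup_upper)
  qed
qed

lemma irreducible_affine_image:
  fixes h :: "('w \<Rightarrow> 'a::field_char_0) \<Rightarrow> 'a"
  assumes h: "h \<in> polyfun V" and U: "U = {a \<in> affine_space W. h a \<noteq> 0}" "U \<noteq> {}"
    and closed: "closedin (subtopology (zariski_affine vs) Y) (\<Phi> ` U)"
    and \<Phi>: "\<And>v. v \<in> vs \<Longrightarrow> (\<lambda>x. \<Phi> x v) \<in> polyfun V"
  shows "irreducible_closedin (subtopology (zariski_affine vs) Y) (\<Phi> ` U)"
proof (rule irreducible_closedin_image[OF h U closed])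
  fix N a assume N: "openin (subtopology (zariski_affine vs) Y) N" "a \<in> U" "\<Phi> a \<in> N"
  obtain N' where N': "openin (zariski_affine vs) N'" "N = N' \<inter> Y"
    using N(1) by (auto simp: openin_subtopology)
  have "\<Phi> a \<in> N'" using N(3) N'(2) by simp
  from openin_zariski_affine_basis[OF N'(1) this] obtain f
    where f: "f \<in> polyfun vs" "f (\<Phi> a) \<noteq> 0" "\<forall>y\<in>affine_space vs. f y \<noteq> 0 \<longrightarrow> y \<in> N'" by blast
  have "\<Phi> ` U \<subseteq> affine_space vs \<inter> Y" using closedin_subset[OF closed] by simp
  then have "\<forall>b\<in>U. f (\<Phi> b) \<noteq> 0 \<longrightarrow> \<Phi> b \<in> N" using f(3) N'(2) by auto
  moreover have "(\<lambda>x. f (\<Phi> x)) \<in> polyfun V" by (rule polyfun_compose[OF f(1) \<Phi>])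
  ultimately show "\<exists>f\<in>polyfun V. f a \<noteq> 0 \<and> (\<forall>b\<in>U. f b \<noteq> 0 \<longrightarrow> \<Phi> b \<in> N)"
    using f(2) by (intro bexI[of _ "\<lambda>x. f (\<Phi> x)"]) auto
qed

text \<open>A coordinate subspace embedded by a polynomial map \<open>\<phi>\<close> that has a coordinate projection
  as inverse, up to scaling of the coordinates.\<close>

locale graph_param =
  fixes vs :: "'v set" and W :: "'w set" and \<phi> :: "('w \<Rightarrow> 'a::field_char_0) \<Rightarrow> 'v \<Rightarrow> 'a"
    and \<pi> :: "'w \<Rightarrow> 'v" and \<epsilon> :: "'w \<Rightarrow> 'a"
  assumes finite_W: "finite W"
    and \<phi>_polyfun: "\<And>v. v \<in> vs \<Longrightarrow> (\<lambda>x. \<phi> x v) \<in> polyfun W"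
    and \<phi>_affine: "\<And>x. \<phi> x \<in> affine_space vs"
    and \<pi>: "\<And>t. t \<in> W \<Longrightarrow> \<pi> t \<in> vs"
    and \<epsilon>: "\<And>t. t \<in> W \<Longrightarrow> \<epsilon> t \<noteq> 0"
    and \<phi>_\<pi>: "\<And>x t. t \<in> W \<Longrightarrow> \<phi> x (\<pi> t) = \<epsilon> t * x t"
begin

abbreviation "Y \<equiv> \<phi> ` affine_space W"

text \<open>The coordinate \<open>\<pi> t\<close> of \<open>\<phi> x\<close> is a non-zero multiple
  of \<open>x t\<close>, so inside \<open>Y\<close> the image is cut out by the coordinates
  \<open>\<pi> t\<close> with \<open>t \<in> W - V\<close>. Irreducibility is inherited from the
  parameter space.\<close>

lemma irreducible_closedin_coordinate_subspace:
  assumes "V \<subseteq> W"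
  shows "irreducible_closedin (subtopology (zariski_affine vs) Y) (\<phi> ` affine_space V)"
proof -
  have V: "affine_space V \<subseteq> (affine_space W :: (_ \<Rightarrow> 'a) set)" using assms by (auto simp: affine_space_def)
  have sub: "\<phi> ` affine_space V = {y \<in> Y. \<forall>f\<in>(\<lambda>t y. y (\<pi> t)) ` (W - V). f y = 0}"
  proof safe
    fix x :: "'w \<Rightarrow> 'a" and t assume "x \<in> affine_space V" "t \<in> W" "t \<notin> V"
    then show "\<phi> x (\<pi> t) = 0" by (simp add: \<phi>_\<pi> affine_space_def)
  next
    fix x :: "'w \<Rightarrow> 'a" assume x: "x \<in> affine_space W" "\<forall>f\<in>(\<lambda>t y. y (\<pi> t)) ` (W - V). f (\<phi> x) = 0"
    have "x t = 0" if "t \<notin> V" for t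
    proof (cases "t \<in> W")
      case True
      then have "\<phi> x (\<pi> t) = 0" using x(2) that by auto
      then show ?thesis using \<phi>_\<pi>[OF True] \<epsilon>[OF True] by simp
    qed (use x(1) in \<open>auto simp: affine_space_def\<close>)
    then have "x \<in> affine_space V" by (auto simp: affine_space_def)
    then show "\<phi> x \<in> \<phi> ` affine_space V" by simp
  qed (use V in auto)
  have closed: "closedin (subtopology (zariski_affine vs) Y) (\<phi> ` affine_space V)"
    using \<phi>_affine \<pi> by (intro closedin_zariski_subtopologyI[OF _ _ sub]) (auto intro: polyfun_var)
  have "(\<lambda>_. 0) \<in> affine_space V" by (auto simp: affine_space_def)
  then have "affine_space V \<noteq> {}" by blast
  then show ?thesis
    using irreducible_affine_image[of "\<lambda>_. 1" W "affine_space V" V vs Y \<phi>] closed \<phi>_polyfun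
    by (simp add: polyfun_const)
qed

text \<open>Coordinate subspaces form a maximal chain.\<close>

lemma krull_dim_eq: "krull_dim (subtopology (zariski_affine vs) Y) = enat (card W)"
proof (rule antisym)
  let ?T = "subtopology (zariski_affine vs) Y"
  have dom: "dominated vs W \<phi> Y" unfolding dominated_def using \<phi>_polyfun by auto
  show "krull_dim ?T \<le> enat (card W)"
    unfolding krull_dim_def
  proof (rule Sup_least)
    fix x assume "x \<in> {enat l |l Z. irreducible_chain ?T l Z}"
    then obtain l Z where Z: "x = enat l" "irreducible_chain ?T l Z" by auto
    have "Z 0 \<noteq> {}" using Z(2) by (auto simp: irreducible_chain_def irreducible_closedin_def)
    \<comment> \<open>The chain is started with the empty family on \<open>Z 0\<close>; the zero
      functions supplied to \<open>alg_indep_0\<close> are placeholders.\<close>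
    then obtain G where G: "\<forall>i<0 + l. G i \<in> polyfun vs" "alg_indep (Z l) G (0 + l)"
      using alg_indep_chain[OF Z(2) alg_indep_0[of "Z 0" "\<lambda>_ _. 0"]] by blast
    have "closedin ?T (Z l)" using Z(2) by (auto simp: irreducible_chain_def irreducible_closedin_def)
    then have "Z l \<subseteq> Y" using closedin_subset by fastforce
    then have "alg_indep Y G l" using G(2) alg_indep_mono by fastforce
    then show "x \<le> enat (card W)" using alg_indep_bound[OF _ _ dom finite_W] G(1) Z(1) by simp
  qed
  obtain w where w: "bij_betw w {..<card W} W"
    using ex_bij_betw_nat_finite[OF finite_W] atLeast0LessThan by metis
  define C where "C = (\<lambda>i. \<phi> ` affine_space (w ` {..<i}))"
  have wW: "w ` {..<i} \<subseteq> W" if "i \<le> card W" for i using w that by (auto simp: bij_betw_def)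
  have "irreducible_chain ?T (card W) C"
    unfolding irreducible_chain_def
  proof (intro conjI allI impI)
    fix i assume "i \<le> card W"
    then show "irreducible_closedin ?T (C i)"
      unfolding C_def by (intro irreducible_closedin_coordinate_subspace wW)
  next
    fix i assume i: "i < card W"
    have "affine_space (w ` {..<i}) \<subseteq> (affine_space (w ` {..<Suc i}) :: ('w \<Rightarrow> 'a) set)"
      unfolding affine_space_def by (auto simp: lessThan_Suc)
    then have "C i \<subseteq> C (Suc i)" unfolding C_def by (rule image_mono)
    moreover define u :: "'w \<Rightarrow> 'a" where "u = (\<lambda>t. if t = w i then 1 else 0)"
    have wi: "w i \<in> W" using w i by (auto simp: bij_betw_def)
    have "u \<in> affine_space (w ` {..<Suc i})" by (auto simp: affine_space_def u_def)
    then have "\<phi> u \<in> C (Suc i)" unfolding C_def by (rule imageI)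
    moreover have "\<phi> u \<notin> C i"
    proof
      assume "\<phi> u \<in> C i"
      then obtain x where x: "\<phi> u = \<phi> x" "x \<in> affine_space (w ` {..<i})" by (auto simp: C_def)
      have "w i \<notin> w ` {..<i}"
      proof
        assume "w i \<in> w ` {..<i}"
        then obtain j where "w j = w i" "j < i" by auto
        then show False using inj_onD[OF bij_betw_imp_inj_on[OF w], of j i] i by simp
      qed
      then have "x (w i) = 0" using x(2) by (auto simp: affine_space_def)
      then show False using \<phi>_\<pi>[OF wi, of u] \<phi>_\<pi>[OF wi, of x] \<epsilon>[OF wi] x(1) by (simp add: u_def)
    qed
    ultimately show "C i \<subset> C (Suc i)" by auto
  qed
  then have "enat (card W) \<in> {enat l |l Z. irreducible_chain ?T l Z}" by blast
  then show "enat (card W) \<le> krull_dim ?T" unfolding krull_dim_def by (rule Sup_upper)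
qed

end

section \<open>Tangent spaces\<close>

text \<open>First-order expansion at \<open>s = 0\<close> of a polynomial function of one variable.
  Derivatives along curves are compared through \<open>jet_unique\<close>, which replaces formal
  differentiation of composed polynomials.\<close>

definition jet :: "('a::field_char_0 \<Rightarrow> 'a) \<Rightarrow> 'a \<Rightarrow> 'a \<Rightarrow> bool" where
  "jet F a D \<longleftrightarrow> (\<exists>p. (\<forall>s. F s = poly p s) \<and> poly.coeff p 0 = a \<and> poly.coeff p 1 = D)"

lemma jet_unique:
  assumes "jet F a D" "jet F b E"
  shows "D = E"
proof -
  obtain p q where "\<forall>s. F s = poly p s" "\<forall>s. F s = poly q s" "poly.coeff p 1 = D" "poly.coeff q 1 = E"
    using assms by (auto simp: jet_def)
  moreover from this have "poly p = poly q" by (auto simp: fun_eq_iff)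
  ultimately show ?thesis by (auto simp: poly_eq_poly_eq_iff)
qed

lemma jet_const: "jet (\<lambda>s. c) c 0"
  unfolding jet_def by (rule exI[of _ "[:c:]"]) auto

lemma jet_linear: "jet (\<lambda>s. a + s * D) a D"
  unfolding jet_def by (rule exI[of _ "[:a, D:]"]) auto

lemma jet_add:
  assumes "jet F a D" "jet G b E"
  shows "jet (\<lambda>s. F s + G s) (a + b) (D + E)"
proof -
  obtain p q where "\<forall>s. F s = poly p s" "poly.coeff p 0 = a" "poly.coeff p 1 = D"
    "\<forall>s. G s = poly q s" "poly.coeff q 0 = b" "poly.coeff q 1 = E"
    using assms by (auto simp: jet_def)
  then show ?thesis unfolding jet_def by (intro exI[of _ "p + q"]) auto
qed

lemma jet_mult:
  assumes "jet F a D" "jet G b E"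
  shows "jet (\<lambda>s. F s * G s) (a * b) (a * E + D * b)"
proof -
  obtain p q where pq: "\<forall>s. F s = poly p s" "poly.coeff p 0 = a" "poly.coeff p 1 = D"
    "\<forall>s. G s = poly q s" "poly.coeff q 0 = b" "poly.coeff q 1 = E"
    using assms by (auto simp: jet_def)
  have "poly.coeff (p * q) 1 = (\<Sum>i\<in>{0, 1}. poly.coeff p i * poly.coeff q (1 - i))"
    unfolding coeff_mult by (rule sum.cong) auto
  then show ?thesis unfolding jet_def using pq
    by (intro exI[of _ "p * q"]) (auto simp: coeff_mult)
qed

lemma jet_cmult: "jet F a D \<Longrightarrow> jet (\<lambda>s. c * F s) (c * a) (c * D)"
  using jet_mult[OF jet_const] by fastforce

lemma jet_sum:
  assumes "\<And>i. i \<in> A \<Longrightarrow> jet (F i) (a i) (D i)"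
  shows "jet (\<lambda>s. \<Sum>i\<in>A. F i s) (\<Sum>i\<in>A. a i) (\<Sum>i\<in>A. D i)"
  using assms
  by (induction A rule: infinite_finite_induct) (auto intro: jet_const jet_add)

lemma jet_power:
  assumes "jet F a D"
  shows "jet (\<lambda>s. F s ^ N) (a ^ N) (of_nat N * D * a ^ (N - 1))"
proof (induction N)
  case 0
  then show ?case using jet_const[of 1] by simp
next
  case (Suc N)
  have "a * (of_nat N * D * a ^ (N - 1)) + D * a ^ N = of_nat (Suc N) * D * a ^ (Suc N - 1)"
    by (cases N) (simp_all add: algebra_simps)
  then show ?case using jet_mult[OF assms Suc] by simp
qed

lemma jet_prod:
  assumes "finite A" "\<And>i. i \<in> A \<Longrightarrow> jet (F i) (a i) (D i)"
  shows "jet (\<lambda>s. \<Prod>i\<in>A. F i s) (\<Prod>i\<in>A. a i) (\<Sum>i\<in>A. D i * (\<Prod>j\<in>A - {i}. a j))"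
  using assms
proof (induction A rule: finite_induct)
  case empty
  then show ?case using jet_const[of 1] by simp
next
  case (insert x A)
  have "(\<Sum>i\<in>A. D i * (\<Prod>j\<in>insert x A - {i}. a j)) = a x * (\<Sum>i\<in>A. D i * (\<Prod>j\<in>A - {i}. a j))"
    unfolding sum_distrib_left
  proof (intro sum.cong refl)
    fix i assume "i \<in> A"
    then have "insert x A - {i} = insert x (A - {i})" using insert by auto
    then show "D i * (\<Prod>j\<in>insert x A - {i}. a j) = a x * (D i * (\<Prod>j\<in>A - {i}. a j))"
      using insert by (simp add: mult_ac)
  qed
  moreover have "insert x A - {x} = A" using insert by auto
  ultimately have "(\<Sum>i\<in>insert x A. D i * (\<Prod>j\<in>insert x A - {i}. a j)) =
      a x * (\<Sum>i\<in>A. D i * (\<Prod>j\<in>A - {i}. a j)) + D x * (\<Prod>j\<in>A. a j)"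
    using insert by (simp add: add.commute)
  moreover have "jet (\<lambda>s. F x s * (\<Prod>i\<in>A. F i s)) (a x * (\<Prod>i\<in>A. a i))
      (a x * (\<Sum>i\<in>A. D i * (\<Prod>j\<in>A - {i}. a j)) + D x * (\<Prod>j\<in>A. a j))"
    using insert by (intro jet_mult) auto
  ultimately show ?case using insert by (simp only: prod.insert not_False_eq_True)
qed

text \<open>Chain rule along an arbitrary polynomial curve; for a straight line it identifies
  \<open>poly_diff\<close> with the directional derivative.\<close>

lemma jet_poly_eval:
  fixes P :: "('v, 'a::field_char_0) polynomial"
  assumes "\<And>v. jet (\<gamma> v) (x v) (u v)"
  shows "jet (\<lambda>s. poly_eval P (\<lambda>v. \<gamma> v s)) (poly_eval P x) (poly_diff P x u)"
  unfolding poly_eval_def poly_diff_def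
  by (intro jet_sum jet_cmult jet_prod jet_power assms) auto

lemma poly_diff_cong:
  assumes "P \<in> polys W" "\<And>v. v \<in> W \<Longrightarrow> u v = w v"
  shows "poly_diff P x u = poly_diff P x w"
  unfolding poly_diff_def
proof (intro sum.cong refl arg_cong2[where f = "(*)"])
  fix \<mu> v assume "\<mu> \<in> Poly_Mapping.keys P" "v \<in> Poly_Mapping.keys \<mu>"
  then show "u v = w v" using assms by (auto simp: polys_def)
qed

lemma poly_diff_sum:
  "poly_diff P x (\<lambda>v. \<Sum>t\<in>W. c t * e t v) = (\<Sum>t\<in>W. c t * poly_diff P x (e t))"
proof (induction W rule: infinite_finite_induct)
  case (insert t W)
  have add: "poly_diff P x (\<lambda>v. a * f v + g v) = a * poly_diff P x f + poly_diff P x g" for a f g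
    unfolding poly_diff_def by (simp add: sum_distrib_left sum.distrib algebra_simps)
  show ?case using insert by (simp add: add)
qed (simp_all add: poly_diff_def)

context graph_param
begin

text \<open>\<open>\<phi>\<close> is given by functions, whereas \<open>poly_diff\<close> needs a
  formal polynomial; all choices give the same derivative because jets are unique.\<close>

definition \<phi>_poly :: "'v \<Rightarrow> ('w, 'a) polynomial" where
  "\<phi>_poly v = (SOME P. P \<in> polys W \<and> (\<lambda>x. \<phi> x v) = poly_eval P)"

lemma \<phi>_poly:
  assumes "v \<in> vs"
  shows "\<phi>_poly v \<in> polys W" "\<phi> x v = poly_eval (\<phi>_poly v) x"
proof -
  have "\<exists>P. P \<in> polys W \<and> (\<lambda>x. \<phi> x v) = poly_eval P"
    using \<phi>_polyfun[OF assms] by (auto simp: polyfun_def)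
  from someI_ex[OF this] have *: "\<phi>_poly v \<in> polys W \<and> (\<lambda>x. \<phi> x v) = poly_eval (\<phi>_poly v)"
    unfolding \<phi>_poly_def .
  then show "\<phi>_poly v \<in> polys W" by blast
  show "\<phi> x v = poly_eval (\<phi>_poly v) x" using conjunct2[OF *] by (rule fun_cong)
qed

definition differential :: "('w \<Rightarrow> 'a) \<Rightarrow> ('w \<Rightarrow> 'a) \<Rightarrow> 'v \<Rightarrow> 'a" where
  "differential x t v = (if v \<in> vs then poly_diff (\<phi>_poly v) x t else 0)"

lemma jet_\<phi>: "jet (\<lambda>s. \<phi> (\<lambda>w. x w + s * t w) v) (\<phi> x v) (differential x t v)"
proof (cases "v \<in> vs")
  case True
  then show ?thesis unfolding \<phi>_poly(2)[OF True] differential_def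
    using jet_poly_eval[OF jet_linear] by simp
next
  case False
  then have "\<phi> x v = 0" for x using \<phi>_affine[of x] by (auto simp: affine_space_def)
  then show ?thesis using False jet_const[of 0] by (simp add: differential_def)
qed

lemma differential_\<pi>:
  assumes "r \<in> W"
  shows "differential x t (\<pi> r) = \<epsilon> r * t r"
proof (rule jet_unique[OF jet_\<phi>])
  show "jet (\<lambda>s. \<phi> (\<lambda>w. x w + s * t w) (\<pi> r)) (\<epsilon> r * x r) (\<epsilon> r * t r)"
    unfolding \<phi>_\<pi>[OF assms] by (intro jet_cmult jet_linear)
qed

text \<open>The curve through \<open>\<phi> x\<close> obtained by moving the parameter in direction
  \<open>t\<close> stays in \<open>Y\<close>, so every equation of \<open>Y\<close> is constantly
  zero along it.\<close>

lemma differential_tangent: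
  assumes "x \<in> affine_space W" "t \<in> affine_space W"
  shows "differential x t \<in> tangent_space vs Y (\<phi> x)"
  unfolding tangent_space_def
proof (intro CollectI conjI ballI impI)
  show "differential x t \<in> affine_space vs" by (auto simp: affine_space_def differential_def)
  fix P assume P: "P \<in> polys vs" "\<forall>z\<in>Y. poly_eval P z = 0"
  have "jet (\<lambda>s. poly_eval P (\<lambda>v. \<phi> (\<lambda>w. x w + s * t w) v)) (poly_eval P (\<phi> x))
      (poly_diff P (\<phi> x) (differential x t))"
    by (rule jet_poly_eval[OF jet_\<phi>])
  moreover have "poly_eval P (\<lambda>v. \<phi> (\<lambda>w. x w + s * t w) v) = 0" for s
  proof -
    have "(\<lambda>w. x w + s * t w) \<in> affine_space W" using assms by (auto simp: affine_space_def)
    then show ?thesis using P(2) by auto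
  qed
  ultimately show "poly_diff P (\<phi> x) (differential x t) = 0"
    using jet_unique[OF _ jet_const[of 0]] by simp
qed

text \<open>\<open>Y\<close> is a graph over its coordinates \<open>\<pi> t\<close>: with
  \<open>pr\<close> recovering the parameters, \<open>y v - \<phi> (pr y) v\<close> vanishes on
  \<open>Y\<close>. Differentiating this equation in direction \<open>u\<close> expresses
  \<open>u v\<close> through the entries \<open>u (\<pi> t)\<close>.\<close>

lemma tangent_differential:
  assumes "x \<in> affine_space W" "u \<in> tangent_space vs Y (\<phi> x)"
  shows "u = differential x (\<lambda>t. if t \<in> W then u (\<pi> t) / \<epsilon> t else 0)"
proof
  fix v
  define pr where "pr = (\<lambda>y t. if t \<in> W then y (\<pi> t) / \<epsilon> t else 0)"
  have pr: "pr (\<phi> z) = z" if "z \<in> affine_space W" for z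
    using that by (auto simp: pr_def affine_space_def fun_eq_iff \<phi>_\<pi> \<epsilon>)
  show "u v = differential x (\<lambda>t. if t \<in> W then u (\<pi> t) / \<epsilon> t else 0) v"
  proof (cases "v \<in> vs")
    case True
    have "(\<lambda>y. \<phi> (pr y) v) \<in> polyfun vs"
    proof (rule polyfun_compose[OF \<phi>_polyfun[OF True]])
      fix t assume t: "t \<in> W"
      have "(\<lambda>y. inverse (\<epsilon> t) * y (\<pi> t)) \<in> polyfun vs"
        using \<pi>[OF t] by (intro polyfun_cmult polyfun_var)
      then show "(\<lambda>y. pr y t) \<in> polyfun vs" using t by (simp add: pr_def divide_inverse mult.commute)
    qed
    then have "(\<lambda>y. y v - \<phi> (pr y) v) \<in> polyfun vs" using True by (intro polyfun_diff polyfun_var)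
    then obtain G where G: "G \<in> polys vs" "\<And>y. y v - \<phi> (pr y) v = poly_eval G y"
      unfolding polyfun_def by (metis (no_types, lifting) imageE)
    have "\<forall>z\<in>Y. poly_eval G z = 0" by (auto simp: G(2)[symmetric] pr)
    then have "poly_diff G (\<phi> x) u = 0" using assms(2) G(1) by (simp add: tangent_space_def)
    then have "jet (\<lambda>s. poly_eval G (\<lambda>v. \<phi> x v + s * u v)) (poly_eval G (\<phi> x)) 0"
      using jet_poly_eval[OF jet_linear, of G "\<phi> x" u] by simp
    moreover have "jet (\<lambda>s. poly_eval G (\<lambda>v. \<phi> x v + s * u v)) (\<phi> x v + - 1 * \<phi> x v)
       (u v + - 1 * differential x (pr u) v)"
    proof -
      have "poly_eval G (\<lambda>v. \<phi> x v + s * u v) =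
          (\<phi> x v + s * u v) + - 1 * \<phi> (\<lambda>w. x w + s * pr u w) v" for s
      proof -
        have "pr (\<lambda>v. \<phi> x v + s * u v) = (\<lambda>w. pr (\<phi> x) w + s * pr u w)"
          by (auto simp: pr_def add_divide_distrib)
        then show ?thesis using pr[OF assms(1)] by (simp add: G(2)[symmetric])
      qed
      then show ?thesis
        by (simp only:) (intro jet_add jet_cmult jet_linear jet_\<phi>)
    qed
    ultimately show ?thesis using jet_unique by (fastforce simp: pr_def)
  next
    case False
    then show ?thesis using assms(2) by (auto simp: tangent_space_def affine_space_def differential_def)
  qed
qed

text \<open>The images of the unit vectors form a basis: their coordinates at the
  \<open>\<pi> r\<close> form a diagonal matrix with non-zero entries, and
  \<open>tangent_differential\<close> shows that they span.\<close>

lemma vdim_tangent_space: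
  assumes "x \<in> affine_space W"
  shows "vdim (tangent_space vs Y (\<phi> x)) = card W"
proof (rule fun_vs.dim_unique)
  define e :: "'w \<Rightarrow> 'w \<Rightarrow> 'a" where "e = (\<lambda>t w. if w = t then 1 else 0)"
  define B where "B = (\<lambda>t. differential x (e t)) ` W"
  have e: "e t \<in> affine_space W" if "t \<in> W" for t using that by (auto simp: e_def affine_space_def)
  then show "B \<subseteq> tangent_space vs Y (\<phi> x)" using differential_tangent[OF assms] by (auto simp: B_def)
  have val: "differential x (e t) (\<pi> r) = (if t = r then \<epsilon> r else 0)" if "r \<in> W" for r t
    using differential_\<pi>[OF that] by (simp add: e_def)
  have inj: "inj_on (\<lambda>t. differential x (e t)) W"
  proof (rule inj_onI)
    fix r t assume rt: "r \<in> W" "t \<in> W" "differential x (e r) = differential x (e t)"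
    have "differential x (e r) (\<pi> r) = differential x (e t) (\<pi> r)" by (simp only: rt(3))
    then show "r = t" using val[OF rt(1), of r] val[OF rt(1), of t] \<epsilon>[OF rt(1)]
      by (cases "t = r") simp_all
  qed
  then show "card B = card W" unfolding B_def by (rule card_image)
  show "fun_vs.independent B"
  proof
    assume "fun_vs.dependent B"
    then obtain c where c: "\<exists>f\<in>B. c f \<noteq> 0" "(\<Sum>f\<in>B. (\<lambda>v. c f * f v)) = 0"
      using fun_vs.dependent_finite[of B] finite_W by (auto simp: B_def)
    have "c (differential x (e r)) = 0" if r: "r \<in> W" for r
    proof -
      have "0 = (\<Sum>f\<in>B. c f * f (\<pi> r))" using fun_cong[OF c(2), of "\<pi> r"] by (simp add: sum_fun_apply)
      also have "\<dots> = (\<Sum>t\<in>W. c (differential x (e t)) * differential x (e t) (\<pi> r))"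
        unfolding B_def by (subst sum.reindex[OF inj]) simp
      also have "\<dots> = c (differential x (e r)) * \<epsilon> r"
        using finite_W r by (simp add: val if_distrib[of "(*) _"] cong: if_cong)
      finally show ?thesis using \<epsilon>[OF r] by simp
    qed
    then show False using c(1) by (auto simp: B_def)
  qed
  show "tangent_space vs Y (\<phi> x) \<subseteq> fun_vs.span B"
  proof
    fix u assume u: "u \<in> tangent_space vs Y (\<phi> x)"
    define t where "t = (\<lambda>w. if w \<in> W then u (\<pi> w) / \<epsilon> w else 0)"
    have "differential x t = (\<Sum>r\<in>W. (\<lambda>v. t r * differential x (e r) v))"
    proof
      fix v
      have "poly_diff (\<phi>_poly v) x t = (\<Sum>r\<in>W. t r * poly_diff (\<phi>_poly v) x (e r))" if "v \<in> vs"
      proof -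
        have "poly_diff (\<phi>_poly v) x t = poly_diff (\<phi>_poly v) x (\<lambda>w. \<Sum>r\<in>W. t r * e r w)"
          by (rule poly_diff_cong[OF \<phi>_poly(1)[OF that]]) (use finite_W in \<open>simp add: e_def if_distrib[of "(*) _"] cong: if_cong\<close>)
        then show ?thesis by (simp add: poly_diff_sum)
      qed
      then show "differential x t v = (\<Sum>r\<in>W. (\<lambda>v. t r * differential x (e r) v)) v"
        by (simp add: differential_def sum_fun_apply)
    qed
    also have "\<dots> \<in> fun_vs.span B"
      by (intro fun_vs.span_sum fun_vs.span_scale fun_vs.span_base) (auto simp: B_def)
    finally show "u \<in> fun_vs.span B"
      using tangent_differential[OF assms u] by (simp add: t_def)
  qed
qed

end

section \<open>The order on subsets\<close>

text \<open>\<open>L \<sqsubseteq> J\<close> says that, if \<open>j\<^sub>1 < \<dots> < j\<^sub>k\<close> are the elements of \<open>J\<close>, then \<open>L\<close> has at least \<open>k\<close> elements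
  \<open>l\<^sub>1 < l\<^sub>2 < \<dots>\<close> and \<open>l\<^sub>a \<le> j\<^sub>a\<close> for \<open>a \<le> k\<close>; the cardinalities may differ.\<close>

definition subset_le :: "nat set \<Rightarrow> nat set \<Rightarrow> bool" (infix "\<sqsubseteq>" 50) where
  "L \<sqsubseteq> J \<longleftrightarrow> (\<forall>x. card (J \<inter> {..<x}) \<le> card (L \<inter> {..<x}))"

lemma subset_le_refl: "J \<sqsubseteq> J"
  by (simp add: subset_le_def)

lemma subset_le_trans: "K \<sqsubseteq> L \<Longrightarrow> L \<sqsubseteq> J \<Longrightarrow> K \<sqsubseteq> J"
  unfolding subset_le_def by (meson order_trans)

lemma card_Int_Suc: "card (J \<inter> {..<Suc x}) = card (J \<inter> {..<x}) + (if x \<in> J then 1 else 0)"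
  by (simp add: lessThan_Suc)

lemma subset_le_antisym:
  assumes "L \<sqsubseteq> J" "J \<sqsubseteq> L"
  shows "L = J"
proof -
  have "card (L \<inter> {..<x}) = card (J \<inter> {..<x})" for x
    using assms by (simp add: subset_le_def eq_iff)
  then have "x \<in> L \<longleftrightarrow> x \<in> J" for x
    using card_Int_Suc[of L x] card_Int_Suc[of J x] by (auto split: if_splits)
  then show ?thesis by blast
qed

lemma subset_le_card:
  assumes "L \<sqsubseteq> J" "L \<subseteq> {..<n}" "J \<subseteq> {..<n}"
  shows "card J \<le> card L"
proof -
  have "L \<inter> {..<n} = L" "J \<inter> {..<n} = J" using assms by auto
  then show ?thesis using assms(1) unfolding subset_le_def by metis
qed

lemma subset_le_pick:
  assumes "L \<sqsubseteq> J" "L \<subseteq> {..<n}" "J \<subseteq> {..<n}" "a < card J"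
  shows "pick L a \<le> pick J a"
proof -
  let ?x = "Suc (pick J a)"
  have "{b \<in> J. b < ?x} = insert (pick J a) {b \<in> J. b < pick J a}"
    using pick_in_set_le[OF assms(4)] by auto
  then have "card {b \<in> J. b < ?x} = Suc a" using card_pick_le[OF assms(4)] by simp
  moreover have "{b \<in> J. b < ?x} = J \<inter> {..<?x}" "{b \<in> L. b < ?x} = L \<inter> {..<?x}" by auto
  ultimately have "Suc a \<le> card {b \<in> L. b < ?x}" using assms(1) by (metis subset_le_def)
  moreover have "a < card L" using subset_le_card[OF assms(1-3)] assms(4) by simp
  ultimately show ?thesis using card_le_pick_le[of a L ?x] by (meson not_less_eq_eq not_le)
qed

lemma pick_bij_betw:
  assumes "finite J"
  shows "bij_betw (pick J) {..<card J} J"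
proof -
  have inj: "inj_on (pick J) {..<card J}"
  proof (rule inj_onI)
    fix a b assume "a \<in> {..<card J}" "b \<in> {..<card J}" "pick J a = pick J b"
    then show "a = b" using pick_mono_le[of a J b] pick_mono_le[of b J a]
      by (metis lessThan_iff less_irrefl linorder_neqE_nat)
  qed
  moreover have "pick J ` {..<card J} \<subseteq> J" using pick_in_set_le by auto
  ultimately show ?thesis using assms card_subset_eq[OF assms, of "pick J ` {..<card J}"]
    by (auto simp: bij_betw_def card_image)
qed

lemma pick_lessThan: "b < k \<Longrightarrow> pick {..<k} b = b"
proof -
  assume b: "b < k"
  have "{a \<in> {..<k}. a < b} = {..<b}" using b by auto
  then show ?thesis using pick_card_in_set[of b "{..<k}"] b by simp
qed

text \<open>Replacing \<open>z\<close> by its predecessor moves one element across the single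
  threshold \<open>x = z\<close>, so all other counts stay the same.\<close>

lemma subset_le_lower:
  assumes "z \<in> J" "z = Suc t" "t \<notin> J"
  shows "card (insert t (J - {z}) \<inter> {..<x}) = card (J \<inter> {..<x}) + (if x = z then 1 else 0)"
proof -
  consider "x \<le> t" | "x = z" | "z < x" using assms(2) by linarith
  then show ?thesis
  proof cases
    case 1
    then have "insert t (J - {z}) \<inter> {..<x} = J \<inter> {..<x}" using assms by auto
    then show ?thesis using 1 assms by simp
  next
    case 2
    then have "insert t (J - {z}) \<inter> {..<x} = insert t (J \<inter> {..<x})" using assms by auto
    then show ?thesis using 2 assms by simp
  next
    case 3
    then have e: "J \<inter> {..<x} = insert z ((J - {z}) \<inter> {..<x})"
      "insert t (J - {z}) \<inter> {..<x} = insert t ((J - {z}) \<inter> {..<x})" using assms by auto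
    show ?thesis unfolding e using 3 assms by simp
  qed
qed

text \<open>At some threshold \<open>M\<close> has a surplus over \<open>J\<close>. Following the
  surplus to the right until it disappears finds an element \<open>z\<close> of \<open>J\<close>;
  going left from \<open>z\<close> through consecutive elements of \<open>J\<close> to the first gap
  \<open>w\<close> keeps the surplus. Lowering \<open>Suc w\<close> costs one at the threshold
  \<open>Suc w\<close> only, which the surplus pays for.\<close>

lemma subset_le_cover:
  assumes "M \<sqsubseteq> J" "M \<noteq> J" "card M = card J" "M \<subseteq> {..<n}" "J \<subseteq> {..<n}"
  shows "\<exists>t. t \<notin> J \<and> Suc t \<in> J \<and> M \<sqsubseteq> insert t (J - {Suc t})"
proof -
  let ?f = "\<lambda>x. card (M \<inter> {..<x}) - card (J \<inter> {..<x})"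
  have le: "card (J \<inter> {..<x}) \<le> card (M \<inter> {..<x})" for x using assms(1) by (simp add: subset_le_def)
  have "\<exists>x. card (J \<inter> {..<x}) < card (M \<inter> {..<x})"
  proof (rule ccontr)
    assume "\<not> ?thesis"
    then have "J \<sqsubseteq> M" by (auto simp: subset_le_def not_less)
    then show False using assms(1,2) subset_le_antisym by blast
  qed
  then obtain x0 where x0: "card (J \<inter> {..<x0}) < card (M \<inter> {..<x0})" by blast
  have "M \<inter> {..<n} = M" "J \<inter> {..<n} = J" using assms by auto
  then have n: "card (J \<inter> {..<n}) = card (M \<inter> {..<n})" using assms(3) by simp
  have "x0 < n"
  proof (rule ccontr)
    assume "\<not> x0 < n"
    then have "M \<inter> {..<x0} = M" "J \<inter> {..<x0} = J" using assms(4,5) by auto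
    then show False using x0 assms(3) by simp
  qed
  define y where "y = (LEAST y. x0 \<le> y \<and> card (J \<inter> {..<y}) = card (M \<inter> {..<y}))"
  have y: "x0 \<le> y" "card (J \<inter> {..<y}) = card (M \<inter> {..<y})"
    using LeastI[of "\<lambda>y. x0 \<le> y \<and> card (J \<inter> {..<y}) = card (M \<inter> {..<y})" n] n \<open>x0 < n\<close>
    by (auto simp: y_def)
  have min: "card (J \<inter> {..<w}) < card (M \<inter> {..<w})" if "x0 \<le> w" "w < y" for w
    using not_less_Least[of w "\<lambda>y. x0 \<le> y \<and> card (J \<inter> {..<y}) = card (M \<inter> {..<y})"] that le[of w]
    by (auto simp: y_def)
  have "x0 \<noteq> y" using x0 y(2) by auto
  then obtain z where z: "y = Suc z" "x0 \<le> z" using y(1) by (cases y) auto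
  have zJ: "z \<in> J" using min[of z] y(2) z card_Int_Suc[of J z] card_Int_Suc[of M z]
    by (auto split: if_splits)
  have fz: "card (J \<inter> {..<z}) < card (M \<inter> {..<z})" using min[of z] z by simp
  have "\<exists>w<z. w \<notin> J"
  proof (rule ccontr)
    assume "\<not> ?thesis"
    then have "J \<inter> {..<z} = {..<z}" by auto
    then have "card (M \<inter> {..<z}) \<le> card (J \<inter> {..<z})" using card_mono[of "{..<z}" "M \<inter> {..<z}"] by simp
    then show False using fz by simp
  qed
  then have "{w. w < z \<and> w \<notin> J} \<noteq> {}" by auto
  define w where "w = Max {w. w < z \<and> w \<notin> J}"
  have w: "w < z" "w \<notin> J" using Max_in[of "{w. w < z \<and> w \<notin> J}"] \<open>{w. w < z \<and> w \<notin> J} \<noteq> {}\<close>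
    by (auto simp: w_def)
  have wmax: "v \<in> J" if "w < v" "v < z" for v
  proof (rule ccontr)
    assume "v \<notin> J"
    then have "v \<le> w" unfolding w_def using that by (intro Max_ge) auto
    then show False using that by simp
  qed
  have wJ: "Suc w \<in> J" using wmax[of "Suc w"] zJ w(1) by (cases "Suc w = z") auto
  \<comment> \<open>Between \<open>w\<close> and \<open>z\<close> every number is in
    \<open>J\<close>, so \<open>M\<close> cannot gain more elements there than \<open>J\<close>
    does.\<close>
  have "card (J \<inter> {..<Suc w}) < card (M \<inter> {..<Suc w})"
  proof -
    have J: "J \<inter> {..<z} = (J \<inter> {..<Suc w}) \<union> {Suc w..<z}" using wmax w(1) by auto
    have "card (J \<inter> {..<z}) = card (J \<inter> {..<Suc w}) + card {Suc w..<z}"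
      unfolding J by (rule card_Un_disjoint) auto
    moreover have "card (M \<inter> {..<z}) \<le> card (M \<inter> {..<Suc w} \<union> {Suc w..<z})"
      by (rule card_mono) auto
    moreover have "card (M \<inter> {..<Suc w} \<union> {Suc w..<z}) \<le> card (M \<inter> {..<Suc w}) + card {Suc w..<z}"
      by (rule card_Un_le)
    ultimately show ?thesis using fz by linarith
  qed
  then have "M \<sqsubseteq> insert w (J - {Suc w})"
    unfolding subset_le_def using le subset_le_lower[OF wJ refl w(2)] by (auto simp: Suc_le_eq)
  then show ?thesis using w(2) wJ by blast
qed

section \<open>Minors\<close>

lemma det_permute_cols:
  assumes "A \<in> carrier_mat n n" "p permutes {0..<n}"
  shows "det (mat n n (\<lambda>(i, j). A $$ (i, p j))) = signof p * det A"
proof -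
  have "mat n n (\<lambda>(i, j). A $$ (i, p j)) =
      transpose_mat (mat n n (\<lambda>(i, j). transpose_mat A $$ (p i, j)))"
    using assms by (intro eq_matI) (auto simp: permutes_in_image)
  moreover have "det (mat n n (\<lambda>(i, j). transpose_mat A $$ (p i, j))) = signof p * det (transpose_mat A)"
    using assms by (intro det_permute_rows) auto
  ultimately show ?thesis using assms(1) det_transpose[of "mat n n (\<lambda>(i, j). transpose_mat A $$ (p i, j))" n]
    by (simp add: det_transpose)
qed

text \<open>In a non-zero Leibniz term \<open>\<rho> (p a) \<le> \<rho> a\<close> for all
  \<open>a\<close>; both sides have the same sum, so \<open>p\<close> fixes every index. A free
  choice of \<open>\<rho>\<close> covers upper, lower and permuted triangular shapes.\<close>

lemma det_rank:
  fixes A :: "nat \<times> nat \<Rightarrow> 'a::comm_ring_1" and \<rho> :: "nat \<Rightarrow> nat"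
  assumes inj: "inj_on \<rho> {..<k}" and zero: "\<And>a b. a < k \<Longrightarrow> b < k \<Longrightarrow> \<rho> a < \<rho> b \<Longrightarrow> A (a, b) = 0"
  shows "det (mat k k A) = (\<Prod>a<k. A (a, a))"
proof -
  have z: "(\<Prod>i = 0..<k. mat k k A $$ (i, p i)) = 0" if p: "p permutes {0..<k}" "p \<noteq> id" for p
  proof -
    have img: "p a < k" if "a < k" for a using p(1) that permutes_in_image[OF p(1), of a] by simp
    have "\<exists>a<k. \<rho> a < \<rho> (p a)"
    proof (rule ccontr)
      assume "\<not> ?thesis"
      then have le: "\<rho> (p a) \<le> \<rho> a" if "a < k" for a using that not_less by blast
      have "\<rho> (p a) = \<rho> a" if a: "a < k" for a
      proof (rule ccontr)
        assume "\<rho> (p a) \<noteq> \<rho> a"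
        then have "(\<Sum>a = 0..<k. \<rho> (p a)) < (\<Sum>a = 0..<k. \<rho> a)"
          using a le by (intro sum_strict_mono_ex1) (auto simp: order_less_le)
        moreover have "(\<Sum>a = 0..<k. \<rho> (p a)) = (\<Sum>a = 0..<k. \<rho> a)"
          using sum.permute[OF p(1), of \<rho>] by (simp add: comp_def)
        ultimately show False by simp
      qed
      then have "p a = a" if "a < k" for a using that inj_onD[OF inj, of "p a" a] img by simp
      then have "p = id" using permutes_not_in[OF p(1)] by (auto simp: fun_eq_iff)
      then show False using p(2) by simp
    qed
    then obtain a where "a < k" "\<rho> a < \<rho> (p a)" by blast
    then have "mat k k A $$ (a, p a) = 0" using zero[of a "p a"] img by simp
    then show ?thesis using \<open>a < k\<close> by (intro prod_zero) auto
  qed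
  have "det (mat k k A) =
      (\<Sum>p\<in>{p. p permutes {0..<k}}. signof p * (\<Prod>i = 0..<k. mat k k A $$ (i, p i)))"
    by (rule det_def') simp
  also have "\<dots> = (\<Sum>p\<in>{id}. signof p * (\<Prod>i = 0..<k. mat k k A $$ (i, p i)))"
    using z by (intro sum.mono_neutral_right) (auto simp: finite_permutations permutes_id)
  also have "\<dots> = (\<Prod>a<k. A (a, a))" by (simp add: atLeast0LessThan)
  finally show ?thesis .
qed

text \<open>Pigeonhole: the columns \<open>C\<close> can be non-zero only in the rows
  \<open>R\<close>, which are too few, so every permutation meets a zero entry.\<close>

lemma det_zero_block:
  fixes A :: "nat \<times> nat \<Rightarrow> 'a::comm_ring_1"
  assumes "R \<subseteq> {..<k}" "C \<subseteq> {..<k}" "card R < card C"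
    "\<And>a b. a < k \<Longrightarrow> a \<notin> R \<Longrightarrow> b \<in> C \<Longrightarrow> A (a, b) = 0"
  shows "det (mat k k A) = 0"
proof -
  have z: "(\<Prod>i = 0..<k. mat k k A $$ (i, p i)) = 0" if p: "p permutes {0..<k}" for p
  proof -
    have img: "p a < k" if "a < k" for a using that permutes_in_image[OF p, of a] by simp
    have fin: "finite R" "finite C" using assms(1,2) finite_subset by auto
    have "\<exists>a<k. a \<notin> R \<and> p a \<in> C"
    proof (rule ccontr)
      assume "\<not> ?thesis"
      then have sub: "{a. a < k \<and> p a \<in> C} \<subseteq> R" by auto
      have "C \<subseteq> p ` {a. a < k \<and> p a \<in> C}"
      proof
        fix c assume c: "c \<in> C"
        then have "c \<in> p ` {0..<k}" using permutes_image[OF p] assms(2) by auto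
        then show "c \<in> p ` {a. a < k \<and> p a \<in> C}" using c by auto
      qed
      then have "card C \<le> card {a. a < k \<and> p a \<in> C}"
        using surj_card_le[of "{a. a < k \<and> p a \<in> C}" C p] by simp
      also have "\<dots> \<le> card R" by (rule card_mono[OF fin(1) sub])
      finally show False using assms(3) by simp
    qed
    then obtain a where "a < k" "a \<notin> R" "p a \<in> C" by blast
    then have "mat k k A $$ (a, p a) = 0" using assms(4)[of a "p a"] img by simp
    then show ?thesis using \<open>a < k\<close> by (intro prod_zero) auto
  qed
  have "det (mat k k A) =
      (\<Sum>p\<in>{p. p permutes {0..<k}}. signof p * (\<Prod>i = 0..<k. mat k k A $$ (i, p i)))"
    by (rule det_def') simp
  also have "\<dots> = 0" by (rule sum.neutral) (use z in auto)
  finally show ?thesis .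
qed

text \<open>Rows are chosen by a function, so they may be unsorted or repeated, which keeps signs
  out of exchange arguments. Matrices are functions on index pairs, so that minors of all sizes are
  taken from the same object.\<close>

definition mdet :: "(nat \<Rightarrow> nat) \<Rightarrow> (nat \<times> nat \<Rightarrow> 'a::comm_ring_1) \<Rightarrow> nat \<Rightarrow> 'a" where
  "mdet e g k = det (mat k k (\<lambda>(a, b). g (e a, b)))"

abbreviation minor :: "nat set \<Rightarrow> (nat \<times> nat \<Rightarrow> 'a::comm_ring_1) \<Rightarrow> nat \<Rightarrow> 'a" where
  "minor L \<equiv> mdet (pick L)"

lemma mdet_cong:
  assumes "\<And>a b. a < k \<Longrightarrow> b < k \<Longrightarrow> g (e a, b) = h (f a, b)"
  shows "mdet e g k = mdet f h k"
  unfolding mdet_def using assms by (intro arg_cong[where f = det] eq_matI) auto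

lemma mdet_id: "mdet id g n = det (mat n n g)"
  unfolding mdet_def by (intro arg_cong[where f = det] eq_matI) auto

lemma mdet_polyfun:
  assumes "\<And>a b. a < k \<Longrightarrow> b < k \<Longrightarrow> (\<lambda>x. g x (e a, b)) \<in> polyfun W"
  shows "(\<lambda>x. mdet e (g x) k) \<in> polyfun W"
  unfolding mdet_def by (rule polyfun_det) (use assms in auto)

lemma det_submatrix:
  assumes "L \<in> ext_basis n k" "k \<le> n"
  shows "det (submatrix (mat n n g) L {..<k}) = minor L g k"
proof -
  have L: "card L = k" "L \<subseteq> {..<n}" using assms by (auto simp: ext_basis_def)
  have "{i. i < n \<and> i \<in> L} = L" "{j. j < n \<and> j < k} = {..<k}" using L assms by auto
  moreover have "pick L a < n" if "a < k" for a using pick_in_set_le[of a L] that L by auto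
  moreover have "pick {..<k} b = b" if "b < k" for b using that by (rule pick_lessThan)
  ultimately show ?thesis unfolding mdet_def submatrix_def using L assms
    by (intro arg_cong[where f = det] eq_matI) auto
qed

text \<open>Two enumerations of the same rows differ by a permutation. The factor is the same for
  all \<open>g\<close>, so it can be absorbed into scalars and into coefficients of
  equations.\<close>

lemma mdet_reorder:
  assumes e: "bij_betw e {..<k} L" and f: "bij_betw f {..<k} L"
  shows "\<exists>s :: 'a::field. s \<noteq> 0 \<and> (\<forall>g. mdet e g k = s * mdet f g k)"
proof -
  define p where "p = (\<lambda>a. if a < k then the_inv_into {..<k} f (e a) else a)"
  have fp: "f (p a) = e a" "p a < k" if "a < k" for a
  proof -
    have "e a \<in> L" using e that by (auto simp: bij_betw_def)
    then show "f (p a) = e a" "p a < k"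
      using that f_the_inv_into_f_bij_betw[OF f] the_inv_into_into[of f "{..<k}" "e a" "{..<k}"] f
      by (auto simp: p_def bij_betw_def)
  qed
  have p: "p permutes {0..<k}"
  proof (rule inj_on_nat_permutes)
    show "inj_on p {0..<k}"
    proof (rule inj_onI)
      fix a b assume "a \<in> {0..<k}" "b \<in> {0..<k}" "p a = p b"
      then have "e a = e b" using fp(1)[of a] fp(1)[of b] by simp
      then show "a = b" using bij_betw_imp_inj_on[OF e] \<open>a \<in> _\<close> \<open>b \<in> _\<close> by (auto dest: inj_onD)
    qed
  qed (use fp in \<open>auto simp: p_def\<close>)
  have "mdet e g k = signof p * mdet f g k" for g :: "nat \<times> nat \<Rightarrow> 'a"
  proof -
    have "mdet e g k = det (mat k k (\<lambda>(i, j). mat k k (\<lambda>(a, b). g (f a, b)) $$ (p i, j)))"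
      unfolding mdet_def using fp by (intro arg_cong[where f = det] eq_matI) auto
    then show ?thesis using det_permute_rows[OF _ p, of "mat k k (\<lambda>(a, b). g (f a, b))"]
      by (simp add: mdet_def)
  qed
  moreover have "(signof p :: 'a) \<noteq> 0" by (simp add: sign_def)
  ultimately show ?thesis by (intro exI[of _ "signof p"] conjI allI)
qed

lemma mdet_minor:
  assumes "inj_on e {..<k}" "L = e ` {..<k}"
  shows "\<exists>s :: 'a::field. s \<noteq> 0 \<and> (\<forall>g. mdet e g k = s * minor L g k)"
proof -
  have c: "card L = k" "finite L" using assms by (auto simp: card_image)
  have "bij_betw e {..<k} L" using assms by (simp add: bij_betw_def)
  moreover have "bij_betw (pick L) {..<k} L" using pick_bij_betw[OF c(2)] c(1) by simp
  ultimately show ?thesis by (rule mdet_reorder)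
qed

definition gmul :: "nat \<Rightarrow> (nat \<times> nat \<Rightarrow> 'a::comm_ring_1) \<Rightarrow> (nat \<times> nat \<Rightarrow> 'a) \<Rightarrow> nat \<times> nat \<Rightarrow> 'a" where
  "gmul n g q = (\<lambda>(r, a). \<Sum>b<n. g (r, b) * q (b, a))"

text \<open>The first \<open>k\<close> columns of the product involve only the first
  \<open>k\<close> columns of \<open>g\<close>, so the minor factors without a sum over column
  subsets.\<close>

lemma mdet_gmul:
  assumes "k \<le> n" "\<And>a b. a < k \<Longrightarrow> k \<le> b \<Longrightarrow> b < n \<Longrightarrow> q (b, a) = 0"
  shows "mdet e (gmul n g q) k = mdet e g k * det (mat k k q)"
proof -
  have "gmul n g q (e a, c) = (\<Sum>b = 0..<k. g (e a, b) * q (b, c))" if "c < k" for a c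
    unfolding gmul_def using assms that
    by (simp, intro sum.mono_neutral_right) auto
  then have "mat k k (\<lambda>(a, b). gmul n g q (e a, b)) = mat k k (\<lambda>(a, b). g (e a, b)) * mat k k q"
    by (intro eq_matI) (auto simp: scalar_prod_def)
  then show ?thesis unfolding mdet_def by (simp add: det_mult[of _ k])
qed

text \<open>If the order failed at the threshold \<open>x\<close>, the columns with bound below
  \<open>x\<close> would live in too few of the chosen rows and form a zero block. Allowing
  \<open>k0 < k\<close> lets bounds on the first columns control minors of higher levels.\<close>

lemma mdet_bound_subset_le:
  fixes g :: "nat \<times> nat \<Rightarrow> 'a::comm_ring_1"
  assumes nz: "mdet e g k \<noteq> 0" and e: "inj_on e {..<k}" "\<And>a. a < k \<Longrightarrow> e a < n"
    and \<beta>: "inj_on \<beta> {..<k0}" "k0 \<le> k"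
    and zero: "\<And>a r. a < k0 \<Longrightarrow> r < n \<Longrightarrow> \<beta> a < r \<Longrightarrow> g (r, a) = 0"
  shows "e ` {..<k} \<sqsubseteq> \<beta> ` {..<k0}"
  unfolding subset_le_def
proof (intro allI, rule ccontr)
  fix x assume "\<not> card (\<beta> ` {..<k0} \<inter> {..<x}) \<le> card (e ` {..<k} \<inter> {..<x})"
  moreover have "\<beta> ` {..<k0} \<inter> {..<x} = \<beta> ` {a. a < k0 \<and> \<beta> a < x}"
    "e ` {..<k} \<inter> {..<x} = e ` {a. a < k \<and> e a < x}" by auto
  moreover have "card (\<beta> ` {a. a < k0 \<and> \<beta> a < x}) = card {a. a < k0 \<and> \<beta> a < x}"
    by (rule card_image, rule inj_on_subset[OF \<beta>(1)]) auto
  moreover have "card (e ` {a. a < k \<and> e a < x}) = card {a. a < k \<and> e a < x}"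
    by (rule card_image, rule inj_on_subset[OF e(1)]) auto
  ultimately have "card {a. a < k \<and> e a < x} < card {a. a < k0 \<and> \<beta> a < x}" by simp
  then have "mdet e g k = 0"
    unfolding mdet_def using \<beta>(2) e(2) zero
    by (intro det_zero_block[of "{a. a < k \<and> e a < x}" k "{a. a < k0 \<and> \<beta> a < x}"]) auto
  then show False using nz by simp
qed

text \<open>Ordered by their pivots, rows and columns form a triangular matrix; the ranking
  \<open>n - \<sigma> a\<close> reverses the order because entries vanish below the pivots.\<close>

lemma mdet_pivots:
  fixes h :: "nat \<times> nat \<Rightarrow> 'a::comm_ring_1"
  assumes "inj_on \<sigma> {..<k}" "\<And>a. a < k \<Longrightarrow> \<sigma> a < n"
    "\<And>a r. a < k \<Longrightarrow> r < n \<Longrightarrow> \<sigma> a < r \<Longrightarrow> h (r, a) = 0"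
  shows "mdet \<sigma> h k = (\<Prod>a<k. h (\<sigma> a, a))"
proof -
  have "det (mat k k (\<lambda>(a, b). h (\<sigma> a, b))) = (\<Prod>a<k. (\<lambda>(a, b). h (\<sigma> a, b)) (a, a))"
  proof (rule det_rank[of "\<lambda>a. n - \<sigma> a"])
    show "inj_on (\<lambda>a. n - \<sigma> a) {..<k}"
    proof (rule inj_onI)
      fix a b assume "a \<in> {..<k}" "b \<in> {..<k}" "n - \<sigma> a = n - \<sigma> b"
      moreover from this have "\<sigma> a = \<sigma> b" using assms(2)[of a] assms(2)[of b] by simp
      ultimately show "a = b" using assms(1) by (auto dest: inj_onD)
    qed
  qed (use assms(2,3) in auto)
  then show ?thesis by (simp add: mdet_def)
qed

section \<open>Bruhat decomposition\<close>

text \<open>Among the vectors in \<open>g\<^sub>a + span {g\<^sub>b | b < a}\<close>, choose one whose last non-zero entry is in the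
  smallest possible row. These rows are distinct for different \<open>a\<close>, since otherwise the vector for
  the larger column could be improved by the other one.\<close>

lemma bruhat_columns:
  fixes g :: "nat \<times> nat \<Rightarrow> 'a::field"
  assumes det: "det (mat n n g) \<noteq> 0"
  shows "\<exists>h \<sigma>. \<sigma> permutes {..<n} \<and> (\<forall>e k. k \<le> n \<longrightarrow> mdet e h k = mdet e g k) \<and>
    (\<forall>a<n. h (\<sigma> a, a) \<noteq> 0 \<and> (\<forall>r<n. \<sigma> a < r \<longrightarrow> h (r, a) = 0))"
proof -
  define vec where "vec = (\<lambda>a c r. g (r, a) + (\<Sum>b<a. c b * g (r, b)))"
  have vecE: "vec a c r = g (r, a) + (\<Sum>b<a. c b * g (r, b))" for a c r by (simp add: vec_def)
  \<comment> \<open>\<open>q c\<close> is unipotent upper triangular, so multiplying by it leaves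
    all minors on the first columns unchanged.\<close>
  define q where "q = (\<lambda>(c :: nat \<Rightarrow> nat \<Rightarrow> 'a) (b, a). if b = a then 1 else if b < a then c a b else 0)"
  have gq: "gmul n g (q c) (r, a) = vec a (c a) r" if "a < n" for c r a
  proof -
    have "gmul n g (q c) (r, a) = (\<Sum>b\<in>insert a {..<a}. g (r, b) * q c (b, a))"
      unfolding gmul_def using that by (simp only: prod.case, intro sum.mono_neutral_right) (auto simp: q_def)
    also have "\<dots> = vec a (c a) r" by (simp add: vec_def q_def mult.commute)
    finally show ?thesis .
  qed
  have detq: "det (mat k k (q c)) = 1" for k c
  proof -
    have "det (mat k k (q c)) = (\<Prod>a<k. q c (a, a))"
    proof (rule det_rank[of "\<lambda>a. k - a"])
      show "inj_on ((-) k) {..<k}" by (auto simp: inj_on_def)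
    qed (auto simp: q_def)
    then show ?thesis by (simp add: q_def)
  qed
  have mq: "mdet e (gmul n g (q c)) k = mdet e g k" if "k \<le> n" for e c k
    using mdet_gmul[OF that, of "q c" e g] detq[of k c] by (auto simp: q_def)
  have nz: "\<exists>r<n. vec a c r \<noteq> 0" if a: "a < n" for a c
  proof (rule ccontr)
    assume "\<not> ?thesis"
    then have "det (mat n n (gmul n g (q (\<lambda>_. c)))) = 0"
      using a gq[OF a, of "\<lambda>_. c"] by (intro det_zero_block[of "{}" n "{a}"]) auto
    then show False using mq[of n id "\<lambda>_. c"] det by (simp add: mdet_id)
  qed
  define piv where "piv = (\<lambda>a c. Max {r. r < n \<and> vec a c r \<noteq> 0})"
  have piv: "piv a c < n" "vec a c (piv a c) \<noteq> 0" if "a < n" for a c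
    using Max_in[of "{r. r < n \<and> vec a c r \<noteq> 0}"] nz[OF that, of c] by (auto simp: piv_def)
  have piv_max: "vec a c r = 0" if "piv a c < r" "r < n" for a c r
  proof (rule ccontr)
    assume "vec a c r \<noteq> 0"
    then have "r \<le> piv a c" unfolding piv_def using that by (intro Max_ge) auto
    then show False using that by simp
  qed
  define cm where "cm = (\<lambda>a. arg_min (piv a) (\<lambda>_. True))"
  have cm: "piv a (cm a) \<le> piv a c" for a c
    unfolding cm_def using arg_min_nat_le[of "\<lambda>_. True" c "piv a"] by simp
  define \<sigma> where "\<sigma> = (\<lambda>a. if a < n then piv a (cm a) else a)"
  have neq: "\<sigma> a \<noteq> \<sigma> b" if ab: "a < b" "b < n" for a b
  proof
    assume eq: "\<sigma> a = \<sigma> b"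
    define r where "r = \<sigma> a"
    have r: "piv a (cm a) = r" "piv b (cm b) = r" using eq ab by (auto simp: r_def \<sigma>_def)
    \<comment> \<open>\<open>t\<close> cancels the common last entry in row \<open>r\<close>. Both
      vectors vanish below that row, so the new one ends strictly higher, against the minimality of
      \<open>cm b\<close>.\<close>
    define t where "t = vec b (cm b) r / vec a (cm a) r"
    define c where "c = (\<lambda>d. cm b d - t * (if d = a then 1 else if d < a then cm a d else 0))"
    have "(\<Sum>d<b. (if d = a then 1 else if d < a then cm a d else 0) * g (x, d)) = vec a (cm a) x" for x
    proof -
      have "(\<Sum>d<b. (if d = a then 1 else if d < a then cm a d else 0) * g (x, d)) =
         (\<Sum>d\<in>insert a {..<a}. (if d = a then 1 else if d < a then cm a d else 0) * g (x, d))"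
        using ab by (intro sum.mono_neutral_right) auto
      then show ?thesis by (simp add: vec_def)
    qed
    then have vec: "vec b c x = vec b (cm b) x - t * vec a (cm a) x" for x
      unfolding vecE[of b] c_def
      by (simp add: left_diff_distrib sum_subtractf mult.assoc sum_distrib_left[symmetric])
    have "vec b c x = 0" if "r \<le> x" "x < n" for x
    proof (cases "x = r")
      case True
      then show ?thesis using vec[of x] piv(2)[of a "cm a"] r ab by (simp add: t_def)
    next
      case False
      then show ?thesis using vec[of x] piv_max[of a "cm a" x] piv_max[of b "cm b" x] r that by simp
    qed
    then have "piv b c < r" using piv[OF ab(2), of c] by (meson not_le)
    then show False using cm[of b c] r by simp
  qed
  have "\<sigma> permutes {..<n}"
  proof (rule inj_on_nat_permutes)
    show "inj_on \<sigma> {..<n}" by (rule inj_onI) (metis lessThan_iff linorder_neqE_nat neq)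
  qed (use piv in \<open>auto simp: \<sigma>_def\<close>)
  moreover have "gmul n g (q cm) (\<sigma> a, a) \<noteq> 0 \<and> (\<forall>r<n. \<sigma> a < r \<longrightarrow> gmul n g (q cm) (r, a) = 0)"
    if "a < n" for a
    using piv(2)[OF that] piv_max that by (simp add: gq \<sigma>_def)
  ultimately show ?thesis using mq
    by (intro exI[of _ "gmul n g (q cm)"] exI[of _ \<sigma>] conjI allI impI) simp_all
qed

text \<open>Only the first \<open>k\<close> columns are permuted, so minors on at least
  \<open>k\<close> columns change by one common sign. Smaller minors are not controlled, which is
  why later arguments retain only the levels from \<open>k\<close> on.\<close>

lemma pivot_sort:
  fixes h :: "nat \<times> nat \<Rightarrow> 'a::field"
  assumes \<sigma>: "\<sigma> permutes {..<n}" and k: "k \<le> n"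
    and zero: "\<And>a r. a < k \<Longrightarrow> r < n \<Longrightarrow> \<sigma> a < r \<Longrightarrow> h (r, a) = 0"
  shows "\<exists>g s. s \<noteq> 0 \<and> (\<forall>e l. k \<le> l \<longrightarrow> mdet e g l = s * mdet e h l) \<and>
    (\<forall>a<k. \<forall>r<n. pick (\<sigma> ` {..<k}) a < r \<longrightarrow> g (r, a) = 0)"
proof -
  let ?P = "\<sigma> ` {..<k}"
  have inj: "inj_on \<sigma> {..<k}" using permutes_inj_on[OF \<sigma>] .
  have cP: "card ?P = k" using inj by (simp add: card_image)
  have bij: "bij_betw (pick ?P) {..<k} ?P" using pick_bij_betw[of ?P] cP by simp
  define \<tau> where "\<tau> = (\<lambda>a. if a < k then inv_into UNIV \<sigma> (pick ?P a) else a)"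
  have \<tau>: "\<sigma> (\<tau> a) = pick ?P a" "\<tau> a < k" if "a < k" for a
  proof -
    have "pick ?P a \<in> ?P" using bij that by (auto simp: bij_betw_def)
    then show "\<sigma> (\<tau> a) = pick ?P a" "\<tau> a < k"
      using that permutes_inverses[OF \<sigma>] by (auto simp: \<tau>_def)
  qed
  have perm: "\<tau> permutes {0..<k}"
  proof (rule inj_on_nat_permutes)
    show "inj_on \<tau> {0..<k}"
    proof (rule inj_onI)
      fix a b assume "a \<in> {0..<k}" "b \<in> {0..<k}" "\<tau> a = \<tau> b"
      then have "pick ?P a = pick ?P b" using \<tau>(1)[of a] \<tau>(1)[of b] by simp
      then show "a = b" using bij \<open>a \<in> _\<close> \<open>b \<in> _\<close> by (auto simp: bij_betw_def dest: inj_onD)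
    qed
  qed (use \<tau> in \<open>auto simp: \<tau>_def\<close>)
  define g where "g = (\<lambda>(r, a). h (r, \<tau> a))"
  have "mdet e g l = signof \<tau> * mdet e h l" if "k \<le> l" for e l
  proof -
    have p: "\<tau> permutes {0..<l}" by (rule permutes_subset[OF perm]) (use that in auto)
    have "\<tau> a < l" if "a < l" for a using permutes_in_image[OF p, of a] that by simp
    then have "mdet e g l = det (mat l l (\<lambda>(i, j). mat l l (\<lambda>(a, b). h (e a, b)) $$ (i, \<tau> j)))"
      unfolding mdet_def g_def by (intro arg_cong[where f = det] eq_matI) auto
    also have "\<dots> = signof \<tau> * mdet e h l"
      unfolding mdet_def by (rule det_permute_cols[OF _ p]) simp
    finally show ?thesis .
  qed
  moreover have "(signof \<tau> :: 'a) \<noteq> 0" by (simp add: sign_def)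
  moreover have "g (r, a) = 0" if "a < k" "r < n" "pick ?P a < r" for a r
    using zero[of "\<tau> a" r] \<tau>[of a] that by (simp add: g_def)
  ultimately show ?thesis by (intro exI[of _ g] exI[of _ "signof \<tau>"] conjI allI impI) simp_all
qed

text \<open>The increasing part makes the permutation flag satisfy the column bounds of
  \<open>J\<close>; the decreasing part makes it the largest flag over \<open>J\<close>, which later
  identifies the maximal preimage.\<close>

lemma ex_permutation:
  assumes "J \<subseteq> {..<n}" "card J = k"
  shows "\<exists>\<sigma>. \<sigma> permutes {..<n} \<and> \<sigma> ` {..<k} = J \<and> (\<forall>a<k. \<sigma> a = pick J a) \<and>
    (\<forall>a b. k \<le> a \<longrightarrow> a < b \<longrightarrow> b < n \<longrightarrow> \<sigma> b < \<sigma> a)"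
proof -
  have fin: "finite J" using assms finite_subset by auto
  have kn: "k \<le> n" using card_mono[OF _ assms(1)] assms(2) by simp
  let ?K = "{..<n} - J"
  have cK: "card ?K = n - k" using card_Diff_subset[OF fin assms(1)] assms(2) by simp
  define \<sigma> where "\<sigma> = (\<lambda>a. if a < k then pick J a else if a < n then pick ?K (n - 1 - a) else a)"
  have bJ: "bij_betw (pick J) {..<k} J" using pick_bij_betw[OF fin] assms(2) by simp
  have bK: "bij_betw (pick ?K) {..<n - k} ?K" using pick_bij_betw[of ?K] cK by simp
  have inJ: "\<sigma> a \<in> J" if "a < k" for a using bJ that by (auto simp: \<sigma>_def bij_betw_def)
  have inK: "\<sigma> a \<in> ?K" if "k \<le> a" "a < n" for a
  proof -
    have "n - 1 - a \<in> {..<n - k}" using that by auto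
    then have "pick ?K (n - 1 - a) \<in> ?K" using bK by (auto simp: bij_betw_def)
    then show ?thesis using that by (simp add: \<sigma>_def)
  qed
  have dec: "\<sigma> b < \<sigma> a" if "k \<le> a" "a < b" "b < n" for a b
    using pick_mono_le[of "n - 1 - a" ?K "n - 1 - b"] that cK by (simp add: \<sigma>_def)
  have "\<sigma> a \<noteq> \<sigma> b" if "a < b" "b < n" for a b
  proof (cases "b < k")
    case True
    then show ?thesis using pick_mono_le[of b J a] assms(2) that by (simp add: \<sigma>_def)
  next
    case False
    then show ?thesis using inJ[of a] inK[of b] dec[of a b] that by (cases "a < k") auto
  qed
  then have "\<sigma> permutes {..<n}"
  proof (intro inj_on_nat_permutes)
    show "inj_on \<sigma> {..<n}" by (rule inj_onI) (metis \<open>\<And>b a. \<lbrakk>a < b; b < n\<rbrakk> \<Longrightarrow> \<sigma> a \<noteq> \<sigma> b\<close> lessThan_iff linorder_neqE_nat)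
    show "\<sigma> \<in> {..<n} \<rightarrow> {..<n}"
    proof
      fix a assume "a \<in> {..<n}"
      then show "\<sigma> a \<in> {..<n}" using inJ[of a] inK[of a] assms(1) by (cases "a < k") auto
    qed
  qed (use kn in \<open>auto simp: \<sigma>_def\<close>)
  moreover have "\<sigma> ` {..<k} = J" using bJ by (auto simp: bij_betw_def \<sigma>_def)
  moreover have "\<forall>a<k. \<sigma> a = pick J a" by (simp add: \<sigma>_def)
  ultimately show ?thesis using dec by (intro exI[of _ \<sigma>] conjI allI impI) simp_all
qed

section \<open>Flags and their Pluecker coordinates\<close>

lemma mem_flag_basis: "L \<in> flag_basis n k j \<longleftrightarrow> L \<in> ext_basis n (k j)"
  by (simp add: flag_basis_def)

lemma ext_basisD:
  assumes "L \<in> ext_basis n l"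
  shows "L \<subseteq> {..<n}" "card L = l" "finite L" "\<And>a. a < l \<Longrightarrow> pick L a < n" "inj_on (pick L) {..<l}"
    "pick L ` {..<l} = L"
proof -
  show L: "L \<subseteq> {..<n}" "card L = l" using assms by (auto simp: ext_basis_def)
  then show fin: "finite L" using finite_subset by auto
  show "pick L a < n" if "a < l" for a using pick_in_set_le[of a L] that L by auto
  show "inj_on (pick L) {..<l}" "pick L ` {..<l} = L"
    using pick_bij_betw[OF fin] L(2) by (auto simp: bij_betw_def)
qed

lemma finite_ext_basis: "finite (ext_basis n l)"
  by (rule finite_subset[of _ "Pow {..<n}"]) (auto simp: ext_basis_def)

lemma ext_basis_image:
  assumes "\<sigma> permutes {..<n}" "l \<le> n"
  shows "\<sigma> ` {..<l} \<in> ext_basis n l"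
proof -
  have "{..<l} \<subseteq> {..<n}" using assms(2) by auto
  then have "\<sigma> ` {..<l} \<subseteq> {..<n}" using image_mono[of "{..<l}" "{..<n}" \<sigma>] permutes_image[OF assms(1)] by simp
  moreover have "card (\<sigma> ` {..<l}) = l" using permutes_inj_on[OF assms(1)] by (simp add: card_image)
  ultimately show ?thesis by (simp add: ext_basis_def)
qed

text \<open>The first \<open>l\<close> columns of \<open>g\<close> span a subspace in the Schubert variety of \<open>J\<close> in an evident way:
  the \<open>a\<close>-th column lies in the span of the first \<open>j\<^sub>a\<close> basis vectors.\<close>

definition col_bounded :: "nat \<Rightarrow> nat set \<Rightarrow> nat \<Rightarrow> (nat \<times> nat \<Rightarrow> 'a::zero) \<Rightarrow> bool" where
  "col_bounded n J l g \<longleftrightarrow> (\<forall>a<l. \<forall>r<n. pick J a < r \<longrightarrow> g (r, a) = 0)"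

lemma col_bounded_mono:
  assumes "col_bounded n L l' g" "L \<sqsubseteq> J" "L \<in> ext_basis n l'" "J \<in> ext_basis n l"
  shows "col_bounded n J l g"
  unfolding col_bounded_def
proof (intro allI impI)
  fix a r assume ar: "a < l" "r < n" "pick J a < r"
  note L = ext_basisD(1,2)[OF assms(3)] and J = ext_basisD(1,2)[OF assms(4)]
  have "pick L a \<le> pick J a" using subset_le_pick[OF assms(2) L(1) J(1)] ar(1) J(2) by simp
  moreover have "a < l'" using subset_le_card[OF assms(2) L(1) J(1)] ar(1) J(2) L(2) by simp
  ultimately show "g (r, a) = 0" using assms(1) ar by (auto simp: col_bounded_def)
qed

lemma col_bounded_minor:
  assumes "col_bounded n J l g" "J \<in> ext_basis n l" "l \<le> l'" "L \<in> ext_basis n l'" "minor L g l' \<noteq> 0"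
  shows "L \<sqsubseteq> J"
proof -
  have "pick L ` {..<l'} \<sqsubseteq> pick J ` {..<l}"
    by (rule mdet_bound_subset_le[where n = n, OF assms(5)])
      (use assms ext_basisD[OF assms(2)] ext_basisD[OF assms(4)] in \<open>auto simp: col_bounded_def\<close>)
  then show ?thesis using ext_basisD(6)[OF assms(2)] ext_basisD(6)[OF assms(4)] by simp
qed

text \<open>\<open>P\<close> collects the pivot rows of the first \<open>l\<close> columns. Its
  minor is the product of the pivots up to a non-zero factor, and sorting the columns by pivots
  yields \<open>h\<close>.\<close>

lemma column_type:
  fixes g :: "nat \<times> nat \<Rightarrow> 'a::field"
  assumes det: "det (mat n n g) \<noteq> 0" and l: "l \<le> n"
  shows "\<exists>P h s. P \<in> ext_basis n l \<and> minor P g l \<noteq> 0 \<and> det (mat n n h) \<noteq> 0 \<and> col_bounded n P l h \<and>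
    s \<noteq> 0 \<and> (\<forall>e l'. l \<le> l' \<longrightarrow> l' \<le> n \<longrightarrow> mdet e h l' = s * mdet e g l')"
proof -
  obtain h \<sigma> where *: "\<sigma> permutes {..<n}" "\<forall>e k. k \<le> n \<longrightarrow> mdet e h k = mdet e g k"
    "\<forall>a<n. h (\<sigma> a, a) \<noteq> 0 \<and> (\<forall>r<n. \<sigma> a < r \<longrightarrow> h (r, a) = 0)"
    using bruhat_columns[OF det] by (elim exE conjE)
  have h: "\<sigma> permutes {..<n}" "\<And>e k. k \<le> n \<Longrightarrow> mdet e h k = mdet e g k"
    "\<And>a. a < n \<Longrightarrow> h (\<sigma> a, a) \<noteq> 0" "\<And>a r. a < n \<Longrightarrow> r < n \<Longrightarrow> \<sigma> a < r \<Longrightarrow> h (r, a) = 0"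
    using * by simp_all
  define P where "P = \<sigma> ` {..<l}"
  have P: "P \<in> ext_basis n l" unfolding P_def using h(1) l by (rule ext_basis_image)
  have im: "\<sigma> a < n" if "a < n" for a using permutes_in_image[OF h(1), of a] that by simp
  have inj: "inj_on \<sigma> {..<l}" by (rule permutes_inj_on[OF h(1)])
  have "mdet \<sigma> h l = (\<Prod>a<l. h (\<sigma> a, a))" using l h(4) im inj by (intro mdet_pivots[where n = n]) auto
  moreover have "\<dots> \<noteq> 0" using h(3) l by simp
  moreover obtain t where "mdet \<sigma> h l = t * minor P h l"
    using mdet_minor[OF inj P_def] by metis
  ultimately have "minor P g l \<noteq> 0" using h(2)[OF l] by auto
  moreover obtain f s where f: "s \<noteq> 0" "\<And>e l'. l \<le> l' \<Longrightarrow> mdet e f l' = s * mdet e h l'"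
    "\<forall>a<l. \<forall>r<n. pick P a < r \<longrightarrow> f (r, a) = 0"
    using pivot_sort[of \<sigma> n l h] h(1,4) l unfolding P_def by auto
  moreover have "mdet e f l' = s * mdet e g l'" if "l \<le> l'" "l' \<le> n" for e l' using f(2) h(2) that by simp
  moreover from this[of n id] have "det (mat n n f) \<noteq> 0" using l det f(1) by (simp add: mdet_id)
  ultimately show ?thesis using P
    by (intro exI[of _ P] exI[of _ f] exI[of _ s]) (auto simp: col_bounded_def)
qed

definition perm_matrix :: "(nat \<Rightarrow> nat) \<Rightarrow> nat \<times> nat \<Rightarrow> 'a::comm_ring_1" where
  "perm_matrix \<sigma> = (\<lambda>(r, a). if r = \<sigma> a then 1 else 0)"

lemma mdet_perm_matrix:
  assumes "inj_on \<sigma> {..<l}"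
  shows "mdet \<sigma> (perm_matrix \<sigma>) l = 1"
proof -
  have "mdet \<sigma> (perm_matrix \<sigma> :: nat \<times> nat \<Rightarrow> 'a) l = det (1\<^sub>m l)"
    unfolding mdet_def using assms
    by (intro arg_cong[where f = det] eq_matI) (auto simp: perm_matrix_def dest: inj_onD)
  then show ?thesis by simp
qed

lemma minor_perm_matrix:
  assumes "\<sigma> permutes {..<n}" "l \<le> n"
  shows "minor (\<sigma> ` {..<l}) (perm_matrix \<sigma> :: nat \<times> nat \<Rightarrow> 'a::field) l \<noteq> 0"
proof -
  have inj: "inj_on \<sigma> {..<l}" by (rule permutes_inj_on[OF assms(1)])
  obtain s :: 'a where "mdet \<sigma> (perm_matrix \<sigma>) l = s * minor (\<sigma> ` {..<l}) (perm_matrix \<sigma>) l"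
    using mdet_minor[OF inj refl] by metis
  then show ?thesis using mdet_perm_matrix[OF inj, where ?'a = 'a] by auto
qed

lemma det_perm_matrix:
  assumes "\<sigma> permutes {..<n}"
  shows "det (mat n n (perm_matrix \<sigma> :: nat \<times> nat \<Rightarrow> 'a::field)) \<noteq> 0"
proof -
  have "bij_betw \<sigma> {..<n} {..<n}" "bij_betw id {..<n} {..<n}" using permutes_imp_bij[OF assms] by auto
  from mdet_reorder[OF this, where ?'a = 'a] obtain s :: 'a
    where "mdet \<sigma> (perm_matrix \<sigma>) n = s * mdet id (perm_matrix \<sigma>) n" by metis
  then show ?thesis using mdet_perm_matrix[OF permutes_inj_on[OF assms], of n, where ?'a = 'a]
    by (auto simp: mdet_id)
qed

text \<open>Some minor on the first \<open>l\<close> columns is non-zero, and the zero block leaves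
  only the rows \<open>{..<l}\<close> for it.\<close>

lemma det_upper_block:
  fixes q :: "nat \<times> nat \<Rightarrow> 'a::field"
  assumes "det (mat n n q) \<noteq> 0" "l \<le> n" "\<And>a b. a < l \<Longrightarrow> l \<le> b \<Longrightarrow> b < n \<Longrightarrow> q (b, a) = 0"
  shows "det (mat l l q) \<noteq> 0"
proof -
  obtain P where P: "P \<in> ext_basis n l" "minor P q l \<noteq> 0" using column_type[OF assms(1,2)] by metis
  note P' = ext_basisD[OF P(1)]
  have "pick P a < l" if a: "a < l" for a
  proof (rule ccontr)
    assume "\<not> pick P a < l"
    then have "minor P q l = 0"
      unfolding mdet_def using assms(3) P'(4) a
      by (intro det_zero_block[of "{..<l} - {a}" l "{..<l}"]) auto
    then show False using P(2) by simp
  qed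
  then have "pick P ` {..<l} \<subseteq> {..<l}" by auto
  then have "P \<subseteq> {..<l}" by (simp only: P'(6))
  then have "P = {..<l}" using P'(2) by (intro card_subset_eq) auto
  then have "minor P q l = mdet id q l" using pick_lessThan by (intro mdet_cong) simp
  then show ?thesis using P(2) by (simp add: mdet_id)
qed

section \<open>Partial flags, their coordinate vectors and the cones over the strata\<close>

locale flag_data =
  fixes n m :: nat and k :: "nat \<Rightarrow> nat"
  assumes m: "1 \<le> m" and k_mono: "strict_mono_on {1..m} k" and k1: "1 \<le> k 1" and km: "k m \<le> n - 1"
begin

lemma k_less: "1 \<le> i \<Longrightarrow> i < j \<Longrightarrow> j \<le> m \<Longrightarrow> k i < k j"
  using k_mono by (auto simp: strict_mono_on_def)

lemma k_le: "1 \<le> i \<Longrightarrow> i \<le> j \<Longrightarrow> j \<le> m \<Longrightarrow> k i \<le> k j"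
  using k_less[of i j] by (cases "i = j") auto

lemma k_pos: "1 \<le> j \<Longrightarrow> j \<le> m \<Longrightarrow> 1 \<le> k j"
  using k_le[of 1 j] k1 by simp

lemma k_less_n: "1 \<le> j \<Longrightarrow> j \<le> m \<Longrightarrow> k j < n"
  using k_le[of j m] km k_pos[of m] m by simp

lemma k_le_n: "1 \<le> j \<Longrightarrow> j \<le> m \<Longrightarrow> k j \<le> n"
  using k_less_n[of j] by simp

lemma k_inj: "i \<in> {1..m} \<Longrightarrow> j \<in> {1..m} \<Longrightarrow> k i \<le> k j \<Longrightarrow> i \<le> j"
  using k_less[of j i] by (meson atLeastAtMost_iff leD leI)

abbreviation flag_space :: "nat set \<Rightarrow> (nat \<times> nat set \<Rightarrow> 'a::zero) set" where
  "flag_space I \<equiv> affine_space (Sigma I (flag_basis n k))"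

text \<open>The scalars \<open>l j\<close> may be zero: arbitrary scalars sweep out the cone over a
  flag, and constant 1 gives a representative of the flag itself.\<close>

definition pvec :: "nat set \<Rightarrow> (nat \<Rightarrow> 'a) \<Rightarrow> (nat \<times> nat \<Rightarrow> 'a::comm_ring_1) \<Rightarrow> nat \<times> nat set \<Rightarrow> 'a" where
  "pvec I l g = (\<lambda>(j, L). if (j, L) \<in> Sigma I (flag_basis n k) then l j * minor L g (k j) else 0)"

lemma pvec_apply: "j \<in> I \<Longrightarrow> L \<in> ext_basis n (k j) \<Longrightarrow> pvec I l g (j, L) = l j * minor L g (k j)"
  by (simp add: pvec_def mem_flag_basis)

lemma pvec_nonzeroD:
  "pvec I l g (j, L) \<noteq> 0 \<Longrightarrow> j \<in> I \<and> L \<in> ext_basis n (k j) \<and> l j \<noteq> 0 \<and> minor L g (k j) \<noteq> 0"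
  by (auto simp: pvec_def mem_flag_basis split: if_splits)

lemma pvec_flag_space: "pvec I l g \<in> flag_space I"
  by (auto simp: affine_space_def pvec_def)

lemma pvec_cong:
  assumes "\<And>j L. j \<in> I \<Longrightarrow> L \<in> ext_basis n (k j) \<Longrightarrow> l j * minor L g (k j) = l' j * minor L g' (k j)"
  shows "pvec I l g = pvec I l' g'"
  using assms by (auto simp: pvec_def mem_flag_basis fun_eq_iff)

lemma pvec_mp_coords:
  fixes g :: "nat \<times> nat \<Rightarrow> 'a::field"
  assumes "det (mat n n g) \<noteq> 0" "I \<subseteq> {1..m}" "\<And>j. j \<in> I \<Longrightarrow> l j \<noteq> 0"
  shows "pvec I l g \<in> mp_coords (flag_basis n k) I"
proof -
  have "curry (pvec I l g) j \<noteq> 0" if j: "j \<in> I" for j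
  proof -
    have "k j \<le> n" using k_le_n[of j] j assms(2) by auto
    then obtain P where P: "P \<in> ext_basis n (k j)" "minor P g (k j) \<noteq> 0"
      using column_type[OF assms(1)] by metis
    then have "curry (pvec I l g) j P \<noteq> 0" using assms(3) j by (simp add: pvec_apply)
    then show ?thesis by (auto simp: fun_eq_iff)
  qed
  then show ?thesis using pvec_flag_space by (auto simp: mp_coords_def)
qed

lemma mp_point_eq_pvec:
  fixes g :: "nat \<times> nat \<Rightarrow> 'a::field"
  assumes "w \<in> mp_coords (flag_basis n k) I"
  shows "mp_point I w = mp_point I (pvec I (\<lambda>_. 1) g) \<longleftrightarrow> (\<exists>l. (\<forall>j\<in>I. l j \<noteq> 0) \<and> w = pvec I l g)"
proof
  assume "mp_point I w = mp_point I (pvec I (\<lambda>_. 1) g)"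
  then obtain c where c: "\<forall>i\<in>I. c i \<noteq> 0 \<and> (\<forall>b. w (i, b) = c i * pvec I (\<lambda>_. 1) g (i, b))"
    using mp_point_eq_iff[OF assms] by blast
  have "w = pvec I c g"
  proof
    fix x :: "nat \<times> nat set"
    obtain j L where x: "x = (j, L)" by (cases x)
    show "w x = pvec I c g x"
    proof (cases "x \<in> Sigma I (flag_basis n k)")
      case True
      then have "w (j, L) = c j * pvec I (\<lambda>_. 1) g (j, L)" using c x by auto
      then show ?thesis using True x by (simp add: pvec_def)
    next
      case False
      then have "w x = 0" using assms unfolding mp_coords_def affine_space_def by blast
      then show ?thesis using False x by (auto simp: pvec_def)
    qed
  qed
  then show "\<exists>l. (\<forall>j\<in>I. l j \<noteq> 0) \<and> w = pvec I l g" using c by (intro exI[of _ c]) auto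
next
  assume "\<exists>l. (\<forall>j\<in>I. l j \<noteq> 0) \<and> w = pvec I l g"
  then obtain l where l: "\<forall>j\<in>I. l j \<noteq> 0" "w = pvec I l g" by blast
  show "mp_point I w = mp_point I (pvec I (\<lambda>_. 1) g)"
    unfolding mp_point_eq_iff[OF assms] using l by (intro exI[of _ l]) (auto simp: pvec_def)
qed

text \<open>Indexing by the subset \<open>J\<close> instead of a coset keeps the Weyl group out of
  the geometry; \<open>stratum_coset_of\<close> later identifies this set with the Schubert
  variety.\<close>

definition Xc :: "nat \<Rightarrow> nat set \<Rightarrow> (nat \<Rightarrow> (nat set \<Rightarrow> 'a::field) set) set" where
  "Xc i J = {mp_point {i..m} (pvec {i..m} (\<lambda>_. 1) g) |g. det (mat n n g) \<noteq> 0 \<and> col_bounded n J (k i) g}"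

definition cone :: "nat \<Rightarrow> nat set \<Rightarrow> (nat \<times> nat set \<Rightarrow> 'a::field) set" where
  "cone i J = {pvec {i..m} l g |l g. det (mat n n g) \<noteq> 0 \<and> col_bounded n J (k i) g}"

lemma mp_point_Xc_iff:
  assumes "w \<in> mp_coords (flag_basis n k) {i..m}"
  shows "mp_point {i..m} w \<in> Xc i J \<longleftrightarrow> (\<exists>l g. (\<forall>j\<in>{i..m}. l j \<noteq> 0) \<and> w = pvec {i..m} l g \<and>
     det (mat n n g) \<noteq> 0 \<and> col_bounded n J (k i) g)"
  unfolding Xc_def using mp_point_eq_pvec[OF assms] by blast

lemma multicone_Xc:
  assumes "i \<in> {1..m}"
  shows "multicone (flag_basis n k) {i..m} (Xc i J) = (cone i J :: (nat \<times> nat set \<Rightarrow> 'a::field) set)"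
proof (rule equalityI; rule subsetI)
  fix v :: "nat \<times> nat set \<Rightarrow> 'a"
  assume "v \<in> multicone (flag_basis n k) {i..m} (Xc i J)"
  then obtain w where w: "v \<in> flag_space {i..m}" "w \<in> mp_coords (flag_basis n k) {i..m}"
    "\<forall>j\<in>{i..m}. curry v j \<in> line (curry w j)" "mp_point {i..m} w \<in> Xc i J"
    by (auto simp: multicone_def)
  then obtain l g where g: "w = pvec {i..m} l g" "det (mat n n g) \<noteq> 0" "col_bounded n J (k i) g"
    using mp_point_Xc_iff[OF w(2)] by blast
  have "\<forall>j\<in>{i..m}. \<exists>c. curry v j = (\<lambda>b. c * curry w j b)" using w(3) by (auto simp: line_def)
  then obtain c where c: "\<forall>j\<in>{i..m}. curry v j = (\<lambda>b. c j * curry w j b)" by metis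
  have "v = pvec {i..m} (\<lambda>j. c j * l j) g"
  proof
    fix x :: "nat \<times> nat set"
    obtain j L where x: "x = (j, L)" by (cases x)
    show "v x = pvec {i..m} (\<lambda>j. c j * l j) g x"
    proof (cases "x \<in> Sigma {i..m} (flag_basis n k)")
      case True
      then have "curry v j L = c j * curry w j L" using c x by auto
      then show ?thesis using True x g(1) by (simp add: pvec_def)
    next
      case False
      then have "v x = 0" using w(1) unfolding affine_space_def by blast
      then show ?thesis using False x by (auto simp: pvec_def)
    qed
  qed
  then show "v \<in> cone i J" using g(2,3) unfolding cone_def by blast
next
  fix v :: "nat \<times> nat set \<Rightarrow> 'a"
  assume "v \<in> cone i J"
  then obtain l g where g: "v = pvec {i..m} l g" "det (mat n n g) \<noteq> 0" "col_bounded n J (k i) g"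
    unfolding cone_def by blast
  let ?w = "pvec {i..m} (\<lambda>_. 1) g"
  have "?w \<in> mp_coords (flag_basis n k) {i..m}" using assms g(2) by (intro pvec_mp_coords) auto
  moreover have "mp_point {i..m} ?w \<in> Xc i J" using g unfolding Xc_def by blast
  moreover have "curry v j \<in> line (curry ?w j)" if "j \<in> {i..m}" for j
  proof -
    have "curry v j = (\<lambda>b. l j * curry ?w j b)" using that by (auto simp: g(1) pvec_def fun_eq_iff)
    then show ?thesis unfolding line_def by (rule range_eqI)
  qed
  ultimately show "v \<in> multicone (flag_basis n k) {i..m} (Xc i J)"
    using pvec_flag_space[of "{i..m}" l g] unfolding multicone_def g(1)
    by (intro CollectI conjI bexI[of _ ?w] ballI)
qed

lemma cone_mono:
  assumes "L \<sqsubseteq> J" "L \<in> ext_basis n (k j)" "J \<in> ext_basis n (k i)" "i \<in> {1..m}" "j \<in> {1..m}"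
  shows "cone j L \<subseteq> (cone i J :: (nat \<times> nat set \<Rightarrow> 'a::field) set)"
proof
  fix v :: "nat \<times> nat set \<Rightarrow> 'a"
  assume "v \<in> cone j L"
  then obtain l g where g: "v = pvec {j..m} l g" "det (mat n n g) \<noteq> 0" "col_bounded n L (k j) g"
    unfolding cone_def by blast
  have "k i \<le> k j" using subset_le_card[OF assms(1)] ext_basisD(1,2)[OF assms(2)] ext_basisD(1,2)[OF assms(3)]
    by simp
  then have "i \<le> j" using k_inj assms(4,5) by blast
  \<comment> \<open>The levels from \<open>i\<close> to \<open>j - 1\<close>, absent in
    \<open>cone j L\<close>, receive the scalar 0.\<close>
  then have "v = pvec {i..m} (\<lambda>x. if x \<in> {j..m} then l x else 0) g"
    by (auto simp: g(1) pvec_def fun_eq_iff)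
  moreover have "col_bounded n J (k i) g" by (rule col_bounded_mono[OF g(3) assms(1-3)])
  ultimately show "v \<in> cone i J" using g(2) unfolding cone_def by blast
qed

lemma cone_coordD:
  assumes "v \<in> cone i J" "v (j, L) \<noteq> 0" "J \<in> ext_basis n (k i)" "i \<in> {1..m}"
  shows "j \<in> {i..m}" "L \<in> ext_basis n (k j)" "L \<sqsubseteq> J"
proof -
  obtain l g where g: "v = pvec {i..m} l g" "det (mat n n g) \<noteq> 0" "col_bounded n J (k i) g"
    using assms(1) unfolding cone_def by blast
  note * = pvec_nonzeroD[OF assms(2)[unfolded g(1)]]
  then show j: "j \<in> {i..m}" and L: "L \<in> ext_basis n (k j)" by auto
  have "k i \<le> k j" using k_le[of i j] j assms(4) by auto
  then show "L \<sqsubseteq> J" using col_bounded_minor[OF g(3) assms(3) _ L] * by blast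
qed

lemma ex_perm_flag:
  assumes "J \<in> ext_basis n l"
  shows "\<exists>g :: nat \<times> nat \<Rightarrow> 'a::field. det (mat n n g) \<noteq> 0 \<and> col_bounded n J l g \<and> minor J g l \<noteq> 0"
proof -
  note J = ext_basisD[OF assms]
  obtain \<sigma> where \<sigma>: "\<sigma> permutes {..<n}" "\<sigma> ` {..<l} = J" "\<forall>a<l. \<sigma> a = pick J a"
    using ex_permutation[OF J(1,2)] by blast
  have "l \<le> n" using J(1,2) card_mono[of "{..<n}" J] by simp
  then have "minor J (perm_matrix \<sigma> :: nat \<times> nat \<Rightarrow> 'a) l \<noteq> 0"
    using minor_perm_matrix[OF \<sigma>(1), of l, where ?'a = 'a] \<sigma>(2) by blast
  moreover have "col_bounded n J l (perm_matrix \<sigma> :: nat \<times> nat \<Rightarrow> 'a)"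
    using \<sigma>(3) by (auto simp: col_bounded_def perm_matrix_def)
  ultimately show ?thesis
    using det_perm_matrix[OF \<sigma>(1)] by (intro exI[of _ "perm_matrix \<sigma>"]) simp
qed

lemma cone_generic:
  assumes "J \<in> ext_basis n (k i)" "i \<in> {1..m}"
  shows "\<exists>v\<in>cone i J. v (i, J) = (1 :: 'a::field)"
proof -
  obtain g :: "nat \<times> nat \<Rightarrow> 'a" where g: "det (mat n n g) \<noteq> 0" "col_bounded n J (k i) g" "minor J g (k i) \<noteq> 0"
    using ex_perm_flag[OF assms(1)] by blast
  then have "pvec {i..m} (\<lambda>_. 1 / minor J g (k i)) g \<in> cone i J" unfolding cone_def by blast
  moreover have "pvec {i..m} (\<lambda>_. 1 / minor J g (k i)) g (i, J) = 1"
    using g(3) assms by (simp add: pvec_apply)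
  ultimately show ?thesis by blast
qed

lemma cone_subset_iff:
  assumes "L \<in> ext_basis n (k j)" "J \<in> ext_basis n (k i)" "i \<in> {1..m}" "j \<in> {1..m}"
  shows "cone j L \<subseteq> (cone i J :: (nat \<times> nat set \<Rightarrow> 'a::field) set) \<longleftrightarrow> L \<sqsubseteq> J"
proof
  assume sub: "cone j L \<subseteq> (cone i J :: (nat \<times> nat set \<Rightarrow> 'a::field) set)"
  obtain v :: "nat \<times> nat set \<Rightarrow> 'a" where "v \<in> cone j L" "v (j, L) = 1"
    using cone_generic[OF assms(1,4)] by blast
  then show "L \<sqsubseteq> J" using cone_coordD(3)[of v i J j L] sub assms by auto
qed (use cone_mono assms in blast)

lemma zero_in_cone:
  assumes "J \<in> ext_basis n (k i)"
  shows "0 \<in> (cone i J :: (nat \<times> nat set \<Rightarrow> 'a::field) set)"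
proof -
  obtain g :: "nat \<times> nat \<Rightarrow> 'a" where g: "det (mat n n g) \<noteq> 0" "col_bounded n J (k i) g"
    using ex_perm_flag[OF assms(1)] by blast
  moreover have "pvec {i..m} (\<lambda>_. 0) g = 0" by (auto simp: pvec_def fun_eq_iff)
  ultimately show ?thesis unfolding cone_def by force
qed

text \<open>Levels below the first non-zero scalar leave no trace in \<open>v\<close>, so the first
  \<open>k j\<close> columns may be mixed freely; their pivot rows give \<open>P\<close>.\<close>

lemma cone_type:
  assumes "v \<in> cone i J" "v \<noteq> 0" "i \<in> {1..m}"
  shows "\<exists>j P. j \<in> {i..m} \<and> P \<in> ext_basis n (k j) \<and> v (j, P) \<noteq> 0 \<and> v \<in> cone j P"
proof -
  obtain l g where g: "v = pvec {i..m} l g" "det (mat n n g) \<noteq> 0" "col_bounded n J (k i) g"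
    using assms(1) unfolding cone_def by blast
  have "\<exists>j. j \<in> {i..m} \<and> l j \<noteq> 0"
  proof (rule ccontr)
    assume "\<not> ?thesis"
    then have "v = 0" by (auto simp: g(1) pvec_def fun_eq_iff)
    then show False using assms(2) by simp
  qed
  define j where "j = (LEAST j. j \<in> {i..m} \<and> l j \<noteq> 0)"
  have j: "j \<in> {i..m}" "l j \<noteq> 0" using LeastI_ex[OF \<open>\<exists>j. _\<close>] by (auto simp: j_def)
  have below: "l x = 0" if "x \<in> {i..m}" "x < j" for x
    using not_less_Least[of x "\<lambda>j. j \<in> {i..m} \<and> l j \<noteq> 0"] that by (auto simp: j_def)
  have "k j \<le> n" using k_le_n[of j] j assms(3) by auto
  then obtain P h s where P: "P \<in> ext_basis n (k j)" "minor P g (k j) \<noteq> 0" "det (mat n n h) \<noteq> 0"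
    "col_bounded n P (k j) h" "s \<noteq> 0" "\<forall>e l'. k j \<le> l' \<longrightarrow> l' \<le> n \<longrightarrow> mdet e h l' = s * mdet e g l'"
    using column_type[OF g(2)] by metis
  have "v = pvec {j..m} (\<lambda>x. l x / s) h"
  proof
    fix x :: "nat \<times> nat set"
    obtain j' L where x: "x = (j', L)" by (cases x)
    show "v x = pvec {j..m} (\<lambda>x. l x / s) h x"
    proof (cases "j' \<in> {j..m}")
      case True
      then have "k j \<le> k j'" "k j' \<le> n" "j' \<in> {i..m}" using k_le[of j j'] k_le_n[of j'] j assms(3) by auto
      then show ?thesis using True P(5,6) by (simp add: g(1) x pvec_def)
    next
      case False
      then show ?thesis using below[of j'] by (auto simp: g(1) x pvec_def)
    qed
  qed
  then have "v \<in> cone j P" using P(3,4) unfolding cone_def by blast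
  moreover have "v (j, P) \<noteq> 0" using j P(1,2) by (simp add: g(1) pvec_apply)
  ultimately show ?thesis using j(1) P(1) by blast
qed

text \<open>The index \<open>P\<close> supplied by \<open>cone_type\<close> belongs to a non-zero
  coordinate, so \<open>coord\<close> applies to it and \<open>cone_mono\<close> finishes. Hence a
  cone inside a larger one is cut out by coordinate functions.\<close>

lemma cone_memI:
  assumes v: "v \<in> cone i J" and i: "i \<in> {1..m}" "i' \<in> {1..m}" and J': "J' \<in> ext_basis n (k i')"
    and coord: "\<And>j L. v (j, L) \<noteq> 0 \<Longrightarrow> L \<sqsubseteq> J'"
  shows "v \<in> cone i' J'"
proof (cases "v = 0")
  case True
  then show ?thesis using zero_in_cone[OF J'] by simp
next
  case False
  then obtain j P where P: "j \<in> {i..m}" "P \<in> ext_basis n (k j)" "v (j, P) \<noteq> 0" "v \<in> cone j P"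
    using cone_type[OF v _ i(1)] by blast
  have "cone j P \<subseteq> (cone i' J' :: (nat \<times> nat set \<Rightarrow> 'a) set)"
    using P coord[OF P(3)] J' i by (intro cone_mono) auto
  then show ?thesis using P(4) by blast
qed

lemma cone_flag_space:
  assumes "i \<in> {1..m}"
  shows "cone i J \<subseteq> flag_space {1..m}"
  using assms by (auto simp: cone_def pvec_def affine_space_def)

lemma irreducible_cone:
  assumes i: "i \<in> {1..m}" and J: "J \<in> ext_basis n (k i)" and i': "i' \<in> {1..m}" "J' \<in> ext_basis n (k i')"
    and sub: "(cone i J :: (nat \<times> nat set \<Rightarrow> 'a::field_char_0) set) \<subseteq> cone i' J'"
  shows "irreducible_closedin (subtopology (zariski_affine (Sigma {1..m} (flag_basis n k))) (cone i' J'))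
     (cone i J :: (nat \<times> nat set \<Rightarrow> 'a) set)"
proof -
  \<comment> \<open>Parameters: one scalar for each level (\<open>Inl\<close>) and the matrix
    entries that the column bounds leave free (\<open>Inr\<close>).\<close>
  define W where "W = Inl ` {i..m} \<union> Inr ` {(r, a). r < n \<and> a < n \<and> (a < k i \<longrightarrow> r \<le> pick J a)}"
  define h where "h = (\<lambda>x :: nat + nat \<times> nat \<Rightarrow> 'a. det (mat n n (\<lambda>p. x (Inr p))))"
  define U where "U = {x \<in> affine_space W. h x \<noteq> 0}"
  define \<Phi> where "\<Phi> = (\<lambda>x :: nat + nat \<times> nat \<Rightarrow> 'a. pvec {i..m} (\<lambda>j. x (Inl j)) (\<lambda>p. x (Inr p)))"
  have ki: "k i \<le> n" using k_le_n i by auto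
  have entry: "(\<lambda>x :: nat + nat \<times> nat \<Rightarrow> 'a. x (Inr p)) \<in> polyfun UNIV" for p by (rule polyfun_var) simp
  have img: "\<Phi> ` U = cone i J"
  proof (intro equalityI subsetI)
    fix v assume "v \<in> \<Phi> ` U"
    then obtain x where x: "v = \<Phi> x" "x \<in> affine_space W" "h x \<noteq> 0" by (auto simp: U_def)
    have "col_bounded n J (k i) (\<lambda>p. x (Inr p))"
      unfolding col_bounded_def
    proof (intro allI impI)
      fix a r assume "a < k i" "r < n" "pick J a < r"
      then have "Inr (r, a) \<notin> W" by (auto simp: W_def)
      then show "x (Inr (r, a)) = 0" using x(2) by (auto simp: affine_space_def)
    qed
    then show "v \<in> cone i J" using x unfolding cone_def \<Phi>_def h_def by blast
  next
    fix v :: "nat \<times> nat set \<Rightarrow> 'a" assume "v \<in> cone i J"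
    then obtain l g where g: "v = pvec {i..m} l g" "det (mat n n g) \<noteq> 0" "col_bounded n J (k i) g"
      unfolding cone_def by blast
    define x where "x = (\<lambda>w. case w of Inl j \<Rightarrow> if j \<in> {i..m} then l j else 0
      | Inr p \<Rightarrow> if p \<in> {..<n} \<times> {..<n} then g p else 0)"
    have xW: "x \<in> affine_space W"
      unfolding affine_space_def
    proof (intro CollectI allI impI)
      fix w assume "w \<notin> W"
      then show "x w = 0"
      proof (cases w)
        case (Inl j)
        then show ?thesis using \<open>w \<notin> W\<close> by (auto simp: x_def W_def)
      next
        case (Inr p)
        obtain r a where p: "p = (r, a)" by (cases p)
        have "\<not> (r < n \<and> a < n \<and> (a < k i \<longrightarrow> r \<le> pick J a))"
          using \<open>w \<notin> W\<close> Inr p by (auto simp: W_def)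
        then show ?thesis using g(3) Inr p by (auto simp: x_def col_bounded_def)
      qed
    qed
    have "mat n n (\<lambda>p. x (Inr p)) = mat n n g" by (intro eq_matI) (auto simp: x_def)
    then have "x \<in> U" using xW g(2) by (simp add: U_def h_def)
    moreover have "\<Phi> x = v"
    proof -
      have "minor L (\<lambda>p. x (Inr p)) (k j) = minor L g (k j)" if "j \<in> {i..m}" "L \<in> ext_basis n (k j)" for j L
        using ext_basisD(4)[OF that(2)] k_le_n[of j] that(1) i by (intro mdet_cong) (auto simp: x_def)
      then show ?thesis unfolding \<Phi>_def g(1) by (intro pvec_cong) (auto simp: x_def)
    qed
    ultimately show "v \<in> \<Phi> ` U" by blast
  qed
  have "irreducible_closedin (subtopology (zariski_affine (Sigma {1..m} (flag_basis n k))) (cone i' J')) (\<Phi> ` U)"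
  proof (rule irreducible_affine_image[OF _ U_def, where V = UNIV])
    show "h \<in> polyfun UNIV" unfolding h_def by (rule polyfun_det) (rule entry)
    show "U \<noteq> {}" using zero_in_cone[OF J, where ?'a = 'a] img by blast
    show "(\<lambda>x. \<Phi> x v) \<in> polyfun UNIV" for v
    proof (cases "v \<in> Sigma {i..m} (flag_basis n k)")
      case True
      have "(\<lambda>x :: nat + nat \<times> nat \<Rightarrow> 'a. x (Inl (fst v)) * minor (snd v) (\<lambda>p. x (Inr p)) (k (fst v))) \<in> polyfun UNIV"
        by (intro polyfun_mult polyfun_var mdet_polyfun entry) simp
      moreover have "(\<lambda>x. \<Phi> x v) = (\<lambda>x. x (Inl (fst v)) * minor (snd v) (\<lambda>p. x (Inr p)) (k (fst v)))"
        using True by (auto simp: \<Phi>_def pvec_def)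
      ultimately show ?thesis by simp
    next
      case False
      then have "(\<lambda>x. \<Phi> x v) = (\<lambda>_. 0)" by (cases v) (auto simp: \<Phi>_def pvec_def)
      then show ?thesis by (simp add: polyfun_const)
    qed
    define F :: "((nat \<times> nat set \<Rightarrow> 'a) \<Rightarrow> 'a) set" where
      "F = (\<lambda>(j, L) v. v (j, L)) ` {(j, L). (j, L) \<in> Sigma {1..m} (flag_basis n k) \<and> \<not> L \<sqsubseteq> J}"
    have "cone i J = {v \<in> cone i' J'. \<forall>f\<in>F. f v = 0}"
    proof (intro equalityI subsetI CollectI conjI ballI)
      fix v :: "nat \<times> nat set \<Rightarrow> 'a" and f assume v: "v \<in> cone i J" and f: "f \<in> F"
      then obtain j L where "f = (\<lambda>v. v (j, L))" "\<not> L \<sqsubseteq> J" by (auto simp: F_def)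
      then show "f v = 0" using cone_coordD(3)[OF v _ J i] by auto
    next
      fix v :: "nat \<times> nat set \<Rightarrow> 'a" assume "v \<in> {v \<in> cone i' J'. \<forall>f\<in>F. f v = 0}"
      then have v: "v \<in> cone i' J'" "\<And>f. f \<in> F \<Longrightarrow> f v = 0" by auto
      show "v \<in> cone i J"
      proof (rule cone_memI[OF v(1) i'(1) i J], rule ccontr)
        fix j L assume nz: "v (j, L) \<noteq> 0" and "\<not> L \<sqsubseteq> J"
        moreover have "(j, L) \<in> Sigma {1..m} (flag_basis n k)"
          using cone_coordD[OF v(1) nz i'(2,1)] i'(1) by (auto simp: mem_flag_basis)
        ultimately have "(\<lambda>v. v (j, L)) \<in> F" unfolding F_def by (intro image_eqI[of _ _ "(j, L)"]) auto
        then show False using v(2) nz by blast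
      qed
    qed (use sub in auto)
    then show "closedin (subtopology (zariski_affine (Sigma {1..m} (flag_basis n k))) (cone i' J')) (\<Phi> ` U)"
      unfolding img using cone_flag_space[OF i'(1), of J']
      by (intro closedin_zariski_subtopologyI[where F = F]) (auto simp: F_def intro!: polyfun_var)
  qed
  then show ?thesis unfolding img .
qed

end

section \<open>Affine charts\<close>

text \<open>The factor that comes from sorting the rows. It is obtained by choice because later
  proofs only use that it is non-zero and the same for all \<open>g\<close>.\<close>

definition msign :: "(nat \<Rightarrow> nat) \<Rightarrow> nat \<Rightarrow> 'a::field" where
  "msign e l = (SOME s. s \<noteq> 0 \<and> (\<forall>g :: nat \<times> nat \<Rightarrow> 'a. mdet e g l = s * minor (e ` {..<l}) g l))"

lemma msign:
  assumes "inj_on e {..<l}"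
  shows "(msign e l :: 'a::field) \<noteq> 0"
    "mdet e (g :: nat \<times> nat \<Rightarrow> 'a) l = msign e l * minor (e ` {..<l}) g l"
proof -
  have "(msign e l :: 'a) \<noteq> 0 \<and> (\<forall>g :: nat \<times> nat \<Rightarrow> 'a. mdet e g l = msign e l * minor (e ` {..<l}) g l)"
    unfolding msign_def by (rule someI_ex, rule mdet_minor[OF assms refl])
  then show "(msign e l :: 'a::field) \<noteq> 0"
    "mdet e (g :: nat \<times> nat \<Rightarrow> 'a) l = msign e l * minor (e ` {..<l}) g l" by auto
qed

context flag_data
begin

text \<open>If \<open>b\<close> is the index of a column, \<open>step i b\<close> is the index \<open>j \<ge> i\<close> of the smallest member of the flag
  to which this column contributes.\<close>

definition step :: "nat \<Rightarrow> nat \<Rightarrow> nat" where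
  "step i b = (LEAST j. i \<le> j \<and> b < k j)"

lemma step:
  assumes "i \<in> {1..m}" "b < k m"
  shows "step i b \<in> {i..m}" "b < k (step i b)"
proof -
  have "i \<le> m \<and> b < k m" using assms by auto
  then have "i \<le> step i b \<and> b < k (step i b)" "step i b \<le> m"
    unfolding step_def by (rule LeastI) (use \<open>i \<le> m \<and> b < k m\<close> in \<open>auto intro: Least_le\<close>)
  then show "step i b \<in> {i..m}" "b < k (step i b)" by auto
qed

lemma step_le:
  assumes "j \<in> {i..m}" "i \<in> {1..m}" "b < k j"
  shows "step i b \<le> j" "k (step i b) \<le> k j" "b < k m"
proof -
  show "step i b \<le> j" unfolding step_def using assms by (intro Least_le) auto
  show b: "b < k m" using assms k_le[of j m] by auto
  show "k (step i b) \<le> k j" using \<open>step i b \<le> j\<close> step(1)[OF assms(2) b] assms by (intro k_le) auto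
qed

lemma step_first:
  assumes "i \<in> {1..m}" "b < k i"
  shows "step i b = i"
  using step_le[of i i b] step(1)[OF assms(1), of b] assms by auto

text \<open>Indices count rows after the permutation: \<open>(a, b)\<close> refers to the entry in
  row \<open>\<sigma> a\<close> of the matrix.\<close>

definition free_entries :: "nat \<Rightarrow> (nat \<times> nat) set" where
  "free_entries i = {(a, b). b < k m \<and> k (step i b) \<le> a \<and> a < n}"

lemma finite_free_entries: "finite (free_entries i)"
  by (rule finite_subset[of _ "{..<n} \<times> {..<k m}"]) (auto simp: free_entries_def)

text \<open>Flags in the chart around the permutation flag of \<open>\<sigma>\<close> have a unique basis whose matrix, after
  permuting the rows by \<open>\<sigma>\<close>, is block lower triangular with identity matrices on the diagonal.\<close>

definition chart_matrix ::
    "(nat \<Rightarrow> nat) \<Rightarrow> (nat \<times> nat) set \<Rightarrow> (nat \<times> nat \<Rightarrow> 'a::comm_ring_1) \<Rightarrow> nat \<times> nat \<Rightarrow> 'a" where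
  "chart_matrix \<sigma> T x = (\<lambda>(r, b). if (inv_into UNIV \<sigma> r, b) \<in> T then x (inv_into UNIV \<sigma> r, b)
     else if r = \<sigma> b then 1 else 0)"

lemma chart_matrix_apply:
  assumes "\<sigma> permutes {..<n}"
  shows "chart_matrix \<sigma> T x (\<sigma> a, b) = (if (a, b) \<in> T then x (a, b) else if a = b then 1 else 0)"
proof -
  have "inv_into UNIV \<sigma> (\<sigma> a) = a" "\<sigma> a = \<sigma> b \<longleftrightarrow> a = b"
    using permutes_inverses(2)[OF assms] permutes_inj[OF assms] by (auto dest: injD)
  then show ?thesis by (simp add: chart_matrix_def)
qed

lemma chart_matrix_polyfun:
  assumes "T \<subseteq> W"
  shows "(\<lambda>x :: nat \<times> nat \<Rightarrow> 'a::comm_ring_1. chart_matrix \<sigma> T x p) \<in> polyfun W"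
proof (cases "(inv_into UNIV \<sigma> (fst p), snd p) \<in> T")
  case True
  then have "(\<lambda>x :: nat \<times> nat \<Rightarrow> 'a. chart_matrix \<sigma> T x p) = (\<lambda>x. x (inv_into UNIV \<sigma> (fst p), snd p))"
    by (auto simp: chart_matrix_def case_prod_beta)
  moreover have "(inv_into UNIV \<sigma> (fst p), snd p) \<in> W" using True assms by blast
  ultimately show ?thesis by (simp only: polyfun_var)
next
  case False
  then have "(\<lambda>x :: nat \<times> nat \<Rightarrow> 'a. chart_matrix \<sigma> T x p) = (\<lambda>x. if fst p = \<sigma> (snd p) then 1 else 0)"
    by (auto simp: chart_matrix_def case_prod_beta)
  then show ?thesis by (simp add: polyfun_const)
qed

context
  fixes i :: nat and \<sigma> :: "nat \<Rightarrow> nat" and T :: "(nat \<times> nat) set"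
  assumes i: "i \<in> {1..m}" and \<sigma>: "\<sigma> permutes {..<n}" and T: "T \<subseteq> free_entries i"
begin

lemma free_lower: "(a, b) \<in> T \<Longrightarrow> b < a"
  using T step(2)[OF i, of b] by (auto simp: free_entries_def)

lemma free_diag: "(a, a) \<notin> T"
  using free_lower[of a a] by auto

lemma mdet_chart_matrix: "mdet \<sigma> (chart_matrix \<sigma> T x) l = 1"
proof -
  have "det (mat l l (\<lambda>(a, b). chart_matrix \<sigma> T x (\<sigma> a, b))) =
     (\<Prod>a<l. (\<lambda>(a, b). chart_matrix \<sigma> T x (\<sigma> a, b)) (a, a))"
    by (rule det_rank[of id]) (use free_lower in \<open>fastforce simp: chart_matrix_apply[OF \<sigma>]\<close>)+
  then show ?thesis unfolding mdet_def by (simp add: chart_matrix_apply[OF \<sigma>] free_diag)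
qed

lemma det_chart_matrix:
  fixes x :: "nat \<times> nat \<Rightarrow> 'a::field"
  shows "det (mat n n (chart_matrix \<sigma> T x)) \<noteq> 0"
proof -
  have "bij_betw \<sigma> {..<n} {..<n}" "bij_betw id {..<n} {..<n}" using permutes_imp_bij[OF \<sigma>] by auto
  from mdet_reorder[OF this, where ?'a = 'a] obtain s :: 'a
    where "mdet \<sigma> (chart_matrix \<sigma> T x) n = s * mdet id (chart_matrix \<sigma> T x) n" by metis
  then show ?thesis using mdet_chart_matrix[of x n] by (auto simp: mdet_id)
qed

text \<open>Only the row \<open>b\<close> of this minor is not a row of an identity block, so that it is the entry in column
  \<open>b\<close> of this row.\<close>

lemma mdet_chart_matrix_entry:
  assumes "(a, b) \<in> free_entries i"
  shows "mdet (\<sigma>(b := \<sigma> a)) (chart_matrix \<sigma> T x) (k (step i b)) = (if (a, b) \<in> T then x (a, b) else 0)"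
proof -
  let ?l = "k (step i b)" and ?e = "\<sigma>(b := \<sigma> a)"
  let ?A = "\<lambda>(c, d). chart_matrix \<sigma> T x (?e c, d)"
  have b: "b < ?l" "?l \<le> a" "b < k m" using assms step(2)[OF i, of b] by (auto simp: free_entries_def)
  have "det (mat ?l ?l ?A) = (\<Prod>c<?l. ?A (c, c))"
  \<comment> \<open>Ranking \<open>b\<close> above all other indices makes the matrix triangular:
    the other rows are unipotent lower triangular with zeros in column \<open>b\<close>, and the
    diagonal entry at \<open>b\<close> is the wanted one.\<close>
  proof (rule det_rank[of "id(b := ?l)"])
    show "inj_on (id(b := ?l)) {..<?l}" by (auto simp: inj_on_def)
    fix c d assume cd: "c < ?l" "d < ?l" "(id(b := ?l)) c < (id(b := ?l)) d"
    then have c: "c \<noteq> b" by (auto split: if_splits)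
    have "(c, d) \<notin> T \<and> c \<noteq> d"
    proof (cases "d = b")
      case True
      then show ?thesis using T c cd(1) by (auto simp: free_entries_def)
    next
      case False
      then show ?thesis using cd(3) c free_lower[of c d] by (auto simp: id_def)
    qed
    then show "?A (c, d) = 0" using c by (simp add: chart_matrix_apply[OF \<sigma>])
  qed
  also have "\<dots> = (\<Prod>c<?l. if c = b then (if (a, b) \<in> T then x (a, b) else 0) else 1)"
    using b free_diag by (intro prod.cong refl) (auto simp: chart_matrix_apply[OF \<sigma>])
  also have "\<dots> = (if (a, b) \<in> T then x (a, b) else 0)" using b(1) by (subst prod.delta) auto
  finally show ?thesis by (simp add: mdet_def)
qed

end

text \<open>Column \<open>b\<close> of \<open>q\<close> is column \<open>b\<close> of the inverse of
  the leading block of size \<open>k (step i b)\<close>, with rows taken in the order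
  \<open>\<sigma>\<close>. This normalizes all blocks at once, and since \<open>q\<close> is block
  upper triangular, each level changes by one scalar.\<close>

lemma chart_matrix_normalize:
  fixes g :: "nat \<times> nat \<Rightarrow> 'a::field"
  assumes i: "i \<in> {1..m}" and \<sigma>: "\<sigma> permutes {..<n}"
    and g: "\<And>j. j \<in> {i..m} \<Longrightarrow> mdet \<sigma> g (k j) \<noteq> 0"
  shows "\<exists>x s. \<forall>j\<in>{i..m}. s j \<noteq> 0 \<and> (\<forall>e. (\<forall>a<k j. e a < n) \<longrightarrow>
    mdet e (chart_matrix \<sigma> (free_entries i) x) (k j) = s j * mdet e g (k j))"
proof -
  define H where "H = (\<lambda>l. mat l l (\<lambda>(a, c). g (\<sigma> a, c)))"
  define q where "q = (\<lambda>(c, b). if b < k m then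
      (if c < k (step i b) then adj_mat (H (k (step i b))) $$ (c, b) / det (H (k (step i b))) else 0)
    else if c = b then 1 else 0)"
  define h where "h = gmul n g q"
  have h: "h (\<sigma> a, b) = (if a = b then 1 else 0)" if "b < k m" "a < k (step i b)" for a b
  proof -
    let ?l = "k (step i b)"
    have l: "?l \<le> n" "b < ?l" using step[OF i that(1)] k_le_n[of "step i b"] i by auto
    have H: "H ?l \<in> carrier_mat ?l ?l" by (simp add: H_def)
    have det: "det (H ?l) \<noteq> 0" using g[OF step(1)[OF i that(1)]] by (simp add: H_def mdet_def)
    have "h (\<sigma> a, b) = (\<Sum>c = 0..<?l. g (\<sigma> a, c) * q (c, b))"
      unfolding h_def gmul_def using that l
      by (simp, intro sum.mono_neutral_right) (auto simp: q_def)
    also have "\<dots> = (\<Sum>c = 0..<?l. H ?l $$ (a, c) * adj_mat (H ?l) $$ (c, b)) / det (H ?l)"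
      unfolding sum_divide_distrib using that by (intro sum.cong) (auto simp: q_def H_def)
    also have "(\<Sum>c = 0..<?l. H ?l $$ (a, c) * adj_mat (H ?l) $$ (c, b)) = (H ?l * adj_mat (H ?l)) $$ (a, b)"
      using that l H adj_mat(1)[OF H] by (simp add: scalar_prod_def)
    also have "\<dots> = (det (H ?l) \<cdot>\<^sub>m 1\<^sub>m ?l) $$ (a, b)" using adj_mat(2)[OF H] by simp
    also have "\<dots> / det (H ?l) = (if a = b then 1 else 0)" using that l det by simp
    finally show ?thesis .
  qed
  define x where "x = (\<lambda>(a, b). h (\<sigma> a, b))"
  let ?N = "chart_matrix \<sigma> (free_entries i) x"
  have N: "?N (r, b) = h (r, b)" if "r < n" "b < k m" for r b
  proof -
    have "r \<in> \<sigma> ` {..<n}" using permutes_image[OF \<sigma>] that by simp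
    then obtain a where a: "r = \<sigma> a" "a < n" by auto
    have "b < k (step i b)" using step(2)[OF i that(2)] .
    then show ?thesis using h[OF that(2), of a] a that(2)
      by (auto simp: chart_matrix_apply[OF \<sigma>] free_entries_def x_def)
  qed
  define s where "s = (\<lambda>j. det (mat (k j) (k j) q))"
  have main: "mdet e ?N (k j) = s j * mdet e g (k j)" if j: "j \<in> {i..m}" and e: "\<forall>a<k j. e a < n" for j e
  proof -
    have km': "k j \<le> k m" "k j \<le> n" using j i k_le[of j m] k_le_n[of j] by auto
    have "mdet e ?N (k j) = mdet e h (k j)" using N e km' by (intro mdet_cong) auto
    also have "\<dots> = mdet e g (k j) * s j"
      unfolding h_def s_def
    proof (rule mdet_gmul[OF km'(2)])
      fix a b assume "a < k j" "k j \<le> b" "b < n"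
      then show "q (b, a) = 0" using step_le[OF j i, of a] by (auto simp: q_def)
    qed
    finally show ?thesis by (simp add: mult.commute)
  qed
  \<comment> \<open>On the rows \<open>\<sigma>\<close> the chart matrix has minor 1, which exhibits
    \<open>s j\<close> as an inverse.\<close>
  have "s j \<noteq> 0" if j: "j \<in> {i..m}" for j
  proof -
    have "\<sigma> a < n" if "a < k j" for a
      using permutes_in_image[OF \<sigma>, of a] that k_le_n[of j] j i by auto
    then have "1 = s j * mdet \<sigma> g (k j)"
      using main[OF j, of \<sigma>] mdet_chart_matrix[OF i \<sigma> subset_refl, of x "k j"] by simp
    then show ?thesis by auto
  qed
  then show ?thesis using main by (intro exI[of _ x] exI[of _ s]) auto
qed

text \<open>An entry in a column \<open>b < k i\<close> is, up to a scalar, the Pluecker coordinate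
  obtained by exchanging \<open>\<sigma> b\<close> for \<open>\<sigma> a\<close>; on
  \<open>cone i J\<close> it can be non-zero only under this order relation. Later columns are
  unconstrained.\<close>

definition chart_set :: "nat \<Rightarrow> (nat \<Rightarrow> nat) \<Rightarrow> nat set \<Rightarrow> (nat \<times> nat) set" where
  "chart_set i \<sigma> J = {(a, b) \<in> free_entries i. b < k i \<longrightarrow>
     insert (\<sigma> a) (\<sigma> ` {..<k i} - {\<sigma> b}) \<sqsubseteq> J}"

lemma chart_set_subset: "chart_set i \<sigma> J \<subseteq> free_entries i"
  by (auto simp: chart_set_def)

lemma finite_chart_set: "finite (chart_set i \<sigma> J)"
  using finite_subset[OF chart_set_subset finite_free_entries] .

lemma swap_entry:
  assumes "\<sigma> permutes {..<n}" "b < l" "l \<le> a" "a < n"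
  shows "inj_on (\<sigma>(b := \<sigma> a)) {..<l}"
    "(\<sigma>(b := \<sigma> a)) ` {..<l} = insert (\<sigma> a) (\<sigma> ` {..<l} - {\<sigma> b})"
    "insert (\<sigma> a) (\<sigma> ` {..<l} - {\<sigma> b}) \<in> ext_basis n l"
proof -
  have inj: "\<sigma> c = \<sigma> d \<longleftrightarrow> c = d" for c d using permutes_inj[OF assms(1)] by (auto dest: injD)
  show 1: "inj_on (\<sigma>(b := \<sigma> a)) {..<l}" using assms by (auto simp: inj_on_def inj)
  show 2: "(\<sigma>(b := \<sigma> a)) ` {..<l} = insert (\<sigma> a) (\<sigma> ` {..<l} - {\<sigma> b})"
    using assms by (auto simp: inj image_iff)
  have "card (insert (\<sigma> a) (\<sigma> ` {..<l} - {\<sigma> b})) = l" using card_image[OF 1] unfolding 2 by simp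
  moreover have "\<sigma> c < n" if "c < n" for c using permutes_in_image[OF assms(1), of c] that by simp
  ultimately show "insert (\<sigma> a) (\<sigma> ` {..<l} - {\<sigma> b}) \<in> ext_basis n l"
    using assms by (auto simp: ext_basis_def)
qed

text \<open>The pivot set \<open>P\<close> of the first \<open>k i\<close> columns is itself the
  index of a non-zero coordinate, hence \<open>P \<sqsubseteq> J\<close>, and sorting by pivots
  produces the column bounds.\<close>

lemma cone_vanishI:
  fixes g :: "nat \<times> nat \<Rightarrow> 'a::field"
  assumes i: "i \<in> {1..m}" and J: "J \<in> ext_basis n (k i)" and det: "det (mat n n g) \<noteq> 0"
    and van: "\<And>L. L \<in> ext_basis n (k i) \<Longrightarrow> minor L g (k i) \<noteq> 0 \<Longrightarrow> L \<sqsubseteq> J"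
  shows "pvec {i..m} l g \<in> cone i J"
proof -
  have "k i \<le> n" using k_le_n[of i] i by auto
  then obtain P h s where P: "P \<in> ext_basis n (k i)" "minor P g (k i) \<noteq> 0" "det (mat n n h) \<noteq> 0"
    "col_bounded n P (k i) h" "s \<noteq> 0" "\<forall>e l'. k i \<le> l' \<longrightarrow> l' \<le> n \<longrightarrow> mdet e h l' = s * mdet e g l'"
    using column_type[OF det] by metis
  have "col_bounded n J (k i) h" by (rule col_bounded_mono[OF P(4) van[OF P(1,2)] P(1) J])
  moreover have "pvec {i..m} l g = pvec {i..m} (\<lambda>j. l j / s) h"
  proof (rule pvec_cong)
    fix j L assume "j \<in> {i..m}"
    then have "k i \<le> k j" "k j \<le> n" using k_le[of i j] k_le_n[of j] i by auto
    then show "l j * minor L g (k j) = l j / s * minor L h (k j)" using P(5,6) by simp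
  qed
  ultimately show ?thesis using P(3) unfolding cone_def by blast
qed

text \<open>After normalization, the entries outside \<open>chart_set\<close> are Pluecker
  coordinates that the order forces to vanish. This direction works in every chart; the converse is
  where \<open>near\<close> enters.\<close>

lemma cone_chart_matrix:
  fixes v :: "nat \<times> nat set \<Rightarrow> 'a::field"
  assumes i: "i \<in> {1..m}" and \<sigma>: "\<sigma> permutes {..<n}" and J: "J \<in> ext_basis n (k i)"
    and v: "v \<in> cone i J" "\<And>j. j \<in> {i..m} \<Longrightarrow> v (j, \<sigma> ` {..<k j}) \<noteq> 0"
  shows "\<exists>x l. v = pvec {i..m} l (chart_matrix \<sigma> (chart_set i \<sigma> J) x)"
proof -
  obtain l g where g: "v = pvec {i..m} l g" "det (mat n n g) \<noteq> 0" "col_bounded n J (k i) g"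
    using v(1) unfolding cone_def by blast
  have inj: "inj_on \<sigma> {..<c}" for c by (rule permutes_inj_on[OF \<sigma>])
  have nz: "mdet \<sigma> g (k j) \<noteq> 0 \<and> l j \<noteq> 0" if "j \<in> {i..m}" for j
    using v(2)[OF that] pvec_nonzeroD[of "{i..m}" l g j "\<sigma> ` {..<k j}"] msign[OF inj[of "k j"], where ?'a = 'a]
    by (simp add: g(1))
  have nz': "mdet \<sigma> g (k j) \<noteq> 0" if "j \<in> {i..m}" for j using nz[OF that] by simp
  have "\<exists>x s. \<forall>j\<in>{i..m}. s j \<noteq> 0 \<and> (\<forall>e. (\<forall>a<k j. e a < n) \<longrightarrow>
      mdet e (chart_matrix \<sigma> (free_entries i) x) (k j) = s j * mdet e g (k j))"
    by (rule chart_matrix_normalize[OF i \<sigma> nz'])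
  then obtain x s where xs0: "\<forall>j\<in>{i..m}. s j \<noteq> 0 \<and> (\<forall>e. (\<forall>a<k j. e a < n) \<longrightarrow>
      mdet e (chart_matrix \<sigma> (free_entries i) x) (k j) = s j * mdet e g (k j))"
    by (elim exE) (rule that)
  have xs: "\<And>j. j \<in> {i..m} \<Longrightarrow> s j \<noteq> 0"
    "\<And>j e. j \<in> {i..m} \<Longrightarrow> \<forall>a<k j. e a < n \<Longrightarrow>
      mdet e (chart_matrix \<sigma> (free_entries i) x) (k j) = s j * mdet e g (k j)"
    using xs0 by simp_all
  have zero: "x (a, b) = 0" if ab: "(a, b) \<in> free_entries i" "(a, b) \<notin> chart_set i \<sigma> J" for a b
  proof -
    have b: "b < k i" and nle: "\<not> insert (\<sigma> a) (\<sigma> ` {..<k i} - {\<sigma> b}) \<sqsubseteq> J"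
      using ab by (auto simp: chart_set_def)
    have st: "step i b = i" by (rule step_first[OF i b])
    have a: "k i \<le> a" "a < n" using ab(1) st by (auto simp: free_entries_def)
    note sw = swap_entry[OF \<sigma> b a]
    let ?L = "insert (\<sigma> a) (\<sigma> ` {..<k i} - {\<sigma> b})"
    have "v (i, ?L) = 0" using cone_coordD(3)[OF v(1) _ J i, of i ?L] nle by blast
    then have "minor ?L g (k i) = 0" using nz[of i] i sw(3) by (simp add: g(1) pvec_apply)
    then have "mdet (\<sigma>(b := \<sigma> a)) g (k i) = 0" using msign(2)[OF sw(1), of g] unfolding sw(2) by simp
    moreover have "(\<sigma>(b := \<sigma> a)) c < n" if "c < k i" for c
      using ext_basisD(1)[OF sw(3)] sw(2) that by blast
    then have "mdet (\<sigma>(b := \<sigma> a)) (chart_matrix \<sigma> (free_entries i) x) (k i) =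
        s i * mdet (\<sigma>(b := \<sigma> a)) g (k i)" using xs(2)[of i] i by auto
    ultimately show ?thesis
      using mdet_chart_matrix_entry[OF i \<sigma> subset_refl ab(1), of x] ab(1) by (simp add: st)
  qed
  have "chart_matrix \<sigma> (free_entries i) x = chart_matrix \<sigma> (chart_set i \<sigma> J) x"
  proof
    fix p :: "nat \<times> nat"
    obtain r b where p: "p = (r, b)" by (cases p)
    obtain a where r: "r = \<sigma> a" using permutes_surj[OF \<sigma>] by (auto dest: surjD)
    have "b < a" if "(a, b) \<in> free_entries i" using free_lower[OF i \<sigma> subset_refl that] .
    then show "chart_matrix \<sigma> (free_entries i) x p = chart_matrix \<sigma> (chart_set i \<sigma> J) x p"
      using zero[of a b] chart_set_subset[of i \<sigma> J] unfolding p r chart_matrix_apply[OF \<sigma>] by auto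
  qed
  then have "v = pvec {i..m} (\<lambda>j. l j / s j) (chart_matrix \<sigma> (chart_set i \<sigma> J) x)"
    unfolding g(1)
    by (intro pvec_cong) (use xs ext_basisD(4) in \<open>simp add: xs\<close>)
  then show ?thesis by blast
qed

text \<open>In these cases the part of \<open>Xc i J\<close> in the chart around a permutation flag \<open>\<sigma>\<close> with
  \<open>\<sigma> ` {..<k i} = M\<close> is a coordinate subspace of the chart.\<close>

definition near :: "nat set \<Rightarrow> nat set \<Rightarrow> bool" where
  "near M J \<longleftrightarrow> M = J \<or> (\<exists>t. t \<notin> J \<and> Suc t \<in> J \<and> M = insert t (J - {Suc t}))"

lemma chart_matrix_in_cone:
  fixes x :: "nat \<times> nat \<Rightarrow> 'a::field"
  assumes i: "i \<in> {1..m}" and \<sigma>: "\<sigma> permutes {..<n}" and J: "J \<in> ext_basis n (k i)"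
    and near: "near (\<sigma> ` {..<k i}) J"
  shows "pvec {i..m} l (chart_matrix \<sigma> (chart_set i \<sigma> J) x) \<in> cone i J"
proof (rule cone_vanishI[OF i J det_chart_matrix[OF i \<sigma> chart_set_subset]])
  fix L assume L: "L \<in> ext_basis n (k i)" "minor L (chart_matrix \<sigma> (chart_set i \<sigma> J) x) (k i) \<noteq> 0"
  let ?M = "\<sigma> ` {..<k i}"
  have inj: "inj_on \<sigma> {..<k i}" by (rule permutes_inj_on[OF \<sigma>])
  \<comment> \<open>\<open>\<beta> b\<close> will bound column \<open>b\<close>. It is
    \<open>\<sigma> b\<close>, except that in the lowered case \<open>t\<close> is raised to
    \<open>Suc t\<close>. The counts of \<open>J\<close> and the lowered set differ only at the
    threshold \<open>Suc t\<close>, which is never \<open>Suc (\<beta> b)\<close>.\<close>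
  have "\<exists>\<beta>. inj_on \<beta> {..<k i} \<and> \<beta> ` {..<k i} = J \<and>
     (\<forall>b<k i. \<sigma> b \<le> \<beta> b \<and> card (J \<inter> {..<Suc (\<beta> b)}) = card (?M \<inter> {..<Suc (\<beta> b)}))"
    using near unfolding near_def
  proof (elim disjE exE conjE)
    assume "?M = J"
    then show ?thesis using inj by (intro exI[of _ \<sigma>]) auto
  next
    fix t assume t: "t \<notin> J" "Suc t \<in> J" "?M = insert t (J - {Suc t})"
    define \<beta> where "\<beta> = (\<lambda>b. if \<sigma> b = t then Suc t else \<sigma> b)"
    have not: "\<sigma> b \<noteq> Suc t" if "b < k i" for b
    proof -
      have "\<sigma> b \<in> insert t (J - {Suc t})" using that t(3) by auto
      then show ?thesis by auto
    qed
    have "inj_on \<beta> {..<k i}"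
    proof (rule inj_onI)
      fix a b assume ab: "a \<in> {..<k i}" "b \<in> {..<k i}" "\<beta> a = \<beta> b"
      then have "\<sigma> a = \<sigma> b" using not[of a] not[of b] by (auto simp: \<beta>_def split: if_splits)
      then show "a = b" using inj_onD[OF inj] ab(1,2) by blast
    qed
    moreover have "\<beta> ` {..<k i} = (\<lambda>s. if s = t then Suc t else s) ` ?M" by (auto simp: \<beta>_def)
    then have "\<beta> ` {..<k i} = J" unfolding t(3) using t(1,2) by auto
    moreover have "card (J \<inter> {..<Suc (\<beta> b)}) = card (?M \<inter> {..<Suc (\<beta> b)})" for b
      unfolding t(3) using subset_le_lower[OF t(2) refl t(1), of "Suc (\<beta> b)"]
      by (auto simp: \<beta>_def split: if_splits)
    ultimately show ?thesis by (intro exI[of _ \<beta>]) (auto simp: \<beta>_def)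
  qed
  then obtain \<beta> where \<beta>: "inj_on \<beta> {..<k i}" "\<beta> ` {..<k i} = J"
    "\<forall>b<k i. \<sigma> b \<le> \<beta> b \<and> card (J \<inter> {..<Suc (\<beta> b)}) = card (?M \<inter> {..<Suc (\<beta> b)})" by blast
  note L' = ext_basisD[OF L(1)]
  have "pick L ` {..<k i} \<sqsubseteq> \<beta> ` {..<k i}"
  proof (rule mdet_bound_subset_le[where n = n, OF L(2) L'(5,4) \<beta>(1) order_refl])
    fix b r assume b: "b < k i" and r: "r < n" "\<beta> b < r"
    have "r \<in> \<sigma> ` {..<n}" using permutes_image[OF \<sigma>] r by simp
    then obtain a where a: "r = \<sigma> a" "a < n" by auto
    have ab: "a \<noteq> b" using \<beta>(3) b r(2) a by auto
    \<comment> \<open>Below the threshold \<open>Suc (\<beta> b)\<close> the exchange loses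
      \<open>\<sigma> b\<close> and gains nothing, so the count drops below that of
      \<open>J\<close>.\<close>
    have "(a, b) \<notin> chart_set i \<sigma> J"
    proof
      assume "(a, b) \<in> chart_set i \<sigma> J"
      then have le: "insert (\<sigma> a) (?M - {\<sigma> b}) \<sqsubseteq> J" using b by (auto simp: chart_set_def)
      let ?X = "{..<Suc (\<beta> b)}"
      have \<sigma>b: "\<sigma> b \<le> \<beta> b" using \<beta>(3) b by blast
      have "insert (\<sigma> a) (?M - {\<sigma> b}) \<inter> ?X = (?M \<inter> ?X) - {\<sigma> b}" using r(2) a by auto
      moreover have "\<sigma> b \<in> ?M \<inter> ?X" using b \<sigma>b by auto
      ultimately have "card (insert (\<sigma> a) (?M - {\<sigma> b}) \<inter> ?X) < card (?M \<inter> ?X)"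
        using card_Diff1_less[of "?M \<inter> ?X" "\<sigma> b"] by simp
      moreover have "card (J \<inter> ?X) = card (?M \<inter> ?X)" using \<beta>(3) b by blast
      ultimately show False using le[unfolded subset_le_def, rule_format, of "Suc (\<beta> b)"] by simp
    qed
    then show "chart_matrix \<sigma> (chart_set i \<sigma> J) x (r, b) = 0"
      using ab by (simp add: a(1) chart_matrix_apply[OF \<sigma>])
  qed
  then show "L \<sqsubseteq> J" using L'(6) \<beta>(2) by simp
qed

definition chart_map :: "nat \<Rightarrow> (nat \<Rightarrow> nat) \<Rightarrow> (nat \<times> nat) set \<Rightarrow> (nat \<times> nat \<Rightarrow> 'a::field) \<Rightarrow> nat \<times> nat set \<Rightarrow> 'a" where
  "chart_map i \<sigma> T x = pvec {i..m} (\<lambda>j. msign \<sigma> (k j)) (chart_matrix \<sigma> T x)"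

text \<open>The Pluecker coordinate from which the entry \<open>(a, b)\<close> is read off, up to
  the factor \<open>chart_coeff\<close>: one row is exchanged, at the lowest level that sees column
  \<open>b\<close>.\<close>

definition chart_index :: "nat \<Rightarrow> (nat \<Rightarrow> nat) \<Rightarrow> nat \<times> nat \<Rightarrow> nat \<times> nat set" where
  "chart_index i \<sigma> = (\<lambda>(a, b). (step i b, insert (\<sigma> a) (\<sigma> ` {..<k (step i b)} - {\<sigma> b})))"

definition chart_coeff :: "nat \<Rightarrow> (nat \<Rightarrow> nat) \<Rightarrow> nat \<times> nat \<Rightarrow> 'a::field" where
  "chart_coeff i \<sigma> = (\<lambda>(a, b). msign \<sigma> (k (step i b)) / msign (\<sigma>(b := \<sigma> a)) (k (step i b)))"

lemma minor_chart_matrix: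
  fixes x :: "nat \<times> nat \<Rightarrow> 'a::field"
  assumes "i \<in> {1..m}" "\<sigma> permutes {..<n}" "T \<subseteq> free_entries i"
  shows "minor (\<sigma> ` {..<l}) (chart_matrix \<sigma> T x) l = 1 / msign \<sigma> l"
  using msign(1)[OF permutes_inj_on[OF assms(2), of "{..<l}"], where ?'a = 'a]
    msign(2)[OF permutes_inj_on[OF assms(2), of "{..<l}"], of "chart_matrix \<sigma> T x"]
    mdet_chart_matrix[OF assms, of x l] by (simp add: field_simps)

lemma chart_map_diag:
  fixes x :: "nat \<times> nat \<Rightarrow> 'a::field"
  assumes "i \<in> {1..m}" "\<sigma> permutes {..<n}" "T \<subseteq> free_entries i" "j \<in> {i..m}"
  shows "chart_map i \<sigma> T x (j, \<sigma> ` {..<k j}) = 1"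
proof -
  have "\<sigma> ` {..<k j} \<in> ext_basis n (k j)"
    using assms(1,4) k_le_n[of j] by (intro ext_basis_image[OF assms(2)]) auto
  then show ?thesis
    using assms(4) msign(1)[OF permutes_inj_on[OF assms(2), of "{..<k j}"], where ?'a = 'a]
    by (simp add: chart_map_def pvec_apply minor_chart_matrix[OF assms(1-3)])
qed

lemma chart_index_mem:
  assumes "i \<in> {1..m}" "\<sigma> permutes {..<n}" "t \<in> free_entries i"
  shows "chart_index i \<sigma> t \<in> Sigma {i..m} (flag_basis n k)"
proof -
  obtain a b where t: "t = (a, b)" by (cases t)
  then have ab: "b < k m" "k (step i b) \<le> a" "a < n" using assms(3) by (auto simp: free_entries_def)
  show ?thesis
    using step[OF assms(1) ab(1)] swap_entry(3)[OF assms(2) step(2)[OF assms(1) ab(1)] ab(2,3)]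
    by (auto simp: t chart_index_def mem_flag_basis)
qed

lemma pvec_chart_index:
  fixes x :: "nat \<times> nat \<Rightarrow> 'a::field"
  assumes i: "i \<in> {1..m}" and \<sigma>: "\<sigma> permutes {..<n}" and T: "T \<subseteq> free_entries i" and t: "t \<in> T"
  shows "pvec {i..m} (\<lambda>j. l j * msign \<sigma> (k j)) (chart_matrix \<sigma> T x) (chart_index i \<sigma> t) =
     l (fst (chart_index i \<sigma> t)) * (chart_coeff i \<sigma> t * x t)"
    "(chart_coeff i \<sigma> t :: 'a) \<noteq> 0"
proof -
  obtain a b where ab: "t = (a, b)" by (cases t)
  then have f: "(a, b) \<in> free_entries i" using t T by auto
  then have b: "b < k m" "k (step i b) \<le> a" "a < n" by (auto simp: free_entries_def)
  note sw = swap_entry[OF \<sigma> step(2)[OF i b(1)] b(2,3)]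
  let ?l = "k (step i b)"
  have "mdet (\<sigma>(b := \<sigma> a)) (chart_matrix \<sigma> T x) ?l = x (a, b)"
    using mdet_chart_matrix_entry[OF i \<sigma> T f, of x] t ab by simp
  then have "minor (insert (\<sigma> a) (\<sigma> ` {..<?l} - {\<sigma> b})) (chart_matrix \<sigma> T x) ?l =
      x (a, b) / msign (\<sigma>(b := \<sigma> a)) ?l"
    using msign(1)[OF sw(1), where ?'a = 'a] msign(2)[OF sw(1), of "chart_matrix \<sigma> T x"] unfolding sw(2) by (simp add: field_simps)
  moreover have "(step i b, insert (\<sigma> a) (\<sigma> ` {..<?l} - {\<sigma> b})) \<in> Sigma {i..m} (flag_basis n k)"
    using chart_index_mem[OF i \<sigma> f] by (simp add: chart_index_def)
  ultimately show "pvec {i..m} (\<lambda>j. l j * msign \<sigma> (k j)) (chart_matrix \<sigma> T x) (chart_index i \<sigma> t) =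
     l (fst (chart_index i \<sigma> t)) * (chart_coeff i \<sigma> t * x t)"
    by (simp add: pvec_def ab chart_index_def chart_coeff_def)
  show "(chart_coeff i \<sigma> t :: 'a) \<noteq> 0"
    using msign(1)[OF sw(1), where ?'a = 'a] msign(1)[OF permutes_inj_on[OF \<sigma>, of "{..<?l}"], where ?'a = 'a]
    by (simp add: ab chart_coeff_def)
qed

lemma pvec_polyfun:
  assumes "\<And>p. (\<lambda>x. g x p) \<in> polyfun W" "\<And>j. (\<lambda>x. l x j) \<in> polyfun W"
  shows "(\<lambda>x. pvec I (l x) (g x) v) \<in> polyfun W"
proof (cases "v \<in> Sigma I (flag_basis n k)")
  case True
  have "(\<lambda>x. l x (fst v) * minor (snd v) (g x) (k (fst v))) \<in> polyfun W"
    by (intro polyfun_mult assms mdet_polyfun)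
  moreover have "(\<lambda>x. pvec I (l x) (g x) v) = (\<lambda>x. l x (fst v) * minor (snd v) (g x) (k (fst v)))"
    using True by (auto simp: pvec_def)
  ultimately show ?thesis by simp
next
  case False
  then have "(\<lambda>x. pvec I (l x) (g x) v) = (\<lambda>_. 0)" by (cases v) (auto simp: pvec_def)
  then show ?thesis by (simp add: polyfun_const)
qed

lemma chart_matrix_cong:
  assumes "\<And>t. t \<in> T \<Longrightarrow> x t = y t"
  shows "chart_matrix \<sigma> T x = chart_matrix \<sigma> T y"
  using assms by (auto simp: chart_matrix_def)

lemma chart_eq:
  assumes i: "i \<in> {1..m}" and \<sigma>: "\<sigma> permutes {..<n}" and J: "J \<in> ext_basis n (k i)"
    and near: "near (\<sigma> ` {..<k i}) J"
  shows "chart (flag_basis n k) {i..m} (\<lambda>j. \<sigma> ` {..<k j}) (Xc i J) =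
     (chart_map i \<sigma> (chart_set i \<sigma> J) ` affine_space (chart_set i \<sigma> J) :: (nat \<times> nat set \<Rightarrow> 'a::field) set)"
proof (rule equalityI; rule subsetI)
  fix v :: "nat \<times> nat set \<Rightarrow> 'a"
  assume "v \<in> chart (flag_basis n k) {i..m} (\<lambda>j. \<sigma> ` {..<k j}) (Xc i J)"
  then have v: "v \<in> cone i J" "\<And>j. j \<in> {i..m} \<Longrightarrow> v (j, \<sigma> ` {..<k j}) = 1"
    by (auto simp: chart_def multicone_Xc[OF i])
  obtain x l where x: "v = pvec {i..m} l (chart_matrix \<sigma> (chart_set i \<sigma> J) x)"
    using cone_chart_matrix[OF i \<sigma> J v(1)] v(2) by auto
  define y where "y = (\<lambda>t. if t \<in> chart_set i \<sigma> J then x t else 0)"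
  have "chart_matrix \<sigma> (chart_set i \<sigma> J) x = chart_matrix \<sigma> (chart_set i \<sigma> J) y"
    by (rule chart_matrix_cong) (simp add: y_def)
  moreover have "l j = msign \<sigma> (k j)" if j: "j \<in> {i..m}" for j
  proof -
    have "\<sigma> ` {..<k j} \<in> ext_basis n (k j)"
      using i j k_le_n[of j] by (intro ext_basis_image[OF \<sigma>]) auto
    then have "l j * (1 / msign \<sigma> (k j)) = 1"
      using v(2)[OF j] j by (simp add: x pvec_apply minor_chart_matrix[OF i \<sigma> chart_set_subset])
    then show ?thesis by (auto simp: field_simps split: if_splits)
  qed
  ultimately have "v = chart_map i \<sigma> (chart_set i \<sigma> J) y"
    unfolding x chart_map_def by (intro pvec_cong) simp
  moreover have "y \<in> affine_space (chart_set i \<sigma> J)" by (auto simp: affine_space_def y_def)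
  ultimately show "v \<in> chart_map i \<sigma> (chart_set i \<sigma> J) ` affine_space (chart_set i \<sigma> J)" by blast
next
  fix v :: "nat \<times> nat set \<Rightarrow> 'a"
  assume "v \<in> chart_map i \<sigma> (chart_set i \<sigma> J) ` affine_space (chart_set i \<sigma> J)"
  then obtain x where x: "v = chart_map i \<sigma> (chart_set i \<sigma> J) x" by blast
  then have "v \<in> cone i J" unfolding chart_map_def using chart_matrix_in_cone[OF i \<sigma> J near] by blast
  then show "v \<in> chart (flag_basis n k) {i..m} (\<lambda>j. \<sigma> ` {..<k j}) (Xc i J)"
    unfolding chart_def multicone_Xc[OF i] x by (auto intro!: chart_map_diag[OF i \<sigma> chart_set_subset])
qed

lemma chart_graph_param:
  assumes i: "i \<in> {1..m}" and \<sigma>: "\<sigma> permutes {..<n}"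
  shows "graph_param (Sigma {i..m} (flag_basis n k)) (chart_set i \<sigma> J)
    (chart_map i \<sigma> (chart_set i \<sigma> J) :: (nat \<times> nat \<Rightarrow> 'a::field_char_0) \<Rightarrow> nat \<times> nat set \<Rightarrow> 'a)
    (chart_index i \<sigma>) (chart_coeff i \<sigma>)"
proof
  show "finite (chart_set i \<sigma> J)" by (rule finite_chart_set)
  show "(\<lambda>x. chart_map i \<sigma> (chart_set i \<sigma> J) x v :: 'a) \<in> polyfun (chart_set i \<sigma> J)" for v
    unfolding chart_map_def by (intro pvec_polyfun chart_matrix_polyfun polyfun_const) simp
  show "chart_map i \<sigma> (chart_set i \<sigma> J) x \<in> flag_space {i..m}" for x :: "nat \<times> nat \<Rightarrow> 'a"
    unfolding chart_map_def by (rule pvec_flag_space)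
  fix t assume t: "t \<in> chart_set i \<sigma> J"
  then show "chart_index i \<sigma> t \<in> Sigma {i..m} (flag_basis n k)"
    using chart_index_mem[OF i \<sigma>] chart_set_subset by blast
  show "(chart_coeff i \<sigma> t :: 'a) \<noteq> 0" by (rule pvec_chart_index(2)[OF i \<sigma> chart_set_subset t])
  show "chart_map i \<sigma> (chart_set i \<sigma> J) x (chart_index i \<sigma> t) = chart_coeff i \<sigma> t * x t"
    for x :: "nat \<times> nat \<Rightarrow> 'a"
    using pvec_chart_index(1)[OF i \<sigma> chart_set_subset t, of "\<lambda>_. 1" x] by (simp add: chart_map_def)
qed

text \<open>The chart is a graph over a coordinate space, so its tangent dimension and its Krull
  dimension both equal the number of chart entries. Dividing by the chart coordinates moves the
  representative into the chart.\<close>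

lemma smooth_at_near:
  fixes g :: "nat \<times> nat \<Rightarrow> 'a::field_char_0"
  assumes i: "i \<in> {1..m}" and \<sigma>: "\<sigma> permutes {..<n}" and J: "J \<in> ext_basis n (k i)"
    and near: "near (\<sigma> ` {..<k i}) J" and g: "det (mat n n g) \<noteq> 0" "col_bounded n J (k i) g"
    and nz: "\<And>j. j \<in> {i..m} \<Longrightarrow> minor (\<sigma> ` {..<k j}) g (k j) \<noteq> 0"
  shows "smooth_at (flag_basis n k) {i..m} (Xc i J) (mp_point {i..m} (pvec {i..m} (\<lambda>_. 1) g))"
proof -
  let ?c = "\<lambda>j. \<sigma> ` {..<k j}"
  interpret graph_param "Sigma {i..m} (flag_basis n k)" "chart_set i \<sigma> J"
    "chart_map i \<sigma> (chart_set i \<sigma> J) :: (nat \<times> nat \<Rightarrow> 'a) \<Rightarrow> nat \<times> nat set \<Rightarrow> 'a"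
    "chart_index i \<sigma>" "chart_coeff i \<sigma>"
    by (rule chart_graph_param[OF i \<sigma>])
  define v where "v = pvec {i..m} (\<lambda>j. 1 / minor (?c j) g (k j)) g"
  have v: "v \<in> chart (flag_basis n k) {i..m} ?c (Xc i J)"
    unfolding chart_def multicone_Xc[OF i]
  proof (intro CollectI conjI ballI)
    show "v \<in> cone i J" unfolding v_def cone_def using g by blast
    fix j assume j: "j \<in> {i..m}"
    then have "?c j \<in> ext_basis n (k j)" using i k_le_n[of j] by (intro ext_basis_image[OF \<sigma>]) auto
    then show "v (j, ?c j) = 1" using j nz[OF j] by (simp add: v_def pvec_apply)
  qed
  moreover have "mp_point {i..m} v = mp_point {i..m} (pvec {i..m} (\<lambda>_. 1) g)"
  proof -
    have "v \<in> mp_coords (flag_basis n k) {i..m}"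
      unfolding v_def using i nz by (intro pvec_mp_coords[OF g(1)]) auto
    from mp_point_eq_pvec[OF this, of g] show ?thesis
      using nz by (elim iffD2, intro exI[of _ "\<lambda>j. 1 / minor (?c j) g (k j)"]) (auto simp: v_def)
  qed
  moreover obtain x where x: "v = chart_map i \<sigma> (chart_set i \<sigma> J) x" "x \<in> affine_space (chart_set i \<sigma> J)"
    using v unfolding chart_eq[OF i \<sigma> J near] by blast
  have "vdim (tangent_space (Sigma {i..m} (flag_basis n k)) (chart (flag_basis n k) {i..m} ?c (Xc i J)) v) =
      card (chart_set i \<sigma> J)"
    unfolding chart_eq[OF i \<sigma> J near] x(1) by (rule vdim_tangent_space[OF x(2)])
  moreover have "krull_dim (subtopology (zariski_affine (Sigma {i..m} (flag_basis n k)))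
      (chart (flag_basis n k) {i..m} ?c (Xc i J) :: (nat \<times> nat set \<Rightarrow> 'a) set)) = enat (card (chart_set i \<sigma> J))"
    unfolding chart_eq[OF i \<sigma> J near] by (rule krull_dim_eq)
  ultimately show ?thesis unfolding smooth_at_def by (intro exI[of _ ?c] bexI[of _ v] conjI) simp_all
qed

end

section \<open>Dimensions of cones\<close>

lemma exchange_subset_le_iff:
  assumes "s \<in> J" "r \<notin> J" "finite J"
  shows "insert r (J - {s}) \<sqsubseteq> J \<longleftrightarrow> r < s"
proof
  assume le: "insert r (J - {s}) \<sqsubseteq> J"
  show "r < s"
  proof (rule ccontr)
    assume "\<not> r < s"
    then have "s < r" using assms by (metis linorder_neqE_nat)
    then have "insert r (J - {s}) \<inter> {..<Suc s} = (J \<inter> {..<Suc s}) - {s}" by auto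
    then have "card (insert r (J - {s}) \<inter> {..<Suc s}) < card (J \<inter> {..<Suc s})"
      using card_Diff1_less[of "J \<inter> {..<Suc s}" s] assms by simp
    then show False using le[unfolded subset_le_def, rule_format, of "Suc s"] by simp
  qed
next
  assume rs: "r < s"
  show "insert r (J - {s}) \<sqsubseteq> J"
    unfolding subset_le_def
  proof
    fix x
    show "card (J \<inter> {..<x}) \<le> card (insert r (J - {s}) \<inter> {..<x})"
    proof (cases "x \<le> s")
      case True
      then show ?thesis using assms(3) by (intro card_mono) auto
    next
      case False
      then have "insert r (J - {s}) \<inter> {..<x} = insert r ((J \<inter> {..<x}) - {s})" using rs by auto
      moreover have "card \<dots> = Suc (card ((J \<inter> {..<x}) - {s}))"
        using assms by (intro card_insert_disjoint) auto
      moreover have "\<dots> = card (J \<inter> {..<x})" using assms False by (intro card_Suc_Diff1) auto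
      ultimately show ?thesis by simp
    qed
  qed
qed

text \<open>Below the element \<open>pick J a\<close> there are \<open>pick J a - a\<close> gaps.
  The total number of gaps is the dimension of the Schubert variety of \<open>J\<close> in the
  Grassmannian.\<close>

lemma sum_card_below:
  assumes "finite J"
  shows "(\<Sum>s\<in>J. card ({..<s} - J)) + (\<Sum>a<card J. a) = \<Sum>J"
proof -
  have bij: "bij_betw (pick J) {..<card J} J" by (rule pick_bij_betw[OF assms])
  have "(\<Sum>s\<in>J. card ({..<s} - J)) = (\<Sum>a<card J. card ({..<pick J a} - J))"
    using sum.reindex_bij_betw[OF bij, of "\<lambda>s. card ({..<s} - J)"] by simp
  moreover have "card ({..<pick J a} - J) + a = pick J a" if "a < card J" for a
  proof -
    have "{b \<in> J. b < pick J a} = {..<pick J a} \<inter> J" by auto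
    then have "card ({..<pick J a} \<inter> J) = a" using card_pick_le[OF that] by simp
    then show ?thesis using card_Diff_subset_Int[of "{..<pick J a}" J] assms
      card_mono[of "{..<pick J a}" "{..<pick J a} \<inter> J"] by simp
  qed
  then have "(\<Sum>a<card J. card ({..<pick J a} - J)) + (\<Sum>a<card J. a) = (\<Sum>a<card J. pick J a)"
    by (simp add: sum.distrib[symmetric])
  moreover have "(\<Sum>a<card J. pick J a) = \<Sum>J" using sum.reindex_bij_betw[OF bij, of "\<lambda>s. s"] by simp
  ultimately show ?thesis by simp
qed

text \<open>As the columns are not sorted, one permutation describes all levels
  simultaneously.\<close>

lemma flag_type:
  fixes g :: "nat \<times> nat \<Rightarrow> 'a::field"
  assumes "det (mat n n g) \<noteq> 0"
  shows "\<exists>\<sigma>. \<sigma> permutes {..<n} \<and> (\<forall>l\<le>n. minor (\<sigma> ` {..<l}) g l \<noteq> 0 \<and>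
    (\<forall>L\<in>ext_basis n l. minor L g l \<noteq> 0 \<longrightarrow> L \<sqsubseteq> \<sigma> ` {..<l}))"
proof -
  obtain h \<sigma> where *: "\<sigma> permutes {..<n}" "\<forall>e k. k \<le> n \<longrightarrow> mdet e h k = mdet e g k"
    "\<forall>a<n. h (\<sigma> a, a) \<noteq> 0 \<and> (\<forall>r<n. \<sigma> a < r \<longrightarrow> h (r, a) = 0)"
    using bruhat_columns[OF assms] by (elim exE conjE)
  have im: "\<sigma> a < n" if "a < n" for a using permutes_in_image[OF *(1), of a] that by simp
  have "minor (\<sigma> ` {..<l}) g l \<noteq> 0 \<and> (\<forall>L\<in>ext_basis n l. minor L g l \<noteq> 0 \<longrightarrow> L \<sqsubseteq> \<sigma> ` {..<l})"
    if l: "l \<le> n" for l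
  proof (intro conjI ballI impI)
    have inj: "inj_on \<sigma> {..<l}" by (rule permutes_inj_on[OF *(1)])
    have "mdet \<sigma> h l = (\<Prod>a<l. h (\<sigma> a, a))" using l *(3) im inj by (intro mdet_pivots[where n = n]) auto
    moreover have "\<dots> \<noteq> 0" using *(3) l by simp
    ultimately have "mdet \<sigma> g l \<noteq> 0" using *(2) l by simp
    then show "minor (\<sigma> ` {..<l}) g l \<noteq> 0" using msign(2)[OF inj, of g] by auto
    fix L assume L: "L \<in> ext_basis n l" "minor L g l \<noteq> 0"
    then have "minor L h l \<noteq> 0" using *(2) l by simp
    then have "pick L ` {..<l} \<sqsubseteq> \<sigma> ` {..<l}"
      using ext_basisD(4,5)[OF L(1)] inj *(3) l by (intro mdet_bound_subset_le[where n = n and g = h]) auto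
    then show "L \<sqsubseteq> \<sigma> ` {..<l}" using ext_basisD(6)[OF L(1)] by simp
  qed
  then show ?thesis using *(1) by (intro exI[of _ \<sigma>]) simp
qed

context flag_data
begin

lemma mp_point_Xc_iff_cone:
  fixes w :: "nat \<times> nat set \<Rightarrow> 'a::field"
  assumes w: "w \<in> mp_coords (flag_basis n k) {i..m}"
  shows "mp_point {i..m} w \<in> Xc i J \<longleftrightarrow> w \<in> cone i J"
proof
  assume "mp_point {i..m} w \<in> Xc i J"
  then show "w \<in> cone i J" unfolding mp_point_Xc_iff[OF w] cone_def by blast
next
  assume "w \<in> cone i J"
  then obtain l g where g: "w = pvec {i..m} l g" "det (mat n n g) \<noteq> 0" "col_bounded n J (k i) g"
    unfolding cone_def by blast
  have "l j \<noteq> 0" if "j \<in> {i..m}" for j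
  proof
    assume "l j = 0"
    then have "curry w j = 0" by (auto simp: g(1) pvec_def fun_eq_iff)
    then show False using w that by (auto simp: mp_coords_def)
  qed
  then show "mp_point {i..m} w \<in> Xc i J" unfolding mp_point_Xc_iff[OF w] using g by blast
qed

lemma Xc_elim:
  assumes "y \<in> (Xc i J :: (nat \<Rightarrow> (nat set \<Rightarrow> 'a::field) set) set)" "i \<in> {1..m}"
  obtains g where "y = mp_point {i..m} (pvec {i..m} (\<lambda>_. 1) g)" "det (mat n n g) \<noteq> 0"
    "col_bounded n J (k i) g" "pvec {i..m} (\<lambda>_. 1) g \<in> mp_coords (flag_basis n k) {i..m}"
proof -
  obtain g where g: "y = mp_point {i..m} (pvec {i..m} (\<lambda>_. 1) g)" "det (mat n n g) \<noteq> 0"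
    "col_bounded n J (k i) g" using assms(1) unfolding Xc_def by blast
  then show thesis using assms(2) by (intro that[of g] pvec_mp_coords) auto
qed

lemma Xc_mono:
  assumes "M \<sqsubseteq> J" "M \<in> ext_basis n (k i)" "J \<in> ext_basis n (k i)" "i \<in> {1..m}"
  shows "Xc i M \<subseteq> (Xc i J :: (nat \<Rightarrow> (nat set \<Rightarrow> 'a::field) set) set)"
proof
  fix y :: "nat \<Rightarrow> (nat set \<Rightarrow> 'a) set" assume "y \<in> Xc i M"
  then obtain g where g: "y = mp_point {i..m} (pvec {i..m} (\<lambda>_. 1) g)" "det (mat n n g) \<noteq> 0"
    "col_bounded n M (k i) g" unfolding Xc_def by blast
  then show "y \<in> Xc i J" using col_bounded_mono[OF g(3) assms(1-3)] unfolding Xc_def by blast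
qed

lemma Xc_psubset:
  assumes "M \<sqsubseteq> J" "M \<in> ext_basis n (k i)" "J \<in> ext_basis n (k i)" "i \<in> {1..m}" "M \<noteq> J"
  shows "Xc i M \<subset> (Xc i J :: (nat \<Rightarrow> (nat set \<Rightarrow> 'a::field) set) set)"
proof -
  have "(Xc i M :: (nat \<Rightarrow> (nat set \<Rightarrow> 'a) set) set) \<noteq> Xc i J"
  proof
    assume "(Xc i M :: (nat \<Rightarrow> (nat set \<Rightarrow> 'a) set) set) = Xc i J"
    then have "cone i M = (cone i J :: (nat \<times> nat set \<Rightarrow> 'a) set)" using multicone_Xc[OF assms(4)] by metis
    then have "J \<sqsubseteq> M" using cone_subset_iff[OF assms(3,2,4,4), where ?'a = 'a] by simp
    then show False using assms(1,5) subset_le_antisym by blast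
  qed
  then show ?thesis using Xc_mono[OF assms(1-4)] by blast
qed

lemma lower_ext_basis:
  assumes "J \<in> ext_basis n l" "t \<notin> J" "Suc t \<in> J"
  shows "insert t (J - {Suc t}) \<in> ext_basis n l" "insert t (J - {Suc t}) \<sqsubseteq> J" "insert t (J - {Suc t}) \<noteq> J"
proof -
  note J = ext_basisD[OF assms(1)]
  have "card (insert t (J - {Suc t})) = card J"
    using J(3) assms by (simp add: card_Suc_Diff1 del: card_Diff_singleton card_Diff_insert)
  moreover have "insert t (J - {Suc t}) \<subseteq> {..<n}" using J(1) assms(3) by auto
  ultimately show "insert t (J - {Suc t}) \<in> ext_basis n l" using J(2) by (simp add: ext_basis_def)
  show "insert t (J - {Suc t}) \<sqsubseteq> J" unfolding subset_le_def
    using subset_le_lower[OF assms(3) refl assms(2)] by simp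
  show "insert t (J - {Suc t}) \<noteq> J" using assms(2) by blast
qed

text \<open>The flag lies in the chart around the permutation flag of its own type
  \<open>\<sigma>\<close>. If the image \<open>M\<close> of \<open>{..<k i}\<close> under
  \<open>\<sigma>\<close> is near \<open>J\<close>, this chart shows smoothness; otherwise
  \<open>subset_le_cover\<close> puts a lower neighbour of \<open>J\<close> strictly in
  between.\<close>

lemma not_smooth_at:
  fixes y :: "nat \<Rightarrow> (nat set \<Rightarrow> 'a::field_char_0) set"
  assumes i: "i \<in> {1..m}" and J: "J \<in> ext_basis n (k i)" and y: "y \<in> Xc i J"
    and ns: "\<not> smooth_at (flag_basis n k) {i..m} (Xc i J) y"
  shows "\<exists>M J'. M \<in> ext_basis n (k i) \<and> J' \<in> ext_basis n (k i) \<and> M \<sqsubseteq> J' \<and> M \<noteq> J' \<and> J' \<sqsubseteq> J \<and> J' \<noteq> J \<and>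
     y \<in> Xc i M"
proof -
  obtain g where g: "y = mp_point {i..m} (pvec {i..m} (\<lambda>_. 1) g)" "det (mat n n g) \<noteq> 0"
    "col_bounded n J (k i) g" "pvec {i..m} (\<lambda>_. 1) g \<in> mp_coords (flag_basis n k) {i..m}"
    by (rule Xc_elim[OF y i])
  have ki: "k i \<le> n" using i k_le_n by auto
  obtain \<sigma> where \<sigma>: "\<sigma> permutes {..<n}" "\<forall>l\<le>n. minor (\<sigma> ` {..<l}) g l \<noteq> 0 \<and>
    (\<forall>L\<in>ext_basis n l. minor L g l \<noteq> 0 \<longrightarrow> L \<sqsubseteq> \<sigma> ` {..<l})" using flag_type[OF g(2)] by blast
  define M where "M = \<sigma> ` {..<k i}"
  have M: "M \<in> ext_basis n (k i)" unfolding M_def by (rule ext_basis_image[OF \<sigma>(1) ki])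
  have MJ: "M \<sqsubseteq> J" using \<sigma>(2) ki col_bounded_minor[OF g(3) J order_refl M] by (simp add: M_def)
  have nn: "\<not> near M J"
  proof
    assume near: "near M J"
    have "minor (\<sigma> ` {..<k j}) g (k j) \<noteq> 0" if "j \<in> {i..m}" for j using \<sigma>(2) k_le_n[of j] i that by auto
    from smooth_at_near[OF i \<sigma>(1) J near[unfolded M_def] g(2,3) this] show False using ns g(1) by simp
  qed
  have "card M = card J" using M J by (simp add: ext_basis_def)
  moreover have "M \<noteq> J" using nn by (auto simp: near_def)
  ultimately obtain t where t: "t \<notin> J" "Suc t \<in> J" "M \<sqsubseteq> insert t (J - {Suc t})"
    using subset_le_cover[OF MJ _ _ ext_basisD(1)[OF M] ext_basisD(1)[OF J]] by blast
  have "M \<noteq> insert t (J - {Suc t})" using nn t(1,2) by (auto simp: near_def)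
  moreover have "pvec {i..m} (\<lambda>_. 1) g \<in> cone i M"
    using \<sigma>(2) ki by (intro cone_vanishI[OF i M g(2)]) (auto simp: M_def)
  then have "y \<in> Xc i M" unfolding g(1) mp_point_Xc_iff_cone[OF g(4)] .
  ultimately show ?thesis using t M lower_ext_basis[OF J t(1,2)]
    by (intro exI[of _ M] exI[of _ "insert t (J - {Suc t})"]) blast
qed

text \<open>A flag in the chart is given by its chart coordinates, and a point of the cone over it by one
  additional scalar for each member of the flag.\<close>

definition cone_params :: "nat \<Rightarrow> (nat \<Rightarrow> nat) \<Rightarrow> nat set \<Rightarrow> (nat + nat \<times> nat) set" where
  "cone_params i \<sigma> J = Inl ` {i..m} \<union> Inr ` chart_set i \<sigma> J"

lemma finite_cone_params: "finite (cone_params i \<sigma> J)"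
  by (simp add: cone_params_def finite_chart_set)

lemma card_cone_params: "card (cone_params i \<sigma> J) = card {i..m} + card (chart_set i \<sigma> J)"
  unfolding cone_params_def using finite_chart_set[of i \<sigma> J]
  by (subst card_Un_disjoint) (auto simp: card_image)

text \<open>Where the product \<open>D\<close> of the chart coordinates is non-zero, the cone is
  parametrized, so \<open>D * f\<close> vanishes on the cone. The cone is irreducible and
  \<open>D\<close> is 1 at the origin of the chart, hence \<open>f\<close> vanishes as well.\<close>

lemma dominated_cone:
  assumes i: "i \<in> {1..m}" and \<sigma>: "\<sigma> permutes {..<n}" and J: "J \<in> ext_basis n (k i)" "\<sigma> ` {..<k i} = J"
  shows "dominated (Sigma {1..m} (flag_basis n k)) (cone_params i \<sigma> J)
    (\<lambda>z. pvec {i..m} (\<lambda>j. if j \<in> {i..m} then z (Inl j) else 0)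
       (chart_matrix \<sigma> (chart_set i \<sigma> J) (\<lambda>t. z (Inr t))))
    (cone i J :: (nat \<times> nat set \<Rightarrow> 'a::field_char_0) set)"
  unfolding dominated_def
proof (intro conjI ballI impI)
  let ?T = "chart_set i \<sigma> J" and ?vs = "Sigma {1..m} (flag_basis n k)" and ?W = "cone_params i \<sigma> J"
  let ?\<psi> = "\<lambda>z :: nat + nat \<times> nat \<Rightarrow> 'a. pvec {i..m} (\<lambda>j. if j \<in> {i..m} then z (Inl j) else 0)
       (chart_matrix \<sigma> ?T (\<lambda>t. z (Inr t)))"
  have near: "near (\<sigma> ` {..<k i}) J" using J by (simp add: near_def)
  show "(\<lambda>z. ?\<psi> z v) \<in> polyfun ?W" for v
  proof (rule pvec_polyfun)
    show "(\<lambda>z :: nat + nat \<times> nat \<Rightarrow> 'a. chart_matrix \<sigma> ?T (\<lambda>t. z (Inr t)) p) \<in> polyfun ?W" for p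
      by (rule polyfun_compose[OF chart_matrix_polyfun[OF subset_refl]])
        (auto simp: cone_params_def intro: polyfun_var)
    show "(\<lambda>z :: nat + nat \<times> nat \<Rightarrow> 'a. if j \<in> {i..m} then z (Inl j) else 0) \<in> polyfun ?W" for j
      by (cases "j \<in> {i..m}") (auto simp: cone_params_def intro: polyfun_var polyfun_const)
  qed
  fix f :: "(nat \<times> nat set \<Rightarrow> 'a) \<Rightarrow> 'a"
  assume f: "f \<in> polyfun ?vs" and zero: "\<forall>z\<in>affine_space ?W. f (?\<psi> z) = 0"
  define D where "D = (\<lambda>v :: nat \<times> nat set \<Rightarrow> 'a. \<Prod>j\<in>{i..m}. v (j, \<sigma> ` {..<k j}))"
  have c: "\<sigma> ` {..<k j} \<in> ext_basis n (k j)" if "j \<in> {i..m}" for j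
    using that i k_le_n[of j] by (intro ext_basis_image[OF \<sigma>]) auto
  have D: "D \<in> polyfun ?vs"
    unfolding D_def using c i by (intro polyfun_prod polyfun_var) (auto simp: mem_flag_basis)
  have prod: "\<forall>v\<in>cone i J. D v * f v = 0"
  proof
    fix v :: "nat \<times> nat set \<Rightarrow> 'a" assume v: "v \<in> cone i J"
    show "D v * f v = 0"
    proof (cases "D v = 0")
      case False
      then have "v (j, \<sigma> ` {..<k j}) \<noteq> 0" if "j \<in> {i..m}" for j using that by (auto simp: D_def)
      then obtain x l where x: "v = pvec {i..m} l (chart_matrix \<sigma> ?T x)"
        using cone_chart_matrix[OF i \<sigma> J(1) v] by blast
      define z where "z = (\<lambda>w. if w \<in> ?W then case w of Inl j \<Rightarrow> l j | Inr t \<Rightarrow> x t else 0)"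
      have "z \<in> affine_space ?W" by (auto simp: affine_space_def z_def)
      moreover have "chart_matrix \<sigma> ?T (\<lambda>t. z (Inr t)) = chart_matrix \<sigma> ?T x"
        by (rule chart_matrix_cong) (auto simp: z_def cone_params_def)
      then have "?\<psi> z = v" unfolding x by (intro pvec_cong) (auto simp: z_def cone_params_def)
      ultimately show ?thesis using zero by auto
    qed simp
  qed
  have irr: "prime_zeros ?vs (cone i J :: (nat \<times> nat set \<Rightarrow> 'a) set)"
    by (rule irreducible_closedin_prime_zeros[OF irreducible_cone[OF i J(1) i J(1) subset_refl]])
  have alt: "(\<forall>v\<in>cone i J. D v = 0) \<or> (\<forall>v\<in>cone i J. f v = 0)"
    by (rule mp[OF bspec[OF bspec[OF irr[unfolded prime_zeros_def] D] f] prod])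
  have "\<not> (\<forall>v\<in>cone i J. D v = 0)"
  proof
    assume all: "\<forall>v\<in>cone i J. D v = 0"
    define v where "v = chart_map i \<sigma> ?T (\<lambda>_. 0 :: 'a)"
    have "v \<in> cone i J" unfolding v_def chart_map_def by (rule chart_matrix_in_cone[OF i \<sigma> J(1) near])
    moreover have "v (j, \<sigma> ` {..<k j}) = 1" if "j \<in> {i..m}" for j
      unfolding v_def by (rule chart_map_diag[OF i \<sigma> chart_set_subset that])
    then have "D v = 1" by (simp add: D_def)
    ultimately show False using all by fastforce
  qed
  then show "f v = 0" if "v \<in> cone i J" for v using alt that by blast
qed

text \<open>The chart coordinates and the coordinates \<open>chart_index\<close> attain any
  prescribed non-zero values: the former fix the scalars of the levels, after which each chart entry
  solves one linear equation.\<close>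

lemma alg_indep_cone:
  assumes i: "i \<in> {1..m}" and \<sigma>: "\<sigma> permutes {..<n}" and J: "J \<in> ext_basis n (k i)" "\<sigma> ` {..<k i} = J"
  shows "\<exists>F. (\<forall>a<card (cone_params i \<sigma> J). F a \<in> polyfun (Sigma {1..m} (flag_basis n k))) \<and>
    alg_indep (cone i J :: (nat \<times> nat set \<Rightarrow> 'a::field_char_0) set) F (card (cone_params i \<sigma> J))"
proof -
  let ?T = "chart_set i \<sigma> J" and ?vs = "Sigma {1..m} (flag_basis n k)" and ?W = "cone_params i \<sigma> J"
  have near: "near (\<sigma> ` {..<k i}) J" using J by (simp add: near_def)
  obtain w where w: "bij_betw w {..<card ?W} ?W"
    using ex_bij_betw_nat_finite[OF finite_cone_params[of i \<sigma> J]] atLeast0LessThan by metis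
  define ix where "ix = (\<lambda>u. case u of Inl j \<Rightarrow> (j, \<sigma> ` {..<k j}) | Inr t \<Rightarrow> chart_index i \<sigma> t)"
  have c: "\<sigma> ` {..<k j} \<in> ext_basis n (k j)" if "j \<in> {i..m}" for j
    using that i k_le_n[of j] by (intro ext_basis_image[OF \<sigma>]) auto
  have ix: "ix u \<in> Sigma {i..m} (flag_basis n k)" if "u \<in> ?W" for u
    using that c chart_index_mem[OF i \<sigma>] chart_set_subset[of i \<sigma> J]
    by (auto simp: cone_params_def ix_def mem_flag_basis)
  define F where "F = (\<lambda>a (v :: nat \<times> nat set \<Rightarrow> 'a). v (ix (w a)))"
  have "F a \<in> polyfun ?vs" if "a < card ?W" for a
  proof -
    have "w a \<in> ?W" using w that by (auto simp: bij_betw_def)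
    then have "ix (w a) \<in> ?vs" using ix i by fastforce
    then show ?thesis unfolding F_def by (rule polyfun_var)
  qed
  moreover have "alg_indep (cone i J) F (card ?W)"
  proof (rule alg_indepI)
    fix y :: "nat \<Rightarrow> 'a" assume y: "\<And>a. a < card ?W \<Longrightarrow> y a \<noteq> 0"
    define z where "z = (\<lambda>u. y (the_inv_into {..<card ?W} w u))"
    have zw: "z (w a) = y a" if "a < card ?W" for a
      using the_inv_into_f_f[OF bij_betw_imp_inj_on[OF w]] that by (simp add: z_def)
    have znz: "z u \<noteq> 0" if "u \<in> ?W" for u
    proof -
      have "u \<in> w ` {..<card ?W}" using w that by (simp add: bij_betw_def)
      then obtain a where "a < card ?W" "u = w a" by blast
      then show ?thesis using zw y by simp
    qed
    define x where "x = (\<lambda>t. z (Inr t) / (z (Inl (fst (chart_index i \<sigma> t))) * chart_coeff i \<sigma> t))"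
    define v where "v = pvec {i..m} (\<lambda>j. z (Inl j) * msign \<sigma> (k j)) (chart_matrix \<sigma> ?T x)"
    have v: "v \<in> cone i J" unfolding v_def by (rule chart_matrix_in_cone[OF i \<sigma> J(1) near])
    have "v (ix u) = z u" if u: "u \<in> ?W" for u
    proof (cases u)
      case (Inl j)
      then have j: "j \<in> {i..m}" using u by (auto simp: cone_params_def)
      then show ?thesis using c[OF j] msign(1)[OF permutes_inj_on[OF \<sigma>, of "{..<k j}"], where ?'a = 'a]
        by (simp add: Inl ix_def v_def pvec_apply minor_chart_matrix[OF i \<sigma> chart_set_subset])
    next
      case (Inr t)
      then have t: "t \<in> ?T" using u by (auto simp: cone_params_def)
      have "Inl (fst (chart_index i \<sigma> t)) \<in> ?W"
        using ix[OF u] Inr by (auto simp: cone_params_def ix_def)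
      then show ?thesis using pvec_chart_index(1)[OF i \<sigma> chart_set_subset t, of "\<lambda>j. z (Inl j)" x] znz
          pvec_chart_index(2)[OF i \<sigma> chart_set_subset t, where ?'a = 'a]
        by (simp add: Inr ix_def v_def x_def)
    qed
    moreover have "w a \<in> ?W" if "a < card ?W" for a using w that by (auto simp: bij_betw_def)
    ultimately have "\<forall>a<card ?W. F a v = y a" using zw by (simp add: F_def)
    then show "\<exists>v\<in>cone i J. \<forall>a<card ?W. F a v = y a" using v by blast
  qed
  ultimately show ?thesis by (intro exI[of _ F]) simp
qed

text \<open>Counted by columns: for \<open>b < k i\<close> an exchange is allowed exactly when it
  lowers \<open>\<sigma> b\<close>, so the rows correspond to the gaps of \<open>J\<close> below
  \<open>\<sigma> b\<close>. The triangular number stands on the left to avoid subtraction.\<close>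

lemma card_chart_set:
  assumes i: "i \<in> {1..m}" and \<sigma>: "\<sigma> permutes {..<n}" and J: "J \<in> ext_basis n (k i)" "\<sigma> ` {..<k i} = J"
  shows "card (chart_set i \<sigma> J) + (\<Sum>a<k i. a) = \<Sum>J + (\<Sum>b\<in>{k i..<k m}. n - k (step i b))"
proof -
  let ?T = "chart_set i \<sigma> J"
  define A where "A = (\<lambda>b. {a. (a, b) \<in> ?T})"
  have inj: "\<sigma> c = \<sigma> d \<longleftrightarrow> c = d" for c d using permutes_inj[OF \<sigma>] by (auto dest: injD)
  have finA: "finite (A b)" for b
    by (rule finite_subset[of _ "{..<n}"]) (auto simp: A_def chart_set_def free_entries_def)
  have "?T = (\<lambda>(b, a). (a, b)) ` (SIGMA b:{..<k m}. A b)"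
    by (auto simp: A_def chart_set_def free_entries_def image_iff)
  moreover have "inj_on (\<lambda>(b, a). (a, b)) (SIGMA b:{..<k m}. A b)" by (auto simp: inj_on_def)
  ultimately have "card ?T = (\<Sum>b<k m. card (A b))"
    using finA by (simp add: card_image card_SigmaI)
  also have "{..<k m} = {..<k i} \<union> {k i..<k m}" using k_le[of i m] i by auto
  also have "(\<Sum>b\<in>{..<k i} \<union> {k i..<k m}. card (A b)) = (\<Sum>b<k i. card (A b)) + (\<Sum>b\<in>{k i..<k m}. card (A b))"
    by (rule sum.union_disjoint) auto
  also have "(\<Sum>b\<in>{k i..<k m}. card (A b)) = (\<Sum>b\<in>{k i..<k m}. n - k (step i b))"
  proof (intro sum.cong refl)
    fix b assume "b \<in> {k i..<k m}"
    then have "A b = {k (step i b)..<n}" by (auto simp: A_def chart_set_def free_entries_def)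
    then show "card (A b) = n - k (step i b)" by simp
  qed
  also have "(\<Sum>b<k i. card (A b)) = (\<Sum>b<k i. card ({..<\<sigma> b} - J))"
  proof (intro sum.cong refl)
    fix b assume "b \<in> {..<k i}"
    then have b: "b < k i" by simp
    have bm: "b < k m" using b k_le[of i m] i by auto
    have \<sigma>b: "\<sigma> b \<in> J" using b J(2) by blast
    have notJ: "\<sigma> a \<notin> J" if "k i \<le> a" for a using that J(2) inj by auto
    have "\<sigma> ` A b = {..<\<sigma> b} - J"
    proof (intro equalityI subsetI)
      fix r assume "r \<in> \<sigma> ` A b"
      then obtain a where a: "r = \<sigma> a" "k i \<le> a" "insert (\<sigma> a) (J - {\<sigma> b}) \<sqsubseteq> J"
        using b step_first[OF i b] J(2) by (auto simp: A_def chart_set_def free_entries_def)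
      then show "r \<in> {..<\<sigma> b} - J"
        using exchange_subset_le_iff[OF \<sigma>b notJ[OF a(2)] ext_basisD(3)[OF J(1)]] notJ by simp
    next
      fix r assume r: "r \<in> {..<\<sigma> b} - J"
      have "\<sigma> b < n" using ext_basisD(1)[OF J(1)] \<sigma>b by auto
      then have "r \<in> \<sigma> ` {..<n}" using r permutes_image[OF \<sigma>] by simp
      then obtain a where a: "r = \<sigma> a" "a < n" by auto
      have "k i \<le> a" using a r J(2) by (metis DiffD2 image_eqI lessThan_iff not_le)
      moreover have "insert (\<sigma> a) (J - {\<sigma> b}) \<sqsubseteq> J"
        using exchange_subset_le_iff[OF \<sigma>b _ ext_basisD(3)[OF J(1)], of r] r a by simp
      ultimately have "a \<in> A b"
        using a(2) b bm step_first[OF i b] J(2) by (simp add: A_def chart_set_def free_entries_def)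
      then show "r \<in> \<sigma> ` A b" using a by blast
    qed
    moreover have "inj_on \<sigma> (A b)" by (rule permutes_inj_on[OF \<sigma>])
    ultimately show "card (A b) = card ({..<\<sigma> b} - J)" using card_image[of \<sigma> "A b"] by simp
  qed
  also have "\<dots> = (\<Sum>s\<in>J. card ({..<s} - J))"
    unfolding J(2)[symmetric] by (subst sum.reindex[OF permutes_inj_on[OF \<sigma>]]) simp
  finally show ?thesis using sum_card_below[OF ext_basisD(3)[OF J(1)]] ext_basisD(2)[OF J(1)] by simp
qed

text \<open>The number of chart parameters of \<open>cone i J\<close>: one scalar for each member of the flag, the
  pairs \<open>s < j\<close> with \<open>j \<in> J\<close> and \<open>s \<notin> J\<close>, and the free entries of the columns from \<open>k i\<close> on.\<close>

definition cone_dim :: "nat \<Rightarrow> nat set \<Rightarrow> nat" where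
  "cone_dim i J = (Suc m - i) + (\<Sum>J + (\<Sum>b\<in>{k i..<k m}. n - k (step i b)) - (\<Sum>a<k i. a))"

text \<open>The second part makes the truncated subtraction in \<open>cone_dim\<close> an honest
  one.\<close>

lemma cone_dim_eq:
  assumes "i \<in> {1..m}" "\<sigma> permutes {..<n}" "J \<in> ext_basis n (k i)" "\<sigma> ` {..<k i} = J"
  shows "card (cone_params i \<sigma> J) = cone_dim i J" "(\<Sum>a<k i. a) \<le> \<Sum>J + (\<Sum>b\<in>{k i..<k m}. n - k (step i b))"
  using card_chart_set[OF assms] by (simp_all add: card_cone_params cone_dim_def)

lemma codim_cone:
  assumes i: "i \<in> {1..m}" "J \<in> ext_basis n (k i)" and j: "j \<in> {1..m}" "L \<in> ext_basis n (k j)"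
    and sub: "cone j L \<subset> (cone i J :: (nat \<times> nat set \<Rightarrow> 'a::field_char_0) set)"
    and dim: "cone_dim i J = Suc (cone_dim j L)"
  shows "codim (subtopology (zariski_affine (Sigma {1..m} (flag_basis n k))) (cone i J))
     (cone j L :: (nat \<times> nat set \<Rightarrow> 'a) set) = 1"
proof -
  let ?vs = "Sigma {1..m} (flag_basis n k)"
  obtain \<sigma> where \<sigma>: "\<sigma> permutes {..<n}" "\<sigma> ` {..<k i} = J"
    using ex_permutation[OF ext_basisD(1,2)[OF i(2)]] by blast
  obtain \<tau> where \<tau>: "\<tau> permutes {..<n}" "\<tau> ` {..<k j} = L"
    using ex_permutation[OF ext_basisD(1,2)[OF j(2)]] by blast
  obtain F where F: "\<forall>a<cone_dim j L. F a \<in> polyfun ?vs"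
    "alg_indep (cone j L :: (nat \<times> nat set \<Rightarrow> 'a) set) F (cone_dim j L)"
    using alg_indep_cone[OF j(1) \<tau>(1) j(2) \<tau>(2), where ?'a = 'a] cone_dim_eq(1)[OF j(1) \<tau>(1) j(2) \<tau>(2)]
    by auto
  show ?thesis
  proof (rule codim_eq_1)
    show "irreducible_closedin (subtopology (zariski_affine ?vs) (cone i J)) (cone j L :: (nat \<times> nat set \<Rightarrow> 'a) set)"
      using sub by (intro irreducible_cone j i) auto
    show "irreducible_closedin (subtopology (zariski_affine ?vs) (cone i J)) (cone i J :: (nat \<times> nat set \<Rightarrow> 'a) set)"
      by (intro irreducible_cone i) auto
    show "cone j L \<subset> (cone i J :: (nat \<times> nat set \<Rightarrow> 'a) set)" by (rule sub)
    show "alg_indep (cone j L :: (nat \<times> nat set \<Rightarrow> 'a) set) F (cone_dim j L)" by (rule F(2))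
    show "F a \<in> polyfun ?vs" if "a < cone_dim j L" for a using F(1) that by blast
    show "finite (cone_params i \<sigma> J)" by (rule finite_cone_params)
    show "card (cone_params i \<sigma> J) = Suc (cone_dim j L)" using cone_dim_eq(1)[OF i(1) \<sigma>(1) i(2) \<sigma>(2)] dim by simp
    show "dominated ?vs (cone_params i \<sigma> J)
      (\<lambda>z. pvec {i..m} (\<lambda>j. if j \<in> {i..m} then z (Inl j) else 0)
       (chart_matrix \<sigma> (chart_set i \<sigma> J) (\<lambda>t. z (Inr t))))
      (cone i J :: (nat \<times> nat set \<Rightarrow> 'a) set)"
      by (rule dominated_cone[OF i(1) \<sigma>(1) i(2) \<sigma>(2)])
  qed
qed

lemma cone_dim_lower:
  assumes i: "i \<in> {1..m}" and J: "J \<in> ext_basis n (k i)" and t: "t \<notin> J" "Suc t \<in> J"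
  shows "cone_dim i J = Suc (cone_dim i (insert t (J - {Suc t})))"
proof -
  let ?L = "insert t (J - {Suc t})"
  have L: "?L \<in> ext_basis n (k i)" by (rule lower_ext_basis(1)[OF J t])
  obtain \<tau> where \<tau>: "\<tau> permutes {..<n}" "\<tau> ` {..<k i} = ?L"
    using ex_permutation[OF ext_basisD(1,2)[OF L]] by blast
  have "\<Sum>?L = t + \<Sum>(J - {Suc t})" using t ext_basisD(3)[OF J] by (intro sum.insert) auto
  moreover have "\<Sum>J = Suc t + \<Sum>(J - {Suc t})" using t ext_basisD(3)[OF J] by (intro sum.remove) auto
  ultimately have "\<Sum>J = Suc (\<Sum>?L)" by simp
  then show ?thesis using cone_dim_eq(2)[OF i \<tau>(1) L \<tau>(2)] by (simp add: cone_dim_def)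
qed

text \<open>Adding the \<open>k (Suc i) - k i\<close> largest rows to \<open>J\<close> raises its
  sum by the number of free entries in the columns from \<open>k i\<close> to
  \<open>k (Suc i) - 1\<close> plus the growth of the triangular number. Everything cancels except
  the scalar of level \<open>i\<close>, which is lost.\<close>

lemma cone_dim_next:
  assumes i: "i \<in> {1..m}" "Suc i \<in> {1..m}" and J: "J \<in> ext_basis n (k i)"
    and top: "J \<inter> {n - (k (Suc i) - k i)..<n} = {}"
    and L: "L = J \<union> {n - (k (Suc i) - k i)..<n}" "L \<in> ext_basis n (k (Suc i))"
  shows "cone_dim i J = Suc (cone_dim (Suc i) L)"
proof -
  define d where "d = k (Suc i) - k i"
  have k: "k i < k (Suc i)" "k (Suc i) < n" using k_less[of i "Suc i"] k_less_n[of "Suc i"] i by auto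
  have km: "k (Suc i) \<le> k m" using k_le[of "Suc i" m] i by auto
  obtain \<sigma> where \<sigma>: "\<sigma> permutes {..<n}" "\<sigma> ` {..<k i} = J"
    using ex_permutation[OF ext_basisD(1,2)[OF J]] by blast
  obtain \<tau> where \<tau>: "\<tau> permutes {..<n}" "\<tau> ` {..<k (Suc i)} = L"
    using ex_permutation[OF ext_basisD(1,2)[OF L(2)]] by blast
  have "\<Sum>L = \<Sum>J + \<Sum>{n - d..<n}"
    unfolding L(1) d_def using top ext_basisD(3)[OF J] by (intro sum.union_disjoint) auto
  also have "\<Sum>{n - d..<n} = (\<Sum>a\<in>{k i..<k (Suc i)}. a + (n - k (Suc i)))"
  proof -
    have "{n - d..<n} = {k i + (n - k (Suc i))..<k (Suc i) + (n - k (Suc i))}" using k by (auto simp: d_def)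
    then show ?thesis using sum.shift_bounds_nat_ivl[of "\<lambda>x. x" "k i" "n - k (Suc i)" "k (Suc i)"] by simp
  qed
  also have "\<dots> = \<Sum>{k i..<k (Suc i)} + d * (n - k (Suc i))" by (simp add: sum.distrib d_def)
  finally have SL: "\<Sum>L = \<Sum>J + (\<Sum>{k i..<k (Suc i)} + d * (n - k (Suc i)))" .
  have Sa: "(\<Sum>a<k (Suc i). a) = (\<Sum>a<k i. a) + \<Sum>{k i..<k (Suc i)}"
    using sum.atLeastLessThan_concat[of 0 "k i" "k (Suc i)" "\<lambda>a. a"] k by (simp add: atLeast0LessThan)
  have "(\<Sum>b\<in>{k i..<k m}. n - k (step i b)) =
      (\<Sum>b\<in>{k i..<k (Suc i)}. n - k (step i b)) + (\<Sum>b\<in>{k (Suc i)..<k m}. n - k (step i b))"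
    by (rule sum.atLeastLessThan_concat[symmetric]) (use k km in auto)
  also have "(\<Sum>b\<in>{k i..<k (Suc i)}. n - k (step i b)) = (\<Sum>b\<in>{k i..<k (Suc i)}. n - k (Suc i))"
  proof (intro sum.cong refl)
    fix b assume b: "b \<in> {k i..<k (Suc i)}"
    have bm: "b < k m" using b km by auto
    have "step i b \<le> Suc i" using step_le(1)[of "Suc i" i b] b i by auto
    moreover have "step i b \<noteq> i" using step(2)[OF i(1) bm] b by auto
    ultimately have "step i b = Suc i" using step(1)[OF i(1) bm] by auto
    then show "n - k (step i b) = n - k (Suc i)" by simp
  qed
  also have "\<dots> = d * (n - k (Suc i))" by (simp add: d_def)
  also have "(\<Sum>b\<in>{k (Suc i)..<k m}. n - k (step i b)) = (\<Sum>b\<in>{k (Suc i)..<k m}. n - k (step (Suc i) b))"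
  proof (intro sum.cong refl)
    fix b assume b: "b \<in> {k (Suc i)..<k m}"
    have "i \<le> j \<and> b < k j \<longleftrightarrow> Suc i \<le> j \<and> b < k j" for j
      using b k by (cases "j = i") auto
    then show "n - k (step i b) = n - k (step (Suc i) b)" by (simp add: step_def)
  qed
  finally have SS: "(\<Sum>b\<in>{k i..<k m}. n - k (step i b)) =
     d * (n - k (Suc i)) + (\<Sum>b\<in>{k (Suc i)..<k m}. n - k (step (Suc i) b))" .
  show ?thesis
    using cone_dim_eq(2)[OF i(1) \<sigma>(1) J \<sigma>(2)] cone_dim_eq(2)[OF i(2) \<tau>(1) L(2) \<tau>(2)] SL Sa SS i
    by (simp add: cone_dim_def Suc_diff_le)
qed

end

section \<open>Schubert varieties are closed\<close>

lemma mdet_row_linear: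
  fixes g :: "nat \<times> nat \<Rightarrow> 'a::comm_ring_1"
  assumes a: "a < l" and row: "\<And>b. b < l \<Longrightarrow> g (e a, b) = (\<Sum>s\<in>A. y s * g (\<rho> s, b))"
  shows "mdet e g l = (\<Sum>s\<in>A. y s * mdet (e(a := \<rho> s)) g l)"
proof -
  define R where "R = (\<lambda>p. \<Prod>c\<in>{0..<l} - {a}. g (e c, p c))"
  have det: "mdet f g l = (\<Sum>p\<in>{p. p permutes {0..<l}}. signof p * (g (f a, p a) * R p))"
    if f: "\<And>c. c \<noteq> a \<Longrightarrow> f c = e c" for f
  proof -
    have "mdet f g l = (\<Sum>p\<in>{p. p permutes {0..<l}}. signof p *
        (\<Prod>c = 0..<l. mat l l (\<lambda>(a, b). g (f a, b)) $$ (c, p c)))"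
      unfolding mdet_def by (rule det_def') simp
    also have "\<dots> = (\<Sum>p\<in>{p. p permutes {0..<l}}. signof p * (g (f a, p a) * R p))"
    proof (intro sum.cong refl arg_cong2[where f = "(*)"])
      fix p assume "p \<in> {p. p permutes {0..<l}}"
      then have p: "p c < l" if "c < l" for c using that permutes_in_image[of p "{0..<l}" c] by simp
      have "(\<Prod>c = 0..<l. mat l l (\<lambda>(a, b). g (f a, b)) $$ (c, p c)) = (\<Prod>c = 0..<l. g (f c, p c))"
        using p by (intro prod.cong) auto
      also have "\<dots> = g (f a, p a) * (\<Prod>c\<in>{0..<l} - {a}. g (f c, p c))"
        using a by (intro prod.remove) auto
      also have "(\<Prod>c\<in>{0..<l} - {a}. g (f c, p c)) = R p"
        unfolding R_def using f by (intro prod.cong) auto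
      finally show "(\<Prod>c = 0..<l. mat l l (\<lambda>(a, b). g (f a, b)) $$ (c, p c)) = g (f a, p a) * R p" .
    qed
    finally show ?thesis .
  qed
  have "(\<Sum>s\<in>A. y s * mdet (e(a := \<rho> s)) g l) =
     (\<Sum>s\<in>A. \<Sum>p\<in>{p. p permutes {0..<l}}. signof p * (y s * g (\<rho> s, p a) * R p))"
    by (subst det) (auto simp: sum_distrib_left mult_ac)
  also have "\<dots> = (\<Sum>p\<in>{p. p permutes {0..<l}}. signof p * ((\<Sum>s\<in>A. y s * g (\<rho> s, p a)) * R p))"
    by (subst sum.swap) (simp add: sum_distrib_left sum_distrib_right)
  also have "\<dots> = (\<Sum>p\<in>{p. p permutes {0..<l}}. signof p * (g (e a, p a) * R p))"
  proof (intro sum.cong refl arg_cong2[where f = "(*)"])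
    fix p assume "p \<in> {p. p permutes {0..<l}}"
    then have "p a < l" using a permutes_in_image[of p "{0..<l}" a] by simp
    then show "(\<Sum>s\<in>A. y s * g (\<rho> s, p a)) = g (e a, p a)" using row by simp
  qed
  also have "\<dots> = mdet e g l" by (rule det[symmetric]) simp
  finally show ?thesis by simp
qed

lemma mdet_not_inj:
  assumes "\<not> inj_on e {..<l}"
  shows "mdet e g l = 0"
proof -
  obtain a b where ab: "a < l" "b < l" "a \<noteq> b" "e a = e b" using assms by (auto simp: inj_on_def)
  have "row (mat l l (\<lambda>(a, b). g (e a, b))) a = row (mat l l (\<lambda>(a, b). g (e a, b))) b"
    using ab by (intro eq_vecI) auto
  then show ?thesis unfolding mdet_def by (rule det_identical_rows[OF _ ab(3,1,2), rotated]) simp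
qed

text \<open>Expand the row \<open>f a0\<close> of \<open>g\<close> in terms of the rows \<open>e 0, \<dots>, e (q - 1)\<close> by Cramer's rule.\<close>

lemma mdet_exchange:
  fixes g :: "nat \<times> nat \<Rightarrow> 'a::field"
  assumes pq: "p \<le> q" and a0: "a0 < p" and nz: "mdet e g q \<noteq> 0"
  shows "mdet e g q * mdet f g p = (\<Sum>s<q. mdet (e(s := f a0)) g q * mdet (f(a0 := e s)) g p)"
proof -
  define H where "H = mat q q (\<lambda>(a, b). g (e a, b))"
  have H: "H \<in> carrier_mat q q" by (simp add: H_def)
  have det: "det H = mdet e g q" by (simp add: H_def mdet_def)
  define y where "y = (\<lambda>s. (\<Sum>b = 0..<q. g (f a0, b) * adj_mat H $$ (b, s)) / det H)"
  have row: "g (f a0, b) = (\<Sum>s<q. y s * g (e s, b))" if b: "b < q" for b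
  proof -
    have "(\<Sum>s<q. y s * g (e s, b)) =
        (\<Sum>s = 0..<q. \<Sum>c = 0..<q. g (f a0, c) * (adj_mat H $$ (c, s) * H $$ (s, b))) / det H"
      unfolding y_def sum_divide_distrib using b
      by (simp add: atLeast0LessThan H_def sum_distrib_right sum_divide_distrib mult.assoc)
    also have "(\<Sum>s = 0..<q. \<Sum>c = 0..<q. g (f a0, c) * (adj_mat H $$ (c, s) * H $$ (s, b))) =
       (\<Sum>c = 0..<q. g (f a0, c) * (adj_mat H * H) $$ (c, b))"
      using b H adj_mat(1)[OF H]
      by (subst sum.swap) (auto simp: scalar_prod_def sum_distrib_left intro!: sum.cong)
    also have "\<dots> = (\<Sum>c = 0..<q. if c = b then g (f a0, c) * det H else 0)"
      unfolding adj_mat(3)[OF H] using b by (intro sum.cong) auto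
    also have "\<dots> = g (f a0, b) * det H" using b by simp
    finally show ?thesis using nz det by simp
  qed
  \<comment> \<open>By linearity in row \<open>s\<close>, every term with
    \<open>t \<noteq> s\<close> repeats a row, so the modified minor isolates the coefficient
    \<open>y s\<close>.\<close>
  have "mdet (e(s := f a0)) g q = y s * mdet e g q" if s: "s < q" for s
  proof -
    have "mdet (e(s := f a0)) g q = (\<Sum>t<q. y t * mdet ((e(s := f a0))(s := e t)) g q)"
      using row by (intro mdet_row_linear[OF s]) simp
    also have "\<dots> = (\<Sum>t<q. if t = s then y s * mdet e g q else 0)"
    proof (intro sum.cong refl)
      fix t assume "t \<in> {..<q}"
      then have "\<not> inj_on (e(s := e t)) {..<q}" if "t \<noteq> s" using that s unfolding inj_on_def by auto
      then show "y t * mdet ((e(s := f a0))(s := e t)) g q = (if t = s then y s * mdet e g q else 0)"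
        using mdet_not_inj by auto
    qed
    finally show ?thesis using s by simp
  qed
  moreover have "mdet f g p = (\<Sum>s<q. y s * mdet (f(a0 := e s)) g p)"
    using row pq by (intro mdet_row_linear[OF a0]) auto
  ultimately show ?thesis by (simp add: sum_distrib_left mult_ac)
qed

context flag_data
begin

section \<open>Points at which all multihomogeneous equations of a stratum hold\<close>

context
  fixes i :: nat and J :: "nat set" and w :: "nat \<times> nat set \<Rightarrow> 'a::field_char_0"
  assumes i: "i \<in> {1..m}" and J: "J \<in> ext_basis n (k i)"
    and w: "w \<in> mp_coords (flag_basis n k) {i..m}"
    and van: "\<And>f d. f \<in> mhfun (Sigma {i..m} (flag_basis n k)) d \<Longrightarrow> \<forall>v\<in>cone i J. f v = 0 \<Longrightarrow> f w = 0"
begin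

text \<open>Among the non-zero coordinates of level \<open>j\<close>, take \<open>c\<close> with the
  largest intersection with \<open>C\<close>. If \<open>c\<close> had a row \<open>r\<close> outside
  \<open>C\<close>, the exchange identity would express the product of the coordinates
  \<open>C\<close> and \<open>c\<close> by terms whose level \<open>j\<close> index meets
  \<open>C\<close> in one more element; these vanish by maximality.\<close>

lemma nested_step:
  assumes j: "j \<in> {i..m}" "Suc j \<in> {i..m}" and \<sigma>: "\<sigma> permutes {..<n}"
    and nz: "w (Suc j, \<sigma> ` {..<k (Suc j)}) \<noteq> 0"
  shows "\<exists>c\<in>ext_basis n (k j). c \<subseteq> \<sigma> ` {..<k (Suc j)} \<and> w (j, c) \<noteq> 0"
proof -
  let ?p = "k j" and ?q = "k (Suc j)"
  define C where "C = \<sigma> ` {..<?q}"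
  have pq: "?p < ?q" "?q \<le> n" using k_less[of j "Suc j"] k_le_n[of "Suc j"] j i by auto
  have C: "C \<in> ext_basis n ?q" unfolding C_def by (rule ext_basis_image[OF \<sigma> pq(2)])
  have inj: "inj_on \<sigma> {..<?q}" by (rule permutes_inj_on[OF \<sigma>])
  have zero: "w (j, c) = 0" if "c \<notin> ext_basis n ?p" for c
    using w that by (auto simp: mp_coords_def affine_space_def mem_flag_basis)
  have "curry w j \<noteq> 0" using w j by (auto simp: mp_coords_def)
  then obtain c0 where c0: "w (j, c0) \<noteq> 0" by (auto simp: fun_eq_iff)
  define K where "K = {c \<in> ext_basis n ?p. w (j, c) \<noteq> 0}"
  have K: "finite K" "K \<noteq> {}" using finite_ext_basis[of n ?p] zero[of c0] c0 by (auto simp: K_def)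
  have "Max ((\<lambda>c. card (c \<inter> C)) ` K) \<in> (\<lambda>c. card (c \<inter> C)) ` K" using K by (intro Max_in) auto
  then obtain c where c0: "c \<in> K" "Max ((\<lambda>c. card (c \<inter> C)) ` K) = card (c \<inter> C)" by auto
  have c: "c \<in> K" "\<And>c'. c' \<in> K \<Longrightarrow> card (c' \<inter> C) \<le> card (c \<inter> C)"
    using c0 K(1) by (auto simp flip: c0(2) intro: Max_ge)
  then have cb: "c \<in> ext_basis n ?p" and cw: "w (j, c) \<noteq> 0" by (auto simp: K_def)
  note c' = ext_basisD[OF cb]
  have "c \<subseteq> C"
  proof (rule ccontr)
    assume "\<not> c \<subseteq> C"
    then obtain r where r: "r \<in> c" "r \<notin> C" by blast
    obtain a0 where a0: "a0 < ?p" "r = pick c a0" using c'(6) r(1) by blast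
    let ?e = "\<lambda>s. \<sigma>(s := r)" and ?f = "\<lambda>s. (pick c)(a0 := \<sigma> s)"
    let ?E = "\<lambda>s. insert r (C - {\<sigma> s})" and ?F = "\<lambda>s. insert (\<sigma> s) (c - {r})"
    \<comment> \<open>If \<open>\<sigma> s\<close> already lies in \<open>c\<close>, the exchanged
      minor has a repeated row; such terms are left out.\<close>
    define S where "S = {s. s < ?q \<and> \<sigma> s \<notin> c}"
    have inje: "inj_on (?e s) {..<?q}" "(?e s) ` {..<?q} = ?E s" "?E s \<in> ext_basis n ?q" if "s < ?q" for s
    proof -
      have "r \<in> \<sigma> ` {..<n}" using permutes_image[OF \<sigma>] r(1) c'(1) by auto
      then obtain a where a: "r = \<sigma> a" "a < n" by auto
      have "?q \<le> a" using r(2) a unfolding C_def by (metis image_eqI lessThan_iff not_le)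
      from swap_entry[OF \<sigma> that this a(2)] show "inj_on (?e s) {..<?q}" "(?e s) ` {..<?q} = ?E s" "?E s \<in> ext_basis n ?q"
        by (auto simp: a(1) C_def)
    qed
    have injf: "inj_on (?f s) {..<?p}" "(?f s) ` {..<?p} = ?F s" "?F s \<in> ext_basis n ?p" if "s \<in> S" for s
    proof -
      have s: "\<sigma> s \<notin> c" "\<sigma> s < n" using that pq(2) permutes_in_image[OF \<sigma>, of s] by (auto simp: S_def)
      have pc: "pick c x \<noteq> \<sigma> s" if "x < ?p" for x using imageI[of x "{..<?p}" "pick c"] c'(6) s(1) that by force
      have ne: "pick c b \<noteq> r" if "b < ?p" "b \<noteq> a0" for b using inj_onD[OF c'(5), of b a0] that a0 by auto
      show 1: "inj_on (?f s) {..<?p}"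
      proof (rule inj_onI)
        fix x y assume "x \<in> {..<?p}" "y \<in> {..<?p}" "(?f s) x = (?f s) y"
        then show "x = y" using inj_onD[OF c'(5), of x y] pc[of x] pc[of y] by (auto split: if_splits)
      qed
      show 2: "(?f s) ` {..<?p} = ?F s"
      proof -
        have "c = insert r (pick c ` ({..<?p} - {a0}))" using c'(6) a0 by (auto simp: image_iff)
        moreover have "r \<notin> pick c ` ({..<?p} - {a0})" using ne by auto
        ultimately have "c - {r} = pick c ` ({..<?p} - {a0})" by blast
        then show ?thesis using a0(1) by (auto simp: image_iff)
      qed
      have "card (?F s) = ?p" using card_image[OF 1] unfolding 2 by simp
      then show "?F s \<in> ext_basis n ?p" using s(2) c'(1) by (auto simp: ext_basis_def)
    qed
    \<comment> \<open>The exchange identity as an equation in the coordinates. The extra factor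
      \<open>v (Suc j, C)\<close> makes it hold on the cone also where the minor of \<open>C\<close>
      vanishes and \<open>mdet_exchange\<close> does not apply.\<close>
    define f where "f = (\<lambda>v :: nat \<times> nat set \<Rightarrow> 'a. v (Suc j, C) * (msign \<sigma> ?q * msign (pick c) ?p *
      (v (Suc j, C) * v (j, c)) -
      (\<Sum>s\<in>S. msign (?e s) ?q * msign (?f s) ?p * (v (Suc j, ?E s) * v (j, ?F s)))))"
    let ?d = "\<lambda>x. (if x = Suc j then 1 else 0) + (if x = j then 1 else 0) :: nat"
    have var: "(\<lambda>v. v (x, L)) \<in> mhfun (Sigma {i..m} (flag_basis n k)) (\<lambda>y. if y = x then 1 else 0)"
      if "x \<in> {i..m}" "L \<in> ext_basis n (k x)" for x L
      using mhfun_var[of "(x, L)" "Sigma {i..m} (flag_basis n k)"] that by (simp add: mem_flag_basis)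
    have mh: "(\<lambda>v. v (Suc j, L) * v (j, L')) \<in> mhfun (Sigma {i..m} (flag_basis n k)) ?d"
      if "L \<in> ext_basis n ?q" "L' \<in> ext_basis n ?p" for L L'
      by (rule mhfun_mult[OF var[OF j(2) that(1)] var[OF j(1) that(2)]])
    have "?E s \<in> ext_basis n ?q" if "s \<in> S" for s using inje(3)[of s] that by (simp add: S_def)
    then have "f \<in> mhfun (Sigma {i..m} (flag_basis n k)) (\<lambda>x. (if x = Suc j then 1 else 0) + ?d x)"
      unfolding f_def by (intro mhfun_mult[OF var[OF j(2) C]] mhfun_diff mhfun_cmult mhfun_sum mh C cb injf(3))
    moreover have "\<forall>v\<in>cone i J. f v = 0"
    proof
      fix v :: "nat \<times> nat set \<Rightarrow> 'a" assume "v \<in> cone i J"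
      then obtain l g where g: "v = pvec {i..m} l g" unfolding cone_def by blast
      have vq: "v (Suc j, L) = l (Suc j) * minor L g ?q" if "L \<in> ext_basis n ?q" for L
        using that j by (simp add: g pvec_apply)
      have vp: "v (j, L) = l j * minor L g ?p" if "L \<in> ext_basis n ?p" for L
        using that j by (simp add: g pvec_apply)
      have mC: "mdet \<sigma> g ?q = msign \<sigma> ?q * minor C g ?q" using msign(2)[OF inj, of g] by (simp add: C_def)
      have mc: "mdet (pick c) g ?p = msign (pick c) ?p * minor c g ?p"
        using msign(2)[OF c'(5), of g] by (simp only: c'(6))
      show "f v = 0"
      proof (cases "mdet \<sigma> g ?q = 0")
        case True
        then have "minor C g ?q = 0" using mC msign(1)[OF inj, where ?'a = 'a] by simp
        then show ?thesis using vq[OF C] by (simp add: f_def)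
      next
        case False
        have "msign \<sigma> ?q * msign (pick c) ?p * (minor C g ?q * minor c g ?p) =
            (msign \<sigma> ?q * minor C g ?q) * (msign (pick c) ?p * minor c g ?p)" by (simp only: mult_ac)
        also have "\<dots> = mdet \<sigma> g ?q * mdet (pick c) g ?p" by (simp only: mC[symmetric] mc[symmetric])
        also have "\<dots> = (\<Sum>s<?q. mdet (?e s) g ?q * mdet (?f s) g ?p)"
          using mdet_exchange[of ?p ?q a0 \<sigma> g "pick c"] pq(1) a0 False by simp
        also have "\<dots> = (\<Sum>s\<in>S. mdet (?e s) g ?q * mdet (?f s) g ?p)"
        proof (rule sum.mono_neutral_right)
          show "\<forall>s\<in>{..<?q} - S. mdet (?e s) g ?q * mdet (?f s) g ?p = 0"
          proof
            fix s assume s: "s \<in> {..<?q} - S"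
            then have "\<sigma> s \<in> c" "\<sigma> s \<noteq> r" using r(2) by (auto simp: S_def C_def)
            then obtain b where b: "b < ?p" "\<sigma> s = pick c b" using c'(6) by blast
            have "b \<noteq> a0" using b(2) a0(2) \<open>\<sigma> s \<noteq> r\<close> by auto
            then have "\<not> inj_on (?f s) {..<?p}" using b a0(1) unfolding inj_on_def by auto
            then show "mdet (?e s) g ?q * mdet (?f s) g ?p = 0" by (simp add: mdet_not_inj)
          qed
        qed (auto simp: S_def)
        also have "\<dots> = (\<Sum>s\<in>S. msign (?e s) ?q * msign (?f s) ?p * (minor (?E s) g ?q * minor (?F s) g ?p))"
        proof (intro sum.cong refl)
          fix s assume s: "s \<in> S"
          then have sq: "s < ?q" by (simp add: S_def)
          show "mdet (?e s) g ?q * mdet (?f s) g ?p =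
              msign (?e s) ?q * msign (?f s) ?p * (minor (?E s) g ?q * minor (?F s) g ?p)"
            using msign(2)[OF inje(1)[OF sq], of g] msign(2)[OF injf(1)[OF s], of g]
            unfolding inje(2)[OF sq] injf(2)[OF s] by simp
        qed
        finally have id: "msign \<sigma> ?q * msign (pick c) ?p * (minor C g ?q * minor c g ?p) =
          (\<Sum>s\<in>S. msign (?e s) ?q * msign (?f s) ?p * (minor (?E s) g ?q * minor (?F s) g ?p))"
          .
        have "(\<Sum>s\<in>S. msign (?e s) ?q * msign (?f s) ?p * (v (Suc j, ?E s) * v (j, ?F s))) =
           l (Suc j) * l j * (\<Sum>s\<in>S. msign (?e s) ?q * msign (?f s) ?p * (minor (?E s) g ?q * minor (?F s) g ?p))"
          unfolding sum_distrib_left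
        proof (intro sum.cong refl)
          fix s assume s: "s \<in> S"
          then have "s < ?q" by (simp add: S_def)
          then show "msign (?e s) ?q * msign (?f s) ?p * (v (Suc j, ?E s) * v (j, ?F s)) =
            l (Suc j) * l j * (msign (?e s) ?q * msign (?f s) ?p * (minor (?E s) g ?q * minor (?F s) g ?p))"
            by (simp add: vq[OF inje(3)] vp[OF injf(3)[OF s]])
        qed
        then show ?thesis unfolding f_def id[symmetric] vq[OF C] vp[OF cb] by simp
      qed
    qed
    ultimately have "f w = 0" by (rule van)
    moreover have "w (j, ?F s) = 0" if s: "s \<in> S" for s
    proof (rule ccontr)
      assume "w (j, ?F s) \<noteq> 0"
      then have "?F s \<in> K" using injf(3)[OF s] by (simp add: K_def)
      then have "card (?F s \<inter> C) \<le> card (c \<inter> C)" by (rule c(2))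
      moreover have "?F s \<inter> C = insert (\<sigma> s) (c \<inter> C)" using s r(2) by (auto simp: S_def C_def)
      moreover have "card (insert (\<sigma> s) (c \<inter> C)) = Suc (card (c \<inter> C))"
        using s c'(3) by (intro card_insert_disjoint) (auto simp: S_def)
      ultimately show False by simp
    qed
    ultimately show False
      using nz cw msign(1)[OF inj, where ?'a = 'a] msign(1)[OF c'(5), where ?'a = 'a]
      by (simp add: f_def C_def[symmetric])
  qed
  then show ?thesis using cb cw unfolding C_def by blast
qed

text \<open>Induction from level \<open>m\<close> downwards: \<open>nested_step\<close> supplies the
  subset for level \<open>j\<close>, and rearranging the first \<open>k (Suc j)\<close> columns
  moves it to the front without affecting higher levels.\<close>

lemma nested_chart: "\<exists>\<sigma>. \<sigma> permutes {..<n} \<and> (\<forall>j\<in>{i..m}. w (j, \<sigma> ` {..<k j}) \<noteq> 0)"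
proof -
  have "\<exists>\<sigma>. \<sigma> permutes {..<n} \<and> (\<forall>j\<in>{m - t..m}. w (j, \<sigma> ` {..<k j}) \<noteq> 0)" if "t \<le> m - i" for t
    using that
  proof (induction t)
    case 0
    have "curry w m \<noteq> 0" using w i by (auto simp: mp_coords_def)
    then obtain c where c: "w (m, c) \<noteq> 0" by (auto simp: fun_eq_iff)
    then have "c \<in> ext_basis n (k m)"
      using w by (auto simp: mp_coords_def affine_space_def mem_flag_basis)
    then obtain \<sigma> where "\<sigma> permutes {..<n}" "\<sigma> ` {..<k m} = c"
      using ex_permutation[OF ext_basisD(1,2)] by blast
    then show ?case using c by (intro exI[of _ \<sigma>]) auto
  next
    case (Suc t)
    define j where "j = m - Suc t"
    have j: "j \<in> {i..m}" "Suc j \<in> {i..m}" "m - t = Suc j" using Suc.prems i by (auto simp: j_def)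
    obtain \<sigma> where \<sigma>: "\<sigma> permutes {..<n}" "\<forall>x\<in>{Suc j..m}. w (x, \<sigma> ` {..<k x}) \<noteq> 0"
      using Suc.IH Suc.prems j(3) by auto
    let ?p = "k j" and ?q = "k (Suc j)"
    have pq: "?p < ?q" "?q \<le> n" using k_less[of j "Suc j"] k_le_n[of "Suc j"] j i by auto
    obtain c where c: "c \<in> ext_basis n ?p" "c \<subseteq> \<sigma> ` {..<?q}" "w (j, c) \<noteq> 0"
      using nested_step[OF j(1,2) \<sigma>(1)] \<sigma>(2) j by auto
    define D where "D = {a. a < ?q \<and> \<sigma> a \<in> c}"
    have D: "\<sigma> ` D = c" using c(2) by (auto simp: D_def)
    then have "card D = ?p" using c(1) card_image[OF permutes_inj_on[OF \<sigma>(1)], of D] by (simp add: ext_basis_def)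
    moreover have "D \<subseteq> {..<?q}" by (auto simp: D_def)
    ultimately obtain \<tau> where \<tau>: "\<tau> permutes {..<?q}" "\<tau> ` {..<?p} = D"
      using ex_permutation[of D ?q ?p] by blast
    have "\<tau> permutes {..<x}" if "?q \<le> x" for x by (rule permutes_subset[OF \<tau>(1)]) (use that in auto)
    then have im: "\<tau> ` {..<x} = {..<x}" if "?q \<le> x" for x using that permutes_image by blast
    have cmp: "(\<sigma> \<circ> \<tau>) ` X = \<sigma> ` (\<tau> ` X)" for X by (simp only: image_comp)
    have "\<sigma> \<circ> \<tau> permutes {..<n}"
      using permutes_compose[OF permutes_subset[OF \<tau>(1)] \<sigma>(1)] pq(2) by auto
    moreover have "w (x, (\<sigma> \<circ> \<tau>) ` {..<k x}) \<noteq> 0" if x: "x \<in> {j..m}" for x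
    proof (cases "x = j")
      case True
      then show ?thesis using c(3) unfolding True cmp \<tau>(2) D by simp
    next
      case False
      then have "x \<in> {Suc j..m}" using x by auto
      moreover from this have "?q \<le> k x" using k_le[of "Suc j" x] by auto
      ultimately show ?thesis unfolding cmp using \<sigma>(2) im by simp
    qed
    ultimately show ?case unfolding j_def[symmetric] by blast
  qed
  from this[of "m - i"] show ?thesis using i by auto
qed

text \<open>Where \<open>D\<close> is non-zero, the function is a fraction with denominator
  \<open>D ^ N\<close> and multidegree zero. Such fractions are closed under sums and products, so
  an identity between minors of chart entries can be turned into a multihomogeneous equation, the
  only kind known to hold at \<open>w\<close>.\<close>

definition rational_deg0 ::
    "((nat \<times> nat set \<Rightarrow> 'a) \<Rightarrow> 'a) \<Rightarrow> ((nat \<times> nat set \<Rightarrow> 'a) \<Rightarrow> 'a) \<Rightarrow> bool" where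
  "rational_deg0 D f \<longleftrightarrow> (\<exists>N P. P \<in> mhfun (Sigma {i..m} (flag_basis n k)) (\<lambda>j. N * (if j \<in> {i..m} then 1 else 0)) \<and>
     (\<forall>v. D v \<noteq> 0 \<longrightarrow> f v * D v ^ N = P v))"

context
  fixes D :: "(nat \<times> nat set \<Rightarrow> 'a) \<Rightarrow> 'a"
  assumes D: "D \<in> mhfun (Sigma {i..m} (flag_basis n k)) (\<lambda>j. if j \<in> {i..m} then 1 else 0)"
begin

lemma rational_deg0_const: "rational_deg0 D (\<lambda>_. c)"
  unfolding rational_deg0_def using mhfun_const[of c] by (intro exI[of _ 0] exI[of _ "\<lambda>_. c"]) simp

lemma rational_deg0_add:
  assumes "rational_deg0 D f" "rational_deg0 D g"
  shows "rational_deg0 D (\<lambda>v. f v + g v)"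
proof -
  let ?d = "\<lambda>N j. N * (if j \<in> {i..m} then 1 else 0) :: nat" and ?vs = "Sigma {i..m} (flag_basis n k)"
  obtain N P where P: "P \<in> mhfun ?vs (?d N)" "\<And>v. D v \<noteq> 0 \<Longrightarrow> f v * D v ^ N = P v"
    using assms(1) unfolding rational_deg0_def by auto
  obtain M Q where Q: "Q \<in> mhfun ?vs (?d M)" "\<And>v. D v \<noteq> 0 \<Longrightarrow> g v * D v ^ M = Q v"
    using assms(2) unfolding rational_deg0_def by auto
  have "(\<lambda>v. P v * D v ^ M + Q v * D v ^ N) \<in> mhfun ?vs (?d (N + M))"
    by (intro mhfun_add mhfun_mult'[OF P(1) mhfun_power[OF D]] mhfun_mult'[OF Q(1) mhfun_power[OF D]])
      (auto simp: algebra_simps)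
  moreover have "(f v + g v) * D v ^ (N + M) = P v * D v ^ M + Q v * D v ^ N" if "D v \<noteq> 0" for v
    unfolding P(2)[OF that, symmetric] Q(2)[OF that, symmetric] power_add by (simp add: algebra_simps)
  ultimately show ?thesis unfolding rational_deg0_def
    by (intro exI[of _ "N + M"] exI[of _ "\<lambda>v. P v * D v ^ M + Q v * D v ^ N"]) simp
qed

lemma rational_deg0_mult:
  assumes "rational_deg0 D f" "rational_deg0 D g"
  shows "rational_deg0 D (\<lambda>v. f v * g v)"
proof -
  let ?d = "\<lambda>N j. N * (if j \<in> {i..m} then 1 else 0) :: nat" and ?vs = "Sigma {i..m} (flag_basis n k)"
  obtain N P where P: "P \<in> mhfun ?vs (?d N)" "\<And>v. D v \<noteq> 0 \<Longrightarrow> f v * D v ^ N = P v"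
    using assms(1) unfolding rational_deg0_def by auto
  obtain M Q where Q: "Q \<in> mhfun ?vs (?d M)" "\<And>v. D v \<noteq> 0 \<Longrightarrow> g v * D v ^ M = Q v"
    using assms(2) unfolding rational_deg0_def by auto
  have "(\<lambda>v. P v * Q v) \<in> mhfun ?vs (?d (N + M))"
    by (intro mhfun_mult'[OF P(1) Q(1)]) (auto simp: algebra_simps)
  moreover have "(f v * g v) * D v ^ (N + M) = P v * Q v" if "D v \<noteq> 0" for v
    unfolding P(2)[OF that, symmetric] Q(2)[OF that, symmetric] power_add by (simp add: algebra_simps)
  ultimately show ?thesis unfolding rational_deg0_def
    by (intro exI[of _ "N + M"] exI[of _ "\<lambda>v. P v * Q v"]) simp
qed

lemma rational_deg0_sum: "(\<And>x. x \<in> A \<Longrightarrow> rational_deg0 D (f x)) \<Longrightarrow> rational_deg0 D (\<lambda>v. \<Sum>x\<in>A. f x v)"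
  by (induction A rule: infinite_finite_induct) (auto intro: rational_deg0_const rational_deg0_add)

lemma rational_deg0_prod: "(\<And>x. x \<in> A \<Longrightarrow> rational_deg0 D (f x)) \<Longrightarrow> rational_deg0 D (\<lambda>v. \<Prod>x\<in>A. f x v)"
  by (induction A rule: infinite_finite_induct) (auto intro: rational_deg0_const rational_deg0_mult)

lemma rational_deg0_mdet:
  assumes "\<And>p. rational_deg0 D (\<lambda>v. g v p)"
  shows "rational_deg0 D (\<lambda>v. mdet e (g v) l)"
proof -
  have "(\<lambda>v. mdet e (g v) l) =
     (\<lambda>v. \<Sum>p | p permutes {0..<l}. signof p * (\<Prod>a = 0..<l. g v (e a, p a)))"
    unfolding mdet_def by (auto simp: fun_eq_iff det_def'[of _ l] permutes_in_image intro!: sum.cong prod.cong)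
  moreover have "rational_deg0 D \<dots>"
    by (intro rational_deg0_sum rational_deg0_mult rational_deg0_const rational_deg0_prod assms)
  ultimately show ?thesis by simp
qed

end

text \<open>In the chart, the ratio of a coordinate to the chart coordinate of its level is, up to a
  factor, a minor of the chart matrix, whose entries are themselves such ratios. Cleared of
  denominators these identities hold at \<open>w\<close> and exhibit it as the vector of a chart
  matrix; its vanishing coordinates then place it in \<open>cone i J\<close>.\<close>

lemma mem_cone: "w \<in> cone i J"
proof -
  obtain \<sigma> where \<sigma>: "\<sigma> permutes {..<n}" and nz: "\<And>j. j \<in> {i..m} \<Longrightarrow> w (j, \<sigma> ` {..<k j}) \<noteq> 0"
    using nested_chart by blast
  let ?vs = "Sigma {i..m} (flag_basis n k)" and ?T = "chart_set i \<sigma> J" and ?c = "\<lambda>j. \<sigma> ` {..<k j}"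
  have c: "?c j \<in> ext_basis n (k j)" if "j \<in> {i..m}" for j
    using that i k_le_n[of j] by (intro ext_basis_image[OF \<sigma>]) auto
  have var: "(\<lambda>v. v (x, L)) \<in> mhfun ?vs (\<lambda>y. if y = x then 1 else 0)"
    if "x \<in> {i..m}" "L \<in> ext_basis n (k x)" for x L
    using mhfun_var[of "(x, L)" ?vs] that by (simp add: mem_flag_basis)
  define D where "D = (\<lambda>v :: nat \<times> nat set \<Rightarrow> 'a. \<Prod>j\<in>{i..m}. v (j, ?c j))"
  have D: "D \<in> mhfun ?vs (\<lambda>j. if j \<in> {i..m} then 1 else 0)"
  proof -
    have "D \<in> mhfun ?vs (\<lambda>y. \<Sum>j\<in>{i..m}. if y = j then 1 else 0)"
      unfolding D_def by (intro mhfun_prod var c)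
    then show ?thesis by simp
  qed
  have ratio: "rational_deg0 D (\<lambda>v. v (j, L) / v (j, ?c j))" if j: "j \<in> {i..m}" "L \<in> ext_basis n (k j)" for j L
  proof -
    let ?P = "\<lambda>v :: nat \<times> nat set \<Rightarrow> 'a. v (j, L) * (\<Prod>x\<in>{i..m} - {j}. v (x, ?c x))"
    have "?P \<in> mhfun ?vs (\<lambda>x. 1 * (if x \<in> {i..m} then 1 else 0))"
    proof (rule mhfun_mult'[OF var[OF j]])
      show "(\<lambda>v. \<Prod>x\<in>{i..m} - {j}. v (x, ?c x)) \<in> mhfun ?vs (\<lambda>y. \<Sum>x\<in>{i..m} - {j}. if y = x then 1 else 0)"
        by (intro mhfun_prod var c) auto
    qed (use j in auto)
    moreover have "v (j, L) / v (j, ?c j) * D v ^ 1 = ?P v" if "D v \<noteq> 0" for v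
    proof -
      have "D v = v (j, ?c j) * (\<Prod>x\<in>{i..m} - {j}. v (x, ?c x))"
        unfolding D_def using j by (intro prod.remove) auto
      then show ?thesis using that by (auto simp: D_def)
    qed
    ultimately show ?thesis unfolding rational_deg0_def by blast
  qed
  define x where "x = (\<lambda>(v :: nat \<times> nat set \<Rightarrow> 'a) t. v (chart_index i \<sigma> t) /
     v (fst (chart_index i \<sigma> t), ?c (fst (chart_index i \<sigma> t))) * inverse (chart_coeff i \<sigma> t))"
  define N where "N = (\<lambda>v. chart_matrix \<sigma> ?T (x v))"
  have N: "rational_deg0 D (\<lambda>v. N v p)" for p
  proof (cases "(inv_into UNIV \<sigma> (fst p), snd p) \<in> ?T")
    case True
    let ?t = "(inv_into UNIV \<sigma> (fst p), snd p)"
    obtain j L where jL: "chart_index i \<sigma> ?t = (j, L)" by (cases "chart_index i \<sigma> ?t")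
    have "(j, L) \<in> ?vs" using chart_index_mem[OF i \<sigma>, of ?t] chart_set_subset True jL by auto
    then have "rational_deg0 D (\<lambda>v. v (j, L) / v (j, ?c j) * inverse (chart_coeff i \<sigma> ?t))"
      by (intro rational_deg0_mult[OF D] ratio rational_deg0_const[OF D]) (auto simp: mem_flag_basis)
    moreover have "(\<lambda>v. N v p) = (\<lambda>v. v (j, L) / v (j, ?c j) * inverse (chart_coeff i \<sigma> ?t))"
      using True jL by (simp add: N_def chart_matrix_def x_def case_prod_beta)
    ultimately show ?thesis by simp
  next
    case False
    then have "(\<lambda>v. N v p) = (\<lambda>v. if fst p = \<sigma> (snd p) then 1 else 0)"
      by (auto simp: N_def chart_matrix_def case_prod_beta)
    then show ?thesis using rational_deg0_const[OF D] by simp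
  qed
  have eq: "w (j, L) / w (j, ?c j) = msign \<sigma> (k j) * minor L (N w) (k j)"
    if j: "j \<in> {i..m}" and L: "L \<in> ext_basis n (k j)" for j L
  proof -
    define f where "f = (\<lambda>v. v (j, L) / v (j, ?c j) + - 1 * (msign \<sigma> (k j) * minor L (N v) (k j)))"
    have "rational_deg0 D f"
      unfolding f_def
      by (intro rational_deg0_add[OF D] rational_deg0_mult[OF D] ratio j L rational_deg0_const[OF D] rational_deg0_mdet[OF D] N)
    then obtain M P where P: "P \<in> mhfun ?vs (\<lambda>j. M * (if j \<in> {i..m} then 1 else 0))"
      "\<And>v. D v \<noteq> 0 \<Longrightarrow> f v * D v ^ M = P v" unfolding rational_deg0_def by auto
    \<comment> \<open>\<open>P\<close> represents \<open>f\<close> only where \<open>D\<close> is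
      non-zero; the factor \<open>D\<close> covers the rest of the cone.\<close>
    have "\<forall>v\<in>cone i J. D v * P v = 0"
    proof
      fix v :: "nat \<times> nat set \<Rightarrow> 'a" assume v: "v \<in> cone i J"
      show "D v * P v = 0"
      proof (cases "D v = 0")
        case False
        then have vnz: "v (j, ?c j) \<noteq> 0" if "j \<in> {i..m}" for j using that by (auto simp: D_def)
        obtain y l where y: "v = pvec {i..m} l (chart_matrix \<sigma> ?T y)"
          using cone_chart_matrix[OF i \<sigma> J v vnz] by blast
        define l' where "l' = (\<lambda>j. l j / msign \<sigma> (k j))"
        have ms: "(msign \<sigma> (k j) :: 'a) \<noteq> 0" for j by (rule msign(1)[OF permutes_inj_on[OF \<sigma>]])
        have l: "l = (\<lambda>j. l' j * msign \<sigma> (k j))" using ms by (simp add: l'_def)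
        have vc: "v (j, ?c j) = l' j" if "j \<in> {i..m}" for j
          using that c[OF that] by (simp add: y pvec_apply minor_chart_matrix[OF i \<sigma> chart_set_subset] l'_def)
        have "x v t = y t" if t: "t \<in> ?T" for t
        proof -
          have mem: "fst (chart_index i \<sigma> t) \<in> {i..m}"
            using chart_index_mem[OF i \<sigma>, of t] chart_set_subset t by fastforce
          have "v (chart_index i \<sigma> t) = l' (fst (chart_index i \<sigma> t)) * (chart_coeff i \<sigma> t * y t)"
            unfolding y l by (rule pvec_chart_index(1)[OF i \<sigma> chart_set_subset t])
          then show ?thesis
            using vc[OF mem] vnz[OF mem] pvec_chart_index(2)[OF i \<sigma> chart_set_subset t, where ?'a = 'a]
            by (simp add: x_def)
        qed
        then have "N v = chart_matrix \<sigma> ?T y" unfolding N_def by (intro chart_matrix_cong)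
        then have "v (j, L) = l j * minor L (N v) (k j)" using j L by (simp add: y pvec_apply)
        then have "f v = 0" using vc[OF j] vnz[OF j] ms[of j] by (simp add: f_def l'_def field_simps)
        then show ?thesis using P(2)[OF False] by simp
      qed simp
    qed
    then have "D w * P w = 0" by (rule van[OF mhfun_mult[OF D P(1)]])
    moreover have "D w \<noteq> 0" using nz by (simp add: D_def)
    ultimately have "f w = 0" using P(2)[of w] by simp
    then show ?thesis by (simp add: f_def)
  qed
  have wz: "w p = 0" if "p \<notin> ?vs" for p using w that unfolding mp_coords_def affine_space_def by blast
  have "w = pvec {i..m} (\<lambda>j. w (j, ?c j) * msign \<sigma> (k j)) (N w)"
  proof
    fix p :: "nat \<times> nat set"
    obtain j L where p: "p = (j, L)" by (cases p)
    show "w p = pvec {i..m} (\<lambda>j. w (j, ?c j) * msign \<sigma> (k j)) (N w) p"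
    proof (cases "p \<in> ?vs")
      case True
      then have "j \<in> {i..m}" "L \<in> ext_basis n (k j)" by (auto simp: p mem_flag_basis)
      then show ?thesis using eq[of j L] nz[of j] by (simp add: p pvec_apply field_simps)
    next
      case False
      then show ?thesis using wz[OF False] by (auto simp: p pvec_def)
    qed
  qed
  moreover have "pvec {i..m} (\<lambda>j. w (j, ?c j) * msign \<sigma> (k j)) (N w) \<in> cone i J"
  proof (rule cone_vanishI[OF i J])
    show "det (mat n n (N w)) \<noteq> 0" unfolding N_def by (rule det_chart_matrix[OF i \<sigma> chart_set_subset])
    fix L assume L: "L \<in> ext_basis n (k i)" "minor L (N w) (k i) \<noteq> 0"
    have ii: "i \<in> {i..m}" using i by auto
    have "(msign \<sigma> (k i) :: 'a) \<noteq> 0" by (rule msign(1)[OF permutes_inj_on[OF \<sigma>]])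
    then have wL: "w (i, L) \<noteq> 0" using eq[OF ii L(1)] L(2) by auto
    show "L \<sqsubseteq> J"
    proof (rule ccontr)
      assume "\<not> L \<sqsubseteq> J"
      then have "\<forall>v\<in>cone i J. v (i, L) = (0 :: 'a)" using cone_coordD(3)[OF _ _ J i] by blast
      then have "w (i, L) = 0" by (rule van[OF var[OF ii L(1)]])
      then show False using wL by simp
    qed
  qed
  ultimately show ?thesis by simp
qed

end

lemma closedin_Xc:
  assumes i: "i \<in> {1..m}" and J: "J \<in> ext_basis n (k i)"
  shows "closedin (zariski_mp (flag_basis n k) {i..m}) (Xc i J :: (nat \<Rightarrow> (nat set \<Rightarrow> 'a::field_char_0) set) set)"
proof (rule closedin_zariski_mpI)
  show "Xc i J \<subseteq> mp_point {i..m} ` (mp_coords (flag_basis n k) {i..m} :: (nat \<times> nat set \<Rightarrow> 'a) set)"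
  proof
    fix y :: "nat \<Rightarrow> (nat set \<Rightarrow> 'a) set" assume "y \<in> Xc i J"
    then obtain g where "y = mp_point {i..m} (pvec {i..m} (\<lambda>_. 1) g)"
      "pvec {i..m} (\<lambda>_. 1) g \<in> mp_coords (flag_basis n k) {i..m}" by (rule Xc_elim[OF _ i])
    then show "y \<in> mp_point {i..m} ` mp_coords (flag_basis n k) {i..m}" by blast
  qed
  fix w :: "nat \<times> nat set \<Rightarrow> 'a"
  assume w: "w \<in> mp_coords (flag_basis n k) {i..m}" and notin: "mp_point {i..m} w \<notin> Xc i J"
  show "\<exists>f d. f \<in> mhfun (Sigma {i..m} (flag_basis n k)) d \<and> f w \<noteq> 0 \<and>
    (\<forall>v\<in>mp_coords (flag_basis n k) {i..m}. mp_point {i..m} v \<in> Xc i J \<longrightarrow> f v = 0)" (is ?ex)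
  proof (rule ccontr)
    assume none: "\<not> ?ex"
    have "w \<in> cone i J"
    proof (rule mem_cone[OF i J w], rule ccontr)
      fix f d assume f: "f \<in> mhfun (Sigma {i..m} (flag_basis n k)) d" "\<forall>v\<in>cone i J. f v = 0" "f w \<noteq> 0"
      have "\<forall>v\<in>mp_coords (flag_basis n k) {i..m}. mp_point {i..m} v \<in> Xc i J \<longrightarrow> f v = 0"
        using f(2) mp_point_Xc_iff_cone by blast
      with f(1,3) have ?ex by (intro exI[of _ f] exI[of _ d] conjI)
      with none show False by (rule notE)
    qed
    then show False using notin mp_point_Xc_iff_cone[OF w] by simp
  qed
qed simp

end

section \<open>Cosets of the Weyl group\<close>

text \<open>Inversions of \<open>u\<close> inject into those of the product: a pair is moved by the
  transposition if its order is preserved, and kept otherwise. The pair \<open>(a, b)\<close> is a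
  new inversion outside the image.\<close>

lemma transpose_greater_length:
  assumes u: "u permutes {..<n}" and ab: "a < b" "b < n" "u a < u b"
  shows "perm_length n u < perm_length n (u \<circ> Transposition.transpose a b)"
proof -
  let ?t = "Transposition.transpose a b" and ?v = "u \<circ> Transposition.transpose a b"
  let ?I = "\<lambda>w. {(x, y). x < y \<and> y < n \<and> w y < w x}"
  have fin: "finite (?I w)" for w :: "nat \<Rightarrow> nat"
    by (rule finite_subset[of _ "{..<n} \<times> {..<n}"]) auto
  have inj: "u x = u y \<longleftrightarrow> x = y" for x y using permutes_inj[OF u] by (auto dest: injD)
  define F where "F = (\<lambda>(x, y). if ?t x < ?t y then (?t x, ?t y) else (x, y))"
  have tn: "?t x < n" if "x < n" for x using that ab by (auto simp: transpose_def)
  have key: "?v y < ?v x" if "(x, y) \<in> ?I u" "\<not> ?t x < ?t y" for x y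
    using that ab by (auto simp: transpose_def split: if_splits)
  have sub: "F ` ?I u \<subseteq> ?I ?v"
  proof
    fix z assume "z \<in> F ` ?I u"
    then obtain x y where xy: "(x, y) \<in> ?I u" "z = F (x, y)" by auto
    then show "z \<in> ?I ?v" using key[OF xy(1)] tn[of y] by (auto simp: F_def)
  qed
  have inv: "F z = F z' \<Longrightarrow> z = z'" if z: "z \<in> ?I u" "z' \<in> ?I u" for z z'
  proof -
    obtain x y x' y' where xy: "z = (x, y)" "z' = (x', y')" by (cases z, cases z')
    assume eq: "F z = F z'"
    have ttn: "?t (?t x) = x" for x by simp
    consider "?t x < ?t y" "?t x' < ?t y'" | "?t x < ?t y" "\<not> ?t x' < ?t y'"
      | "\<not> ?t x < ?t y" "?t x' < ?t y'" | "\<not> ?t x < ?t y" "\<not> ?t x' < ?t y'" by blast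
    then show "z = z'"
    proof cases
      case 1
      then have "?t x = ?t x'" "?t y = ?t y'" using eq by (auto simp: F_def xy)
      then show ?thesis using ttn xy by metis
    next
      case 2
      then have "x' = ?t x" "y' = ?t y" using eq by (auto simp: F_def xy)
      then show ?thesis using 2 z xy by simp
    next
      case 3
      then have "x = ?t x'" "y = ?t y'" using eq by (auto simp: F_def xy)
      then show ?thesis using 3 z xy by simp
    next
      case 4
      then show ?thesis using eq by (auto simp: F_def xy)
    qed
  qed
  have "(a, b) \<in> ?I ?v" using ab by simp
  moreover have "(a, b) \<notin> F ` ?I u"
  proof
    assume "(a, b) \<in> F ` ?I u"
    then obtain x y where xy: "(x, y) \<in> ?I u" "F (x, y) = (a, b)" by auto
    show False
    proof (cases "?t x < ?t y")
      case True
      then have "?t x = a" "?t y = b" using xy(2) by (auto simp: F_def)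
      then have "x = b" "y = a" by (auto simp: transpose_eq_iff)
      then show False using xy(1) ab by auto
    next
      case False
      then show False using xy ab by (auto simp: F_def)
    qed
  qed
  ultimately have "F ` ?I u \<subset> ?I ?v" using sub by blast
  then have "card (F ` ?I u) < card (?I ?v)" by (rule psubset_card_mono[OF fin])
  moreover have "card (F ` ?I u) = card (?I u)" by (rule card_image) (use inv in \<open>auto intro!: inj_onI\<close>)
  ultimately show ?thesis by (simp add: perm_length_def)
qed

lemma transpose_initial_segment:
  fixes u :: "nat \<Rightarrow> nat"
  assumes u: "u permutes {..<n}" and ab: "a < b" "b < n"
  shows "(u \<circ> Transposition.transpose a b) ` {..<l} =
    (if a < l \<and> l \<le> b then insert (u b) (u ` {..<l} - {u a}) else u ` {..<l})"
proof (cases "a < l \<and> l \<le> b")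
  case True
  have inj: "u x = u y \<longleftrightarrow> x = y" for x y using permutes_inj[OF u] by (auto dest: injD)
  have "Transposition.transpose a b ` ({..<l} - {a}) = (\<lambda>x. x) ` ({..<l} - {a})"
    using True by (intro image_cong) (auto simp: transpose_def)
  moreover have "{..<l} = insert a ({..<l} - {a})" using True by auto
  ultimately have "Transposition.transpose a b ` {..<l} = insert b ({..<l} - {a})"
    by (metis image_ident image_insert transpose_apply_first)
  then have "(u \<circ> Transposition.transpose a b) ` {..<l} = u ` insert b ({..<l} - {a})"
    by (metis image_comp)
  also have "\<dots> = insert (u b) (u ` {..<l} - {u a})" by (auto simp: inj)
  finally show ?thesis using True by simp
next
  case False
  then have "Transposition.transpose a b ` {..<l} = {..<l}"
    using ab by (intro transpose_image_eq) auto
  then have "(u \<circ> Transposition.transpose a b) ` {..<l} = u ` {..<l}" by (metis image_comp)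
  then show ?thesis unfolding if_not_P[OF False] .
qed

lemma transpose_permutes:
  fixes u :: "nat \<Rightarrow> nat"
  assumes "u permutes {..<n}" "a < n" "b < n"
  shows "u \<circ> Transposition.transpose a b permutes {..<n}"
  using assms by (intro permutes_compose[OF permutes_swap_id]) auto

text \<open>For \<open>a < b\<close>, growing length forces \<open>u a < u b\<close> by
  \<open>transpose_greater_length\<close>; an initial segment separating \<open>a\<close> and
  \<open>b\<close> then exchanges \<open>u a\<close> for the larger \<open>u b\<close>.\<close>

lemma bruhat_step_subset_le:
  assumes u: "u permutes {..<n}" and ab: "a < n" "b < n"
    and len: "perm_length n u < perm_length n (u \<circ> Transposition.transpose a b)"
  shows "u ` {..<l} \<sqsubseteq> (u \<circ> Transposition.transpose a b) ` {..<l}"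
proof -
  have main: "u ` {..<l} \<sqsubseteq> (u \<circ> Transposition.transpose a b) ` {..<l}"
    if ab: "a < b" "b < n" and len: "perm_length n u < perm_length n (u \<circ> Transposition.transpose a b)" for a b
  proof -
    let ?v = "u \<circ> Transposition.transpose a b"
    have inj: "u x = u y \<longleftrightarrow> x = y" for x y using permutes_inj[OF u] by (auto dest: injD)
    have lt: "u a < u b"
    proof (rule ccontr)
      assume "\<not> u a < u b"
      then have "?v a < ?v b" using inj[of a b] ab by auto
      moreover have "?v permutes {..<n}" using ab by (intro transpose_permutes[OF u]) auto
      ultimately have "perm_length n ?v < perm_length n (?v \<circ> Transposition.transpose a b)"
        using transpose_greater_length[OF _ ab] by blast
      moreover have "?v \<circ> Transposition.transpose a b = u" by (simp only: comp_assoc transpose_comp_involutory comp_id)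
      ultimately show False using len by simp
    qed
    show ?thesis
    proof (cases "a < l \<and> l \<le> b")
      case True
      have v: "?v ` {..<l} = insert (u b) (u ` {..<l} - {u a})"
        using transpose_initial_segment[OF u ab] True by simp
      have "u b \<notin> u ` {..<l}" "u a \<in> u ` {..<l}" using inj True by auto
      then have "insert (u a) (?v ` {..<l} - {u b}) = u ` {..<l}" unfolding v by auto
      moreover have "insert (u a) (?v ` {..<l} - {u b}) \<sqsubseteq> ?v ` {..<l}"
        using exchange_subset_le_iff[of "u b" "?v ` {..<l}" "u a"] lt inj ab
        unfolding v by auto
      ultimately show ?thesis by simp
    next
      case False
      then show ?thesis using transpose_initial_segment[OF u ab, of l] subset_le_refl by (auto simp del: comp_apply)
    qed
  qed
  consider "a < b" | "b < a" | "a = b" by linarith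
  then show ?thesis
  proof cases
    case 2
    then show ?thesis using main[of b a] len ab by (simp add: transpose_commute)
  next
    case 3
    then show ?thesis using len by simp
  qed (use main len ab in blast)
qed

lemma bruhat_subset_le:
  assumes "bruhat n u v" "u permutes {..<n}"
  shows "v permutes {..<n}" "u ` {..<l} \<sqsubseteq> v ` {..<l}"
proof -
  have "v permutes {..<n} \<and> u ` {..<l} \<sqsubseteq> v ` {..<l}"
    using assms(1) unfolding bruhat_def
  proof (induction rule: rtranclp_induct)
    case base
    then show ?case using assms(2) subset_le_refl by simp
  next
    case (step v v')
    then obtain a b where ab: "a < n" "b < n" "v' = v \<circ> Transposition.transpose a b"
      "perm_length n v < perm_length n v'" by blast
    have v: "v permutes {..<n}" "u ` {..<l} \<sqsubseteq> v ` {..<l}" using step.IH by auto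
    have "v' permutes {..<n}" unfolding ab(3) by (rule transpose_permutes[OF v(1) ab(1,2)])
    moreover have "v ` {..<l} \<sqsubseteq> v' ` {..<l}"
      using bruhat_step_subset_le[OF v(1) ab(1,2)] ab(3,4) by blast
    ultimately show ?case using subset_le_trans[OF v(2)] by blast
  qed
  then show "v permutes {..<n}" "u ` {..<l} \<sqsubseteq> v ` {..<l}" by auto
qed

text \<open>Fix a threshold \<open>x\<close>. If \<open>u\<close> has a value below \<open>x\<close>
  at a position from \<open>c\<close> to \<open>l - 1\<close>, all values from \<open>x\<close> on
  occur before position \<open>l\<close>, so \<open>v\<close> has no more of them there. Otherwise
  the values of \<open>u\<close> below \<open>x\<close> come from the common initial part.\<close>

lemma decreasing_subset_le:
  assumes u: "u permutes {..<n}" and v: "v permutes {..<n}" and eq: "u ` {..<c} = v ` {..<c}"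
    and l: "c \<le> l" "l \<le> n"
    and dec: "\<And>a b. c \<le> a \<Longrightarrow> a < l \<Longrightarrow> l \<le> b \<Longrightarrow> b < n \<Longrightarrow> u b < u a"
  shows "v ` {..<l} \<sqsubseteq> u ` {..<l}"
  unfolding subset_le_def
proof
  fix x
  have cu: "card (u ` {..<l}) = l" "card (v ` {..<l}) = l"
    using permutes_inj_on[OF u] permutes_inj_on[OF v] by (auto simp: card_image)
  show "card (u ` {..<l} \<inter> {..<x}) \<le> card (v ` {..<l} \<inter> {..<x})"
  proof (cases "\<exists>a. c \<le> a \<and> a < l \<and> u a < x")
    case True
    then obtain a where a: "c \<le> a" "a < l" "u a < x" by blast
    have "v ` {..<l} - {..<x} \<subseteq> u ` {..<l} - {..<x}"
    proof
      fix y assume y: "y \<in> v ` {..<l} - {..<x}"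
      then obtain d where "y = v d" "d < l" by auto
      then have "y < n" using permutes_in_image[OF v, of d] l(2) by simp
      then have "y \<in> u ` {..<n}" using permutes_image[OF u] by simp
      then obtain b where b: "y = u b" "b < n" by auto
      have "b < l"
      proof (rule ccontr)
        assume "\<not> b < l"
        then have "u b < u a" using dec[of a b] a b by simp
        then show False using y b a by simp
      qed
      then show "y \<in> u ` {..<l} - {..<x}" using y b by auto
    qed
    then have "card (v ` {..<l} - {..<x}) \<le> card (u ` {..<l} - {..<x})" by (intro card_mono) auto
    moreover have split: "card (w ` {..<l}) = card (w ` {..<l} \<inter> {..<x}) + card (w ` {..<l} - {..<x})" for w :: "nat \<Rightarrow> nat"
    proof -
      have "w ` {..<l} = (w ` {..<l} \<inter> {..<x}) \<union> (w ` {..<l} - {..<x})" by auto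
      also have "card \<dots> = card (w ` {..<l} \<inter> {..<x}) + card (w ` {..<l} - {..<x})"
        by (rule card_Un_disjoint) auto
      finally show ?thesis .
    qed
    ultimately show ?thesis using cu split[of u] split[of v] by linarith
  next
    case False
    have "u ` {..<l} \<inter> {..<x} \<subseteq> v ` {..<l} \<inter> {..<x}"
    proof
      fix y assume "y \<in> u ` {..<l} \<inter> {..<x}"
      then obtain a where a: "y = u a" "a < l" "u a < x" by auto
      then have "a < c" using False by (meson not_le)
      then have "y \<in> v ` {..<c}" using a eq by auto
      then show "y \<in> v ` {..<l} \<inter> {..<x}" using l a by auto
    qed
    then show ?thesis by (intro card_mono) auto
  qed
qed

text \<open>The coset of \<open>v\<close> modulo the Weyl group of the parabolic with steps
  \<open>Ls\<close>: right multiplication by a stabilizer of initial segments does not change their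
  images.\<close>

definition flag_class :: "nat \<Rightarrow> nat set \<Rightarrow> (nat \<Rightarrow> nat) \<Rightarrow> (nat \<Rightarrow> nat) set" where
  "flag_class n Ls v = {u. u permutes {..<n} \<and> (\<forall>l\<in>Ls. u ` {..<l} = v ` {..<l})}"

lemma weyl_simps [simp]:
  "carrier (weyl n) = {\<sigma>. \<sigma> permutes {..<n}}" "monoid.mult (weyl n) = (\<circ>)" "monoid.one (weyl n) = id"
  by (simp_all add: weyl_def)

lemma SL_simps [simp]:
  "carrier (SL n) = {g \<in> carrier_mat n n. det g = 1}" "monoid.mult (SL n) = (*)" "monoid.one (SL n) = 1\<^sub>m n"
  by (simp_all add: SL_def)

lemma flag_class_lcoset:
  assumes "v permutes {..<n}"
  shows "v <#\<^bsub>weyl n\<^esub> flag_class n Ls id = flag_class n Ls v"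
proof (rule equalityI; rule subsetI)
  fix u assume "u \<in> v <#\<^bsub>weyl n\<^esub> flag_class n Ls id"
  then obtain h where h: "u = v \<circ> h" "h permutes {..<n}" "\<forall>l\<in>Ls. h ` {..<l} = {..<l}"
    by (auto simp: l_coset_def flag_class_def)
  have "u ` {..<l} = v ` (h ` {..<l})" for l unfolding h(1) by (simp only: image_comp)
  then show "u \<in> flag_class n Ls v"
    using h permutes_compose[OF h(2) assms] by (simp add: flag_class_def)
next
  fix u assume "u \<in> flag_class n Ls v"
  then have u: "u permutes {..<n}" "\<forall>l\<in>Ls. u ` {..<l} = v ` {..<l}" by (auto simp: flag_class_def)
  define h where "h = inv_into UNIV v \<circ> u"
  have vh: "v \<circ> h = u" unfolding h_def using permutes_surj[OF assms] by (simp add: fun_eq_iff surj_f_inv_f)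
  have "h ` {..<l} = inv_into UNIV v ` (u ` {..<l})" for l unfolding h_def by (simp only: image_comp)
  then have "h ` {..<l} = {..<l}" if "l \<in> Ls" for l
    using u(2) that image_inv_f_f[OF permutes_inj[OF assms]] by simp
  moreover have "h permutes {..<n}"
    unfolding h_def by (rule permutes_compose[OF u(1) permutes_inv[OF assms]])
  ultimately have "h \<in> flag_class n Ls id" by (simp add: flag_class_def)
  then show "u \<in> v <#\<^bsub>weyl n\<^esub> flag_class n Ls id" unfolding l_coset_def using vh by force
qed

lemma lcosets_flag_class:
  "lcosets\<^bsub>weyl n\<^esub> (flag_class n Ls id) = flag_class n Ls ` {v. v permutes {..<n}}"
  unfolding LCOSETS_def using flag_class_lcoset by (auto simp: image_iff)

lemma flag_class_eq: "u \<in> flag_class n Ls v \<Longrightarrow> flag_class n Ls u = flag_class n Ls v"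
  by (auto simp: flag_class_def)

lemma flag_class_self: "v permutes {..<n} \<Longrightarrow> v \<in> flag_class n Ls v"
  by (simp add: flag_class_def)

text \<open>Rescaling the last column gives determinant \<open>1\<close>, without changing the minors that only involve
  the other columns.\<close>

lemma scale_to_SL:
  fixes g :: "nat \<times> nat \<Rightarrow> 'a::field"
  assumes det: "det (mat n n g) \<noteq> 0" and n: "0 < n"
  shows "\<exists>A \<in> carrier (SL n). \<exists>s. (\<forall>a<n. s a \<noteq> 0) \<and> (\<forall>a<n - 1. s a = 1) \<and>
    (\<forall>r<n. \<forall>a<n. A $$ (r, a) = s a * g (r, a))"
proof -
  define s where "s = (\<lambda>a. if a = n - 1 then 1 / det (mat n n g) else 1)"
  define q where "q = (\<lambda>(b, a). if b = a then s a else 0)"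
  define A where "A = mat n n (gmul n g q)"
  have entry: "gmul n g q (r, a) = s a * g (r, a)" if "a < n" for r a
  proof -
    have "gmul n g q (r, a) = (\<Sum>b<n. if b = a then g (r, b) * s a else 0)"
      unfolding gmul_def q_def by (simp only: prod.case, intro sum.cong) auto
    then show ?thesis using that by simp
  qed
  have "det (mat n n q) = (\<Prod>a<n. q (a, a))"
    by (rule det_rank[of id]) (auto simp: q_def)
  also have "\<dots> = (\<Prod>a\<in>{..<n} - {n - 1}. s a) * s (n - 1)"
    using n by (subst prod.remove[of _ "n - 1"]) (auto simp: q_def)
  also have "(\<Prod>a\<in>{..<n} - {n - 1}. s a) = 1" by (rule prod.neutral) (auto simp: s_def)
  finally have "det (mat n n q) = 1 / det (mat n n g)" by (simp add: s_def)
  moreover have "det A = det (mat n n g) * det (mat n n q)"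
    unfolding A_def using mdet_gmul[of n n q id g] by (simp add: mdet_id)
  ultimately have "det A = 1" using det by simp
  moreover have "A \<in> carrier_mat n n" by (simp add: A_def)
  ultimately show ?thesis using det entry
    by (intro bexI[of _ A] exI[of _ s]) (auto simp: s_def A_def)
qed

lemma ex_weyl_rep:
  assumes \<sigma>: "\<sigma> permutes {..<n}" and n: "0 < n"
  shows "\<exists>w :: 'a::field mat. w \<in> weyl_reps n \<sigma>"
proof -
  obtain A :: "'a mat" and s where A: "A \<in> carrier (SL n)" "\<forall>a<n. s a \<noteq> 0"
    "\<forall>r<n. \<forall>a<n. A $$ (r, a) = s a * perm_matrix \<sigma> (r, a)"
    using scale_to_SL[OF det_perm_matrix[OF \<sigma>] n] by blast
  then have "A \<in> weyl_reps n \<sigma>" unfolding weyl_reps_def by (auto simp: perm_matrix_def)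
  then show ?thesis by blast
qed

context flag_data
begin

lemma n_pos: "0 < n"
  using k_less_n[of 1] m by simp

text \<open>A representative of \<open>\<sigma>\<close> has its non-zero entries at
  \<open>(\<sigma> b, b)\<close>, so it lies in \<open>P\<close> exactly when
  \<open>\<sigma>\<close> maps each \<open>{..<l}\<close> into, hence onto, itself.\<close>

lemma weyl_of_flag:
  assumes "Ls \<subseteq> {..n}" "P = {g \<in> carrier (SL n). \<forall>l\<in>Ls. \<forall>a b. l \<le> a \<longrightarrow> a < n \<longrightarrow> b < l \<longrightarrow> g $$ (a, b) = (0 :: 'a::field)}"
  shows "weyl_of n P = flag_class n Ls id"
proof (rule equalityI; rule subsetI)
  fix \<sigma> assume "\<sigma> \<in> weyl_of n P"
  then obtain w where w: "\<sigma> permutes {..<n}" "w \<in> weyl_reps n \<sigma>" "w \<in> P" by (auto simp: weyl_of_def)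
  have "\<sigma> ` {..<l} = {..<l}" if l: "l \<in> Ls" for l
  proof -
    have "\<sigma> b < l" if "b < l" for b
    proof (rule ccontr)
      assume "\<not> \<sigma> b < l"
      have "l \<le> n" using assms(1) l by auto
      then have "b < n" "\<sigma> b < n" using that permutes_in_image[OF w(1), of b] by auto
      then have "w $$ (\<sigma> b, b) \<noteq> 0" using w(2) by (auto simp: weyl_reps_def)
      moreover have "w $$ (\<sigma> b, b) = 0"
        using w(3) l that \<open>\<not> \<sigma> b < l\<close> \<open>\<sigma> b < n\<close> unfolding assms(2) by auto
      ultimately show False by simp
    qed
    then have "\<sigma> ` {..<l} \<subseteq> {..<l}" by auto
    then show ?thesis using permutes_inj_on[OF w(1), of "{..<l}"]
      by (intro card_subset_eq) (auto simp: card_image)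
  qed
  then show "\<sigma> \<in> flag_class n Ls id" using w(1) by (simp add: flag_class_def)
next
  fix \<sigma> assume "\<sigma> \<in> flag_class n Ls id"
  then have \<sigma>: "\<sigma> permutes {..<n}" "\<forall>l\<in>Ls. \<sigma> ` {..<l} = {..<l}" by (auto simp: flag_class_def)
  obtain w :: "'a mat" where w: "w \<in> weyl_reps n \<sigma>" using ex_weyl_rep[OF \<sigma>(1) n_pos] by blast
  have "w $$ (a, b) = 0" if "l \<in> Ls" "l \<le> a" "a < n" "b < l" for l a b
  proof -
    have "\<sigma> b \<in> {..<l}" using \<sigma>(2) that by blast
    then have "a \<noteq> \<sigma> b" using that by auto
    moreover have "b < n" using that by simp
    ultimately show ?thesis using w that(3) unfolding weyl_reps_def by blast
  qed
  then have "w \<in> P" using w unfolding assms(2) weyl_reps_def by auto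
  then show "\<sigma> \<in> weyl_of n P" using \<sigma>(1) w by (auto simp: weyl_of_def)
qed

lemma weyl_of_parabolic:
  "i \<in> {1..m} \<Longrightarrow> weyl_of n (parabolic n (k i) :: 'a::field mat set) = flag_class n {k i} id"
  by (rule weyl_of_flag) (use k_le_n[of i] in \<open>auto simp: parabolic_def\<close>)

lemma weyl_of_flag_parabolic:
  assumes "i \<in> {1..m}"
  shows "weyl_of n (flag_parabolic n k m i :: 'a::field mat set) = flag_class n (k ` {i..m}) id"
proof (rule weyl_of_flag)
  show "k ` {i..m} \<subseteq> {..n}" using assms k_le_n by auto
  have "i \<in> {i..m}" using assms by auto
  then show "flag_parabolic n k m i = {g \<in> carrier (SL n). \<forall>l\<in>k ` {i..m}. \<forall>a b. l \<le> a \<longrightarrow> a < n \<longrightarrow> b < l \<longrightarrow> g $$ (a, b) = (0 :: 'a)}"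
    unfolding flag_parabolic_def parabolic_def by blast
qed

definition coset_of :: "nat \<Rightarrow> nat set \<Rightarrow> (nat \<Rightarrow> nat) set" where
  "coset_of i J = {v. v permutes {..<n} \<and> v ` {..<k i} = J}"

lemma flag_class_coset_of: "flag_class n {k i} v = coset_of i (v ` {..<k i})"
  by (auto simp: flag_class_def coset_of_def)

lemma strata_eq:
  "strata TYPE('a::field) n k m = {(coset_of i J, i) |i J. i \<in> {1..m} \<and> J \<in> ext_basis n (k i)}"
proof (rule equalityI; rule subsetI)
  fix p assume "p \<in> strata TYPE('a) n k m"
  then obtain \<theta> i where p: "p = (\<theta>, i)" "i \<in> {1..m}"
    "\<theta> \<in> lcosets\<^bsub>weyl n\<^esub> (weyl_of n (parabolic n (k i) :: 'a mat set))" by (auto simp: strata_def)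
  then obtain v where v: "v permutes {..<n}" "\<theta> = flag_class n {k i} v"
    unfolding weyl_of_parabolic[OF p(2)] lcosets_flag_class by blast
  have "v ` {..<k i} \<in> ext_basis n (k i)" using p(2) k_le_n by (intro ext_basis_image[OF v(1)]) auto
  then show "p \<in> {(coset_of i J, i) |i J. i \<in> {1..m} \<and> J \<in> ext_basis n (k i)}"
    using p v flag_class_coset_of by blast
next
  fix p assume "p \<in> {(coset_of i J, i) |i J. i \<in> {1..m} \<and> J \<in> ext_basis n (k i)}"
  then obtain i J where p: "p = (coset_of i J, i)" "i \<in> {1..m}" "J \<in> ext_basis n (k i)" by blast
  obtain \<sigma> where \<sigma>: "\<sigma> permutes {..<n}" "\<sigma> ` {..<k i} = J"
    using ex_permutation[OF ext_basisD(1,2)[OF p(3)]] by blast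
  have "coset_of i J = flag_class n {k i} \<sigma>" using \<sigma>(2) flag_class_coset_of by simp
  then have "coset_of i J \<in> lcosets\<^bsub>weyl n\<^esub> (weyl_of n (parabolic n (k i) :: 'a mat set))"
    unfolding weyl_of_parabolic[OF p(2)] lcosets_flag_class using \<sigma>(1) by blast
  then show "p \<in> strata TYPE('a) n k m" using p by (auto simp: strata_def)
qed

lemma coset_subset_coset_of:
  assumes "J \<in> ext_basis n (k i)"
  shows "coset_subset (k i) (coset_of i J) = J"
proof -
  obtain \<sigma> where "\<sigma> permutes {..<n}" "\<sigma> ` {..<k i} = J"
    using ex_permutation[OF ext_basisD(1,2)[OF assms]] by blast
  then have "\<sigma> \<in> coset_of i J" by (simp add: coset_of_def)
  then show ?thesis unfolding coset_subset_def coset_of_def by blast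
qed

text \<open>Bruhat comparison implies \<open>\<sqsubseteq>\<close> at every level, where the
  decreasing tail of \<open>u\<close> is already largest, so no other class lies above. Any other
  class has an ascent across some \<open>k j\<close>, and the corresponding transposition moves it
  up inside \<open>coset_of i J\<close>.\<close>

lemma max_preimage_eq:
  assumes i: "i \<in> {1..m}" and u: "u permutes {..<n}" "u ` {..<k i} = J"
    and dec: "\<And>a b. k i \<le> a \<Longrightarrow> a < b \<Longrightarrow> b < n \<Longrightarrow> u b < u a"
  shows "max_preimage n (flag_parabolic n k m i :: 'a::field mat set) (coset_of i J) =
    flag_class n (k ` {i..m}) u"
proof -
  let ?Ls = "k ` {i..m}"
  have cosets: "lcosets\<^bsub>weyl n\<^esub> (weyl_of n (flag_parabolic n k m i :: 'a mat set)) = flag_class n ?Ls ` {v. v permutes {..<n}}"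
    unfolding weyl_of_flag_parabolic[OF i] lcosets_flag_class ..
  have ii: "i \<in> {i..m}" using i by auto
  have max: "u ` {..<k j} = v ` {..<k j}"
    if v: "v permutes {..<n}" "v ` {..<k i} = J" and j: "j \<in> {i..m}" and le: "u ` {..<k j} \<sqsubseteq> v ` {..<k j}" for v j
  proof -
    have "k i \<le> k j" "k j \<le> n" using j i k_le[of i j] k_le_n[of j] by auto
    then have "v ` {..<k j} \<sqsubseteq> u ` {..<k j}"
      using dec u(2) v(2) by (intro decreasing_subset_le[OF u(1) v(1)]) auto
    then show ?thesis using le by (rule subset_le_antisym[rotated])
  qed
  show ?thesis
    unfolding max_preimage_def cosets
  proof (rule the_equality)
    show "flag_class n ?Ls u \<in> flag_class n ?Ls ` {v. v permutes {..<n}} \<and> flag_class n ?Ls u \<subseteq> coset_of i J \<and>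
      (\<forall>\<tau>\<in>flag_class n ?Ls ` {v. v permutes {..<n}}. \<tau> \<subseteq> coset_of i J \<longrightarrow>
        bruhat_coset n (flag_class n ?Ls u) \<tau> \<longrightarrow> \<tau> = flag_class n ?Ls u)"
    proof (intro conjI ballI impI)
      show "flag_class n ?Ls u \<in> flag_class n ?Ls ` {v. v permutes {..<n}}" using u(1) by blast
      show "flag_class n ?Ls u \<subseteq> coset_of i J" using ii u(2) unfolding flag_class_def coset_of_def by blast
      fix \<tau> assume \<tau>: "\<tau> \<in> flag_class n ?Ls ` {v. v permutes {..<n}}" "\<tau> \<subseteq> coset_of i J"
        "bruhat_coset n (flag_class n ?Ls u) \<tau>"
      obtain u' v where uv: "u' \<in> flag_class n ?Ls u" "v \<in> \<tau>" "bruhat n u' v"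
        using \<tau>(3) by (auto simp: bruhat_coset_def)
      have u': "u' permutes {..<n}" "\<And>j. j \<in> {i..m} \<Longrightarrow> u' ` {..<k j} = u ` {..<k j}"
        using uv(1) by (auto simp: flag_class_def)
      have v: "v permutes {..<n}" "v ` {..<k i} = J" using uv(2) \<tau>(2) by (auto simp: coset_of_def)
      have "u ` {..<k j} = v ` {..<k j}" if "j \<in> {i..m}" for j
        using max[OF v that] bruhat_subset_le(2)[OF uv(3) u'(1), of "k j"] u'(2)[OF that] by simp
      then have "v \<in> flag_class n ?Ls u" using v(1) by (simp add: flag_class_def)
      then have "flag_class n ?Ls v = flag_class n ?Ls u" by (rule flag_class_eq)
      moreover have "flag_class n ?Ls v = \<tau>" using \<tau>(1) uv(2) flag_class_eq by blast
      ultimately show "\<tau> = flag_class n ?Ls u" by simp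
    qed
  next
    fix \<sigma> assume \<sigma>: "\<sigma> \<in> flag_class n ?Ls ` {v. v permutes {..<n}} \<and> \<sigma> \<subseteq> coset_of i J \<and>
      (\<forall>\<tau>\<in>flag_class n ?Ls ` {v. v permutes {..<n}}. \<tau> \<subseteq> coset_of i J \<longrightarrow> bruhat_coset n \<sigma> \<tau> \<longrightarrow> \<tau> = \<sigma>)"
    then obtain v where v: "v permutes {..<n}" "\<sigma> = flag_class n ?Ls v" by blast
    have v\<sigma>: "v \<in> \<sigma>" using v flag_class_self by simp
    then have vJ: "v ` {..<k i} = J" using \<sigma> by (auto simp: coset_of_def)
    show "\<sigma> = flag_class n ?Ls u"
    proof (rule ccontr)
      assume "\<sigma> \<noteq> flag_class n ?Ls u"
      then have "v \<notin> flag_class n ?Ls u" using v(2) flag_class_eq by blast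
      then obtain j where j: "j \<in> {i..m}" "v ` {..<k j} \<noteq> u ` {..<k j}" using v(1) unfolding flag_class_def by blast
      have kj: "k i \<le> k j" "k j \<le> n" using j i k_le[of i j] k_le_n[of j] by auto
      \<comment> \<open>Without such an ascent, \<open>decreasing_subset_le\<close> would apply to
        \<open>v\<close> at level \<open>j\<close>, and \<open>v\<close> would agree with
        \<open>u\<close> there.\<close>
      have "\<exists>a b. k i \<le> a \<and> a < k j \<and> k j \<le> b \<and> b < n \<and> v a < v b"
      proof (rule ccontr)
        assume none: "\<not> ?thesis"
        have "u ` {..<k j} \<sqsubseteq> v ` {..<k j}"
        proof (rule decreasing_subset_le[OF v(1) u(1) _ kj])
          show "v ` {..<k i} = u ` {..<k i}" using vJ u(2) by simp
          fix a b assume ab: "k i \<le> a" "a < k j" "k j \<le> b" "b < n"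
          have "\<not> v a < v b" using none ab by (metis (no_types))
          moreover have "v a \<noteq> v b" using injD[OF permutes_inj[OF v(1)], of a b] ab by linarith
          ultimately show "v b < v a" by simp
        qed
        then show False using max[OF v(1) vJ j(1)] j(2) by simp
      qed
      then obtain a b where ab: "k i \<le> a" "a < k j" "k j \<le> b" "b < n" "v a < v b" by blast
      have aln: "a < b" "a < n" using ab by auto
      define v' where "v' = v \<circ> Transposition.transpose a b"
      have v': "v' permutes {..<n}" unfolding v'_def by (rule transpose_permutes[OF v(1) aln(2) ab(4)])
      have "perm_length n v < perm_length n v'"
        unfolding v'_def by (rule transpose_greater_length[OF v(1) aln(1) ab(4,5)])
      then have "bruhat n v v'"
        unfolding bruhat_def v'_def using aln(2) ab(4) by (intro r_into_rtranclp) blast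
      then have "bruhat_coset n \<sigma> (flag_class n ?Ls v')"
        unfolding bruhat_coset_def using v\<sigma> flag_class_self[OF v'] by blast
      moreover have "v' ` {..<k i} = J"
        using transpose_initial_segment[OF v(1) aln(1) ab(4), of "k i"] ab(1) vJ by (simp add: v'_def)
      then have "flag_class n ?Ls v' \<subseteq> coset_of i J" using ii unfolding flag_class_def coset_of_def by blast
      ultimately have "flag_class n ?Ls v' = \<sigma>" using \<sigma> v' by blast
      then have "v' \<in> flag_class n ?Ls v" using flag_class_self[OF v'] v(2) by blast
      then have "v' ` {..<k j} = v ` {..<k j}" using j(1) by (auto simp: flag_class_def)
      moreover have "v' ` {..<k j} = insert (v b) (v ` {..<k j} - {v a})"
        using transpose_initial_segment[OF v(1) aln(1) ab(4), of "k j"] ab by (simp add: v'_def)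
      moreover have "v a \<in> v ` {..<k j}" using ab by blast
      moreover have "v a \<noteq> v b" using ab by simp
      ultimately show False by blast
    qed
  qed
qed

end

section \<open>Schubert varieties\<close>

context flag_data
begin

definition flag_entries :: "nat \<Rightarrow> nat set \<Rightarrow> (nat \<times> nat) set" where
  "flag_entries i J = {(r, a). r < n \<and> a < n \<and> (a < k i \<longrightarrow> r \<le> pick J a)}"

lemma flag_entries_col_bounded:
  assumes "x \<in> affine_space (flag_entries i J)"
  shows "col_bounded n J (k i) x"
  using assms by (auto simp: col_bounded_def affine_space_def flag_entries_def)

text \<open>Entries outside the \<open>n\<close> by \<open>n\<close> square are never read by these
  minors, so setting them to 0 gives a point of a finite-dimensional parameter space.\<close>

lemma restrict_flag_entries:
  assumes g: "col_bounded n J (k i) g" and i: "i \<in> {1..m}"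
  defines "x \<equiv> \<lambda>p. if p \<in> {..<n} \<times> {..<n} then g p else 0"
  shows "x \<in> affine_space (flag_entries i J)" "mat n n x = mat n n g" "pvec {i..m} l x = pvec {i..m} l g"
proof -
  show "x \<in> affine_space (flag_entries i J)"
    unfolding affine_space_def
  proof (intro CollectI allI impI)
    fix p assume p: "p \<notin> flag_entries i J"
    obtain r a where "p = (r, a)" by (cases p)
    then show "x p = 0" using p g by (auto simp: x_def flag_entries_def col_bounded_def)
  qed
  show "mat n n x = mat n n g" by (intro eq_matI) (auto simp: x_def)
  have "minor L x (k j) = minor L g (k j)" if "j \<in> {i..m}" "L \<in> ext_basis n (k j)" for j L
    using ext_basisD(4)[OF that(2)] k_le_n[of j] that(1) i by (intro mdet_cong) (auto simp: x_def)
  then show "pvec {i..m} l x = pvec {i..m} l g" by (intro pvec_cong) simp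
qed

lemma Xc_param:
  assumes i: "i \<in> {1..m}"
  shows "(Xc i J :: (nat \<Rightarrow> (nat set \<Rightarrow> 'a::field) set) set) =
    (\<lambda>x. mp_point {i..m} (pvec {i..m} (\<lambda>_. 1) x)) ` {x \<in> affine_space (flag_entries i J). det (mat n n x) \<noteq> 0}"
proof (rule equalityI; rule subsetI)
  fix y :: "nat \<Rightarrow> (nat set \<Rightarrow> 'a) set" assume "y \<in> Xc i J"
  then obtain g where g: "y = mp_point {i..m} (pvec {i..m} (\<lambda>_. 1) g)" "det (mat n n g) \<noteq> 0"
    "col_bounded n J (k i) g" unfolding Xc_def by blast
  let ?x = "\<lambda>p. if p \<in> {..<n} \<times> {..<n} then g p else 0"
  note x = restrict_flag_entries[OF g(3) i]
  show "y \<in> (\<lambda>x. mp_point {i..m} (pvec {i..m} (\<lambda>_. 1) x)) ` {x \<in> affine_space (flag_entries i J). det (mat n n x) \<noteq> 0}"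
    using x(1) g(2) by (intro image_eqI[of _ _ ?x]) (auto simp only: x(2,3) g(1) mem_Collect_eq)
next
  fix y :: "nat \<Rightarrow> (nat set \<Rightarrow> 'a) set"
  assume "y \<in> (\<lambda>x. mp_point {i..m} (pvec {i..m} (\<lambda>_. 1) x)) ` {x \<in> affine_space (flag_entries i J). det (mat n n x) \<noteq> 0}"
  then show "y \<in> Xc i J" unfolding Xc_def using flag_entries_col_bounded by blast
qed

lemma polyfun_pvec:
  fixes f :: "(nat \<times> nat set \<Rightarrow> 'a::field) \<Rightarrow> 'a"
  assumes "f \<in> mhfun (Sigma I (flag_basis n k)) d"
  shows "(\<lambda>x. f (pvec I (\<lambda>_. 1) x)) \<in> polyfun UNIV"
proof (rule polyfun_compose[of f "Sigma I (flag_basis n k)"])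
  show "f \<in> polyfun (Sigma I (flag_basis n k))" using assms mhfun_subset_polyfun by blast
  fix v assume "v \<in> Sigma I (flag_basis n k)"
  then have "(\<lambda>x :: nat \<times> nat \<Rightarrow> 'a. pvec I (\<lambda>_. 1) x v) = (\<lambda>x. minor (snd v) x (k (fst v)))"
    by (auto simp: pvec_def)
  also have "\<dots> \<in> polyfun UNIV" by (intro mdet_polyfun polyfun_var) simp
  finally show "(\<lambda>x :: nat \<times> nat \<Rightarrow> 'a. pvec I (\<lambda>_. 1) x v) \<in> polyfun UNIV" .
qed

lemma Xc_nonempty:
  assumes "J \<in> ext_basis n (k i)"
  shows "(Xc i J :: (nat \<Rightarrow> (nat set \<Rightarrow> 'a::field) set) set) \<noteq> {}"
  using ex_perm_flag[OF assms, where ?'a = 'a] unfolding Xc_def by blast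

lemma polyfun_det_UNIV: "(\<lambda>x :: nat \<times> nat \<Rightarrow> 'a::comm_ring_1. det (mat n n x)) \<in> polyfun UNIV"
  by (rule polyfun_det) (rule polyfun_var, simp)

lemma irreducible_Xc:
  assumes i: "i \<in> {1..m}" and J: "J \<in> ext_basis n (k i)"
  shows "irreducible_closedin (zariski_mp (flag_basis n k) {i..m})
    (Xc i J :: (nat \<Rightarrow> (nat set \<Rightarrow> 'a::field_char_0) set) set)"
  unfolding Xc_param[OF i]
proof (rule irreducible_closedin_image[OF polyfun_det_UNIV refl])
  show "{x \<in> affine_space (flag_entries i J). det (mat n n x) \<noteq> (0::'a)} \<noteq> {}"
    using Xc_nonempty[OF J, where ?'a = 'a] unfolding Xc_param[OF i] by blast
  show "closedin (zariski_mp (flag_basis n k) {i..m})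
     ((\<lambda>x. mp_point {i..m} (pvec {i..m} (\<lambda>_. 1) x)) ` {x \<in> affine_space (flag_entries i J). det (mat n n x) \<noteq> (0::'a)})"
    using closedin_Xc[OF i J, where ?'a = 'a] unfolding Xc_param[OF i] .
  fix N :: "(nat \<Rightarrow> (nat set \<Rightarrow> 'a) set) set" and a :: "nat \<times> nat \<Rightarrow> 'a"
  assume N: "openin (zariski_mp (flag_basis n k) {i..m}) N" "mp_point {i..m} (pvec {i..m} (\<lambda>_. 1) a) \<in> N"
    and a: "a \<in> {x \<in> affine_space (flag_entries i J). det (mat n n x) \<noteq> 0}"
  have co: "pvec {i..m} (\<lambda>_. 1) x \<in> mp_coords (flag_basis n k) {i..m}" if "det (mat n n x) \<noteq> 0"
    for x :: "nat \<times> nat \<Rightarrow> 'a" using that i by (intro pvec_mp_coords) auto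
  have "pvec {i..m} (\<lambda>_. 1) a \<in> mp_coords (flag_basis n k) {i..m}" using a by (intro co) simp
  from openin_zariski_mp_basis[OF N(1) _ this N(2)]
  obtain f d where f: "f \<in> mhfun (Sigma {i..m} (flag_basis n k)) d" "f (pvec {i..m} (\<lambda>_. 1) a) \<noteq> 0"
    "\<forall>v\<in>mp_coords (flag_basis n k) {i..m}. f v \<noteq> 0 \<longrightarrow> mp_point {i..m} v \<in> N" by auto
  show "\<exists>f\<in>polyfun UNIV. f a \<noteq> 0 \<and>
    (\<forall>b\<in>{x \<in> affine_space (flag_entries i J). det (mat n n x) \<noteq> 0}. f b \<noteq> 0 \<longrightarrow>
      mp_point {i..m} (pvec {i..m} (\<lambda>_. 1) b) \<in> N)"
    using f(2,3) co by (intro bexI[OF _ polyfun_pvec[OF f(1)]]) auto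
qed

text \<open>The non-smooth points lie in finitely many closed strata at least two steps below
  \<open>J\<close>. An irreducible \<open>Z\<close> is contained in one of them, and an intermediate
  stratum completes a chain of length 2 above \<open>Z\<close>.\<close>

lemma smooth_in_codim_one_Xc:
  assumes i: "i \<in> {1..m}" and J: "J \<in> ext_basis n (k i)"
  shows "smooth_in_codim_one (flag_basis n k) {i..m}
    (Xc i J :: (nat \<Rightarrow> (nat set \<Rightarrow> 'a::field_char_0) set) set)"
  unfolding smooth_in_codim_one_def codim_def
proof (rule INF_greatest)
  let ?X = "\<lambda>M. Xc i M :: (nat \<Rightarrow> (nat set \<Rightarrow> 'a) set) set"
  let ?T = "subtopology (zariski_mp (flag_basis n k) {i..m}) (?X J)"
  fix Z
  assume "Z \<in> {Z. irreducible_closedin ?T Z \<and> Z \<subseteq> {x \<in> ?X J. \<not> smooth_at (flag_basis n k) {i..m} (?X J) x}}"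
  then have Z: "irreducible_closedin ?T Z" "Z \<subseteq> {x \<in> ?X J. \<not> smooth_at (flag_basis n k) {i..m} (?X J) x}"
    by auto
  define K where "K = {M \<in> ext_basis n (k i). M \<sqsubseteq> J \<and>
    (\<exists>J'\<in>ext_basis n (k i). M \<sqsubseteq> J' \<and> M \<noteq> J' \<and> J' \<sqsubseteq> J \<and> J' \<noteq> J)}"
  have irr: "irreducible_closedin ?T (?X M)" if "M \<in> ext_basis n (k i)" "M \<sqsubseteq> J" for M
    by (rule irreducible_closedin_subtopology[OF irreducible_Xc[OF i that(1)] Xc_mono[OF that(2,1) J i]])
  have "\<exists>C\<in>?X ` K. Z \<subseteq> C"
  proof (rule irreducible_closedin_finite_Union[OF Z(1)])
    show "finite (?X ` K)" using finite_ext_basis[of n "k i"] by (simp add: K_def)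
    show "closedin ?T C" if "C \<in> ?X ` K" for C using that irr by (auto simp: K_def irreducible_closedin_def)
    show "Z \<subseteq> \<Union>(?X ` K)"
    proof
      fix z assume "z \<in> Z"
      then have "z \<in> ?X J" "\<not> smooth_at (flag_basis n k) {i..m} (?X J) z" using Z(2) by auto
      from not_smooth_at[OF i J this] obtain M J' where "M \<in> ext_basis n (k i)" "J' \<in> ext_basis n (k i)"
        "M \<sqsubseteq> J'" "M \<noteq> J'" "J' \<sqsubseteq> J" "J' \<noteq> J" "z \<in> ?X M" by blast
      then have "M \<in> K" "z \<in> ?X M" using subset_le_trans[of M J' J] unfolding K_def by blast+
      then show "z \<in> \<Union>(?X ` K)" by blast
    qed
  qed
  then obtain M J' where M: "M \<in> ext_basis n (k i)" "J' \<in> ext_basis n (k i)" "M \<sqsubseteq> J'" "M \<noteq> J'" "J' \<sqsubseteq> J" "J' \<noteq> J"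
    "Z \<subseteq> ?X M" unfolding K_def by blast
  have less: "Z \<subset> ?X J'" "?X J' \<subset> ?X J"
    using M(7) Xc_psubset[OF M(3,1,2) i M(4), where ?'a = 'a] Xc_psubset[OF M(5,2) J i M(6), where ?'a = 'a]
    by blast+
  define C where "C = (\<lambda>a :: nat. if a = 0 then Z else if a = 1 then ?X J' else ?X J)"
  have "irreducible_chain ?T 2 C"
    unfolding irreducible_chain_def
  proof (intro conjI allI impI)
    show "irreducible_closedin ?T (C a)" for a
      using Z(1) irr[OF M(2,5)] irr[OF J subset_le_refl] by (simp add: C_def)
    fix a :: nat assume "a < 2"
    then have "a = 0 \<or> a = 1" by auto
    then show "C a \<subset> C (Suc a)" using less by (auto simp: C_def)
  qed
  moreover have "C 0 = Z" by (simp add: C_def)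
  ultimately have "enat 2 \<le> Sup {enat l |l C. irreducible_chain ?T l C \<and> C 0 = Z}"
    by (intro Sup_upper) blast
  then show "2 \<le> Sup {enat l |l C. irreducible_chain ?T l C \<and> C 0 = Z}"
    by (simp add: numeral_eq_enat)
qed

section \<open>The Pluecker embedding on cosets\<close>

lemma ext_act_basis_vector:
  fixes g :: "'a::comm_ring_1 mat"
  assumes "g \<in> carrier_mat n n" "l \<le> n"
  shows "ext_act n l g (ext_basis_vector {..<l}) =
    (\<lambda>L. if L \<in> ext_basis n l then minor L (\<lambda>p. g $$ p) l else 0)"
proof
  fix L
  have l: "{..<l} \<in> ext_basis n l" using assms(2) by (auto simp: ext_basis_def)
  have "(\<Sum>J\<in>ext_basis n l. det (submatrix g L J) * ext_basis_vector {..<l} J) =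
      (\<Sum>J\<in>ext_basis n l. if J = {..<l} then det (submatrix g L {..<l}) else 0)"
    by (intro sum.cong) (auto simp: ext_basis_vector_def)
  also have "\<dots> = det (submatrix g L {..<l})" using l finite_ext_basis[of n l] by simp
  finally have *: "(\<Sum>J\<in>ext_basis n l. det (submatrix g L J) * ext_basis_vector {..<l} J) = det (submatrix g L {..<l})" .
  have g: "mat n n (\<lambda>p. g $$ p) = g" using assms(1) by (intro eq_matI) auto
  show "ext_act n l g (ext_basis_vector {..<l}) L = (if L \<in> ext_basis n l then minor L (\<lambda>p. g $$ p) l else 0)"
    unfolding ext_act_def * using det_submatrix[of L n l "\<lambda>p. g $$ p", unfolded g] assms(2) by simp
qed

text \<open>The scalar is the determinant of the upper left block of \<open>q\<close>, hence common
  to all row sets; this makes the Pluecker line independent of the representative.\<close>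

lemma minor_mult_parabolic:
  fixes A q :: "'a::field mat"
  assumes A: "A \<in> carrier_mat n n" and q: "q \<in> parabolic n l" and l: "l \<le> n"
  shows "\<exists>c. c \<noteq> 0 \<and> (\<forall>L\<in>ext_basis n l. minor L (\<lambda>p. (A * q) $$ p) l = c * minor L (\<lambda>p. A $$ p) l)"
proof -
  let ?A = "\<lambda>p. A $$ p" and ?q = "\<lambda>p. q $$ p"
  have qc: "q \<in> carrier_mat n n" "det q = 1" using q by (auto simp: parabolic_def)
  have zero: "q $$ (b, a) = 0" if "a < l" "l \<le> b" "b < n" for a b using q that by (auto simp: parabolic_def)
  have "mat n n ?q = q" using qc(1) by (intro eq_matI) auto
  then have "det (mat n n ?q) \<noteq> 0" using qc(2) by simp
  then have "det (mat l l ?q) \<noteq> 0" by (rule det_upper_block[OF _ l]) (rule zero)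
  moreover have "minor L (\<lambda>p. (A * q) $$ p) l = det (mat l l ?q) * minor L ?A l" if L: "L \<in> ext_basis n l" for L
  proof -
    have "minor L (\<lambda>p. (A * q) $$ p) l = minor L (gmul n ?A ?q) l"
    proof (rule mdet_cong)
      fix a b assume "a < l" "b < l"
      then have "pick L a < n" "b < n" using ext_basisD(4)[OF L] l by auto
      then show "(A * q) $$ (pick L a, b) = gmul n ?A ?q (pick L a, b)"
        using A qc(1) by (auto simp: gmul_def scalar_prod_def atLeast0LessThan)
    qed
    also have "\<dots> = minor L ?A l * det (mat l l ?q)" by (rule mdet_gmul[OF l]) (rule zero)
    finally show ?thesis by (simp only: mult.commute)
  qed
  ultimately show ?thesis by blast
qed

lemma pluecker_coset:
  fixes A :: "'a::field mat"
  assumes A: "A \<in> carrier (SL n)" and i: "i \<in> {1..m}"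
  shows "pluecker n k m i (A <#\<^bsub>SL n\<^esub> flag_parabolic n k m i) = mp_point {i..m} (pvec {i..m} (\<lambda>_. 1) (\<lambda>p. A $$ p))"
  unfolding pluecker_def mp_point_def
proof (rule restrict_ext)
  fix j assume j: "j \<in> {i..m}"
  let ?v = "curry (pvec {i..m} (\<lambda>_. 1) (\<lambda>p. A $$ p)) j"
  let ?C = "A <#\<^bsub>SL n\<^esub> flag_parabolic n k m i"
  have kj: "k j \<le> n" using j i k_le_n[of j] by auto
  have Ac: "A \<in> carrier_mat n n" using A by simp
  have v: "?v = (\<lambda>L. if L \<in> ext_basis n (k j) then minor L (\<lambda>p. A $$ p) (k j) else 0)"
    using j by (auto simp: pvec_def mem_flag_basis)
  have same: "line (ext_act n (k j) g (ext_basis_vector {..<k j})) = line ?v" if g: "g \<in> ?C" for g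
  proof -
    obtain q where q: "g = A * q" "q \<in> flag_parabolic n k m i" using g by (auto simp: l_coset_def)
    have qp: "q \<in> parabolic n (k j)" using q(2) j unfolding flag_parabolic_def by blast
    obtain c where c: "c \<noteq> 0" "\<forall>L\<in>ext_basis n (k j). minor L (\<lambda>p. (A * q) $$ p) (k j) = c * minor L (\<lambda>p. A $$ p) (k j)"
      using minor_mult_parabolic[OF Ac qp kj] by blast
    have "q \<in> carrier_mat n n" using qp by (auto simp: parabolic_def)
    then have "A * q \<in> carrier_mat n n" using Ac by (intro mult_carrier_mat)
    from ext_act_basis_vector[OF this kj]
    have "ext_act n (k j) g (ext_basis_vector {..<k j}) = (\<lambda>L. c * ?v L)" unfolding q(1) v using c(2) by auto
    then show ?thesis using line_cmult[OF c(1), of ?v] by simp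
  qed
  have "1\<^sub>m n \<in> flag_parabolic n k m i" using k_le_n i by (auto simp: flag_parabolic_def parabolic_def)
  then have "A * 1\<^sub>m n \<in> ?C" unfolding l_coset_def by auto
  then show "(\<Union>g\<in>?C. line (ext_act n (k j) g (ext_basis_vector {..<k j}))) = line ?v" using same by blast
qed

lemma ex_SL_pvec:
  fixes g :: "nat \<times> nat \<Rightarrow> 'a::field"
  assumes det: "det (mat n n g) \<noteq> 0" and i: "i \<in> {1..m}"
  shows "\<exists>A\<in>carrier (SL n). \<exists>s. (\<forall>a<n. s a \<noteq> 0) \<and> (\<forall>r<n. \<forall>a<n. A $$ (r, a) = s a * g (r, a)) \<and>
    pvec {i..m} (\<lambda>_. 1) (\<lambda>p. A $$ p) = pvec {i..m} (\<lambda>_. 1) g"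
proof -
  obtain A s where A: "A \<in> carrier (SL n)" "\<forall>a<n. s a \<noteq> 0" "\<forall>a<n - 1. s a = 1"
    "\<forall>r<n. \<forall>a<n. A $$ (r, a) = s a * g (r, a)" using scale_to_SL[OF det n_pos] by blast
  have "minor L (\<lambda>p. A $$ p) (k j) = minor L g (k j)" if j: "j \<in> {i..m}" and L: "L \<in> ext_basis n (k j)" for j L
  proof (rule mdet_cong)
    fix a b assume ab: "a < k j" "b < k j"
    \<comment> \<open>Every level satisfies \<open>k j < n\<close>, so the rescaled last column is
      never read.\<close>
    then have "b < n - 1" using k_less_n[of j] j i by auto
    then show "A $$ (pick L a, b) = g (pick L a, b)" using A(3,4) ext_basisD(4)[OF L ab(1)] by simp
  qed
  then have "pvec {i..m} (\<lambda>_. 1) (\<lambda>p. A $$ p) = pvec {i..m} (\<lambda>_. 1) g" by (intro pvec_cong) simp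
  then show ?thesis using A by blast
qed

lemma SL_det_entries:
  assumes "A \<in> carrier (SL n)"
  shows "det (mat n n (\<lambda>p. A $$ p)) = 1"
proof -
  have "mat n n (\<lambda>p. A $$ p) = A" using assms by (intro eq_matI) auto
  then show ?thesis using assms by simp
qed

lemma subset_le_top:
  assumes "L \<in> ext_basis n l"
  shows "L \<sqsubseteq> {n - l..<n}"
  unfolding subset_le_def
proof
  fix x
  note L = ext_basisD[OF assms]
  have ln: "l \<le> n" using card_mono[of "{..<n}" L] L(1,2) by simp
  have "{n - l..<n} \<inter> {..<x} = {n - l..<min n x}" by auto
  then have c: "card ({n - l..<n} \<inter> {..<x}) = min n x - (n - l)" by simp
  have "L - {..<x} \<subseteq> {x..<n}" using L(1) by auto
  then have "card (L - {..<x}) \<le> n - x" using card_mono[of "{x..<n}" "L - {..<x}"] by simp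
  moreover have "card (L \<inter> {..<x}) + card (L - {..<x}) = l"
    using card_Int_Diff[OF L(3), of "{..<x}"] L(2) by simp
  ultimately show "card ({n - l..<n} \<inter> {..<x}) \<le> card (L \<inter> {..<x})" using c ln by linarith
qed

lemma top_ext_basis: "l \<le> n \<Longrightarrow> {n - l..<n} \<in> ext_basis n l"
  by (auto simp: ext_basis_def)

lemma mp_point_mem_Xc:
  fixes g :: "nat \<times> nat \<Rightarrow> 'a::field"
  assumes i: "i \<in> {1..m}" and J: "J \<in> ext_basis n (k i)" and det: "det (mat n n g) \<noteq> 0"
    and van: "\<And>L. L \<in> ext_basis n (k i) \<Longrightarrow> minor L g (k i) \<noteq> 0 \<Longrightarrow> L \<sqsubseteq> J"
  shows "mp_point {i..m} (pvec {i..m} (\<lambda>_. 1) g) \<in> Xc i J"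
proof -
  have "pvec {i..m} (\<lambda>_. 1) g \<in> mp_coords (flag_basis n k) {i..m}" using det i by (intro pvec_mp_coords) auto
  then show ?thesis using cone_vanishI[OF i J det van] by (simp add: mp_point_Xc_iff_cone)
qed

text \<open>The top subset dominates all subsets of its size, so belonging to its stratum is no
  condition.\<close>

lemma flag_variety_eq:
  assumes i: "i \<in> {1..m}"
  shows "flag_variety n k m i = (Xc i {n - k i..<n} :: (nat \<Rightarrow> (nat set \<Rightarrow> 'a::field) set) set)"
proof (rule equalityI; rule subsetI)
  have top: "{n - k i..<n} \<in> ext_basis n (k i)" using top_ext_basis k_le_n[of i] i by simp
  fix y :: "nat \<Rightarrow> (nat set \<Rightarrow> 'a) set" assume "y \<in> flag_variety n k m i"
  then obtain A :: "'a mat" where A: "A \<in> carrier (SL n)" "y = pluecker n k m i (A <#\<^bsub>SL n\<^esub> flag_parabolic n k m i)"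
    unfolding flag_variety_def LCOSETS_def by blast
  show "y \<in> Xc i {n - k i..<n}" unfolding A(2) pluecker_coset[OF A(1) i]
    using SL_det_entries[OF A(1)] subset_le_top by (intro mp_point_mem_Xc[OF i top]) auto
next
  fix y :: "nat \<Rightarrow> (nat set \<Rightarrow> 'a) set" assume "y \<in> Xc i {n - k i..<n}"
  then obtain g where g: "y = mp_point {i..m} (pvec {i..m} (\<lambda>_. 1) g)" "det (mat n n g) \<noteq> 0"
    unfolding Xc_def by blast
  obtain A where A: "A \<in> carrier (SL n)" "pvec {i..m} (\<lambda>_. 1) (\<lambda>p. A $$ p) = pvec {i..m} (\<lambda>_. 1) g"
    using ex_SL_pvec[OF g(2) i] by blast
  have "y = pluecker n k m i (A <#\<^bsub>SL n\<^esub> flag_parabolic n k m i)" unfolding g(1) pluecker_coset[OF A(1) i] A(2) ..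
  then show "y \<in> flag_variety n k m i" using A(1) unfolding flag_variety_def LCOSETS_def by blast
qed

section \<open>Schubert cells and their closures\<close>

definition schubert_cell :: "nat \<Rightarrow> (nat \<Rightarrow> nat) set \<Rightarrow> (nat \<Rightarrow> (nat set \<Rightarrow> 'a::field) set) set" where
  "schubert_cell i \<sigma> = {pluecker n k m i ((b \<otimes>\<^bsub>SL n\<^esub> w) <#\<^bsub>SL n\<^esub> flag_parabolic n k m i) |b w.
     b \<in> borel n \<and> (\<exists>u\<in>\<sigma>. w \<in> weyl_reps n u)}"

lemma mult_weyl_rep:
  fixes b w :: "'a::field mat"
  assumes "b \<in> carrier_mat n n" "w \<in> weyl_reps n u" "u permutes {..<n}" "r < n" "a < n"
  shows "(b * w) $$ (r, a) = b $$ (r, u a) * w $$ (u a, a)"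
proof -
  have w: "w \<in> carrier_mat n n" "\<And>c. c < n \<Longrightarrow> w $$ (c, a) \<noteq> 0 \<longleftrightarrow> c = u a"
    using assms(2,5) by (auto simp: weyl_reps_def)
  have ua: "u a < n" using permutes_in_image[OF assms(3), of a] assms(5) by simp
  have "(b * w) $$ (r, a) = (\<Sum>c = 0..<n. b $$ (r, c) * w $$ (c, a))"
    using assms(1,4,5) w(1) by (simp add: scalar_prod_def)
  also have "\<dots> = (\<Sum>c\<in>{u a}. b $$ (r, c) * w $$ (c, a))"
    by (rule sum.mono_neutral_right) (use w(2) ua in auto)
  finally show ?thesis by simp
qed

text \<open>An upper triangular factor on the left only fills entries above the pivots, so column
  \<open>a\<close> of \<open>b * w\<close> still vanishes below row \<open>v a\<close>.\<close>

lemma schubert_cell_subset: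
  assumes i: "i \<in> {1..m}" and u: "u permutes {..<n}" "u ` {..<k i} = J"
  shows "schubert_cell i (flag_class n (k ` {i..m}) u) \<subseteq> (Xc i J :: (nat \<Rightarrow> (nat set \<Rightarrow> 'a::field) set) set)"
proof
  have ki: "k i \<le> n" using k_le_n[of i] i by simp
  have J: "J \<in> ext_basis n (k i)" using ext_basis_image[OF u(1) ki] u(2) by simp
  fix y :: "nat \<Rightarrow> (nat set \<Rightarrow> 'a) set" assume "y \<in> schubert_cell i (flag_class n (k ` {i..m}) u)"
  then obtain b w v where y: "y = pluecker n k m i ((b * w) <#\<^bsub>SL n\<^esub> flag_parabolic n k m i)"
    "b \<in> borel n" "v \<in> flag_class n (k ` {i..m}) u" "w \<in> weyl_reps n v" by (auto simp: schubert_cell_def)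
  have ii: "i \<in> {i..m}" using i by auto
  have v: "v permutes {..<n}" "v ` {..<k i} = J" using y(3) ii u(2) by (auto simp: flag_class_def)
  have b: "b \<in> carrier_mat n n" "det b = 1" "upper_triangular b" using y(2) by (auto simp: borel_def)
  have w: "w \<in> carrier_mat n n" "det w = 1" using y(4) by (auto simp: weyl_reps_def)
  have bw: "b * w \<in> carrier (SL n)" using b w by (simp add: det_mult[of _ n])
  have zero: "(b * w) $$ (r, a) = 0" if "a < k i" "r < n" "v a < r" for r a
    using mult_weyl_rep[OF b(1) y(4) v(1) that(2), of a] that ki b(1) upper_triangularD[OF b(3) that(3)] by simp
  show "y \<in> Xc i J" unfolding y(1) pluecker_coset[OF bw i]
  proof (rule mp_point_mem_Xc[OF i J])
    show "det (mat n n (\<lambda>p. (b * w) $$ p)) \<noteq> 0" using SL_det_entries[OF bw] by simp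
    fix L assume L: "L \<in> ext_basis n (k i)" "minor L (\<lambda>p. (b * w) $$ p) (k i) \<noteq> 0"
    have "pick L ` {..<k i} \<sqsubseteq> v ` {..<k i}"
      by (rule mdet_bound_subset_le[where n = n, OF L(2) ext_basisD(5)[OF L(1)] ext_basisD(4)[OF L(1)]
            permutes_inj_on[OF v(1)] order_refl zero])
    then show "L \<sqsubseteq> J" unfolding ext_basisD(6)[OF L(1)] v(2) .
  qed
qed

text \<open>The non-zero minors bound the pivot permutation \<open>\<sigma>\<close> from below by
  \<open>u\<close>; the column bounds and the decreasing tail bound it from above. So
  \<open>\<sigma>\<close> is in the class of \<open>u\<close>, and dividing by a representative of
  \<open>\<sigma>\<close> leaves an upper triangular matrix because the pivots are the last non-zero
  entries.\<close>

lemma mem_schubert_cell: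
  fixes g :: "nat \<times> nat \<Rightarrow> 'a::field"
  assumes i: "i \<in> {1..m}" and u: "u permutes {..<n}" "u ` {..<k i} = J"
    and dec: "\<And>a b. k i \<le> a \<Longrightarrow> a < b \<Longrightarrow> b < n \<Longrightarrow> u b < u a"
    and g: "det (mat n n g) \<noteq> 0" "col_bounded n J (k i) g" and nz: "\<And>j. j \<in> {i..m} \<Longrightarrow> minor (u ` {..<k j}) g (k j) \<noteq> 0"
  shows "mp_point {i..m} (pvec {i..m} (\<lambda>_. 1) g) \<in> schubert_cell i (flag_class n (k ` {i..m}) u)"
proof -
  have ki: "k i \<le> n" using k_le_n[of i] i by simp
  have J: "J \<in> ext_basis n (k i)" using ext_basis_image[OF u(1) ki] u(2) by simp
  obtain h \<sigma> where *: "\<sigma> permutes {..<n}" "\<forall>e k. k \<le> n \<longrightarrow> mdet e h k = mdet e g k"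
    "\<forall>a<n. h (\<sigma> a, a) \<noteq> 0 \<and> (\<forall>r<n. \<sigma> a < r \<longrightarrow> h (r, a) = 0)"
    using bruhat_columns[OF g(1)] by (elim exE conjE)
  have h: "\<sigma> permutes {..<n}" "\<And>e k. k \<le> n \<Longrightarrow> mdet e h k = mdet e g k"
    "\<And>a. a < n \<Longrightarrow> h (\<sigma> a, a) \<noteq> 0" "\<And>a r. a < n \<Longrightarrow> r < n \<Longrightarrow> \<sigma> a < r \<Longrightarrow> h (r, a) = 0"
    using * by simp_all
  have \<sigma>n: "\<sigma> a < n" if "a < n" for a using permutes_in_image[OF h(1), of a] that by simp
  have up: "u ` {..<k j} \<sqsubseteq> \<sigma> ` {..<k j}" if j: "j \<in> {i..m}" for j
  proof -
    have kj: "k j \<le> n" using j i k_le_n[of j] by auto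
    have L: "u ` {..<k j} \<in> ext_basis n (k j)" by (rule ext_basis_image[OF u(1) kj])
    have "minor (u ` {..<k j}) h (k j) \<noteq> 0" using nz[OF j] h(2)[OF kj] by simp
    then have "pick (u ` {..<k j}) ` {..<k j} \<sqsubseteq> \<sigma> ` {..<k j}"
      by (rule mdet_bound_subset_le[where n = n, OF _ ext_basisD(5)[OF L] ext_basisD(4)[OF L]
            permutes_inj_on[OF h(1)] order_refl]) (use h(4) kj in auto)
    then show ?thesis unfolding ext_basisD(6)[OF L] .
  qed
  have "\<sigma> ` {..<k i} \<sqsubseteq> J"
  proof (rule col_bounded_minor[OF g(2) J order_refl ext_basis_image[OF h(1) ki]])
    have inj: "inj_on \<sigma> {..<k i}" by (rule permutes_inj_on[OF h(1)])
    have "mdet \<sigma> h (k i) = (\<Prod>a<k i. h (\<sigma> a, a))"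
      using ki h(4) \<sigma>n inj by (intro mdet_pivots[where n = n]) auto
    moreover have "\<dots> \<noteq> 0" using h(3) ki by simp
    moreover obtain t where "mdet \<sigma> h (k i) = t * minor (\<sigma> ` {..<k i}) h (k i)"
      using mdet_minor[OF inj refl] by metis
    ultimately show "minor (\<sigma> ` {..<k i}) g (k i) \<noteq> 0" using h(2)[OF ki] by auto
  qed
  moreover have "J \<sqsubseteq> \<sigma> ` {..<k i}" using up[of i] u(2) i by auto
  ultimately have \<sigma>J: "u ` {..<k i} = \<sigma> ` {..<k i}" using u(2) by (simp add: subset_le_antisym)
  have "\<sigma> ` {..<k j} = u ` {..<k j}" if j: "j \<in> {i..m}" for j
  proof -
    have "k i \<le> k j" "k j \<le> n" using j i k_le[of i j] k_le_n[of j] by auto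
    then have "\<sigma> ` {..<k j} \<sqsubseteq> u ` {..<k j}" using dec by (intro decreasing_subset_le[OF u(1) h(1) \<sigma>J]) auto
    then show ?thesis using up[OF j] by (rule subset_le_antisym)
  qed
  then have \<sigma>: "\<sigma> \<in> flag_class n (k ` {i..m}) u" using h(1) by (simp add: flag_class_def)
  have "det (mat n n h) \<noteq> 0" using g(1) h(2)[of n id] by (simp add: mdet_id)
  from ex_SL_pvec[OF this i] obtain A s where A: "A \<in> carrier (SL n)" "\<forall>a<n. s a \<noteq> 0"
    "\<forall>r<n. \<forall>a<n. A $$ (r, a) = s a * h (r, a)" "pvec {i..m} (\<lambda>_. 1) (\<lambda>p. A $$ p) = pvec {i..m} (\<lambda>_. 1) h" by blast
  obtain w :: "'a mat" where w: "w \<in> weyl_reps n \<sigma>" using ex_weyl_rep[OF h(1) n_pos] by blast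
  have wc: "w \<in> carrier_mat n n" "det w = 1" and wnz: "\<And>a. a < n \<Longrightarrow> w $$ (\<sigma> a, a) \<noteq> 0"
    using w \<sigma>n by (auto simp: weyl_reps_def)
  have Ac: "A \<in> carrier_mat n n" "det A = 1" using A(1) by auto
  define \<tau> where "\<tau> = inv_into UNIV \<sigma>"
  have \<tau>: "\<tau> (\<sigma> a) = a" "\<sigma> (\<tau> a) = a" for a using permutes_inverses[OF h(1)] by (auto simp: \<tau>_def)
  have \<tau>n: "\<tau> a < n" if "a < n" for a
    using permutes_in_image[OF permutes_inv[OF h(1)], of a] that by (simp add: \<tau>_def)
  \<comment> \<open>The product of \<open>A\<close> with the inverse of the monomial matrix
    \<open>w\<close>, written entrywise.\<close>
  define b where "b = mat n n (\<lambda>(r, c). A $$ (r, \<tau> c) / w $$ (c, \<tau> c))"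
  have bc: "b \<in> carrier_mat n n" by (simp add: b_def)
  have bw: "b * w = A"
  proof (rule eq_matI)
    fix r a assume "r < dim_row A" "a < dim_col A"
    then have ra: "r < n" "a < n" using Ac by auto
    have "(b * w) $$ (r, a) = b $$ (r, \<sigma> a) * w $$ (\<sigma> a, a)" by (rule mult_weyl_rep[OF bc w h(1) ra])
    also have "\<dots> = A $$ (r, a)" using ra \<sigma>n[OF ra(2)] wnz[OF ra(2)] by (simp add: b_def \<tau>)
    finally show "(b * w) $$ (r, a) = A $$ (r, a)" .
  qed (use bc wc Ac in auto)
  have "det b * det w = det A" using det_mult[OF bc wc(1)] bw by simp
  then have "det b = 1" using wc(2) Ac(2) by simp
  moreover have "upper_triangular b"
  proof (rule upper_triangularI)
    fix c r assume "c < r" "r < dim_row b"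
    then have rc: "c < r" "r < n" "c < n" using bc by auto
    then have "h (r, \<tau> c) = 0" using h(4)[OF \<tau>n[OF rc(3)] rc(2)] by (simp add: \<tau>)
    then show "b $$ (r, c) = 0" using rc A(3) \<tau>n[OF rc(3)] by (simp add: b_def)
  qed
  ultimately have "b \<in> borel n" using bc by (simp add: borel_def)
  moreover have "mp_point {i..m} (pvec {i..m} (\<lambda>_. 1) g) = pluecker n k m i ((b \<otimes>\<^bsub>SL n\<^esub> w) <#\<^bsub>SL n\<^esub> flag_parabolic n k m i)"
  proof -
    have "pvec {i..m} (\<lambda>_. 1) h = pvec {i..m} (\<lambda>_. 1) g"
      using h(2) k_le_n i by (intro pvec_cong) auto
    then show ?thesis using pluecker_coset[OF A(1) i] A(4) bw by simp
  qed
  ultimately show ?thesis unfolding schubert_cell_def using \<sigma> w by blast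
qed

text \<open>Density of the cell: \<open>P\<close> encodes invertibility and the neighbourhood,
  \<open>Q\<close> the minors that characterize the cell. \<open>P\<close> is non-zero at the given
  point and \<open>Q\<close> at the permutation matrix, both in the affine space of column-bounded
  matrices, so some matrix there satisfies both.\<close>

lemma schubert_variety_eq:
  assumes i: "i \<in> {1..m}" and u: "u permutes {..<n}" "u ` {..<k i} = J" "\<And>a. a < k i \<Longrightarrow> u a = pick J a"
    and dec: "\<And>a b. k i \<le> a \<Longrightarrow> a < b \<Longrightarrow> b < n \<Longrightarrow> u b < u a"
  shows "schubert_variety n k m i (flag_class n (k ` {i..m}) u) =
    (Xc i J :: (nat \<Rightarrow> (nat set \<Rightarrow> 'a::field_char_0) set) set)"
proof -
  let ?S = "schubert_cell i (flag_class n (k ` {i..m}) u) :: (nat \<Rightarrow> (nat set \<Rightarrow> 'a) set) set"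
  let ?T = "zariski_mp (flag_basis n k) {i..m} :: (nat \<Rightarrow> (nat set \<Rightarrow> 'a) set) topology"
  let ?F = "flag_variety n k m i :: (nat \<Rightarrow> (nat set \<Rightarrow> 'a) set) set"
  have ki: "k i \<le> n" using k_le_n[of i] i by simp
  have J: "J \<in> ext_basis n (k i)" using ext_basis_image[OF u(1) ki] u(2) by simp
  have sub: "Xc i J \<subseteq> ?F"
    unfolding flag_variety_eq[OF i] by (rule Xc_mono[OF subset_le_top[OF J] J top_ext_basis[OF ki] i])
  have co: "pvec {i..m} (\<lambda>_. 1) x \<in> mp_coords (flag_basis n k) {i..m}" if "det (mat n n x) \<noteq> 0"
    for x :: "nat \<times> nat \<Rightarrow> 'a" using that i by (intro pvec_mp_coords) auto
  have "subtopology ?T ?F closure_of ?S = Xc i J"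
  proof
    show "subtopology ?T ?F closure_of ?S \<subseteq> Xc i J"
      by (rule closure_of_minimal[OF schubert_cell_subset[OF i u(1,2)]
            closedin_subset_topspace[OF closedin_Xc[OF i J] sub]])
    show "Xc i J \<subseteq> subtopology ?T ?F closure_of ?S"
    proof
      fix y :: "nat \<Rightarrow> (nat set \<Rightarrow> 'a) set" assume y: "y \<in> Xc i J"
      then obtain x where x: "x \<in> affine_space (flag_entries i J)" "det (mat n n x) \<noteq> 0"
        "y = mp_point {i..m} (pvec {i..m} (\<lambda>_. 1) x)" unfolding Xc_param[OF i] by auto
      show "y \<in> subtopology ?T ?F closure_of ?S"
        unfolding in_closure_of
      proof (intro conjI allI impI)
        have "Xc i J \<subseteq> topspace ?T" by (rule closedin_subset[OF closedin_Xc[OF i J]])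
        then show "y \<in> topspace (subtopology ?T ?F)" using y sub by (auto simp: topspace_subtopology)
        fix N assume "y \<in> N \<and> openin (subtopology ?T ?F) N"
        then obtain N' where N': "openin ?T N'" "N = N' \<inter> ?F" "y \<in> N'" by (auto simp: openin_subtopology)
        from openin_zariski_mp_basis[OF N'(1) _ co[OF x(2)]] N'(3) x(3)
        obtain f d where f: "f \<in> mhfun (Sigma {i..m} (flag_basis n k)) d" "f (pvec {i..m} (\<lambda>_. 1) x) \<noteq> 0"
          "\<forall>v\<in>mp_coords (flag_basis n k) {i..m}. f v \<noteq> 0 \<longrightarrow> mp_point {i..m} v \<in> N'" by auto
        define P where "P = (\<lambda>x. det (mat n n x) * f (pvec {i..m} (\<lambda>_. 1) x))"
        define Q where "Q = (\<lambda>x :: nat \<times> nat \<Rightarrow> 'a. \<Prod>j\<in>{i..m}. minor (u ` {..<k j}) x (k j))"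
        have P: "P \<in> polyfun UNIV" unfolding P_def by (rule polyfun_mult[OF polyfun_det_UNIV polyfun_pvec[OF f(1)]])
        have Q: "Q \<in> polyfun UNIV" unfolding Q_def by (intro polyfun_prod mdet_polyfun polyfun_var) simp
        have "col_bounded n J (k i) (perm_matrix u :: nat \<times> nat \<Rightarrow> 'a)"
          using u(3) by (auto simp: col_bounded_def perm_matrix_def)
        note pm = restrict_flag_entries[OF this i]
        let ?p = "\<lambda>p. if p \<in> {..<n} \<times> {..<n} then perm_matrix u p else (0 :: 'a)"
        have "Q ?p \<noteq> 0"
        proof -
          have "minor (u ` {..<k j}) ?p (k j) \<noteq> 0" if j: "j \<in> {i..m}" for j
          proof -
            have kj: "k j \<le> n" using j i k_le_n[of j] by auto
            have "minor (u ` {..<k j}) ?p (k j) = minor (u ` {..<k j}) (perm_matrix u) (k j)"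
              using ext_basisD(4)[OF ext_basis_image[OF u(1) kj]] kj by (intro mdet_cong) auto
            then show ?thesis using minor_perm_matrix[OF u(1) kj, where ?'a = 'a] by simp
          qed
          then show ?thesis by (simp add: Q_def)
        qed
        moreover have "P x \<noteq> 0" using x(2) f(2) by (simp add: P_def)
        ultimately obtain c where c: "c \<in> affine_space (flag_entries i J)" "P c \<noteq> 0" "Q c \<noteq> 0"
          using polyfun_nonzero_common[OF P Q x(1) pm(1)] by blast
        let ?y = "mp_point {i..m} (pvec {i..m} (\<lambda>_. 1) c)"
        have dc: "det (mat n n c) \<noteq> 0" "f (pvec {i..m} (\<lambda>_. 1) c) \<noteq> 0" using c(2) by (auto simp: P_def)
        have "minor (u ` {..<k j}) c (k j) \<noteq> 0" if "j \<in> {i..m}" for j using c(3) that by (auto simp: Q_def)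
        from mem_schubert_cell[OF i u(1,2) dec dc(1) flag_entries_col_bounded[OF c(1)] this]
        have "?y \<in> ?S" .
        moreover have "?y \<in> N'" using f(3) co[OF dc(1)] dc(2) by blast
        moreover have "?y \<in> ?F" using schubert_cell_subset[OF i u(1,2), where ?'a = 'a] sub \<open>?y \<in> ?S\<close> by blast
        ultimately show "\<exists>y. y \<in> ?S \<and> y \<in> N" using N'(2) by blast
      qed
    qed
  qed
  then show ?thesis unfolding schubert_variety_def schubert_cell_def .
qed

lemma stratum_coset_of:
  assumes i: "i \<in> {1..m}" and J: "J \<in> ext_basis n (k i)"
  shows "stratum n k m (coset_of i J, i) = (Xc i J :: (nat \<Rightarrow> (nat set \<Rightarrow> 'a::field_char_0) set) set)"
proof -
  obtain u where u: "u permutes {..<n}" "u ` {..<k i} = J" "\<forall>a<k i. u a = pick J a"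
    "\<forall>a b. k i \<le> a \<longrightarrow> a < b \<longrightarrow> b < n \<longrightarrow> u b < u a"
    using ex_permutation[OF ext_basisD(1,2)[OF J]] by (elim exE conjE)
  have dec: "u b < u a" if "k i \<le> a" "a < b" "b < n" for a b using u(4) that by blast
  have "max_preimage n (flag_parabolic n k m i :: 'a mat set) (coset_of i J) = flag_class n (k ` {i..m}) u"
    by (rule max_preimage_eq[OF i u(1,2) dec])
  then show ?thesis
    using schubert_variety_eq[OF i u(1,2) u(3)[rule_format] dec, where ?'a = 'a] by (simp add: stratum_def)
qed

end

section \<open>The stratification\<close>

lemma covers_on_below:
  assumes "finite A" "p \<in> A" "q \<in> A" "C q \<subset> C p"
  shows "\<exists>r. covers_on A C p r \<and> C q \<subseteq> C r"
proof -
  let ?K = "C ` {r \<in> A. C r \<subset> C p}"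
  have "finite ?K" "C q \<in> ?K" using assms by auto
  from finite_has_maximal2[OF this] obtain D where D: "D \<in> ?K" "C q \<subseteq> D" "\<forall>E\<in>?K. D \<subseteq> E \<longrightarrow> D = E"
    by blast
  then obtain r where r: "r \<in> A" "C r \<subset> C p" "D = C r" by blast
  have "\<not> (\<exists>s\<in>A. C r \<subset> C s \<and> C s \<subset> C p)" using D(3) r(3) by blast
  then have "covers_on A C p r" using r assms(2) by (simp add: covers_on_def)
  then show ?thesis using D(2) r(3) by blast
qed

lemma subset_le_superset: "J \<subseteq> L \<Longrightarrow> finite L \<Longrightarrow> L \<sqsubseteq> J"
  unfolding subset_le_def by (auto intro!: card_mono)

lemma initial_elements:
  assumes L: "L \<in> ext_basis n l" and c: "c \<le> l"
  shows "pick L ` {..<c} \<in> ext_basis n c" "pick L ` {..<c} \<subseteq> L"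
    "\<And>y z. y \<in> L - pick L ` {..<c} \<Longrightarrow> z \<in> pick L ` {..<c} \<Longrightarrow> z < y"
proof -
  note L' = ext_basisD[OF L]
  have "inj_on (pick L) {..<c}" using inj_on_subset[OF L'(5)] c by auto
  moreover show "pick L ` {..<c} \<subseteq> L" using L'(6) c by (metis image_mono lessThan_subset_iff)
  ultimately show "pick L ` {..<c} \<in> ext_basis n c" using L'(1) by (auto simp: ext_basis_def card_image)
  fix y z assume y: "y \<in> L - pick L ` {..<c}" and z: "z \<in> pick L ` {..<c}"
  obtain a where a: "a < c" "z = pick L a" using z by auto
  have "y \<in> pick L ` {..<l}" using y L'(6) by simp
  then obtain b where b: "b < l" "y = pick L b" by auto
  have "\<not> b < c" using y b(2) by blast
  then show "z < y" using pick_mono_le[of b L a] a b L'(2) by simp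
qed

text \<open>If all \<open>c\<close> smallest elements lie below the threshold, they are counted in
  full and \<open>J\<close> has no more; otherwise \<open>L\<close> and its initial part have the
  same elements below it.\<close>

lemma initial_elements_subset_le:
  assumes L: "L \<in> ext_basis n l" and J: "J \<in> ext_basis n c" and le: "L \<sqsubseteq> J" and c: "c \<le> l"
  shows "pick L ` {..<c} \<sqsubseteq> J"
  unfolding subset_le_def
proof
  fix x
  let ?M = "pick L ` {..<c}"
  note M = initial_elements[OF L c]
  show "card (J \<inter> {..<x}) \<le> card (?M \<inter> {..<x})"
  proof (cases "?M \<subseteq> {..<x}")
    case True
    then have "card (?M \<inter> {..<x}) = card J" using ext_basisD(2)[OF M(1)] ext_basisD(2)[OF J] by (simp add: Int_absorb2)
    then show ?thesis using card_mono[OF ext_basisD(3)[OF J], of "J \<inter> {..<x}"] by simp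
  next
    case False
    then obtain z where "z \<in> ?M" "\<not> z < x" unfolding subset_iff lessThan_iff by blast
    then have "L \<inter> {..<x} \<subseteq> ?M \<inter> {..<x}" using M(3) by fastforce
    then have "card (L \<inter> {..<x}) \<le> card (?M \<inter> {..<x})" by (intro card_mono) auto
    then show ?thesis using le unfolding subset_le_def by (meson order_trans)
  qed
qed

context flag_data
begin

lemma cone_psubset_iff:
  assumes "L \<in> ext_basis n (k j)" "J \<in> ext_basis n (k i)" "i \<in> {1..m}" "j \<in> {1..m}"
  shows "cone j L \<subset> (cone i J :: (nat \<times> nat set \<Rightarrow> 'a::field) set) \<longleftrightarrow> L \<sqsubseteq> J \<and> L \<noteq> J"
  using cone_subset_iff[OF assms, where ?'a = 'a] cone_subset_iff[OF assms(2,1,4,3), where ?'a = 'a]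
    subset_le_antisym[of L J] subset_le_refl[of J] by (auto simp: psubset_eq)

lemma ext_basis_level:
  assumes "J \<in> ext_basis n (k i)" "J \<in> ext_basis n (k j)" "i \<in> {1..m}" "j \<in> {1..m}"
  shows "i = j"
proof -
  have "k i = k j" using ext_basisD(2)[OF assms(1)] ext_basisD(2)[OF assms(2)] by simp
  then show ?thesis using k_inj[OF assms(3,4)] k_inj[OF assms(4,3)] by simp
qed

text \<open>If \<open>(L, j)\<close> is covered by \<open>(J, i)\<close>, then \<open>L\<close> arises by lowering an element of \<open>J\<close>, or
  \<open>j = i + 1\<close> and \<open>L\<close> is the largest subset of size \<open>k j\<close> with initial part \<open>J\<close>.\<close>

lemma codim_cone_cover:
  assumes i: "i \<in> {1..m}" "J \<in> ext_basis n (k i)" and j: "j \<in> {1..m}" "L \<in> ext_basis n (k j)"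
    and LJ: "L \<sqsubseteq> J" "L \<noteq> J"
    and cov: "\<And>h M. h \<in> {1..m} \<Longrightarrow> M \<in> ext_basis n (k h) \<Longrightarrow> L \<sqsubseteq> M \<Longrightarrow> M \<sqsubseteq> J \<Longrightarrow> M = L \<or> M = J"
  shows "codim (subtopology (zariski_affine (Sigma {1..m} (flag_basis n k))) (cone i J))
     (cone j L :: (nat \<times> nat set \<Rightarrow> 'a::field_char_0) set) = 1"
proof (rule codim_cone[OF i j])
  note J = ext_basisD[OF i(2)] and L = ext_basisD[OF j(2)]
  show "cone j L \<subset> (cone i J :: (nat \<times> nat set \<Rightarrow> 'a) set)"
    using LJ unfolding cone_psubset_iff[OF j(2) i(2,1) j(1)] by blast
  have kij: "k i \<le> k j" using subset_le_card[OF LJ(1) L(1) J(1)] L(2) J(2) by simp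
  show "cone_dim i J = Suc (cone_dim j L)"
  proof (cases "i = j")
    case True
    then have "card L = card J" using L(2) J(2) by simp
    from subset_le_cover[OF LJ this L(1) J(1)] obtain t where
      t: "t \<notin> J" "Suc t \<in> J" "L \<sqsubseteq> insert t (J - {Suc t})" by blast
    note M = lower_ext_basis[OF i(2) t(1,2)]
    have "insert t (J - {Suc t}) = L" using cov[OF i(1) M(1) t(3) M(2)] M(3) by blast
    then show ?thesis using cone_dim_lower[OF i t(1,2)] True by simp
  next
    case False
    then have ij: "i < j" using k_inj[OF i(1) j(1) kij] by simp
    define d where "d = k (Suc i) - k i"
    have i1: "Suc i \<in> {1..m}" using ij j(1) by auto
    have k1: "k i < k (Suc i)" "k (Suc i) \<le> k j" using k_less[of i "Suc i"] k_le[of "Suc i" j] ij i(1) j(1) by auto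
    note P = initial_elements[OF j(2) kij]
    \<comment> \<open>The \<open>k i\<close> smallest elements of \<open>L\<close> form a candidate
      between \<open>L\<close> and \<open>J\<close>; the covering property will force it to be
      \<open>J\<close>.\<close>
    have "pick L ` {..<k i} = L \<or> pick L ` {..<k i} = J"
      by (rule cov[OF i(1) P(1) subset_le_superset[OF P(2) L(3)] initial_elements_subset_le[OF j(2) i(2) LJ(1) kij]])
    moreover have "pick L ` {..<k i} \<noteq> L" using P(1) ext_basis_level[OF _ j(2) i(1) j(1)] False by auto
    ultimately have PJ: "pick L ` {..<k i} = J" by blast
    note Q = initial_elements[OF j(2) k1(2)]
    have "J \<subseteq> pick L ` {..<k (Suc i)}" using PJ k1(1) by (auto simp: image_iff)
    then have QJ: "pick L ` {..<k (Suc i)} \<sqsubseteq> J" using ext_basisD(3)[OF Q(1)] by (rule subset_le_superset)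
    \<comment> \<open>The candidate one level further is forced to be \<open>L\<close>, hence
      \<open>j = Suc i\<close>.\<close>
    have "pick L ` {..<k (Suc i)} = L \<or> pick L ` {..<k (Suc i)} = J"
      by (rule cov[OF i1 Q(1) subset_le_superset[OF Q(2) L(3)] QJ])
    moreover have "pick L ` {..<k (Suc i)} \<noteq> J" using Q(1) ext_basis_level[OF _ i(2) i1 i(1)] by auto
    ultimately have "pick L ` {..<k (Suc i)} = L" by blast
    then have ji: "j = Suc i" using ext_basis_level[OF Q(1) _ i1 j(1)] j(2) by simp
    have JL: "J \<subseteq> L" using P(2) PJ by simp
    have cd: "card (L - J) = d" using card_Diff_subset[OF J(3) JL] L(2) J(2) by (simp add: d_def ji)
    then have LJd: "L - J \<in> ext_basis n d" using L(1) by (auto simp: ext_basis_def)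
    have dn: "d \<le> n" using k_le_n[of j] j(1) by (simp add: d_def ji)
    have disj: "J \<inter> {n - d..<n} = {}"
    proof -
      have "z < n - d" if z: "z \<in> J" for z
      proof -
        have "L - J \<subseteq> {Suc z..<n}" using P(3)[of _ z] z L(1) unfolding PJ by (auto simp: Suc_le_eq)
        then have "d \<le> n - Suc z" using card_mono[of "{Suc z..<n}" "L - J"] cd by simp
        moreover have "z < n" using z J(1) by auto
        ultimately show ?thesis by linarith
      qed
      then show ?thesis by fastforce
    qed
    \<comment> \<open>\<open>J\<close> together with the \<open>d\<close> largest rows again lies
      between \<open>L\<close> and \<open>J\<close>. This determines \<open>L\<close> and gives the
      shape required by \<open>cone_dim_next\<close>.\<close>
    define N where "N = J \<union> {n - d..<n}"
    have "card N = k j" using disj J dn k1 by (simp add: N_def card_Un_disjoint d_def ji)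
    then have N: "N \<in> ext_basis n (k j)" using J(1) by (auto simp: N_def ext_basis_def)
    have "L \<sqsubseteq> N" unfolding subset_le_def
    proof
      fix x
      have "N \<inter> {..<x} = (J \<inter> {..<x}) \<union> ({n - d..<n} \<inter> {..<x})" by (auto simp: N_def)
      then have "card (N \<inter> {..<x}) \<le> card (J \<inter> {..<x}) + card ({n - d..<n} \<inter> {..<x})" using card_Un_le by metis
      also have "card ({n - d..<n} \<inter> {..<x}) \<le> card ((L - J) \<inter> {..<x})"
        using subset_le_top[OF LJd] unfolding subset_le_def by blast
      also have "card (J \<inter> {..<x}) + card ((L - J) \<inter> {..<x}) = card ((J \<inter> {..<x}) \<union> ((L - J) \<inter> {..<x}))"
        by (rule card_Un_disjoint[symmetric]) auto
      also have "(J \<inter> {..<x}) \<union> ((L - J) \<inter> {..<x}) = L \<inter> {..<x}" using JL by blast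
      finally show "card (N \<inter> {..<x}) \<le> card (L \<inter> {..<x})" by simp
    qed
    moreover have "N \<sqsubseteq> J" using ext_basisD(3)[OF N] by (intro subset_le_superset) (auto simp: N_def)
    ultimately have "N = L \<or> N = J" by (intro cov[OF j(1) N])
    moreover have "N \<noteq> J" using N ext_basis_level[OF _ i(2) j(1) i(1)] False by auto
    ultimately have "L = J \<union> {n - d..<n}" by (simp add: N_def)
    then show ?thesis
      using cone_dim_next[OF i(1) i1 i(2), of L] disj j(2) unfolding ji d_def by blast
  qed
qed

lemma seshadri_flag_variety:
  "seshadri_stratification m (flag_basis n k)
    (flag_variety n k m 1 :: (nat \<Rightarrow> (nat set \<Rightarrow> 'a::field_char_0) set) set)
    (strata TYPE('a) n k m) (\<lambda>(\<theta>, i). {i..m}) (stratum n k m) (pluecker_coordinate n k m)"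
proof -
  let ?X = "flag_variety n k m 1 :: (nat \<Rightarrow> (nat set \<Rightarrow> 'a) set) set"
  let ?A = "strata TYPE('a) n k m" and ?I = "\<lambda>(\<theta> :: (nat \<Rightarrow> nat) set, i). {i..m}"
  let ?Xs = "stratum n k m :: _ \<Rightarrow> (nat \<Rightarrow> (nat set \<Rightarrow> 'a) set) set"
  let ?f = "pluecker_coordinate n k m :: _ \<Rightarrow> (nat \<times> nat set \<Rightarrow> 'a) \<Rightarrow> 'a"
  let ?top = "{n - k 1..<n}"
  define C where "C = (\<lambda>p. multicone (flag_basis n k) (?I p) (?Xs p))"
  have m1: "1 \<in> {1..m}" using m by simp
  have top: "?top \<in> ext_basis n (k 1)" using top_ext_basis k_le_n[of 1] m by simp
  have X: "?X = Xc 1 ?top" by (rule flag_variety_eq[OF m1])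
  have coneX: "multicone (flag_basis n k) {1..m} ?X = cone 1 ?top" unfolding X by (rule multicone_Xc[OF m1])
  have C: "C (coset_of i J, i) = cone i J" if "i \<in> {1..m}" "J \<in> ext_basis n (k i)" for i J
    unfolding C_def using stratum_coset_of[OF that, where ?'a = 'a] multicone_Xc[OF that(1), of J, where ?'a = 'a] by simp
  have memA: "p \<in> ?A \<longleftrightarrow> (\<exists>i J. p = (coset_of i J, i) \<and> i \<in> {1..m} \<and> J \<in> ext_basis n (k i))" for p
    unfolding strata_eq by blast
  have subX: "cone i J \<subseteq> (cone 1 ?top :: (nat \<times> nat set \<Rightarrow> 'a) set)"
    if "i \<in> {1..m}" "J \<in> ext_basis n (k i)" for i J
  proof -
    have "{n - k i..<n} \<sqsubseteq> ?top"
      using k_le[of 1 i] that(1) by (intro subset_le_superset) auto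
    then show ?thesis using subset_le_trans[OF subset_le_top[OF that(2)]] by (intro cone_mono[OF _ that(2) top m1 that(1)]) blast
  qed
  have f: "?f (coset_of i J, i) v = v (i, J)" if "i \<in> {1..m}" "J \<in> ext_basis n (k i)" "v \<in> cone 1 ?top" for i J v
    unfolding pluecker_coordinate_def coneX using that(3) coset_subset_coset_of[OF that(2)] by simp
  have finA: "finite ?A"
  proof -
    have "?A = (\<lambda>(i, J). (coset_of i J, i)) ` (Sigma {1..m} (\<lambda>i. ext_basis n (k i)))" unfolding strata_eq by auto
    then show ?thesis using finite_ext_basis by simp
  qed
  show ?thesis
    unfolding seshadri_stratification_def Let_def C_def[symmetric]
  proof (intro conjI)
    show "\<forall>i\<in>{1..m}. finite (flag_basis n k i)" using finite_ext_basis by (simp add: flag_basis_def)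
    show "closedin (zariski_mp (flag_basis n k) {1..m}) ?X" unfolding X by (rule closedin_Xc[OF m1 top])
    show "finite ?A" by (rule finA)
    show "\<forall>p\<in>?A. ?I p \<noteq> {} \<and> ?I p \<subseteq> {1..m}" by (auto simp: strata_def)
    show "\<forall>p\<in>?A. irreducible_closedin (zariski_mp (flag_basis n k) (?I p)) (?Xs p) \<and>
      ?Xs p \<subseteq> (\<lambda>x. restrict x (?I p)) ` ?X \<and> smooth_in_codim_one (flag_basis n k) (?I p) (?Xs p)"
    proof
      fix p assume "p \<in> ?A"
      then obtain i J where p: "p = (coset_of i J, i)" "i \<in> {1..m}" "J \<in> ext_basis n (k i)" unfolding memA by blast
      have s: "?Xs p = Xc i J" "?I p = {i..m}" unfolding p(1) using stratum_coset_of[OF p(2,3)] by auto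
      have "Xc i J \<subseteq> (\<lambda>x. restrict x {i..m}) ` ?X"
      proof
        fix y :: "nat \<Rightarrow> (nat set \<Rightarrow> 'a) set" assume "y \<in> Xc i J"
        then obtain g where g: "y = mp_point {i..m} (pvec {i..m} (\<lambda>_. 1) g)" "det (mat n n g) \<noteq> 0"
          unfolding Xc_def by blast
        \<comment> \<open>The same matrix \<open>g\<close> defines a full point of the flag variety;
          restriction just forgets the levels below \<open>i\<close>.\<close>
        have "{1..m} \<inter> {i..m} = {i..m}" using p(2) by auto
        moreover have "curry (pvec {i..m} (\<lambda>_. 1) g) j = curry (pvec {1..m} (\<lambda>_. 1) g) j" if "j \<in> {i..m}" for j
          using that p(2) by (auto simp: pvec_def fun_eq_iff)
        ultimately have "y = restrict (mp_point {1..m} (pvec {1..m} (\<lambda>_. 1) g)) {i..m}"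
          unfolding g(1) mp_point_def restrict_restrict by (auto intro!: restrict_ext)
        moreover have "mp_point {1..m} (pvec {1..m} (\<lambda>_. 1) g) \<in> ?X"
          unfolding X by (rule mp_point_mem_Xc[OF m1 top g(2) subset_le_top])
        ultimately show "y \<in> (\<lambda>x. restrict x {i..m}) ` ?X" by (rule image_eqI)
      qed
      then show "irreducible_closedin (zariski_mp (flag_basis n k) (?I p)) (?Xs p) \<and>
        ?Xs p \<subseteq> (\<lambda>x. restrict x (?I p)) ` ?X \<and> smooth_in_codim_one (flag_basis n k) (?I p) (?Xs p)"
        unfolding s using irreducible_Xc[OF p(2,3)] smooth_in_codim_one_Xc[OF p(2,3)] by (intro conjI)
    qed
    show "\<forall>p\<in>?A. (\<exists>d. (\<forall>j. j \<notin> ?I p \<longrightarrow> d j = 0) \<and> ?f p \<in> coord_ring_component m (flag_basis n k) ?X d) \<and>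
      \<not> (\<exists>c. \<forall>x\<in>multicone (flag_basis n k) {1..m} ?X. ?f p x = c)"
    proof
      fix p assume "p \<in> ?A"
      then obtain i J where p: "p = (coset_of i J, i)" "i \<in> {1..m}" "J \<in> ext_basis n (k i)" unfolding memA by blast
      let ?d = "\<lambda>j. if j = i then 1 else 0 :: nat"
      have "(i, J) \<in> Sigma {1..m} (flag_basis n k)" using p by (simp add: mem_flag_basis)
      from mhfun_var[OF this]
      have "(\<lambda>x. x (i, J) :: 'a) \<in> mhfun (Sigma {1..m} (flag_basis n k)) ?d" by simp
      then obtain P :: "(nat \<times> nat set, 'a) polynomial"
        where P: "P \<in> polys (Sigma {1..m} (flag_basis n k))" "multihomogeneous P ?d" "(\<lambda>x. x (i, J)) = poly_eval P"
        by (auto simp: mhfun_def)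
      have "?f p = restrict (poly_eval P) (multicone (flag_basis n k) {1..m} ?X)"
        unfolding p(1) P(3)[symmetric] pluecker_coordinate_def using coset_subset_coset_of[OF p(3)]
        by (simp add: restrict_def fun_eq_iff)
      then have "?f p \<in> coord_ring_component m (flag_basis n k) ?X ?d"
        using P(1,2) unfolding coord_ring_component_def by blast
      moreover have "?d j = 0" if "j \<notin> ?I p" for j using that p by auto
      moreover have "\<not> (\<exists>c. \<forall>x\<in>multicone (flag_basis n k) {1..m} ?X. ?f p x = c)"
      proof
        assume "\<exists>c. \<forall>x\<in>multicone (flag_basis n k) {1..m} ?X. ?f p x = c"
        then obtain c where c: "\<forall>x\<in>cone 1 ?top. ?f p x = c" unfolding coneX by blast
        obtain v :: "nat \<times> nat set \<Rightarrow> 'a" where v: "v \<in> cone i J" "v (i, J) = 1" using cone_generic[OF p(3,2)] by blast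
        have v1: "v \<in> cone 1 ?top" using v(1) subX[OF p(2,3)] by blast
        have z1: "0 \<in> (cone 1 ?top :: (nat \<times> nat set \<Rightarrow> 'a) set)" by (rule zero_in_cone[OF top])
        have "?f p v = 1" "?f p 0 = 0" using f[OF p(2,3) v1] f[OF p(2,3) z1] v(2) unfolding p(1) by simp_all
        then show False using bspec[OF c v1] bspec[OF c z1] by simp
      qed
      ultimately show "(\<exists>d. (\<forall>j. j \<notin> ?I p \<longrightarrow> d j = 0) \<and> ?f p \<in> coord_ring_component m (flag_basis n k) ?X d) \<and>
        \<not> (\<exists>c. \<forall>x\<in>multicone (flag_basis n k) {1..m} ?X. ?f p x = c)" by (intro conjI exI[of _ ?d]) auto
    qed
    show "inj_on C ?A"
    proof (rule inj_onI)
      fix p q assume "p \<in> ?A" "q \<in> ?A" and eq: "C p = C q"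
      then obtain i J j L where p: "p = (coset_of i J, i)" "i \<in> {1..m}" "J \<in> ext_basis n (k i)"
        and q: "q = (coset_of j L, j)" "j \<in> {1..m}" "L \<in> ext_basis n (k j)" unfolding memA by blast
      have "cone i J = (cone j L :: (nat \<times> nat set \<Rightarrow> 'a) set)" using eq C p q by simp
      then have "L \<sqsubseteq> J" "J \<sqsubseteq> L"
        using cone_subset_iff[OF p(3) q(3,2) p(2), where ?'a = 'a] cone_subset_iff[OF q(3) p(3,2) q(2), where ?'a = 'a]
        by auto
      then have "L = J" by (rule subset_le_antisym)
      then show "p = q" using ext_basis_level[of J i j] p q by simp
    qed
    show "\<exists>pmax\<in>?A. ?I pmax = {1..m} \<and> ?Xs pmax = ?X"
    proof (rule bexI[of _ "(coset_of 1 ?top, 1)"])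
      show "(coset_of 1 ?top, 1) \<in> ?A" unfolding memA using m1 top by blast
      show "?I (coset_of 1 ?top, 1) = {1..m} \<and> ?Xs (coset_of 1 ?top, 1) = ?X"
        unfolding X using stratum_coset_of[OF m1 top] by simp
    qed
    show "\<forall>p q. covers_on ?A C p q \<longrightarrow>
      codim (subtopology (zariski_affine (Sigma {1..m} (flag_basis n k))) (C p)) (C q) = 1"
    proof (intro allI impI)
      fix p q assume cov: "covers_on ?A C p q"
      then have "p \<in> ?A" "q \<in> ?A" "C q \<subset> C p" by (auto simp: covers_on_def)
      then obtain i J j L where p: "p = (coset_of i J, i)" "i \<in> {1..m}" "J \<in> ext_basis n (k i)"
        and q: "q = (coset_of j L, j)" "j \<in> {1..m}" "L \<in> ext_basis n (k j)" unfolding memA by blast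
      have Cp: "C p = cone i J" and Cq: "C q = cone j L" using p q C by auto
      have LJ: "L \<sqsubseteq> J" "L \<noteq> J"
        using \<open>C q \<subset> C p\<close> unfolding Cp Cq cone_psubset_iff[OF q(3) p(3,2) q(2)] by auto
      show "codim (subtopology (zariski_affine (Sigma {1..m} (flag_basis n k))) (C p)) (C q) = 1"
        unfolding Cp Cq
      proof (rule codim_cone_cover[OF p(2,3) q(2,3) LJ], rule ccontr)
        fix h M assume h: "h \<in> {1..m}" "M \<in> ext_basis n (k h)" "L \<sqsubseteq> M" "M \<sqsubseteq> J" "\<not> (M = L \<or> M = J)"
        have "C q \<subset> C (coset_of h M, h)" "C (coset_of h M, h) \<subset> C p"
          unfolding Cp Cq C[OF h(1,2)] cone_psubset_iff[OF q(3) h(2,1) q(2)] cone_psubset_iff[OF h(2) p(3,2) h(1)]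
          using h(3-5) by auto
        moreover have "(coset_of h M, h) \<in> ?A" unfolding memA using h(1,2) by blast
        ultimately show False using cov unfolding covers_on_def by blast
      qed
    qed
    show "\<forall>p\<in>?A. \<forall>q\<in>?A. \<not> C q \<subseteq> C p \<longrightarrow> (\<forall>x\<in>C p. ?f q x = 0)"
    proof (intro ballI impI, rule ccontr)
      fix p q x assume "p \<in> ?A" "q \<in> ?A" and nle: "\<not> C q \<subseteq> C p" and x: "x \<in> C p" and nz: "?f q x \<noteq> 0"
      then obtain i J j L where p: "p = (coset_of i J, i)" "i \<in> {1..m}" "J \<in> ext_basis n (k i)"
        and q: "q = (coset_of j L, j)" "j \<in> {1..m}" "L \<in> ext_basis n (k j)" unfolding memA by blast
      have Cp: "C p = cone i J" and Cq: "C q = cone j L" using p q C by auto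
      have "x \<in> cone 1 ?top" using x subX[OF p(2,3)] unfolding Cp by blast
      then have "x (j, L) \<noteq> 0" using f[OF q(2,3)] nz unfolding q(1) by simp
      then have "L \<sqsubseteq> J" using cone_coordD(3)[OF x[unfolded Cp] _ p(3,2)] by blast
      then show False using nle unfolding Cp Cq cone_subset_iff[OF q(3) p(3,2) q(2)] by simp
    qed
    show "\<forall>p\<in>?A. {x \<in> multicone (flag_basis n k) {1..m} ?X. ?f p x = 0} \<inter> C p =
      {0} \<union> (\<Union>q\<in>{q. covers_on ?A C p q}. C q)"
    proof
      fix p assume pA: "p \<in> ?A"
      then obtain i J where p: "p = (coset_of i J, i)" "i \<in> {1..m}" "J \<in> ext_basis n (k i)" unfolding memA by blast
      have Cp: "C p = cone i J" using p C by auto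
      have "{x \<in> multicone (flag_basis n k) {1..m} ?X. ?f p x = 0} \<inter> C p = {x \<in> cone i J. x (i, J) = 0}"
        unfolding coneX Cp using subX[OF p(2,3)] f[OF p(2,3)] unfolding p(1) by auto
      also have "\<dots> = {0} \<union> (\<Union>q\<in>{q. covers_on ?A C p q}. C q)"
      proof (intro equalityI subsetI)
        fix x :: "nat \<times> nat set \<Rightarrow> 'a" assume "x \<in> {x \<in> cone i J. x (i, J) = 0}"
        then have x: "x \<in> cone i J" "x (i, J) = 0" by auto
        show "x \<in> {0} \<union> (\<Union>q\<in>{q. covers_on ?A C p q}. C q)"
        proof (cases "x = 0")
          case False
          from cone_type[OF x(1) False p(2)] obtain j P where
            P: "j \<in> {i..m}" "P \<in> ext_basis n (k j)" "x (j, P) \<noteq> 0" "x \<in> cone j P" by blast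
          have j: "j \<in> {1..m}" using P(1) p(2) by auto
          have "P \<sqsubseteq> J" by (rule cone_coordD(3)[OF x(1) P(3) p(3,2)])
          moreover have "P \<noteq> J" using P(2,3) x(2) ext_basis_level[OF _ p(3) j p(2)] by auto
          ultimately have "C (coset_of j P, j) \<subset> C p"
            unfolding Cp C[OF j P(2)] cone_psubset_iff[OF P(2) p(3,2) j] by blast
          moreover have "(coset_of j P, j) \<in> ?A" unfolding memA using j P(2) by blast
          ultimately have "\<exists>r. covers_on ?A C p r \<and> C (coset_of j P, j) \<subseteq> C r"
            by (intro covers_on_below[OF finA pA])
          then obtain r where r: "covers_on ?A C p r" "C (coset_of j P, j) \<subseteq> C r" by (elim exE conjE)
          have "x \<in> C r" using P(4) r(2) unfolding C[OF j P(2)] by (rule subsetD[rotated])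
          with r(1) show ?thesis by (intro UnI2 UN_I[of r]) auto
        qed simp
      next
        fix x :: "nat \<times> nat set \<Rightarrow> 'a" assume "x \<in> {0} \<union> (\<Union>q\<in>{q. covers_on ?A C p q}. C q)"
        then consider "x = 0" | q where "covers_on ?A C p q" "x \<in> C q" by blast
        then show "x \<in> {x \<in> cone i J. x (i, J) = 0}"
        proof cases
          case 1
          then show ?thesis using zero_in_cone[OF p(3)] by simp
        next
          case 2
          then have "q \<in> ?A" and sub: "C q \<subset> C p" by (auto simp: covers_on_def)
          then obtain j L where q: "q = (coset_of j L, j)" "j \<in> {1..m}" "L \<in> ext_basis n (k j)" unfolding memA by blast
          have Cq: "C q = cone j L" using q C by auto
          have LJ: "L \<sqsubseteq> J" "L \<noteq> J" using sub unfolding Cp Cq cone_psubset_iff[OF q(3) p(3,2) q(2)] by auto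
          have "x (i, J) = 0"
          proof (rule ccontr)
            assume "x (i, J) \<noteq> 0"
            then have "J \<sqsubseteq> L" using cone_coordD(3)[OF 2(2)[unfolded Cq] _ q(3,2)] by blast
            then show False using LJ subset_le_antisym by blast
          qed
          then show ?thesis using 2(2) sub Cp by blast
        qed
      qed
      finally show "{x \<in> multicone (flag_basis n k) {1..m} ?X. ?f p x = 0} \<inter> C p =
        {0} \<union> (\<Union>q\<in>{q. covers_on ?A C p q}. C q)" .
    qed
  qed
qed

end

theorem theorem11p6:
  fixes n m :: nat and k :: "nat \<Rightarrow> nat"
  assumes "1 \<le> m" and "strict_mono_on {1..m} k" and "1 \<le> k 1" and "k m \<le> n - 1"
  shows "seshadri_stratification m (flag_basis n k)
           (flag_variety n k m 1 ::
              (nat \<Rightarrow> (nat set \<Rightarrow> 'a :: {alg_closed_field, field_char_0}) set) set)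
           (strata TYPE('a) n k m)
           (\<lambda>(\<theta>, i). {i..m})
           (stratum n k m)
           (pluecker_coordinate n k m)"
proof -
  interpret flag_data n m k using assms by unfold_locales
  show ?thesis by (rule seshadri_flag_variety)
qed

end
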